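(* Let $V:\mathbb{T}\to\mathbb{R}$ be real-analytic, $\omega\in\mathbb{T}_{c,a}$, and assume $L(\omega,E)\ge\gamma>0$ for any $E\in(E',E'')$. There exist $N_0=N_0(V,c,a,\gamma)$ and $C_0=C_0(V,c,a,\gamma)$ such that if $N\ge N_0$ and $G_1,G_2$ are two (distinct) gaps in $\mathcal{S}_\omega\cap(E',E'')$ with $|G_1|,|G_2|>\exp(-N^{1-})$, then $$\operatorname{dist}(G_1,G_2)>\exp(-(\log N)^{C_0}).$$ The same statement holds for gaps in $\mathcal{S}_{\bar N,\omega}\cap(E',E'')$ for every $\bar N\ge N$: if $N\ge N_0$, $\bar N\ge N$, and $G_1,G_2$ are two distinct gaps in $\mathcal{S}_{\bar N,\omega}\cap(E',E'')$ with $|G_1|,|G_2|>\exp(-N^{1-})$, then $\operatorname{dist}(G_1,G_2)>\exp(-(\log N)^{C_0})$.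
   Context: $N^{1-}$ means $N^{1-\epsilon}$ for some small absolute constant $\epsilon>0$ (for example $\epsilon=1/100$ suffices). $\mathbb{T}=\mathbb{R}/\mathbb{Z}$, $\|\cdot\|$ applied to a real number is the distance to the nearest integer. For constants $c,a>0$, $\mathbb{T}_{c,a}=\{\omega:\ \|n\omega\|\ge \frac{c}{n(\log n)^a}\ \text{for all integers } n\ge2\}$. $H(x,\omega)$ is the operator on $\ell^2(\mathbb{Z})$ given by $[H(x,\omega)\varphi](n)=-\varphi(n-1)-\varphi(n+1)+V(x+n\omega)\varphi(n)$. For irrational $\omega$ its spectrum does not depend on $x$ and is denoted $\mathcal{S}_\omega$. $H_{[-N,N]}(x,\omega)$ is the restriction of $H(x,\omega)$ to $\{-N,\dots,N\}$ with Dirichlet boundary conditions, and $\mathcal{S}_{N,\omega}=\bigcup_{x\in\mathbb{T}}\operatorname{spec}H_{[-N,N]}(x,\omega)$. The Lyapunov exponent is $L(\omega,E)=\lim_{N\to\infty}\frac1N\int_0^1\log\|M_N(x,\omega,E)\|\,dx$, where $M_N(x,\omega,E)=\prod_{k=N}^{1}\begin{bmatrix}V(x+k\omega)-E&-1\\1&0\end{bmatrix}$ (factors ordered with $k=N$ leftmost). For a closed set $\mathcal{S}$, a gap in $\mathcal{S}\cap(E',E'')$ is a connected component of $(E',E'')\setminus\mathcal{S}$; $|G|$ denotes the length of $G$. *)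

theory Defs
  imports "HOL-Analysis.Analysis"
begin

text \<open>Functions on the circle are represented by 1-periodic functions on the real line, and
  points of the circle by real representatives.\<close>

definition real_analytic :: "(real \<Rightarrow> real) \<Rightarrow> bool" where
  "real_analytic f \<longleftrightarrow>
     (\<forall>x. \<exists>r>0. \<exists>b :: nat \<Rightarrow> real. \<forall>y. \<bar>y - x\<bar> < r \<longrightarrow> (\<lambda>k. b k * (y - x) ^ k) sums f y)"

definition dist_int :: "real \<Rightarrow> real" where
  "dist_int t = \<bar>t - of_int (round t)\<bar>"

definition diophantine :: "real \<Rightarrow> real \<Rightarrow> real set" where
  "diophantine c a =
     {\<omega>. \<forall>n::nat. n \<ge> 2 \<longrightarrow> dist_int (real n * \<omega>) \<ge> c / (real n * ln (real n) powr a)}"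

definition ell2_norm :: "(int \<Rightarrow> complex) \<Rightarrow> real" where
  "ell2_norm \<phi> = sqrt (\<Sum>\<^sub>\<infinity>n. (cmod (\<phi> n))\<^sup>2)"

text \<open>The space of square-summable functions on \<open>\<Lambda>\<close>, as a subspace of the
  sequences on all integers via extension by zero.\<close>

definition ell2 :: "int set \<Rightarrow> (int \<Rightarrow> complex) set" where
  "ell2 \<Lambda> = {\<phi>. (\<lambda>n. (cmod (\<phi> n))\<^sup>2) summable_on UNIV \<and> (\<forall>n. n \<notin> \<Lambda> \<longrightarrow> \<phi> n = 0)}"

text \<open>The spectrum of an operator \<open>T\<close> on a space \<open>X\<close> of square-summable sequences: the
  complement of those \<open>z\<close> for which \<open>T - z\<close> has an everywhere defined bounded inverse on \<open>X\<close>.\<close>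

definition spec ::
  "(int \<Rightarrow> complex) set \<Rightarrow> ((int \<Rightarrow> complex) \<Rightarrow> int \<Rightarrow> complex) \<Rightarrow> complex set" where
  "spec X T = {z. \<not> (bij_betw (\<lambda>\<phi> n. T \<phi> n - z * \<phi> n) X X \<and>
     (\<exists>C. \<forall>\<phi>\<in>X. ell2_norm \<phi> \<le> C * ell2_norm (\<lambda>n. T \<phi> n - z * \<phi> n)))}"

definition schroedinger ::
  "(real \<Rightarrow> real) \<Rightarrow> real \<Rightarrow> real \<Rightarrow> (int \<Rightarrow> complex) \<Rightarrow> int \<Rightarrow> complex" where
  "schroedinger V x \<omega> \<phi> n =
     - \<phi> (n - 1) - \<phi> (n + 1) + of_real (V (x + of_int n * \<omega>)) * \<phi> n"

text \<open>Elements of \<^term>\<open>ell2 \<Lambda>\<close> vanish off \<open>\<Lambda>\<close>, so cutting off the image is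
  the restriction with Dirichlet boundary conditions.\<close>

definition dirichlet ::
  "int set \<Rightarrow> ((int \<Rightarrow> complex) \<Rightarrow> int \<Rightarrow> complex) \<Rightarrow> (int \<Rightarrow> complex) \<Rightarrow> int \<Rightarrow> complex" where
  "dirichlet \<Lambda> T \<phi> n = (if n \<in> \<Lambda> then T \<phi> n else 0)"

text \<open>These operators are self-adjoint, so passing to the real points of the spectrum loses
  nothing. For irrational \<open>\<omega>\<close> the set \<open>full_spectrum V x \<omega>\<close> does not depend on \<open>x\<close>.\<close>

definition full_spectrum :: "(real \<Rightarrow> real) \<Rightarrow> real \<Rightarrow> real \<Rightarrow> real set" where
  "full_spectrum V x \<omega> = {E. complex_of_real E \<in> spec (ell2 UNIV) (schroedinger V x \<omega>)}"

definition finite_spectrum :: "(real \<Rightarrow> real) \<Rightarrow> nat \<Rightarrow> real \<Rightarrow> real set" where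
  "finite_spectrum V N \<omega> = (\<Union>x. {E. complex_of_real E \<in>
     spec (ell2 {- int N..int N}) (dirichlet {- int N..int N} (schroedinger V x \<omega>))})"

primrec transfer_matrix ::
  "(real \<Rightarrow> real) \<Rightarrow> nat \<Rightarrow> real \<Rightarrow> real \<Rightarrow> real \<Rightarrow> real ^ 2 ^ 2" where
  "transfer_matrix V 0 x \<omega> E = mat 1"
| "transfer_matrix V (Suc k) x \<omega> E =
     vector [vector [V (x + real (Suc k) * \<omega>) - E, - 1], vector [1, 0]]
       ** transfer_matrix V k x \<omega> E"

definition lyapunov :: "(real \<Rightarrow> real) \<Rightarrow> real \<Rightarrow> real \<Rightarrow> real" where
  "lyapunov V \<omega> E =
     lim (\<lambda>N. 1 / real N * integral {0..1} (\<lambda>x. ln (onorm ((*v) (transfer_matrix V N x \<omega> E)))))"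

definition gaps :: "real set \<Rightarrow> real \<Rightarrow> real \<Rightarrow> real set set" where
  "gaps S E' E'' = components ({E'<..<E''} - S)"

definition gap_length :: "real set \<Rightarrow> real" where
  "gap_length G = measure lborel G"

end

theory Submission
 imports Defs "HOL-Complex_Analysis.Complex_Analysis" "HOL-Real_Asymp.Real_Asymp" "HOL-Computational_Algebra.Fundamental_Theorem_Algebra"
begin

text \<open>Suppose that two gaps of length more than \<open>\<delta> = exp (- N powr 0.99)\<close> are at distance at most
\<open>exp (- (ln N) ^ 20)\<close>. Then the spectrum between them is an island: a set of tiny diameter with
spectrum-free collars of width \<open>\<delta>\<close> on both sides. An island cannot contain a point \<open>E0\<close> of the
spectrum (\<open>no_spectrum_in_small_island\<close>), for the following reason.

The island is narrower than \<open>exp (- CW * m)\<close> for scales \<open>m\<close> of the order of a power of \<open>ln N\<close>, so transfer matrices over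
\<open>m\<close> sites do not distinguish its energies, and only \<open>E0\<close> matters. The Lyapunov exponent is used only through the
growth \<open>ln (hs M\<^sub>n) \<ge> \<gamma> * n\<close> at some phase for each \<open>n\<close> (\<open>lyapunov_imp_growth\<close>). Up to a bounded error, the
logarithm of the squared norm of \<open>M\<^sub>n\<close> is that of a trigonometric polynomial of degree \<open>O(n)\<close>, and its averages along
the rotation are nearly constant off a few tiny intervals (\<open>trig_log_average\<close>); this gives
\<open>large_deviation\<close>. By pigeonhole there is a scale \<open>m\<close> at which \<open>M\<^sub>2\<^sub>m\<close> is nearly as large as the
square of the largest norm of \<open>M\<^sub>m\<close> (\<open>good_scale\<close>), and then every solution is small in the
centre of a good window compared with its edges. At a phase where the corner entry of a transfer matrix
is large (\<open>entry_large\<close>) a Dirichlet solution must grow away from its end. Ends of this kind are called cuts. The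
orbit is dense at a polynomial rate, so cuts exist in every window much shorter than \<open>N\<close>, and one
cut serves all phases within distance \<open>N ^ -3\<close>.

Cut an approximate eigenfunction of energy \<open>E0\<close> down to an interval of length \<open>O(N)\<close> whose ends are cuts or
ends of the lattice (\<open>state_at_an_end\<close>). When the phase moves, the eigenvalue of this interval stays in the island:
its eigenfunctions are tiny at cuts, hence are approximate eigenfunctions of the whole
operator, whose energies lie near the spectrum and so not in the collars (\<open>refine\<close>, \<open>track\<close>). At a phase for
which all windows in the interval are good, the eigenfunction can have its maximum neither inside
nor at a cut (\<open>eigenvector_position\<close>); so it sits at an end of the lattice. Such an edge state
survives a motion of the phase in small steps, so it is present at some phase \<open>z\<close> and also at \<open>z + \<omega>\<close>. Then one matrix of
determinant 1 contracts two independent vectors (\<open>no_two_edges\<close>), which is absurd. A right end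
becomes a left end under \<open>n \<mapsto> - n\<close>, \<open>\<omega> \<mapsto> - \<omega>\<close>.\<close>

section \<open>Derivatives of periodic analytic functions\<close>

lemma has_real_derivative_Re_of_real:
 fixes G :: "complex => complex"
 assumes "(G has_field_derivative G') (at (of_real y))"
 shows "((%t. Re (G (of_real t))) has_real_derivative Re G') (at y)"
proof -
 have "((%t. G (of_real t)) has_vector_derivative G') (at y)"
  using assms by (rule has_vector_derivative_real_field)
 then have "((%t. Re (G (of_real t))) has_vector_derivative Re G') (at y)"
  by (rule bounded_linear.has_vector_derivative[OF bounded_linear_Re])
 then show ?thesis
  by (simp add: has_real_derivative_iff_has_vector_derivative)
qed

text \<open>The power series converges on a complex disc, so Cauchy's estimate bounds all derivatives on a smaller
interval.\<close>

lemma local_derivative_bounds: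
 fixes V :: "real => real"
 assumes r: "r > 0" and sm: "!!y. \<bar>y - x\<bar> < r ==> (%k. b k * (y - x) ^ k) sums V y"
 shows "\<exists>A R. A >= 0 & R > 0 & (ALL m y. \<bar>y - x\<bar> < r / 2 -->
   ((deriv ^^ m) V has_real_derivative (deriv ^^ Suc m) V y) (at y) &
   \<bar>(deriv ^^ m) V y\<bar> <= A * fact m * R ^ m)"
proof -
 define F :: "complex => complex" where "F z = (\<Sum>k. of_real (b k) * (z - of_real x) ^ k)" for z
 have sF: "(%k. of_real (b k) * (z - of_real x) ^ k) sums F z" if "z \<in> ball (of_real x) r" for z
 proof -
  obtain t where t: "cmod (z - of_real x) < t" "t < r"
   using \<open>z \<in> ball (of_real x) r\<close> dense by (auto simp: dist_norm norm_minus_commute) 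
  have "t > 0" using t(1) norm_ge_zero[of "z - of_real x"] by linarith
  have "(%k. b k * t ^ k) sums V (x + t)"
   using sm[of "x + t"] t \<open>t > 0\<close> by simp
  then have "summable (%k. complex_of_real (b k * t ^ k))"
   by (intro summable_of_real) (rule sums_summable)
  then have "summable (%k. complex_of_real (b k) * (of_real t) ^ k)"
   by (simp only: of_real_mult of_real_power)
  then have "summable (%k. complex_of_real (b k) * (z - of_real x) ^ k)"
   by (rule powser_inside) (use t \<open>t > 0\<close> in simp)
  then show ?thesis unfolding F_def by (rule summable_sums)
 qed
 have hol: "F holomorphic_on ball (of_real x) r"
  using sF by (rule power_series_holomorphic)
 have reF: "Re (F (of_real y)) = V y" if "\<bar>y - x\<bar> < r" for y
 proof -
  have "(%k. of_real (b k) * (of_real y - of_real x) ^ k) sums F (of_real y)"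
   by (rule sF) (use that in \<open>simp add: dist_norm norm_minus_commute flip: of_real_diff\<close>)
  then have "(%k. of_real (b k * (y - x) ^ k)) sums F (of_real y)" by simp
  moreover have "(%k. of_real (b k * (y - x) ^ k)) sums (of_real (V y) :: complex)"
   using sm[OF that] by (rule sums_of_real)
  ultimately show ?thesis using sums_unique2 by fastforce
 qed
 have mem: "complex_of_real y \<in> ball (of_real x) r" if "\<bar>y - x\<bar> < r" for y
  using that by (simp add: dist_norm norm_minus_commute flip: of_real_diff)
 have D: "((%t. Re ((deriv ^^ m) F (of_real t))) has_real_derivative Re ((deriv ^^ Suc m) F (of_real y))) (at y)"
  if "\<bar>y - x\<bar> < r" for m y
  by (rule has_real_derivative_Re_of_real)
   (rule has_field_derivative_higher_deriv[OF hol open_ball mem[OF that]])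
 have eq: "ALL y. \<bar>y - x\<bar> < r --> (deriv ^^ m) V y = Re ((deriv ^^ m) F (of_real y))" for m
 proof (induction m)
  case 0
  then show ?case using reF by simp
 next
  case (Suc m)
  show ?case
  proof (intro allI impI)
   fix y assume y: "\<bar>y - x\<bar> < r"
   have "\<forall>\<^sub>F t in nhds y. \<bar>t - x\<bar> < r"
    by (rule eventually_nhds_in_open[of "{t. \<bar>t - x\<bar> < r}", simplified])
     (use y in \<open>auto intro!: open_Collect_less continuous_intros\<close>)
   then have "\<forall>\<^sub>F t in nhds y. (deriv ^^ m) V t = Re ((deriv ^^ m) F (of_real t))"
    by eventually_elim (use Suc in blast)
   then have "deriv ((deriv ^^ m) V) y = deriv (%t. Re ((deriv ^^ m) F (of_real t))) y"
    by (rule deriv_cong_ev) simp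
   also have "... = Re ((deriv ^^ Suc m) F (of_real y))"
    using D[OF y] by (rule DERIV_imp_deriv)
   finally show "(deriv ^^ Suc m) V y = Re ((deriv ^^ Suc m) F (of_real y))" by simp
  qed
 qed
 have DV: "((deriv ^^ m) V has_real_derivative (deriv ^^ Suc m) V y) (at y)" if y: "\<bar>y - x\<bar> < r" for m y
 proof -
  have "\<forall>\<^sub>F t in nhds y. \<bar>t - x\<bar> < r"
   by (rule eventually_nhds_in_open[of "{t. \<bar>t - x\<bar> < r}", simplified])
    (use y in \<open>auto intro!: open_Collect_less continuous_intros\<close>)
  then have ev: "\<forall>\<^sub>F t in nhds y. (deriv ^^ m) V t = Re ((deriv ^^ m) F (of_real t))"
   by eventually_elim (use eq in blast)
  show ?thesis
   using D[OF y, of m] eq[rule_format, OF y, of "Suc m"] DERIV_cong_ev[OF refl ev refl] by simp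
 qed
 have "compact (F ` cball (of_real x) (3 * r / 4))"
  by (rule compact_continuous_image)
   (use r in \<open>auto intro!: holomorphic_on_imp_continuous_on holomorphic_on_subset[OF hol]\<close>)
 then have "bounded (F ` cball (of_real x) (3 * r / 4))" by (rule compact_imp_bounded)
 then obtain B where B': "\<forall>z\<in>F ` cball (of_real x) (3 * r / 4). cmod z <= B"
  unfolding bounded_iff by blast
 have B: "cmod (F z) <= B" if "z \<in> cball (of_real x) (3 * r / 4)" for z
  using B' that by blast
 have "cmod (F (of_real x)) <= B" by (rule B) (use r in simp)
 then have B0: "B >= 0" using norm_ge_zero order_trans by blast
 have bd: "\<bar>(deriv ^^ m) V y\<bar> <= B * fact m * (4 / r) ^ m" if y: "\<bar>y - x\<bar> < r / 2" for m y
 proof -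
  have dxy: "dist (complex_of_real x) (of_real y) < r / 2"
   using y by (simp add: dist_norm abs_minus_commute flip: of_real_diff)
  have sub: "cball (complex_of_real y) (r / 4) \<subseteq> cball (of_real x) (3 * r / 4)"
  proof
   fix w assume "w \<in> cball (complex_of_real y) (r / 4)"
   then have "dist (of_real y) w <= r / 4" by simp
   then show "w \<in> cball (of_real x) (3 * r / 4)"
    using dist_triangle[of "complex_of_real x" w "of_real y"] dxy by simp
  qed
  have sub2: "cball (complex_of_real y) (r / 4) \<subseteq> ball (of_real x) r"
   using sub r by (auto simp: subset_iff)
  have "cmod ((deriv ^^ m) F (of_real y)) <= fact m * B / (r / 4) ^ m"
  proof (rule Cauchy_inequality)
   show "F holomorphic_on ball (of_real y) (r / 4)"
    using hol by (rule holomorphic_on_subset) (use sub2 in auto)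
   show "continuous_on (cball (complex_of_real y) (r / 4)) F"
    using hol sub2 holomorphic_on_imp_continuous_on holomorphic_on_subset by blast
   show "0 < r / 4" using r by simp
   fix w assume "cmod (complex_of_real y - w) = r / 4"
   then have "w \<in> cball (complex_of_real y) (r / 4)" by (simp add: dist_norm)
   then show "cmod (F w) <= B" using sub B by blast
  qed
  moreover have "\<bar>(deriv ^^ m) V y\<bar> <= cmod ((deriv ^^ m) F (of_real y))"
   using eq[of m] y r by (simp add: abs_Re_le_cmod)
  ultimately show ?thesis by (simp add: power_divide mult_ac)
 qed
 show ?thesis
  by (rule exI[of _ B], rule exI[of _ "4 / r"]) (use B0 r DV bd in auto)
qed

lemma periodic_of_int:
 fixes f :: "real => 'a"
 assumes "!!x. f (x + 1) = f x"
 shows "f (x + of_int k) = f x"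
proof (induction k rule: int_induct[where k = 0])
 case base
 then show ?case by simp
next
 case (step1 i)
 then show ?case using assms[of "x + of_int i"] by (simp add: add.assoc)
next
 case (step2 i)
 then show ?case using assms[of "x + of_int (i - 1)"] by (simp add: algebra_simps)
qed

lemma real_analytic_derivative_bounds:
 fixes V :: "real => real"
 assumes an: "real_analytic V" and per: "!!x. V (x + 1) = V x"
 obtains A R where "A >= 0" "R > 0"
  "!!m y. ((deriv ^^ m) V has_real_derivative (deriv ^^ Suc m) V y) (at y)"
  "!!m y. \<bar>(deriv ^^ m) V y\<bar> <= A * fact m * R ^ m"
  "!!m y. (deriv ^^ m) V (y + 1) = (deriv ^^ m) V y"
proof -
 have pm: "(deriv ^^ m) V (y + 1) = (deriv ^^ m) V y" for m y
 proof (induction m arbitrary: y)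
  case (Suc m)
  have "deriv ((deriv ^^ m) V) (y + 1) = deriv (%t. (deriv ^^ m) V (t + 1)) y"
   by (simp add: deriv_def DERIV_shift)
  then show ?case using Suc by simp
 qed (use per in simp)
 define P where "P x r A R \<longleftrightarrow> r > 0 & A >= 0 & R > 0 & (ALL m y. \<bar>y - x\<bar> < r -->
   ((deriv ^^ m) V has_real_derivative (deriv ^^ Suc m) V y) (at y) &
   \<bar>(deriv ^^ m) V y\<bar> <= A * fact m * R ^ m)" for x r A R :: real
 have "\<exists>r A R. P x r A R" for x
 proof -
  obtain r b where "r > 0" "ALL y. \<bar>y - x\<bar> < r --> (%k. b k * (y - x) ^ k) sums V y"
   using an unfolding real_analytic_def by metis
  then obtain A R where "A >= 0" "R > 0" "ALL m y. \<bar>y - x\<bar> < r / 2 -->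
   ((deriv ^^ m) V has_real_derivative (deriv ^^ Suc m) V y) (at y) &
   \<bar>(deriv ^^ m) V y\<bar> <= A * fact m * R ^ m"
   using local_derivative_bounds[of r x b V] by blast
  then have "P x (r / 2) A R" unfolding P_def using \<open>r > 0\<close> by auto
  then show ?thesis by blast
 qed
 then obtain r A R where P: "!!x. P x (r x) (A x) (R x)" by metis
 obtain C where C: "C \<subseteq> {0..1}" "finite C" "{0..1} \<subseteq> (\<Union>x\<in>C. ball x (r x))"
 proof (rule compactE_image[of "{0..1::real}" "{0..1}" "%x. ball x (r x)"])
  show "{0..1} \<subseteq> (\<Union>x\<in>{0..1}. ball x (r x))"
   using P unfolding P_def by (auto intro!: bexI)
 qed auto
 define AA RR where "AA = (\<Sum>x\<in>C. A x)" and "RR = 1 + (\<Sum>x\<in>C. R x)"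
 have A0: "A x >= 0" and R0: "R x > 0" for x using P[of x] unfolding P_def by auto
 have AA: "AA >= 0" unfolding AA_def using A0 by (simp add: sum_nonneg)
 have RR: "RR > 0" unfolding RR_def using R0 by (smt (verit) sum_nonneg)
 have main: "((deriv ^^ m) V has_real_derivative (deriv ^^ Suc m) V y) (at y) &
   \<bar>(deriv ^^ m) V y\<bar> <= AA * fact m * RR ^ m" if y: "y \<in> {0..1}" for m y
 proof -
  obtain x where x: "x \<in> C" "y \<in> ball x (r x)" using C y by blast
  have "A x <= AA" unfolding AA_def by (rule member_le_sum) (use x C A0 in auto)
  moreover have "R x <= RR"
   unfolding RR_def using member_le_sum[of x C R] x C R0 by (smt (verit))
  then have "R x ^ m <= RR ^ m" by (rule power_mono) (use R0[of x] in simp)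
  ultimately have "A x * fact m * R x ^ m <= AA * fact m * RR ^ m"
   using A0[of x] R0[of x] AA by (intro mult_mono) auto
  moreover have "\<bar>y - x\<bar> < r x" using x by (simp add: dist_real_def abs_minus_commute)
  then have "((deriv ^^ m) V has_real_derivative (deriv ^^ Suc m) V y) (at y) &
    \<bar>(deriv ^^ m) V y\<bar> <= A x * fact m * R x ^ m"
   using P[of x] unfolding P_def by blast
  ultimately show ?thesis by linarith
 qed
 have pmi: "(deriv ^^ m) V (y + of_int k) = (deriv ^^ m) V y" for m y k
  by (rule periodic_of_int) (rule pm)
 show ?thesis
 proof (rule that[of AA RR])
  fix m and y :: real
  define z where "z = frac y"
  have z: "z \<in> {0..1}" unfolding z_def using frac_lt_1[of y] by (simp add: less_imp_le)
  have y: "y = z + of_int \<lfloor>y\<rfloor>" unfolding z_def frac_def by simp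
  show "((deriv ^^ m) V has_real_derivative (deriv ^^ Suc m) V y) (at y)"
  proof -
   have "((deriv ^^ m) V has_real_derivative (deriv ^^ Suc m) V (z + of_int \<lfloor>y\<rfloor>)) (at (z + of_int \<lfloor>y\<rfloor>))"
    by (simp only: DERIV_shift pmi main[OF z])
   then show ?thesis by (simp only: y[symmetric])
  qed
  show "\<bar>(deriv ^^ m) V y\<bar> <= AA * fact m * RR ^ m"
   using main[OF z, of m] pmi[of m z "\<lfloor>y\<rfloor>"] unfolding y[symmetric] by simp
 qed (rule AA RR pm)+
qed

lemma integral_periodic_shift:
 fixes f :: "real => 'a::euclidean_space"
 assumes cont: "continuous_on UNIV f" and per: "!!x. f (x + 1) = f x"
 shows "integral {0..1} (%t. f (t + a)) = integral {0..1} f"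
proof -
 define b where "b = frac a"
 have b: "0 <= b" "b <= 1" unfolding b_def using frac_lt_1[of a] by auto
 have int: "f integrable_on {u..v}" for u v
  by (rule integrable_continuous_real) (rule continuous_on_subset[OF cont], simp)
 have "f (t + a) = f (t + b)" for t
  using periodic_of_int[of f "t + b" "\<lfloor>a\<rfloor>", OF per] unfolding b_def frac_def
  by (simp add: algebra_simps)
 then have "integral {0..1} (%t. f (t + a)) = integral {0..1} (%t. f (t + b))" by simp
 also have "... = integral {b..1 + b} f"
  using integral_shift_Icc_real[of 0 1 f b] by (simp add: o_def add.commute)
 also have "... = integral {b..1} f + integral {1..1 + b} f"
  by (rule Henstock_Kurzweil_Integration.integral_combine[symmetric]) (use b int in auto)
 also have "integral {1..1 + b} f = integral {0..b} (%t. f (t + 1))"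
  using integral_shift_Icc_real[of 0 b f 1] by (simp add: o_def add.commute)
 also have "... = integral {0..b} f" using per by simp
 also have "integral {b..1} f + integral {0..b} f = integral {0..1} f"
  using Henstock_Kurzweil_Integration.integral_combine[of 0 b 1 f] b int
  by (simp add: add.commute)
 finally show ?thesis .
qed

section \<open>Fourier series of periodic analytic functions\<close>

abbreviation e1 :: "real => complex" where "e1 x \<equiv> cis (2 * pi * x)"

lemma e1_of_int [simp]: "e1 (of_int k) = 1"
 by (simp add: cis_conv_exp exp_eq_1 mult.commute)

lemma e1_periodic: "e1 (x + 1) = e1 x"
 by (simp add: ring_distribs flip: cis_mult)

lemma e1_add: "e1 (x + y) = e1 x * e1 y"
 by (simp add: ring_distribs flip: cis_mult)

text \<open>Shifting \<open>t\<close> by \<open>1 / (2 * k)\<close> changes the sign of the character, so the integral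
is half of one whose factor \<open>f t - f (t + 1 / (2 * k))\<close> is uniformly small.\<close>

lemma Riemann_Lebesgue_periodic:
 fixes f :: "real => complex"
 assumes cont: "continuous_on UNIV f" and per: "!!x. f (x + 1) = f x" and eps: "ep > 0"
 shows "\<exists>K>0. ALL k. \<bar>k\<bar> >= K --> cmod (integral {0..1} (%t. f t * e1 (- of_int k * t))) <= ep"
proof -
 have "uniformly_continuous_on {-1..2} f"
  by (rule compact_uniformly_continuous) (use continuous_on_subset[OF cont] in auto)
 then obtain \<delta> where \<delta>: "\<delta> > 0" "!!x y. x \<in> {-1..2} ==> y \<in> {-1..2} ==> dist y x < \<delta> ==> dist (f y) (f x) < ep"
  unfolding uniformly_continuous_on_def using eps by metis
 obtain K :: int where K: "of_int K > 1 / \<delta>" "K > 0"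
  using ex_less_of_int[of "max (1 / \<delta>) 0"] by (metis max_less_iff_conj of_int_0_less_iff)
 show ?thesis
 proof (intro exI conjI allI impI)
  show "K > 0" by (rule K)
  fix k :: int assume k: "\<bar>k\<bar> >= K"
  define a where "a = 1 / (2 * real_of_int k)"
  have k0: "k ~= 0" using k K by auto
  have "\<bar>a\<bar> = 1 / (2 * \<bar>real_of_int k\<bar>)" unfolding a_def by simp
  also have "... <= 1 / (2 * real_of_int K)"
   using k K by (intro divide_left_mono) (auto simp: k0)
  also have "... < \<delta>"
   using K \<delta>(1) by (simp add: field_simps) 
  finally have a: "\<bar>a\<bar> < \<delta>" .
  have a1: "\<bar>a\<bar> <= 1"
  proof -
   have "\<bar>real_of_int k\<bar> >= 1" using k0 by linarith
   then show ?thesis unfolding a_def by (simp add: field_simps)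
  qed
  define g where "g t = f t * e1 (- of_int k * t)" for t
  have gc: "continuous_on UNIV g"
   unfolding g_def by (intro continuous_intros cont)
  have gp: "g (t + 1) = g t" for t
  proof -
   have "e1 (- of_int k * (t + 1)) = e1 (- of_int k * t) * e1 (of_int (- k))"
    unfolding e1_add[symmetric] by (simp add: algebra_simps)
   then show ?thesis unfolding g_def using per e1_of_int[of "- k"] by simp
  qed
  have sh: "g (t + a) = - (f (t + a) * e1 (- of_int k * t))" for t
  proof -
   have "- of_int k * (t + a) = - of_int k * t + (- 1 / 2)"
    unfolding a_def using k0 by (simp add: field_simps)
   then have "e1 (- of_int k * (t + a)) = e1 (- of_int k * t) * e1 (- 1 / 2)"
    by (simp only: e1_add)
   also have "e1 (- 1 / 2) = - 1" by (simp add: complex_eq_iff)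
   finally show ?thesis unfolding g_def by simp
  qed
  have int: "g integrable_on {0..1}" "(%t. g (t + a)) integrable_on {0..1}"
   by (rule integrable_continuous_real, rule continuous_on_subset[OF gc], simp,
     rule integrable_continuous_real, rule continuous_on_subset[of UNIV],
     rule continuous_on_compose2[OF gc]) (auto intro!: continuous_intros)
  have "2 * integral {0..1} g = integral {0..1} g + integral {0..1} (%t. g (t + a))"
   using integral_periodic_shift[OF gc gp, of a] by simp
  also have "... = integral {0..1} (%t. g t + g (t + a))"
   by (rule integral_add[symmetric]) (use int in auto)
  finally have eq: "2 * integral {0..1} g = integral {0..1} (%t. g t + g (t + a))" .
  have "cmod (integral {0..1} (%t. g t + g (t + a))) <= ep * (1 - 0)"
  proof (rule integral_bound)
   show "continuous_on {0..1} (%t. g t + g (t + a))"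
    by (intro continuous_intros continuous_on_subset[OF gc] continuous_on_compose2[OF gc]) auto
   fix t :: real assume t: "t \<in> {0..1}"
   have "g t + g (t + a) = (f t - f (t + a)) * e1 (- of_int k * t)"
    unfolding sh unfolding g_def by (simp add: algebra_simps)
   then have "cmod (g t + g (t + a)) = dist (f t) (f (t + a))"
    by (simp add: norm_mult dist_norm)
   also have "... < ep"
    by (rule \<delta>(2)) (use t a a1 in \<open>auto simp: dist_real_def\<close>)
   finally show "cmod (g t + g (t + a)) <= ep" by simp
  qed auto
  then have "2 * cmod (integral {0..1} g) <= ep"
   using eq by (metis diff_zero mult.right_neutral norm_mult norm_numeral)
  then show "cmod (integral {0..1} (%t. f t * e1 (- of_int k * t))) <= ep"
   unfolding g_def using eps by simp
 qed
qed

lemma int_interval_telescope: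
 fixes F :: "int => complex"
 shows "(\<Sum>k = - int n..int n. F (k - 1) - F k) = F (- int n - 1) - F (int n)"
proof (induction n)
 case (Suc n)
 have S: "{- int (Suc n)..int (Suc n)} = insert (- int n - 1) (insert (int n + 1) {- int n..int n})"
  by auto
 have "(\<Sum>k = - int (Suc n)..int (Suc n). F (k - 1) - F k) =
  F (- int n - 1 - 1) - F (- int n - 1) + (F (int n + 1 - 1) - F (int n + 1) + (F (- int n - 1) - F (int n)))"
  unfolding S Suc[symmetric] by simp
 also have "... = F (- int (Suc n) - 1) - F (int (Suc n))"
  by (simp add: add.commute diff_diff_eq)
 finally show ?case .
qed simp

lemma exp_ix_derivative:
 "((%z. exp (2 * pi * c * \<i> * z)) has_field_derivative (2 * pi * c * \<i>) * exp (2 * pi * c * \<i> * z)) (at z)"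
 by (auto intro!: derivative_eq_intros)

lemma e1_conv_exp: "e1 (c * t) = exp (2 * pi * c * \<i> * of_real t)"
 by (simp add: cis_conv_exp mult_ac)

lemma e1_has_derivative:
 "((%t. e1 (c * t)) has_vector_derivative (2 * pi * c * \<i>) * e1 (c * t)) (at t within S)"
 unfolding e1_conv_exp
 by (rule has_vector_derivative_at_within, rule has_vector_derivative_real_field, rule exp_ix_derivative)

lemma integral_e1: "integral {0..1} (%t. e1 (of_int k * t)) = (if k = 0 then 1 else 0)"
proof (cases "k = 0")
 case False
 define w where "w = 2 * complex_of_real pi * complex_of_real (of_int k) * \<i>"
 have w: "w ~= 0" unfolding w_def using False by simp
 have "((%t. w * e1 (of_int k * t)) has_integral e1 (of_int k * 1) - e1 (of_int k * 0)) {0..1}"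
  unfolding w_def
  by (rule fundamental_theorem_of_calculus) (use e1_has_derivative[of "of_int k"] in auto)
 then have "((%t. inverse w * (w * e1 (of_int k * t))) has_integral inverse w * 0) {0..1}"
  by (intro has_integral_mult_right) simp
 then have "((%t. e1 (of_int k * t)) has_integral 0) {0..1}"
  using w by (simp add: mult.assoc[symmetric])
 then show ?thesis using False by (simp add: integral_unique)
qed simp

lemma e1_eq_1_iff: "e1 t = 1 \<longleftrightarrow> t \<in> \<int>"
proof
 assume "e1 t = 1"
 then obtain n :: int where "2 * pi * t = of_int (2 * n) * pi"
  by (auto simp: cis_conv_exp exp_eq_1)
 then have "t = of_int n" by simp
 then show "t \<in> \<int>" by simp
qed (auto elim!: Ints_cases)

text \<open>Multiplication by \<open>e1 t - 1\<close> shifts Fourier coefficients and takes differences, so this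
quotient makes the partial sums of the Fourier series at \<open>x\<close> telescope.\<close>

lemma periodic_quotient_continuous:
 fixes V :: "real => real"
 assumes cont: "continuous_on UNIV V" and per: "!!x. V (x + 1) = V x"
  and D: "(V has_real_derivative D) (at x)"
 defines "\<phi> \<equiv> %t. if e1 t = 1 then of_real D / (2 * pi * \<i>) else of_real (V (x + t) - V x) / (e1 t - 1)"
 shows "continuous_on UNIV \<phi>" "!!t. \<phi> (t + 1) = \<phi> t" "!!t. of_real (V (x + t) - V x) = \<phi> t * (e1 t - 1)"
proof -
 show p: "\<phi> (t + 1) = \<phi> t" for t
  unfolding \<phi>_def using e1_periodic[of t] per[of "x + t"] by (simp add: add.assoc)
 show "of_real (V (x + t) - V x) = \<phi> t * (e1 t - 1)" for t
 proof (cases "e1 t = 1")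
  case True
  then obtain k where "t = of_int k" using e1_eq_1_iff by (auto elim!: Ints_cases)
  then show ?thesis using periodic_of_int[of V x k, OF per] True by simp
 qed (simp add: \<phi>_def)
 have c0: "isCont \<phi> 0"
 proof -
  have L1: "((%h. of_real ((V (x + h) - V x) / h)) \<longlongrightarrow> complex_of_real D) (at 0)"
   using D unfolding DERIV_def by (rule tendsto_of_real)
  have "((%z. (exp (2 * pi * 1 * \<i> * (0 + z)) - exp (2 * pi * 1 * \<i> * 0)) / z) \<longlongrightarrow> (2 * pi * 1 * \<i>) * exp (2 * pi * 1 * \<i> * 0)) (at 0)"
   using exp_ix_derivative[of 1 0] unfolding DERIV_def by simp
  moreover have "filterlim complex_of_real (at 0) (at 0)"
   unfolding filterlim_at by (auto intro!: tendsto_eq_intros simp: eventually_at_filter)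
  ultimately have "((%h. (exp (2 * pi * 1 * \<i> * (0 + complex_of_real h)) - exp (2 * pi * 1 * \<i> * 0)) / of_real h) \<longlongrightarrow> (2 * pi * 1 * \<i>) * exp (2 * pi * 1 * \<i> * 0)) (at 0)"
   by (rule filterlim_compose)
  then have L2: "((%h. (e1 h - 1) / of_real h) \<longlongrightarrow> 2 * pi * \<i>) (at 0)"
   using e1_conv_exp[of 1] by simp
  have "((%h. of_real ((V (x + h) - V x) / h) / ((e1 h - 1) / of_real h)) \<longlongrightarrow> of_real D / (2 * pi * \<i>)) (at 0)"
   by (rule tendsto_divide[OF L1 L2]) simp
  moreover have "\<forall>\<^sub>F h in at 0. of_real ((V (x + h) - V x) / h) / ((e1 h - 1) / of_real h) = \<phi> h"
  proof -
   have "e1 h ~= 1" if "h ~= 0" "\<bar>h\<bar> < 1" for h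
    using that e1_eq_1_iff by (auto elim!: Ints_cases)
   then have "of_real ((V (x + h) - V x) / h) / ((e1 h - 1) / of_real h) = \<phi> h" if "h ~= 0" "dist h 0 < 1" for h
    using that by (simp add: \<phi>_def)
   then show ?thesis unfolding eventually_at by (intro exI[of _ 1]) auto
  qed
  ultimately have "(\<phi> \<longlongrightarrow> of_real D / (2 * pi * \<i>)) (at 0)"
   by (rule Lim_transform_eventually)
  moreover have "\<phi> 0 = of_real D / (2 * pi * \<i>)" unfolding \<phi>_def by simp
  ultimately show ?thesis by (simp add: isCont_def)
 qed
 have "isCont \<phi> t" for t
 proof (cases "e1 t = 1")
  case True
  then obtain k where k: "t = of_int k" using e1_eq_1_iff by (auto elim!: Ints_cases)
  have "\<phi> (of_int k + h) = \<phi> (0 + h)" for h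
   using periodic_of_int[of \<phi> h k, OF p] by (simp add: add.commute)
  from this[of 0] this c0 show ?thesis unfolding k isCont_iff by simp
 next
  case False
  have "open {s. e1 s ~= 1}"
   by (rule open_Collect_neq) (intro continuous_intros)+
  then have ev: "\<forall>\<^sub>F s in nhds t. e1 s ~= 1"
   using False eventually_nhds_in_open by fastforce
  have "continuous_on UNIV e1" by (intro continuous_intros)
  then have cE: "isCont e1 s" for s by (simp add: continuous_on_eq_continuous_at)
  have cV: "isCont V s" for s using cont by (simp add: continuous_on_eq_continuous_at)
  have "isCont (%s. of_real (V (x + s) - V x) / (e1 s - 1)) t"
   using False by (intro continuous_intros isCont_o2[OF _ cV] cE) auto
  then show ?thesis
   by (subst isCont_cong[OF eventually_mono[OF ev]]) (auto simp: \<phi>_def)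
 qed
 then show "continuous_on UNIV \<phi>" by (simp add: continuous_at_imp_continuous_on)
qed

text \<open>With the quotient of the previous lemma, partial sum minus value is a difference of two Fourier
coefficients of high frequency, which vanish in the limit by Riemann--Lebesgue.\<close>

lemma fourier_partial_sums:
 fixes V :: "real => real"
 assumes cont: "continuous_on UNIV V" and per: "!!x. V (x + 1) = V x"
  and D: "(V has_real_derivative D) (at x)"
 defines "c \<equiv> %k::int. integral {0..1} (%t. of_real (V t) * e1 (- of_int k * t))"
 shows "(%n. \<Sum>k = - int n..int n. c k * e1 (of_int k * x)) \<longlonglongrightarrow> of_real (V x)"
proof -
 obtain \<phi> where \<phi>: "continuous_on UNIV \<phi>" "!!t. \<phi> (t + 1) = \<phi> t"
   "!!t. of_real (V (x + t) - V x) = \<phi> t * (e1 t - 1)"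
  using periodic_quotient_continuous[OF cont per D] by blast
 define F where "F k = integral {0..1} (%t. \<phi> t * e1 (- of_int k * t))" for k :: int
 have intg: "(%t. g t * e1 (- of_int k * t)) integrable_on {0..1}" if "continuous_on UNIV g" for g and k :: int
  by (intro integrable_continuous_real continuous_intros continuous_on_subset[OF that]) auto
 have key: "c k * e1 (of_int k * x) = (if k = 0 then of_real (V x) else 0) + (F (k - 1) - F k)" for k
 proof -
  define g where "g t = of_real (V t) * e1 (- of_int k * (t - x))" for t
  have gc: "continuous_on UNIV g" unfolding g_def by (intro continuous_intros cont)
  have gp: "g (t + 1) = g t" for t
  proof -
   have "e1 (- of_int k * (t + 1 - x)) = e1 (- of_int k * (t - x)) * e1 (of_int (- k))"
    unfolding e1_add[symmetric] by (simp add: algebra_simps)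
   then have "e1 (- of_int k * (t + 1 - x)) = e1 (- of_int k * (t - x))"
    by (simp only: e1_of_int mult_1_right)
   then show ?thesis unfolding g_def using per by (simp only:)
  qed
  have "c k * e1 (of_int k * x) = integral {0..1} (%t. (of_real (V t) * e1 (- of_int k * t)) * e1 (of_int k * x))"
   unfolding c_def by simp
  also have "(%t. (of_real (V t) * e1 (- of_int k * t)) * e1 (of_int k * x)) = g"
  proof
   fix t
   have "e1 (- of_int k * t) * e1 (of_int k * x) = e1 (- of_int k * (t - x))"
    unfolding e1_add[symmetric] by (simp add: algebra_simps)
   then show "(of_real (V t) * e1 (- of_int k * t)) * e1 (of_int k * x) = g t"
    unfolding g_def by (simp only: mult.assoc)
  qed
  also have "integral {0..1} g = integral {0..1} (%t. g (t + x))"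
   by (rule integral_periodic_shift[OF gc gp, symmetric])
  also have "(%t. g (t + x)) = (%t. of_real (V x) * e1 (of_int (- k) * t) +
    (\<phi> t * e1 (- of_int (k - 1) * t) - \<phi> t * e1 (- of_int k * t)))"
  proof
   fix t
   have 1: "e1 (- of_int (k - 1) * t) = e1 t * e1 (- of_int k * t)"
    unfolding e1_add[symmetric] by (simp add: algebra_simps)
   have "g (t + x) = (of_real (V x) + of_real (V (x + t) - V x)) * e1 (- of_int k * t)"
    unfolding g_def by (simp add: add.commute)
   also have "... = of_real (V x) * e1 (of_int (- k) * t) + (\<phi> t * (e1 t * e1 (- of_int k * t)) - \<phi> t * e1 (- of_int k * t))"
    unfolding \<phi>(3) by (simp add: algebra_simps)
   finally show "g (t + x) = of_real (V x) * e1 (of_int (- k) * t) +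
    (\<phi> t * e1 (- of_int (k - 1) * t) - \<phi> t * e1 (- of_int k * t))" unfolding 1 .
  qed
  also have "integral {0..1} ... = integral {0..1} (%t. of_real (V x) * e1 (of_int (- k) * t)) +
    integral {0..1} (%t. \<phi> t * e1 (- of_int (k - 1) * t) - \<phi> t * e1 (- of_int k * t))"
   by (rule integral_add; (intro integrable_diff intg \<phi>(1))?)
    (intro integrable_continuous_real continuous_intros)
  also have "integral {0..1} (%t. of_real (V x) * e1 (of_int (- k) * t)) = of_real (V x) * (if k = 0 then 1 else 0)"
   unfolding integral_mult_right integral_e1 by simp
  also have "integral {0..1} (%t. \<phi> t * e1 (- of_int (k - 1) * t) - \<phi> t * e1 (- of_int k * t)) = F (k - 1) - F k"
   unfolding F_def by (rule integral_diff; intro intg \<phi>(1))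
  finally show ?thesis by simp
 qed
 have sum: "(\<Sum>k = - int n..int n. c k * e1 (of_int k * x)) = of_real (V x) + (F (- int n - 1) - F (int n))" for n
 proof -
  have "(\<Sum>k = - int n..int n. c k * e1 (of_int k * x)) =
   (\<Sum>k = - int n..int n. if k = 0 then of_real (V x) else 0) + (\<Sum>k = - int n..int n. F (k - 1) - F k)"
   unfolding key by (rule sum.distrib)
  then show ?thesis unfolding int_interval_telescope by simp
 qed
 have "(%n. F (- int n - 1) - F (int n)) \<longlonglongrightarrow> 0"
 proof (rule LIMSEQ_I)
  fix r :: real assume r: "r > 0"
  obtain K where K: "K > 0" "!!k. \<bar>k\<bar> >= K ==> cmod (F k) <= r / 3"
   using Riemann_Lebesgue_periodic[OF \<phi>(1,2), of "r / 3"] r unfolding F_def by auto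
  show "\<exists>no. \<forall>n\<ge>no. cmod (F (- int n - 1) - F (int n) - 0) < r"
  proof (intro exI[of _ "nat K"] allI impI)
   fix n assume "n >= nat K"
   then have "cmod (F (- int n - 1)) <= r / 3" "cmod (F (int n)) <= r / 3"
    by (intro K(2); simp)+
   then show "cmod (F (- int n - 1) - F (int n) - 0) < r"
    using norm_triangle_ineq4[of "F (- int n - 1)" "F (int n)"] r by simp
  qed
 qed
 then have "(%n. of_real (V x) + (F (- int n - 1) - F (int n))) \<longlonglongrightarrow> of_real (V x) + 0"
  by (intro tendsto_add tendsto_const)
 then show ?thesis unfolding sum by simp
qed

lemma summable_on_int_split:
 fixes f :: "int => real"
 assumes "(%n. f (int n)) summable_on UNIV" "(%n. f (- int n)) summable_on UNIV"
 shows "f summable_on UNIV"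
proof -
 have 1: "f summable_on range int"
  using assms(1) by (subst summable_on_reindex) (auto simp: o_def)
 have 2: "f summable_on range (%n. - int n)"
  using assms(2) by (subst summable_on_reindex) (auto simp: o_def inj_on_def)
 have "(UNIV :: int set) = range int \<union> range (%n. - int n)"
 proof (rule set_eqI)
  fix k :: int
  show "k \<in> UNIV \<longleftrightarrow> k \<in> range int \<union> range (%n. - int n)"
   by (cases k rule: int_cases2) auto
 qed
 then show ?thesis using summable_on_union[OF 1 2] by simp
qed

lemma summable_on_exp_abs_int:
 assumes "\<rho> > 0"
 shows "(%k::int. exp (- (\<rho> * \<bar>of_int k\<bar>)) :: real) summable_on UNIV"
proof -
 have "summable (%n. norm (exp (- \<rho>) ^ n))"
  using assms by (simp add: summable_geometric)
 then have "(%n::nat. exp (- \<rho>) ^ n) summable_on UNIV"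
  by (rule norm_summable_imp_summable_on)
 then have "(%n::nat. exp (- (\<rho> * real n)) :: real) summable_on UNIV"
  by (simp add: exp_of_nat_mult[symmetric] mult.commute)
 then show ?thesis by (intro summable_on_int_split) simp_all
qed

lemma filterlim_symmetric_intervals:
 "filterlim (%n. {- int n..int n}) (finite_subsets_at_top UNIV) sequentially"
 unfolding filterlim_finite_subsets_at_top
proof safe
 fix X :: "int set" assume X: "finite X"
 have K: "\<bar>x\<bar> <= Max (abs ` X)" if "x \<in> X" for x
  using X that by (intro Max_ge) auto
 define K where "K = Max (abs ` X)"
 show "\<forall>\<^sub>F n in sequentially. finite {- int n..int n} & X \<subseteq> {- int n..int n} & {- int n..int n} \<subseteq> UNIV"
 proof (rule eventually_sequentiallyI[of "nat K"])
  fix n assume "nat K <= n"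
  then show "finite {- int n..int n} & X \<subseteq> {- int n..int n} & {- int n..int n} \<subseteq> UNIV"
   using K unfolding K_def[symmetric] by fastforce
 qed
qed

text \<open>Integrating by parts \<open>m\<close> times bounds the coefficient at \<open>k\<close> by \<open>A * fact
m * (R / (2 * pi * \<bar>k\<bar>)) ^ m\<close> for every \<open>m\<close>. Weighting these bounds by the exponential
series in \<open>m\<close> yields exponential decay.\<close>

theorem real_analytic_fourier_series:
 fixes V :: "real => real"
 assumes an: "real_analytic V" and per: "!!x. V (x + 1) = V x"
 obtains \<rho> v where "\<rho> > 0" "!!x. ((%k::int. v k * e1 (of_int k * x)) has_sum of_real (V x)) UNIV"
  "(%k::int. cmod (v k) * exp (\<rho> * \<bar>of_int k\<bar>)) summable_on UNIV"
proof -
 obtain A R where A: "A >= 0" "R > 0"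
  "!!m y. ((deriv ^^ m) V has_real_derivative (deriv ^^ Suc m) V y) (at y)"
  "!!m y. \<bar>(deriv ^^ m) V y\<bar> <= A * fact m * R ^ m"
  "!!m y. (deriv ^^ m) V (y + 1) = (deriv ^^ m) V y"
  using real_analytic_derivative_bounds[OF an per] by metis
 define C where "C m k = integral {0..1} (%t. complex_of_real ((deriv ^^ m) V t) * e1 (- of_int k * t))" for m and k :: int
 have Dc: "continuous_on S ((deriv ^^ m) V)" for S m
  using A(3) by (meson DERIV_continuous_on has_field_derivative_at_within)
 have step: "C (Suc m) k = (2 * pi * of_int k * \<i>) * C m k" for m k
 proof -
  let ?f = "%t. complex_of_real ((deriv ^^ m) V t) * e1 (- of_int k * t)"
  let ?g = "%t. complex_of_real ((deriv ^^ m) V t) * ((2 * pi * (- of_int k) * \<i>) * e1 (- of_int k * t)) +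
    of_real ((deriv ^^ Suc m) V t) * e1 (- of_int k * t)"
  have "(?g has_integral ?f 1 - ?f 0) {0..1}"
  proof (rule fundamental_theorem_of_calculus)
   fix t :: real assume "t \<in> {0..1}"
   have "((%t. complex_of_real ((deriv ^^ m) V t)) has_vector_derivative of_real ((deriv ^^ Suc m) V t)) (at t within {0..1})"
    using A(3)[of m t, THEN DERIV_subset, of "{0..1}"]
    by (intro has_vector_derivative_of_real) (auto intro: has_field_derivative_at_within)
   moreover have "((%t. e1 (- of_int k * t)) has_vector_derivative (2 * pi * (- of_int k) * \<i>) * e1 (- of_int k * t)) (at t within {0..1})"
    using e1_has_derivative[of "- of_int k" t "{0..1}"] by simp
   ultimately show "(?f has_vector_derivative ?g t) (at t within {0..1})"
    by (rule has_vector_derivative_mult)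
  qed simp
  moreover have "?f 1 = ?f 0"
   using A(5)[of m 0] e1_of_int[of "- k"] by simp
  ultimately have 1: "integral {0..1} ?g = 0" by (simp add: integral_unique)
  have "?g = (%t. (- (2 * pi * of_int k * \<i>)) * ?f t + of_real ((deriv ^^ Suc m) V t) * e1 (- of_int k * t))"
   by (simp add: algebra_simps)
  moreover have "integral {0..1} (%t. (- (2 * pi * of_int k * \<i>)) * ?f t + of_real ((deriv ^^ Suc m) V t) * e1 (- of_int k * t)) =
    integral {0..1} (%t. (- (2 * pi * of_int k * \<i>)) * ?f t) + C (Suc m) k"
   unfolding C_def by (rule integral_add; intro integrable_continuous_real continuous_intros Dc)
  ultimately show ?thesis using 1 unfolding integral_mult_right C_def[symmetric]
   by (simp add: add_eq_0_iff)
 qed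
 have pw: "C m k = (2 * pi * of_int k * \<i>) ^ m * C 0 k" for m k
  by (induction m) (simp_all add: step)
 have Cb: "cmod (C m k) <= A * fact m * R ^ m" for m k
 proof -
  have "cmod (C m k) <= (A * fact m * R ^ m) * (1 - 0)" unfolding C_def
  proof (rule integral_bound)
   show "continuous_on {0..1} (%t. complex_of_real ((deriv ^^ m) V t) * e1 (- of_int k * t))"
    by (intro continuous_intros Dc)
  qed (use A(4) in \<open>auto simp: norm_mult\<close>)
  then show ?thesis by simp
 qed
 define \<sigma> where "\<sigma> = ln 2 * pi / R"
 have \<sigma>: "\<sigma> > 0" unfolding \<sigma>_def using A(2) by simp
 have decay: "cmod (C 0 k) <= 2 * A * exp (- (\<sigma> * \<bar>of_int k\<bar>))" for k
 proof (cases "k = 0")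
  case True
  then show ?thesis using Cb[of 0 k] A(1) by simp
 next
  case False
  define t where "t = 2 * pi * \<bar>real_of_int k\<bar> / R"
  have t: "t > 0" unfolding t_def using False A(2) by simp
  define m where "m = nat \<lfloor>t / 2\<rfloor>"
  have m: "real m <= t / 2" "t / 2 <= real m + 1" unfolding m_def using t by linarith+
  have "(2 * pi * \<bar>real_of_int k\<bar>) ^ m * cmod (C 0 k) <= A * fact m * R ^ m"
   using Cb[of m k] unfolding pw[of m] by (simp add: norm_mult norm_power)
  then have "(t * R) ^ m * cmod (C 0 k) <= A * fact m * R ^ m"
   unfolding t_def using A(2) by simp
  then have "t ^ m * cmod (C 0 k) <= A * fact m"
   using A(2) by (simp add: power_mult_distrib mult_ac)
  also have "... <= A * (t / 2) ^ m"
  proof -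
   have "fact m <= real m ^ m" using fact_le_power[of m, where ?'a = real] by simp
   also have "... <= (t / 2) ^ m" by (rule power_mono) (use m in auto)
   finally show ?thesis using A(1) by (intro mult_left_mono)
  qed
  finally have "t ^ m * cmod (C 0 k) <= t ^ m * (A * (1 / 2) ^ m)"
   by (simp add: power_divide mult_ac)
  then have "cmod (C 0 k) <= A * (1 / 2) ^ m" using t by simp
  also have "(1 / 2 :: real) ^ m = exp (- (ln 2 * real m))"
   by (simp add: exp_minus power_one_over inverse_eq_divide mult.commute[of "ln 2"] exp_of_nat_mult)
  also have "A * ... <= A * exp (ln 2 - \<sigma> * \<bar>of_int k\<bar>)"
  proof (rule mult_left_mono)
   have "\<sigma> * \<bar>of_int k\<bar> = ln 2 * (t / 2)" unfolding \<sigma>_def t_def by simp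
   also have "... <= ln 2 * (real m + 1)" using m by (intro mult_left_mono) auto
   finally show "exp (- (ln 2 * real m)) <= exp (ln 2 - \<sigma> * \<bar>of_int k\<bar>)"
    by (simp add: algebra_simps)
  qed (rule A(1))
  also have "... = 2 * A * exp (- (\<sigma> * \<bar>of_int k\<bar>))"
   by (simp add: exp_diff exp_minus field_simps)
  finally show ?thesis .
 qed
 have sm: "(%k::int. cmod (C 0 k) * exp (\<sigma> / 2 * \<bar>of_int k\<bar>)) summable_on UNIV"
 proof (rule summable_on_comparison_test)
  show "(%k::int. 2 * A * exp (- (\<sigma> / 2 * \<bar>of_int k\<bar>))) summable_on UNIV"
   by (intro summable_on_cmult_right summable_on_exp_abs_int) (use \<sigma> in simp)
  fix k :: int
  have "cmod (C 0 k) * exp (\<sigma> / 2 * \<bar>of_int k\<bar>) <= (2 * A * exp (- (\<sigma> * \<bar>of_int k\<bar>))) * exp (\<sigma> / 2 * \<bar>of_int k\<bar>)"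
   by (rule mult_right_mono[OF decay]) simp
  also have "... = 2 * A * exp (- (\<sigma> / 2 * \<bar>of_int k\<bar>))"
   by (simp add: mult.assoc mult_exp_exp)
  finally show "cmod (C 0 k) * exp (\<sigma> / 2 * \<bar>of_int k\<bar>) <= 2 * A * exp (- (\<sigma> / 2 * \<bar>of_int k\<bar>))" .
 qed auto
 have sm0: "(%k::int. C 0 k * e1 (of_int k * x)) summable_on UNIV" for x
 proof (rule abs_summable_summable)
  show "(%k. cmod (C 0 k * e1 (of_int k * x))) summable_on UNIV"
  proof (rule summable_on_comparison_test[OF sm])
   fix k :: int
   have "cmod (C 0 k) * 1 <= cmod (C 0 k) * exp (\<sigma> / 2 * \<bar>of_int k\<bar>)"
    using \<sigma> by (intro mult_left_mono) auto
   then show "cmod (C 0 k * e1 (of_int k * x)) <= cmod (C 0 k) * exp (\<sigma> / 2 * \<bar>of_int k\<bar>)"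
    by (simp add: norm_mult)
  qed auto
 qed
 have hs: "((%k::int. C 0 k * e1 (of_int k * x)) has_sum of_real (V x)) UNIV" for x
 proof -
  obtain S where S: "((%k::int. C 0 k * e1 (of_int k * x)) has_sum S) UNIV"
   using sm0[of x] by (auto simp: summable_on_def)
  then have "((%n. \<Sum>k = - int n..int n. C 0 k * e1 (of_int k * x)) \<longlongrightarrow> S) sequentially"
   unfolding has_sum_def by (rule filterlim_compose[OF _ filterlim_symmetric_intervals])
  moreover have "(%n. \<Sum>k = - int n..int n. C 0 k * e1 (of_int k * x)) \<longlonglongrightarrow> of_real (V x)"
   using fourier_partial_sums[of V, OF _ per, of "deriv V x" x] Dc[of UNIV 0] A(3)[of 0 x]
   unfolding C_def by simp
  ultimately have "S = of_real (V x)" by (rule LIMSEQ_unique)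
  then show ?thesis using S by simp
 qed
 show ?thesis
  by (rule that[of "\<sigma> / 2" "C 0"]) (use \<sigma> hs sm in auto)
qed

abbreviation wt :: "real => int => real" where "wt \<rho> k \<equiv> exp (\<rho> * \<bar>of_int k\<bar>)"

section \<open>Functions with exponentially decaying Fourier coefficients\<close>

lemma has_sum_convolution:
 fixes a b :: "int => 'a :: {real_normed_field, banach}"
 assumes a: "(%k. norm (a k)) summable_on UNIV" "(a has_sum A) UNIV"
  and b: "(%k. norm (b k)) summable_on UNIV" "(b has_sum B) UNIV"
 shows "((%n. \<Sum>\<^sub>\<infinity>k. a k * b (n - k)) has_sum A * B) UNIV"
  and "(%k. norm (a k * b (n - k))) summable_on UNIV"
proof -
 define F where "F = (%(k, l). a k * b l)"
 have abs: "(%p. norm (F p)) summable_on UNIV \<times> UNIV"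
 proof (rule Infinite_Sum.abs_summable_on_Sigma_iff[THEN iffD2], intro conjI ballI)
  fix k :: int
  show "(%y. norm (F (k, y))) summable_on UNIV"
   unfolding F_def using b(1) by (simp add: norm_mult summable_on_cmult_right)
 next
  have "(%k. (\<Sum>\<^sub>\<infinity>l. norm (F (k, l)))) = (%k. norm (a k) * (\<Sum>\<^sub>\<infinity>l. norm (b l)))"
   unfolding F_def by (simp add: norm_mult infsum_cmult_right b(1))
  then show "(%x. norm (\<Sum>\<^sub>\<infinity>y. norm (F (x, y)))) summable_on UNIV"
   using a(1) by (simp add: norm_mult summable_on_cmult_left abs_mult infsum_nonneg)
 qed
 have hs: "(F has_sum A * B) (UNIV \<times> UNIV)"
 proof (rule has_sum_SigmaI)
  show "((%l. F (k, l)) has_sum a k * B) UNIV" for k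
   unfolding F_def using has_sum_cmult_right[OF b(2)] by simp
  show "((%k. a k * B) has_sum A * B) UNIV" using has_sum_cmult_left[OF a(2)] .
  show "F summable_on UNIV \<times> UNIV" using abs by (rule abs_summable_summable)
 qed
 define h where "h = (%(n, k). (k, n - k :: int))"
 have bij: "bij_betw h (UNIV \<times> UNIV) (UNIV \<times> UNIV)"
  by (rule bij_betwI[of _ _ _ "%(k, l). (k + l, k)"]) (auto simp: h_def)
 have hs2: "((%p. F (h p)) has_sum A * B) (UNIV \<times> UNIV)"
  using has_sum_reindex_bij_betw[OF bij] hs by blast
 have abs2: "(%p. norm (F (h p))) summable_on UNIV \<times> UNIV"
  using summable_on_reindex_bij_betw[OF bij, of "%p. norm (F p)"] abs by simp
 then have in': "(%k. norm (F (h (n, k)))) summable_on UNIV" for n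
  unfolding Infinite_Sum.abs_summable_on_Sigma_iff by auto
 then show "(%k. norm (a k * b (n - k))) summable_on UNIV"
  by (simp add: F_def h_def)
 have "((%k. F (h (n, k))) has_sum (\<Sum>\<^sub>\<infinity>k. a k * b (n - k))) UNIV" for n
  using abs_summable_summable[OF in'[of n]] by (simp add: F_def h_def)
 then show "((%n. \<Sum>\<^sub>\<infinity>k. a k * b (n - k)) has_sum A * B) UNIV"
  by (rule has_sum_SigmaD[OF hs2])
qed

text \<open>Boundary values of functions analytic in a strip, with the norm of an algebra: norms multiply under
products, so entries of a product of \<open>n\<close> transfer matrices have norm at most \<open>C ^
n\<close>.\<close>

definition fourier_class :: "real => real => (real => complex) => bool" where
 "fourier_class \<rho> B f \<longleftrightarrow> (\<exists>(c :: int => complex) S.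
   (ALL x. ((%k. c k * e1 (of_int k * x)) has_sum f x) UNIV) &
   ((%k. cmod (c k) * wt \<rho> k) has_sum S) UNIV & S <= B)"

lemma fourier_class_mono: "fourier_class \<rho> B f ==> B <= C ==> fourier_class \<rho> C f"
 unfolding fourier_class_def by (meson order_trans)

lemma fourier_class_const: "fourier_class \<rho> (cmod a) (%_. a)"
 unfolding fourier_class_def
proof (intro exI conjI allI)
 let ?c = "%k::int. if k = 0 then a else 0"
 show "((%k. ?c k * e1 (of_int k * x)) has_sum a) UNIV" for x
  by (rule has_sum_finite_neutralI[of "{0}"]) auto
 show "((%k. cmod (?c k) * wt \<rho> k) has_sum cmod a) UNIV"
  by (rule has_sum_finite_neutralI[of "{0}"]) auto
qed simp

lemma fourier_class_add:
 assumes "fourier_class \<rho> A f" "fourier_class \<rho> B g"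
 shows "fourier_class \<rho> (A + B) (%x. f x + g x)"
proof -
 obtain c S where c: "!!x. ((%k. c k * e1 (of_int k * x)) has_sum f x) UNIV"
   "((%k. cmod (c k) * wt \<rho> k) has_sum S) UNIV" "S <= A"
  using assms(1) unfolding fourier_class_def by blast
 obtain d T where d: "!!x. ((%k. d k * e1 (of_int k * x)) has_sum g x) UNIV"
   "((%k. cmod (d k) * wt \<rho> k) has_sum T) UNIV" "T <= B"
  using assms(2) unfolding fourier_class_def by blast
 have ST: "((%k. cmod (c k) * wt \<rho> k + cmod (d k) * wt \<rho> k) has_sum S + T) UNIV"
  by (rule has_sum_add[OF c(2) d(2)])
 have le: "cmod (c k + d k) * wt \<rho> k <= cmod (c k) * wt \<rho> k + cmod (d k) * wt \<rho> k" for k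
  unfolding distrib_right[symmetric] by (intro mult_right_mono norm_triangle_ineq) simp
 have "(%k. cmod (c k + d k) * wt \<rho> k) summable_on UNIV"
  by (rule summable_on_comparison_test[OF has_sum_imp_summable[OF ST]]) (use le in auto)
 then obtain U where U: "((%k. cmod (c k + d k) * wt \<rho> k) has_sum U) UNIV"
  by (auto simp: summable_on_def)
 have "U <= S + T" using has_sum_mono[OF U ST] le by blast
 then show ?thesis
  unfolding fourier_class_def
  using U c(3) d(3) has_sum_add[OF c(1) d(1)]
  by (intro exI[of _ "%k. c k + d k"] exI[of _ U]) (auto simp: distrib_right)
qed

lemma fourier_class_mult:
 assumes "fourier_class \<rho> A f" "fourier_class \<rho> B g" and \<rho>: "\<rho> >= 0"
 shows "fourier_class \<rho> (A * B) (%x. f x * g x)"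
proof -
 obtain c S where c: "!!x. ((%k. c k * e1 (of_int k * x)) has_sum f x) UNIV"
   "((%k. cmod (c k) * wt \<rho> k) has_sum S) UNIV" "S <= A"
  using assms(1) unfolding fourier_class_def by blast
 obtain d T where d: "!!x. ((%k. d k * e1 (of_int k * x)) has_sum g x) UNIV"
   "((%k. cmod (d k) * wt \<rho> k) has_sum T) UNIV" "T <= B"
  using assms(2) unfolding fourier_class_def by blast
 have S0: "S >= 0" "T >= 0" by (rule has_sum_nonneg[OF c(2)], simp, rule has_sum_nonneg[OF d(2)], simp)
 have abs: "(%k. cmod (c k)) summable_on UNIV" if "((%k. cmod (c k) * wt \<rho> k) has_sum S) UNIV" for c :: "int => complex" and S
 proof (rule summable_on_comparison_test[OF has_sum_imp_summable[OF that]])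
  fix k :: int
  have "cmod (c k) * 1 <= cmod (c k) * wt \<rho> k"
   using \<rho> by (intro mult_left_mono) auto
  then show "cmod (c k) <= cmod (c k) * wt \<rho> k" by simp
 qed auto
 define p where "p n = (\<Sum>\<^sub>\<infinity>k. c k * d (n - k))" for n
 have 1: "((%n. p n * e1 (of_int n * x)) has_sum f x * g x) UNIV" for x
 proof -
  have "((%n. \<Sum>\<^sub>\<infinity>k. (c k * e1 (of_int k * x)) * (d (n - k) * e1 (of_int (n - k) * x))) has_sum f x * g x) UNIV"
   by (rule has_sum_convolution(1)) (use c d abs[OF c(2)] abs[OF d(2)] in \<open>auto simp: norm_mult\<close>)
  also have "(%n. \<Sum>\<^sub>\<infinity>k. (c k * e1 (of_int k * x)) * (d (n - k) * e1 (of_int (n - k) * x))) = (%n. p n * e1 (of_int n * x))"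
  proof
   fix n
   have "(c k * e1 (of_int k * x)) * (d (n - k) * e1 (of_int (n - k) * x)) = (c k * d (n - k)) * e1 (of_int n * x)" for k
   proof -
    have "e1 (of_int k * x) * e1 (of_int (n - k) * x) = e1 (of_int n * x)"
     unfolding e1_add[symmetric] by (simp add: algebra_simps)
    then show ?thesis by (metis mult.assoc mult.left_commute)
   qed
   then have eq: "(%k. (c k * e1 (of_int k * x)) * (d (n - k) * e1 (of_int (n - k) * x))) = (%k. (c k * d (n - k)) * e1 (of_int n * x))"
    by (rule ext)
   show "(\<Sum>\<^sub>\<infinity>k. (c k * e1 (of_int k * x)) * (d (n - k) * e1 (of_int (n - k) * x))) = p n * e1 (of_int n * x)"
    unfolding eq p_def by (rule infsum_cmult_left') 
  qed
  finally show ?thesis .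
 qed
 define q where "q n = (\<Sum>\<^sub>\<infinity>k. (cmod (c k) * wt \<rho> k) * (cmod (d (n - k)) * exp (\<rho> * \<bar>of_int (n - k)\<bar>)))" for n
 have q: "(q has_sum S * T) UNIV"
  unfolding q_def
  by (rule has_sum_convolution(1)) (use c d in \<open>auto intro: has_sum_imp_summable\<close>)
 have le: "cmod (p n) * exp (\<rho> * \<bar>of_int n\<bar>) <= q n" for n
 proof -
  have s1: "(%k. cmod (c k * d (n - k))) summable_on UNIV"
   by (rule has_sum_convolution(2)[where A = "f 0" and B = "g 0"]) (use abs[OF c(2)] abs[OF d(2)] c(1)[of 0] d(1)[of 0] in auto)
  have s2: "(%k. (cmod (c k) * wt \<rho> k) * (cmod (d (n - k)) * exp (\<rho> * \<bar>of_int (n - k)\<bar>))) summable_on UNIV"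
   using has_sum_convolution(2)[OF _ c(2) _ d(2), of n] has_sum_imp_summable[OF c(2)] has_sum_imp_summable[OF d(2)]
   by (simp add: abs_mult)
  have "cmod (p n) <= (\<Sum>\<^sub>\<infinity>k. cmod (c k * d (n - k)))"
   unfolding p_def by (rule norm_infsum_bound[OF s1])
  then have "cmod (p n) * exp (\<rho> * \<bar>of_int n\<bar>) <= (\<Sum>\<^sub>\<infinity>k. cmod (c k * d (n - k))) * exp (\<rho> * \<bar>of_int n\<bar>)"
   by (rule mult_right_mono) simp
  also have "... = (\<Sum>\<^sub>\<infinity>k. cmod (c k * d (n - k)) * exp (\<rho> * \<bar>of_int n\<bar>))"
   by (rule infsum_cmult_left'[symmetric])
  also have "... <= q n" unfolding q_def
  proof (rule infsum_mono)
   show "(%k. cmod (c k * d (n - k)) * exp (\<rho> * \<bar>of_int n\<bar>)) summable_on UNIV"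
    by (rule summable_on_cmult_left[OF s1])
   fix k
   have "exp (\<rho> * \<bar>of_int n\<bar>) <= wt \<rho> k * exp (\<rho> * \<bar>of_int (n - k)\<bar>)"
    unfolding mult_exp_exp distrib_left[symmetric] using \<rho> by (auto intro!: mult_left_mono)
   then have "cmod (c k * d (n - k)) * exp (\<rho> * \<bar>of_int n\<bar>) <= cmod (c k * d (n - k)) * (wt \<rho> k * exp (\<rho> * \<bar>of_int (n - k)\<bar>))"
    by (rule mult_left_mono) simp
   then show "cmod (c k * d (n - k)) * exp (\<rho> * \<bar>of_int n\<bar>) <= (cmod (c k) * wt \<rho> k) * (cmod (d (n - k)) * exp (\<rho> * \<bar>of_int (n - k)\<bar>))"
    by (simp add: norm_mult mult_ac)
  qed (rule s2)
  finally show ?thesis .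
 qed
 have "(%n. cmod (p n) * exp (\<rho> * \<bar>of_int n\<bar>)) summable_on UNIV"
  by (rule summable_on_comparison_test[OF has_sum_imp_summable[OF q]]) (use le in auto)
 then obtain U where U: "((%n. cmod (p n) * exp (\<rho> * \<bar>of_int n\<bar>)) has_sum U) UNIV"
  by (auto simp: summable_on_def)
 have "U <= S * T" using has_sum_mono[OF U q] le by blast
 also have "... <= A * B" using S0 c(3) d(3) by (intro mult_mono) auto
 finally show ?thesis unfolding fourier_class_def using 1 U by blast
qed

lemma fourier_class_shift:
 assumes "fourier_class \<rho> A f"
 shows "fourier_class \<rho> A (%x. f (x + a))"
proof -
 obtain c S where c: "!!x. ((%k. c k * e1 (of_int k * x)) has_sum f x) UNIV"
   "((%k. cmod (c k) * wt \<rho> k) has_sum S) UNIV" "S <= A"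
  using assms(1) unfolding fourier_class_def by blast
 have "c k * e1 (of_int k * (x + a)) = (c k * e1 (of_int k * a)) * e1 (of_int k * x)" for k x
 proof -
  have "e1 (of_int k * (x + a)) = e1 (of_int k * a) * e1 (of_int k * x)"
   unfolding e1_add[symmetric] by (simp add: algebra_simps)
  then show ?thesis by (simp only: mult.assoc)
 qed
 then have "((%k. (c k * e1 (of_int k * a)) * e1 (of_int k * x)) has_sum f (x + a)) UNIV" for x
  using c(1)[of "x + a"] by (simp only:)
 then show ?thesis unfolding fourier_class_def
  using c(2,3) by (intro exI[of _ "%k. c k * e1 (of_int k * a)"] exI[of _ S]) (auto simp: norm_mult)
qed

text \<open>The frequencies beyond \<open>D\<close> carry weight at least \<open>exp (\<rho> * D)\<close> in the
norm.\<close>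

lemma fourier_class_truncate:
 assumes "fourier_class \<rho> B f" and \<rho>: "\<rho> >= 0"
 obtains t :: "int => complex" where
  "!!D x. cmod (f x - (\<Sum>k = - int D..int D. t k * e1 (of_int k * x))) <= B * exp (- \<rho> * real D)"
proof -
 obtain c S where c: "!!x. ((%k. c k * e1 (of_int k * x)) has_sum f x) UNIV"
   "((%k. cmod (c k) * wt \<rho> k) has_sum S) UNIV" "S <= B"
  using assms(1) unfolding fourier_class_def by blast
 have "cmod (f x - (\<Sum>k = - int D..int D. c k * e1 (of_int k * x))) <= B * exp (- \<rho> * real D)" for D x
 proof -
  let ?I = "{- int D..int D}"
  have d1: "((%k. c k * e1 (of_int k * x)) has_sum (f x - (\<Sum>k\<in>?I. c k * e1 (of_int k * x)))) (UNIV - ?I)"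
   by (rule has_sum_Diff[OF c(1) has_sum_finite]) auto
  have d2: "((%k. cmod (c k) * wt \<rho> k) has_sum (S - (\<Sum>k\<in>?I. cmod (c k) * wt \<rho> k))) (UNIV - ?I)"
   by (rule has_sum_Diff[OF c(2) has_sum_finite]) auto
  let ?S = "S - (\<Sum>k\<in>?I. cmod (c k) * wt \<rho> k)"
  have d3: "((%k. cmod (c k) * wt \<rho> k * exp (- \<rho> * real D)) has_sum (?S * exp (- \<rho> * real D))) (UNIV - ?I)"
   by (rule has_sum_cmult_left[OF d2])
  have le: "cmod (c k * e1 (of_int k * x)) <= cmod (c k) * wt \<rho> k * exp (- \<rho> * real D)" if "k \<in> UNIV - ?I" for k
  proof -
   have "\<bar>k\<bar> >= int D" using that by auto
   then have "real D <= \<bar>real_of_int k\<bar>" by linarith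
   then have "1 <= wt \<rho> k * exp (- \<rho> * real D)"
    unfolding mult_exp_exp using \<rho> by (auto simp: mult_left_mono)
   then have "cmod (c k) * 1 <= cmod (c k) * (wt \<rho> k * exp (- \<rho> * real D))"
    by (intro mult_left_mono) auto
   then show ?thesis by (simp add: norm_mult mult.assoc)
  qed
  have "(%k. cmod (c k * e1 (of_int k * x))) summable_on (UNIV - ?I)"
   by (rule summable_on_comparison_test[OF has_sum_imp_summable[OF d3]]) (use le in auto)
  then obtain n where n: "((%k. cmod (c k * e1 (of_int k * x))) has_sum n) (UNIV - ?I)"
   by (auto simp: summable_on_def)
  have "cmod (f x - (\<Sum>k\<in>?I. c k * e1 (of_int k * x))) <= n"
   by (rule norm_has_sum_bound[OF n d1])
  also have "n <= ?S * exp (- \<rho> * real D)" using has_sum_mono[OF n d3] le by blast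
  also have "... <= B * exp (- \<rho> * real D)"
   using c(3) by (intro mult_right_mono) (auto simp: diff_le_eq intro!: add_increasing2 sum_nonneg)
  finally show ?thesis .
 qed
 then show ?thesis by (rule that)
qed

lemma trig_coefficient_bound:
 fixes t :: "int => complex"
 assumes "!!x. cmod (\<Sum>k = - int D..int D. t k * e1 (of_int k * x)) <= M" "\<bar>j\<bar> <= int D"
 shows "cmod (t j) <= M"
proof -
 let ?f = "%x. (\<Sum>k = - int D..int D. t k * e1 (of_int k * x)) * e1 (- of_int j * x)"
 have "?f = (%x. \<Sum>k = - int D..int D. t k * e1 (of_int (k - j) * x))"
 proof
  fix x
  have "e1 (of_int k * x) * e1 (- of_int j * x) = e1 (of_int (k - j) * x)" for k
   unfolding e1_add[symmetric] by (simp add: algebra_simps)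
  then show "?f x = (\<Sum>k = - int D..int D. t k * e1 (of_int (k - j) * x))"
   unfolding sum_distrib_right by (simp only: mult.assoc)
 qed
 then have "integral {0..1} ?f = (\<Sum>k = - int D..int D. integral {0..1} (%x. t k * e1 (of_int (k - j) * x)))"
  by (simp only:, intro integral_sum integrable_continuous_real continuous_intros) simp
 also have "... = (\<Sum>k = - int D..int D. t k * (if k - j = 0 then 1 else 0))"
  unfolding integral_mult_right integral_e1 by simp
 also have "... = (\<Sum>k = - int D..int D. if k = j then t k else 0)"
  by (intro sum.cong) auto
 also have "... = t j" using assms(2) by (simp add: abs_le_iff)
 finally have "t j = integral {0..1} ?f" by simp
 moreover have "cmod (integral {0..1} ?f) <= M * (1 - 0)"
 proof (rule integral_bound)
  show "continuous_on {0..1} ?f" by (intro continuous_intros)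
  show "cmod (?f t) <= M" for t using assms(1)[of t] by (simp add: norm_mult)
 qed simp
 ultimately show ?thesis by simp
qed

section \<open>Orbit averages of logarithms of trigonometric polynomials\<close>

lemma dist_int_le: "dist_int t <= \<bar>t - of_int k\<bar>"
 unfolding dist_int_def by (rule round_diff_minimal)

lemma dist_int_triangle: "dist_int (s + t) <= dist_int s + dist_int t"
proof -
 have "dist_int (s + t) <= \<bar>(s + t) - of_int (round s + round t)\<bar>" by (rule dist_int_le)
 also have "... <= dist_int s + dist_int t" unfolding dist_int_def by simp
 finally show ?thesis .
qed

lemma dist_int_minus: "dist_int (- t) = dist_int t"
proof -
 have "dist_int (- t) <= dist_int t" for t
 proof -
  have "dist_int (- t) <= \<bar>- t - of_int (- round t)\<bar>" by (rule dist_int_le)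
  then show ?thesis unfolding dist_int_def[of t] by simp
 qed
 from this[of t] this[of "- t"] show ?thesis by simp
qed

lemma dist_int_le_abs: "dist_int t <= \<bar>t\<bar>"
 using dist_int_le[of t 0] by simp

lemma norm_e1_minus_1: "cmod (e1 t - 1) >= dist_int t"
proof -
 define r where "r = t - of_int (round t)"
 have r: "\<bar>r\<bar> <= 1 / 2" unfolding r_def using of_int_round_abs_le[of t] by (simp add: abs_minus_commute)
 have "e1 t = e1 r * e1 (of_int (round t))" unfolding e1_add[symmetric] r_def by simp
 then have er: "e1 t = e1 r" by (simp only: e1_of_int mult_1_right)
 have "(cmod (e1 r - 1))^2 = (cos (2 * pi * r) - 1)^2 + (sin (2 * pi * r))^2"
  by (simp add: cmod_power2)
 also have "... = 2 - 2 * cos (2 * (pi * r))"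
  using sin_cos_squared_add[of "2 * pi * r"] by (simp add: power2_eq_square algebra_simps)
 also have "... = (2 * sin (pi * r))^2"
  unfolding cos_double_sin by (simp add: power2_eq_square)
 finally have "sqrt ((cmod (e1 r - 1))^2) = sqrt ((2 * sin (pi * r))^2)" by simp
 then have n: "cmod (e1 r - 1) = 2 * \<bar>sin (pi * r)\<bar>"
  unfolding real_sqrt_abs by (simp add: abs_mult)
 have sb: "\<bar>sin y\<bar> >= \<bar>y\<bar> / 3" if "\<bar>y\<bar> <= 2" for y :: real
 proof -
  have "\<bar>sin y - y\<bar> <= \<bar>y\<bar> ^ 3 / 6"
   using Maclaurin_sin_bound[of y 3]
   by (simp add: sin_coeff_def lessThan_nat_numeral lessThan_Suc fact_numeral eval_nat_numeral)
  moreover have "\<bar>y\<bar> ^ 3 <= 4 * \<bar>y\<bar>"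
  proof -
   have "\<bar>y\<bar> * \<bar>y\<bar> <= 2 * 2" using that by (intro mult_mono) auto
   then have "\<bar>y\<bar> * \<bar>y\<bar> * \<bar>y\<bar> <= 4 * \<bar>y\<bar>" by (intro mult_right_mono) auto
   then show ?thesis by (simp add: power3_eq_cube)
  qed
  ultimately show ?thesis by linarith
 qed
 have "\<bar>pi * r\<bar> <= pi * (1 / 2)" unfolding abs_mult using r by (intro mult_mono) auto
 then have "\<bar>pi * r\<bar> <= 2" using pi_half_less_two by linarith
 then have "\<bar>sin (pi * r)\<bar> >= \<bar>pi * r\<bar> / 3" by (rule sb)
 moreover have "\<bar>pi * r\<bar> >= 2 * \<bar>r\<bar>" unfolding abs_mult using pi_ge_two by (intro mult_mono) auto
 ultimately have "2 * \<bar>sin (pi * r)\<bar> >= \<bar>r\<bar>" by linarith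
 then show ?thesis unfolding er n by (simp add: dist_int_def r_def)
qed

lemma norm_e1_diff: "cmod (e1 x - e1 y) >= dist_int (x - y)"
proof -
 have "e1 x - e1 y = e1 y * (e1 (x - y) - 1)"
  using e1_add[of y "x - y"] by (simp add: right_diff_distrib)
 then have "cmod (e1 x - e1 y) = cmod (e1 (x - y) - 1)" by (simp add: norm_mult)
 then show ?thesis using norm_e1_minus_1[of "x - y"] by simp
qed

text \<open>Expand \<open>ln \<bar>1 - w / e1\<bar>\<close> in powers of \<open>w\<close>. The orbit sum of each
character is geometric, hence at most \<open>1 / dist_int (k * \<omega>)\<close>, and the Diophantine condition lets
the geometric weights win.\<close>

lemma birkhoff_log_factor:
 fixes w :: complex
 assumes dio: "!!n::nat. n >= 1 ==> dist_int (real n * \<omega>) >= c / (real n)^2" and c: "c > 0"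
  and s: "0 <= s" "s < 1" and w: "cmod w <= s"
 shows "\<bar>\<Sum>j<K. ln (cmod (e1 (x + real j * \<omega>) - w))\<bar> <= 2 / (c * (1 - s)^2)"
proof -
 define u where "u j = w * e1 (- (x + real j * \<omega>))" for j :: nat
 have nu: "cmod (u j) <= s" for j unfolding u_def using w by (simp add: norm_mult)
 have lnu: "ln (cmod (e1 (x + real j * \<omega>) - w)) = Re (ln (1 - u j))" for j
 proof -
  have "e1 (x + real j * \<omega>) * e1 (- (x + real j * \<omega>)) = 1"
   unfolding e1_add[symmetric] by simp
  then have "e1 (x + real j * \<omega>) - w = e1 (x + real j * \<omega>) * (1 - u j)"
   unfolding u_def by (simp add: right_diff_distrib mult.left_commute)
  then have "cmod (e1 (x + real j * \<omega>) - w) = cmod (1 - u j)" by (simp add: norm_mult)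
  moreover have "1 - u j ~= 0" using nu[of j] s by auto
  ultimately show ?thesis by (simp add: Re_Ln)
 qed
 have sums1: "(%n. - ((u j) ^ n) / of_nat n) sums ln (1 - u j)" for j
  using Ln_series'[of "- u j"] nu[of j] s by simp
 have sums: "(%n. \<Sum>j<K. - ((u j) ^ n) / of_nat n) sums (\<Sum>j<K. ln (1 - u j))"
  by (rule sums_sum) (rule sums1)
 have geo: "cmod (\<Sum>j<K. - ((u j) ^ n) / of_nat n) <= (2 / c) * (real n * s ^ n)" for n
 proof (cases "n = 0")
  case False
  define q where "q = e1 (- (real n * \<omega>))"
  have "dist_int (- (real n * \<omega>)) >= c / (real n)^2" using dio[of n] False dist_int_minus by simp
  then have q1: "cmod (q - 1) >= c / (real n)^2"
   unfolding q_def using norm_e1_minus_1[of "- (real n * \<omega>)"] by linarith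
  have cn: "c / (real n)^2 > 0" using c False by simp
  then have qne: "q ~= 1" using q1 by auto
  have uj: "(u j) ^ n = (w * e1 (- x)) ^ n * q ^ j" for j
  proof -
   have "e1 (- (x + real j * \<omega>)) = e1 (- x) * e1 (- real j * \<omega>)"
    unfolding e1_add[symmetric] by (simp add: algebra_simps)
   moreover have "e1 (- real j * \<omega>) ^ n = q ^ j"
   proof -
    have "e1 (- real j * \<omega>) ^ n = cis (real n * (2 * pi * (- real j * \<omega>)))" by (rule Complex.DeMoivre)
    moreover have "q ^ j = cis (real j * (2 * pi * (- (real n * \<omega>))))"
     unfolding q_def by (rule Complex.DeMoivre)
    moreover have "real n * (2 * pi * (- real j * \<omega>)) = real j * (2 * pi * (- (real n * \<omega>)))" by simp
    ultimately show ?thesis by (simp only:)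
   qed
   ultimately show ?thesis unfolding u_def by (simp add: power_mult_distrib)
  qed
  have "(\<Sum>j<K. q ^ j) = (q ^ K - 1) / (q - 1)"
   using qne by (rule geometric_sum)
  then have "cmod (\<Sum>j<K. q ^ j) = cmod (q ^ K - 1) / cmod (q - 1)" by (simp add: norm_divide)
  also have "... <= 2 / (c / (real n)^2)"
  proof (rule frac_le)
   have "cmod (q ^ K - 1) <= cmod (q ^ K) + 1" using norm_triangle_ineq4[of "q ^ K" 1] by simp
   then show "cmod (q ^ K - 1) <= 2" unfolding q_def by (simp add: norm_power)
  qed (use cn q1 in auto)
  finally have g: "cmod (\<Sum>j<K. q ^ j) <= 2 * (real n)^2 / c" by simp
  have "(\<Sum>j<K. - ((u j) ^ n) / of_nat n) = - ((w * e1 (- x)) ^ n / of_nat n) * (\<Sum>j<K. q ^ j)"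
   unfolding uj by (simp add: sum_distrib_left)
  then have "cmod (\<Sum>j<K. - ((u j) ^ n) / of_nat n) = (cmod w ^ n / real n) * cmod (\<Sum>j<K. q ^ j)"
   by (simp add: norm_mult norm_divide norm_power)
  also have "... <= (s ^ n / real n) * (2 * (real n)^2 / c)"
   using g w s c by (intro mult_mono divide_right_mono power_mono) auto
  also have "... = (2 / c) * (real n * s ^ n)" using False by (simp add: power2_eq_square)
  finally show ?thesis .
 qed simp
 have gs: "(%n. real (Suc n) * s ^ n) sums (1 / (1 - s)^2)"
  using geometric_deriv_sums[of s] s by simp
 have gs2: "(%n. (2 / c) * (real n * s ^ n)) sums ((2 / c) * (s * (1 / (1 - s)^2)))"
 proof (rule sums_mult)
  have "(%n. s * (real (Suc n) * s ^ n)) sums (s * (1 / (1 - s)^2))" by (rule sums_mult[OF gs])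
  then have "(%n. real (Suc n) * s ^ (Suc n)) sums (s * (1 / (1 - s)^2))" by (simp add: mult_ac)
  then have "(%n. real n * s ^ n) sums (s * (1 / (1 - s)^2) + real 0 * s ^ 0)"
   by (rule sums_Suc_iff[of "%n. real n * s ^ n", THEN iffD1])
  then show "(%n. real n * s ^ n) sums (s * (1 / (1 - s)^2))" by simp
 qed
 have "cmod (\<Sum>j<K. ln (1 - u j)) <= (2 / c) * (s * (1 / (1 - s)^2))"
  using norm_sums_le[OF sums gs2] geo by blast
 also have "... <= (2 / c) * (1 * (1 / (1 - s)^2))"
  using s c by (intro mult_left_mono mult_right_mono) auto
 finally have "cmod (\<Sum>j<K. ln (1 - u j)) <= 2 / (c * (1 - s)^2)" by simp
 moreover have "(\<Sum>j<K. ln (cmod (e1 (x + real j * \<omega>) - w))) = Re (\<Sum>j<K. ln (1 - u j))"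
  unfolding lnu by simp
 moreover have "\<bar>Re (\<Sum>j<K. ln (1 - u j))\<bar> <= cmod (\<Sum>j<K. ln (1 - u j))"
  by (rule abs_Re_le_cmod)
 ultimately show ?thesis by linarith
qed

text \<open>This identity trades a zero \<open>\<zeta>\<close> on or near the unit circle for the zero \<open>s *
\<zeta>\<close>, for which the previous estimate applies, at a controlled loss.\<close>

lemma norm_diff_scaled:
 fixes z \<zeta> :: complex
 assumes "cmod z = 1"
 shows "(cmod (z - of_real s * \<zeta>))^2 = s * (cmod (z - \<zeta>))^2 + (1 - s) * (1 - s * (cmod \<zeta>)^2)"
proof -
 have "(Re z)^2 + (Im z)^2 = 1" using assms by (simp add: cmod_power2[symmetric])
 moreover have "(Re z - s * Re \<zeta>)^2 + (Im z - s * Im \<zeta>)^2 =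
   s * ((Re z - Re \<zeta>)^2 + (Im z - Im \<zeta>)^2) + (1 - s) * (((Re z)^2 + (Im z)^2) - s * ((Re \<zeta>)^2 + (Im \<zeta>)^2))"
  by (simp add: power2_eq_square algebra_simps)
 ultimately show ?thesis by (simp add: cmod_power2)
qed

text \<open>Of any \<open>b\<close> consecutive indices at most one is near, and only that one pays
\<open>g\<close>.\<close>

lemma sum_blocks_le:
 fixes \<phi> :: "nat => real"
 assumes far: "!!j. ~ near j ==> \<phi> j <= f" and near: "!!j. near j ==> \<phi> j <= g"
  and one: "!!j j'. near j ==> near j' ==> j < j' ==> j' - j >= b" and fg: "f >= 0" "g >= 0"
 shows "(\<Sum>j<B * b. \<phi> j) <= real B * (real b * f + g)"
proof -
 have blk: "(\<Sum>j\<in>{m..<m + b}. \<phi> j) <= real b * f + g" for m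
 proof (cases "\<exists>j\<in>{m..<m + b}. near j")
  case False
  then have "(\<Sum>j\<in>{m..<m + b}. \<phi> j) <= (\<Sum>j\<in>{m..<m + b}. f)"
   by (intro sum_mono far) auto
  then show ?thesis using fg by simp
 next
  case True
  then obtain i where i: "i \<in> {m..<m + b}" "near i" by blast
  have "~ near j" if "j \<in> {m..<m + b} - {i}" for j
  proof
   assume "near j"
   then have "i < j ==> j - i >= b" "j < i ==> i - j >= b" using one i(2) by auto
   then show False using that i(1) by (cases i j rule: linorder_cases) auto
  qed
  then have "(\<Sum>j\<in>{m..<m + b} - {i}. \<phi> j) <= (\<Sum>j\<in>{m..<m + b} - {i}. f)"
   by (intro sum_mono far) auto
  also have "... <= (\<Sum>j\<in>{m..<m + b}. f)" using fg by (intro sum_mono2) auto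
  also have "... = real b * f" by simp
  finally show ?thesis using near[OF i(2)] sum.remove[of "{m..<m + b}" i \<phi>] i(1) by simp
 qed
 have "(\<Sum>j<B * b. \<phi> j) = (\<Sum>m<B. \<Sum>j\<in>{m * b..<m * b + b}. \<phi> j)"
  by (rule sum.nat_group[symmetric])
 also have "... <= (\<Sum>m<B. real b * f + g)" by (intro sum_mono blk)
 finally show ?thesis by simp
qed

text \<open>The orbit has length \<open>b ^ 17\<close> and zeros are moved by \<open>1 - s = b powr -8\<close>, so the
loss \<open>1 / (1 - s)\<^sup>2 = b ^ 16\<close> is a fraction \<open>1 / b\<close> of the number of summands. The
upper bound holds at every phase since \<open>ln\<close> is only singular downwards.\<close>

lemma zero_log_upper:
 fixes \<zeta> :: complex and b :: nat
 assumes dio: "!!n::nat. n >= 1 ==> dist_int (real n * \<omega>) >= c / (real n)^2" and c: "c > 0"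
  and z: "cmod \<zeta> <= 1" "!!x. e1 x ~= \<zeta>" and b: "b >= 2"
 shows "(\<Sum>j<b ^ 17. ln (cmod (e1 (x + real j * \<omega>) - \<zeta>))) <= real (b ^ 17) * ((2 / c + 8 / c^2 + 1) / real b)"
proof -
 define s where "s = 1 - 1 / real b ^ 8"
 have b8: "real b ^ 8 >= 2 ^ 8" using b by (intro power_mono) auto
 then have "1 / real b ^ 8 <= 1 / 2 ^ 8" using b by (intro divide_left_mono) auto
 moreover have "1 / real b ^ 8 > 0" using b by simp
 ultimately have s: "1 / 2 <= s" "s < 1" unfolding s_def by auto
 have le: "ln (cmod (e1 y - \<zeta>)) <= ln (cmod (e1 y - of_real s * \<zeta>)) + 1 / real b" for y
 proof -
  have p: "cmod (e1 y - \<zeta>) > 0" using z(2)[of y] by simp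
  have "s * (cmod \<zeta>)^2 <= 1 * 1^2" using s z(1) by (intro mult_mono power_mono) auto
  then have "s * (cmod (e1 y - \<zeta>))^2 <= (cmod (e1 y - of_real s * \<zeta>))^2"
   unfolding norm_diff_scaled[of "e1 y" s \<zeta>, simplified] using s by simp
  then have "ln (s * (cmod (e1 y - \<zeta>))^2) <= ln ((cmod (e1 y - of_real s * \<zeta>))^2)"
   using s p by (intro ln_mono) auto
  moreover have "cmod (e1 y - of_real s * \<zeta>) > 0"
  proof -
   have "cmod (of_real s * \<zeta>) < 1"
   proof -
    have "cmod (of_real s * \<zeta>) = s * cmod \<zeta>" using s by (simp add: norm_mult)
    also have "... <= s * 1" using s z(1) by (intro mult_left_mono) auto
    finally show ?thesis using s by simp
   qed
   then have "e1 y ~= of_real s * \<zeta>" by (metis norm_cis less_irrefl)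
   then show ?thesis by simp
  qed
  ultimately have "ln s + 2 * ln (cmod (e1 y - \<zeta>)) <= 2 * ln (cmod (e1 y - of_real s * \<zeta>))"
   using s p by (simp add: ln_mult ln_realpow)
  moreover have "- ln s <= 2 / real b"
  proof -
   have "ln (1 / s) <= 1 / s - 1" using s by (intro ln_le_minus_one) auto
   also have "... = (1 - s) / s" using s by (simp add: field_simps)
   also have "... <= (1 - s) / (1 / 2)" using s by (intro divide_left_mono) auto
   also have "... = 2 / real b ^ 8" unfolding s_def by simp
   also have "... <= 2 / real b ^ 1" using b by (intro divide_left_mono power_increasing) auto
   finally show ?thesis using s by (simp add: ln_div)
  qed
  ultimately show ?thesis by simp
 qed
 have cs: "cmod (of_real s * \<zeta>) <= s"
 proof -
  have "cmod (of_real s * \<zeta>) = s * cmod \<zeta>" using s by (simp add: norm_mult)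
  also have "... <= s * 1" using s z(1) by (intro mult_left_mono) auto
  finally show ?thesis by simp
 qed
 have "(\<Sum>j<b ^ 17. ln (cmod (e1 (x + real j * \<omega>) - \<zeta>))) <=
  (\<Sum>j<b ^ 17. ln (cmod (e1 (x + real j * \<omega>) - of_real s * \<zeta>)) + 1 / real b)"
  by (intro sum_mono le)
 also have "... = (\<Sum>j<b ^ 17. ln (cmod (e1 (x + real j * \<omega>) - of_real s * \<zeta>))) + real (b ^ 17) / real b"
  by (simp add: sum.distrib)
 also have "(\<Sum>j<b ^ 17. ln (cmod (e1 (x + real j * \<omega>) - of_real s * \<zeta>))) <= 2 / (c * (1 - s)^2)"
  using birkhoff_log_factor[OF dio c _ s(2) cs, of x "b ^ 17"] s(1) by linarith
 also have "2 / (c * (1 - s)^2) = real (b ^ 17) * (2 / c / real b)"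
  unfolding s_def using b c by (simp add: field_simps power_numeral_reduce eval_nat_numeral)
 also have "real (b ^ 17) * (2 / c / real b) + real (b ^ 17) / real b = real (b ^ 17) * ((2 / c + 1) / real b)"
  by (simp add: distrib_left add_divide_distrib)
 also have "... <= real (b ^ 17) * ((2 / c + 8 / c^2 + 1) / real b)"
  using c by (intro mult_left_mono divide_right_mono) auto
 finally show ?thesis by simp
qed

text \<open>A visit near the zero costs at most \<open>\<kappa> * b\<close> because of the excluded interval, and by
the Diophantine condition there is at most one visit in \<open>b\<close> steps.\<close>

lemma zero_log_lower:
 fixes \<zeta> :: complex and b :: nat
 assumes dio: "!!n::nat. n >= 1 ==> dist_int (real n * \<omega>) >= c / (real n)^2" and c: "c > 0"
  and z: "cmod \<zeta> <= 1" "!!x. e1 x ~= \<zeta>" and b: "b >= 2" and \<kappa>: "\<kappa> > 0" "exp (- \<kappa> * real b) <= 1 / 2"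
  and \<theta>: "\<zeta> = cmod \<zeta> * e1 \<theta>"
  and far: "!!j. j < b ^ 17 ==> dist_int (x + real j * \<omega> - \<theta>) >= exp (- \<kappa> * real b)"
 shows "(\<Sum>j<b ^ 17. ln (cmod (e1 (x + real j * \<omega>) - \<zeta>))) >= - (real (b ^ 17) * ((2 / c + 8 / c^2 + 1) / real b + \<kappa>))"
proof -
 define s where "s = 1 - 1 / real b ^ 8"
 have b8: "real b ^ 8 >= 2 ^ 8" using b by (intro power_mono) auto
 then have "1 / real b ^ 8 <= 1 / 2 ^ 8" using b by (intro divide_left_mono) auto
 moreover have "1 / real b ^ 8 > 0" using b by simp
 ultimately have s: "1 / 2 <= s" "s < 1" unfolding s_def by auto
 have "1 / real b ^ 8 <= 1 / 2 ^ 8" using b8 b by (intro divide_left_mono) auto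
 then have s4: "4 * (1 - s) <= 1 / 4" unfolding s_def by simp
 define d where "d y = cmod (e1 y - \<zeta>)" for y
 have dpos: "d y > 0" for y unfolding d_def using z(2)[of y] by simp
 have dlow: "d y >= dist_int (y - \<theta>) / 2" for y
 proof -
  have "cmod (\<zeta> - e1 \<theta>) = 1 - cmod \<zeta>"
  proof -
   have "\<zeta> - e1 \<theta> = of_real (cmod \<zeta> - 1) * e1 \<theta>" using \<theta> by (simp add: algebra_simps)
   then have "cmod (\<zeta> - e1 \<theta>) = \<bar>cmod \<zeta> - 1\<bar>" by (simp only: norm_mult norm_of_real norm_cis mult_1_right)
   then show ?thesis using z(1) by simp
  qed
  moreover have "1 - cmod \<zeta> <= d y" unfolding d_def using norm_triangle_ineq2[of "e1 y" \<zeta>] by simp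
  moreover have "cmod (e1 y - e1 \<theta>) <= d y + cmod (\<zeta> - e1 \<theta>)"
   unfolding d_def using norm_triangle_ineq[of "e1 y - \<zeta>" "\<zeta> - e1 \<theta>"] by simp
  ultimately show ?thesis using norm_e1_diff[of y \<theta>] by linarith
 qed
 have pos1: "1 + (1 - s) / (d y)^2 > 0" for y using s by (intro add_pos_nonneg) auto
 define \<phi> where "\<phi> j = (if j < b ^ 17 then ln (1 + (1 - s) / (d (x + real j * \<omega>))^2) / 2 else 0)" for j :: nat
 have le: "ln (cmod (e1 (x + real j * \<omega>) - of_real s * \<zeta>)) <= ln (d (x + real j * \<omega>)) + \<phi> j" if "j < b ^ 17" for j
 proof -
  let ?y = "x + real j * \<omega>"
  have sz: "0 <= s * (cmod \<zeta>)^2" using s by simp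
  have "cmod (of_real s * \<zeta>) < 1"
  proof -
   have "cmod (of_real s * \<zeta>) = s * cmod \<zeta>" using s by (simp add: norm_mult)
   also have "... <= s * 1" using s z(1) by (intro mult_left_mono) auto
   finally show ?thesis using s by simp
  qed
  then have "e1 ?y ~= of_real s * \<zeta>" by (metis norm_cis less_irrefl)
  then have p: "cmod (e1 ?y - of_real s * \<zeta>) > 0" by simp
  have "(cmod (e1 ?y - of_real s * \<zeta>))^2 <= 1 * (d ?y)^2 + (1 - s) * 1"
   unfolding norm_diff_scaled[of "e1 ?y" s \<zeta>, simplified] d_def[symmetric]
   using s sz by (intro add_mono mult_right_mono mult_left_mono) auto
  also have "... = (d ?y)^2 * (1 + (1 - s) / (d ?y)^2)" using dpos[of ?y] by (simp add: field_simps)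
  finally have "ln ((cmod (e1 ?y - of_real s * \<zeta>))^2) <= ln ((d ?y)^2 * (1 + (1 - s) / (d ?y)^2))"
   using p by (intro ln_mono) auto
  also have "... = ln ((d ?y)^2) + ln (1 + (1 - s) / (d ?y)^2)"
   using dpos[of ?y] pos1 by (intro ln_mult_pos) auto
  finally show ?thesis using p dpos[of ?y] that unfolding \<phi>_def by (simp add: ln_realpow)
 qed
 define near where "near j \<longleftrightarrow> j < b ^ 17 & dist_int (x + real j * \<omega> - \<theta>) < c / (2 * (real b)^2)" for j
 have sb: "(\<Sum>j<b ^ 16 * b. \<phi> j) <= real (b ^ 16) * (real b * (8 / c^2 / real b ^ 4) + \<kappa> * real b)"
 proof (rule sum_blocks_le[where near = near])
  fix j assume nj: "~ near j"
  show "\<phi> j <= 8 / c^2 / real b ^ 4"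
  proof (cases "j < b ^ 17")
   case True
   let ?y = "x + real j * \<omega>"
   have "dist_int (?y - \<theta>) >= c / (2 * (real b)^2)" using nj True unfolding near_def by simp
   then have "d ?y >= c / (4 * (real b)^2)" using dlow[of ?y] by (simp add: field_simps)
   then have "(d ?y)^2 >= (c / (4 * (real b)^2))^2" using c by (intro power_mono) auto
   then have "(1 - s) / (d ?y)^2 <= (1 - s) / (c / (4 * (real b)^2))^2"
    using s c b by (intro divide_left_mono mult_pos_pos) (use dpos[of ?y] in auto)
   also have "... = 16 / c^2 / real b ^ 4"
    unfolding s_def using b c by (simp add: field_simps power_numeral_reduce eval_nat_numeral)
   finally have *: "(1 - s) / (d ?y)^2 <= 16 / c^2 / real b ^ 4" .
   have "ln (1 + (1 - s) / (d ?y)^2) <= (1 - s) / (d ?y)^2"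
    using s by (intro ln_add_one_self_le_self) auto
   then show ?thesis unfolding \<phi>_def using * True by simp
  qed (simp add: \<phi>_def)
 next
  fix j assume nj: "near j"
  then have j: "j < b ^ 17" unfolding near_def by simp
  let ?y = "x + real j * \<omega>" and ?t = "exp (- \<kappa> * real b)"
  have t0: "?t > 0" by simp
  have t2: "?t * ?t <= 1 / 2 * (1 / 2)" using \<kappa>(2) by (intro mult_mono) auto
  have "d ?y >= ?t / 2" using dlow[of ?y] far[OF j] by simp
  then have "(d ?y)^2 >= (?t / 2)^2" by (intro power_mono) auto
  then have "(1 - s) / (d ?y)^2 <= (1 - s) / (?t / 2)^2"
   using s by (intro divide_left_mono mult_pos_pos) (use dpos[of ?y] in auto)
  also have "... = 4 * (1 - s) / ?t^2" by (simp add: power_divide)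
  also have "... <= (1 / 4) / ?t^2" using s4 by (intro divide_right_mono) auto
  finally have "1 + (1 - s) / (d ?y)^2 <= 1 + (1 / 4) / ?t^2" by simp
  also have "... <= 1 / ?t^2"
   using t2 by (simp add: field_simps power2_eq_square)
  finally have "ln (1 + (1 - s) / (d ?y)^2) <= ln (1 / ?t^2)"
   using pos1 by (intro ln_mono) auto
  also have "... = 2 * (\<kappa> * real b)" by (simp add: ln_div ln_realpow)
  finally show "\<phi> j <= \<kappa> * real b" unfolding \<phi>_def using j by simp
 next
  fix j j' assume n: "near j" "near j'" "j < j'"
  show "j' - j >= b"
  proof (rule ccontr)
   assume "~ j' - j >= b"
   then have lt: "j' - j < b" "j' - j >= 1" using n(3) by auto
   have "dist_int (real (j' - j) * \<omega>) >= c / (real (j' - j))^2" using lt by (intro dio)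
   moreover have "c / (real (j' - j))^2 >= c / (real b)^2"
    using lt c by (intro divide_left_mono power_mono mult_pos_pos) auto
   moreover have "dist_int (real (j' - j) * \<omega>) <= dist_int (x + real j' * \<omega> - \<theta>) + dist_int (- (x + real j * \<omega> - \<theta>))"
    using dist_int_triangle[of "x + real j' * \<omega> - \<theta>" "- (x + real j * \<omega> - \<theta>)"] n(3)
    by (simp add: of_nat_diff algebra_simps)
   moreover have "dist_int (x + real j' * \<omega> - \<theta>) < c / (2 * (real b)^2)" "dist_int (- (x + real j * \<omega> - \<theta>)) < c / (2 * (real b)^2)"
    using n unfolding near_def dist_int_minus by auto
   moreover have "c / (2 * (real b)^2) + c / (2 * (real b)^2) = c / (real b)^2" by (simp add: field_simps)
   ultimately show False by linarith
  qed
 qed (use c \<kappa> in auto)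
 have b17: "b ^ 17 = b ^ 16 * b" by (simp add: eval_nat_numeral)
 have cs: "cmod (of_real s * \<zeta>) <= s"
 proof -
  have "cmod (of_real s * \<zeta>) = s * cmod \<zeta>" using s by (simp add: norm_mult)
  also have "... <= s * 1" using s z(1) by (intro mult_left_mono) auto
  finally show ?thesis by simp
 qed
 have "- (2 / (c * (1 - s)^2)) <= (\<Sum>j<b ^ 17. ln (cmod (e1 (x + real j * \<omega>) - of_real s * \<zeta>)))"
  using birkhoff_log_factor[OF dio c _ s(2) cs, of x "b ^ 17"] s(1) by linarith
 also have "... <= (\<Sum>j<b ^ 17. ln (d (x + real j * \<omega>)) + \<phi> j)"
  by (intro sum_mono le) auto
 also have "... = (\<Sum>j<b ^ 17. ln (d (x + real j * \<omega>))) + (\<Sum>j<b ^ 17. \<phi> j)" by (rule sum.distrib)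
 also have "(\<Sum>j<b ^ 17. \<phi> j) <= real (b ^ 16) * (real b * (8 / c^2 / real b ^ 4) + \<kappa> * real b)"
  using sb unfolding b17 .
 also have "... = real (b ^ 17) * (8 / c^2 / real b ^ 4 + \<kappa>)"
  unfolding b17 by (simp add: algebra_simps)
 also have "... <= real (b ^ 17) * (8 / c^2 / real b ^ 1 + \<kappa>)"
  using b c by (intro mult_left_mono add_right_mono divide_left_mono power_increasing) auto
 finally have 1: "(\<Sum>j<b ^ 17. ln (d (x + real j * \<omega>))) >= - (2 / (c * (1 - s)^2)) - real (b ^ 17) * (8 / c^2 / real b + \<kappa>)"
  by simp
 have "2 / (c * (1 - s)^2) = real (b ^ 17) * (2 / c / real b)"
  unfolding s_def using b c by (simp add: field_simps power_numeral_reduce eval_nat_numeral)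
 then have "(\<Sum>j<b ^ 17. ln (d (x + real j * \<omega>))) >= - (real (b ^ 17) * (2 / c / real b)) - real (b ^ 17) * (8 / c^2 / real b + \<kappa>)"
  using 1 by simp
 also have "- (real (b ^ 17) * (2 / c / real b)) - real (b ^ 17) * (8 / c^2 / real b + \<kappa>) >= - (real (b ^ 17) * ((2 / c + 8 / c^2 + 1) / real b + \<kappa>))"
 proof -
  have "(2 / c + 8 / c^2 + 1) / real b = 2 / c / real b + 8 / c^2 / real b + 1 / real b"
   by (simp add: add_divide_distrib)
  then show ?thesis by (simp add: algebra_simps)
 qed
 finally show ?thesis unfolding d_def .
qed

text \<open>Zeros outside the unit disc are reflected into it; on the circle this changes the modulus only by a
constant factor.\<close>

lemma poly_unit_circle_factor:
 fixes p :: "complex poly"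
 assumes "p ~= 0"
 shows "\<exists>A zs. A > 0 & length zs <= degree p & (\<forall>\<zeta>\<in>set zs. cmod \<zeta> <= 1) &
  (ALL z. cmod z = 1 --> cmod (poly p z) = A * (\<Prod>\<zeta>\<leftarrow>zs. cmod (z - \<zeta>)))"
 using assms
proof (induction "degree p" arbitrary: p)
 case 0
 then obtain a where p: "p = [:a:]" using degree_eq_zeroE by metis
 then show ?case using 0 by (intro exI[of _ "cmod a"] exI[of _ "[]"]) auto
next
 case (Suc n)
 have "~ constant (poly p)" using Suc.hyps(2) by (simp add: constant_degree)
 then obtain \<zeta> where "poly p \<zeta> = 0" using Fundamental_Theorem_Algebra.fundamental_theorem_of_algebra by blast
 then have "[:- \<zeta>, 1:] dvd p" by (simp only: poly_eq_0_iff_dvd)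
 then obtain q where q: "p = [:- \<zeta>, 1:] * q" by (rule dvdE)
 have q0: "q ~= 0" using q Suc.prems by auto
 have dq: "degree q = n"
 proof -
  have "degree p = degree [:- \<zeta>, 1:] + degree q" unfolding q by (rule degree_mult_eq) (use q0 in auto)
  then show ?thesis using Suc.hyps(2) by simp
 qed
 obtain A zs where A: "A > 0" "length zs <= degree q" "\<forall>\<zeta>\<in>set zs. cmod \<zeta> <= 1"
  "!!z. cmod z = 1 ==> cmod (poly q z) = A * (\<Prod>\<zeta>\<leftarrow>zs. cmod (z - \<zeta>))"
  using Suc.hyps(1)[of q] dq q0 by blast
 have pz: "cmod (poly p z) = cmod (z - \<zeta>) * cmod (poly q z)" for z
  unfolding q by (simp add: norm_mult left_diff_distrib[symmetric])
 show ?case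
 proof (cases "cmod \<zeta> <= 1")
  case True
  then show ?thesis using A dq Suc.hyps(2) pz by (intro exI[of _ A] exI[of _ "\<zeta> # zs"]) auto
 next
  case False
  have fl: "cmod (z - \<zeta>) = cmod \<zeta> * cmod (z - 1 / cnj \<zeta>)" if z: "cmod z = 1" for z
  proof -
   have zz: "z * cnj z = 1" using z by (simp add: complex_norm_square[symmetric])
   have "\<zeta> ~= 0" using False by auto
   then have "cmod \<zeta> * cmod (z - 1 / cnj \<zeta>) = cmod (cnj \<zeta> * (z - 1 / cnj \<zeta>))" by (simp add: norm_mult)
   also have "cnj \<zeta> * (z - 1 / cnj \<zeta>) = z * cnj (\<zeta> - z)"
    using \<open>\<zeta> ~= 0\<close> zz by (simp add: algebra_simps)
   also have "cmod (z * cnj (\<zeta> - z)) = cmod (z - \<zeta>)" using z by (simp add: norm_mult norm_minus_commute del: complex_cnj_diff)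
   finally show ?thesis by simp
  qed
  have "cmod (1 / cnj \<zeta>) <= 1" using False by (simp add: norm_divide divide_le_eq_1)
  moreover have "A * cmod \<zeta> > 0" using A(1) False by (intro mult_pos_pos) auto
  ultimately show ?thesis using A dq Suc.hyps(2) pz fl False
   by (intro exI[of _ "A * cmod \<zeta>"] exI[of _ "(1 / cnj \<zeta>) # zs"]) auto
 qed
qed

lemma trig_poly_factor:
 fixes t :: "int => complex" and D :: nat
 defines "T \<equiv> %x. \<Sum>k = - int D..int D. t k * e1 (of_int k * x)"
 assumes nz: "T x0 ~= 0"
 shows "\<exists>A zs. A > 0 & length zs <= 2 * D & (\<forall>\<zeta>\<in>set zs. cmod \<zeta> <= 1) &
  (ALL x. cmod (T x) = A * (\<Prod>\<zeta>\<leftarrow>zs. cmod (e1 x - \<zeta>)))"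
proof -
 define P where "P = (\<Sum>k\<le>2 * D. monom (t (int k - int D)) k)"
 have dP: "degree P <= 2 * D" unfolding P_def
  by (rule degree_sum_le) (auto intro: order_trans[OF degree_monom_le])
 have PT: "poly P (e1 x) = e1 (real D * x) * T x" for x
 proof -
  have "T x = (\<Sum>k\<le>2 * D. t (int k - int D) * e1 (of_int (int k - int D) * x))"
   unfolding T_def
   by (rule sum.reindex_bij_witness[of _ "%k. int k - int D" "%k. nat (k + int D)"]) auto
  then have "e1 (real D * x) * T x = (\<Sum>k\<le>2 * D. t (int k - int D) * (e1 (real D * x) * e1 (of_int (int k - int D) * x)))"
   by (simp add: sum_distrib_left mult_ac)
  also have "... = (\<Sum>k\<le>2 * D. t (int k - int D) * e1 x ^ k)"
  proof (rule sum.cong[OF refl])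
   fix k
   have "e1 (real D * x) * e1 (of_int (int k - int D) * x) = e1 (real k * x)"
    unfolding e1_add[symmetric] by (simp add: algebra_simps)
   also have "... = e1 x ^ k" unfolding Complex.DeMoivre by (rule arg_cong[where f = cis]) simp
   finally show "t (int k - int D) * (e1 (real D * x) * e1 (of_int (int k - int D) * x)) = t (int k - int D) * e1 x ^ k" by simp
  qed
  also have "... = poly P (e1 x)" unfolding P_def by (simp add: poly_sum poly_monom)
  finally show ?thesis by simp
 qed
 have nPT: "cmod (poly P (e1 x)) = cmod (T x)" for x unfolding PT by (simp add: norm_mult)
 have "P ~= 0" using nPT[of x0] nz by auto
 from poly_unit_circle_factor[OF this] obtain A zs where A: "A > 0" "length zs <= degree P" "\<forall>\<zeta>\<in>set zs. cmod \<zeta> <= 1"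
  "ALL z. cmod z = 1 --> cmod (poly P z) = A * (\<Prod>\<zeta>\<leftarrow>zs. cmod (z - \<zeta>))" by blast
 have "cmod (T x) = A * (\<Prod>\<zeta>\<leftarrow>zs. cmod (e1 x - \<zeta>))" for x
  using A(4)[rule_format, of "e1 x"] nPT by simp
 then show ?thesis using A dP by (intro exI[of _ A] exI[of _ zs]) auto
qed

abbreviation avoids :: "real set => real => nat => real => bool" where
 "avoids \<Theta> \<kappa> b x \<equiv> \<forall>\<theta>\<in>\<Theta>. dist_int (x - \<theta>) >= exp (- \<kappa> * real b)"

lemma ln_prod_list:
 assumes "!!x. x \<in> set xs ==> f x > (0::real)"
 shows "ln (\<Prod>x\<leftarrow>xs. f x) = (\<Sum>x\<leftarrow>xs. ln (f x)) & (\<Prod>x\<leftarrow>xs. f x) > 0"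
 using assms
proof (induction xs)
 case (Cons x xs)
 then have "f x > 0" "ln (\<Prod>x\<leftarrow>xs. f x) = (\<Sum>x\<leftarrow>xs. ln (f x))" "(\<Prod>x\<leftarrow>xs. f x) > 0" by auto
 then show ?case by (simp add: ln_mult_pos)
qed simp

lemma sum_sum_list_swap:
 fixes f :: "nat => 'b => real"
 shows "(\<Sum>j<K. \<Sum>x\<leftarrow>xs. f j x) = (\<Sum>x\<leftarrow>xs. \<Sum>j<K. f j x)"
 by (induction xs) (simp_all add: sum.distrib)

text \<open>Sum the estimates for single zeros. The set \<open>\<Theta>\<close> collects the arguments of the zeros
and their preimages along the orbit.\<close>

theorem trig_log_average:
 fixes t :: "int => complex" and b D :: nat
 defines "T \<equiv> %x. \<Sum>k = - int D..int D. t k * e1 (of_int k * x)"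
 assumes nz: "!!x. T x ~= 0"
  and dio: "!!n::nat. n >= 1 ==> dist_int (real n * \<omega>) >= c / (real n)^2" and c: "c > 0"
  and b: "b >= 2" and \<kappa>: "\<kappa> > 0" "exp (- \<kappa> * real b) <= 1 / 2"
 shows "\<exists>A \<Theta>. finite \<Theta> & card \<Theta> <= 2 * D * b ^ 17 &
  (ALL x. (\<Sum>j<b ^ 17. ln (cmod (T (x + real j * \<omega>)))) <= real (b ^ 17) * (A + 2 * real D * ((2 / c + 8 / c^2 + 1) / real b))) &
  (ALL x. avoids \<Theta> \<kappa> b x -->
   (\<Sum>j<b ^ 17. ln (cmod (T (x + real j * \<omega>)))) >= real (b ^ 17) * (A - 2 * real D * ((2 / c + 8 / c^2 + 1) / real b + \<kappa>)))"
proof -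
 let ?C = "(2 / c + 8 / c^2 + 1) / real b" and ?K = "b ^ 17"
 have C0: "?C >= 0" using c by simp
 obtain A zs where A: "A > 0" "length zs <= 2 * D" "\<forall>\<zeta>\<in>set zs. cmod \<zeta> <= 1"
  "!!x. cmod (T x) = A * (\<Prod>\<zeta>\<leftarrow>zs. cmod (e1 x - \<zeta>))"
  using trig_poly_factor[where t = t and D = D and ?x0.0 = 0] nz[of 0] unfolding T_def by blast
 have ne: "e1 x ~= \<zeta>" if "\<zeta> \<in> set zs" for x \<zeta>
 proof
  assume "e1 x = \<zeta>"
  then have "(\<Prod>\<zeta>\<leftarrow>zs. cmod (e1 x - \<zeta>)) = 0" using that by (auto simp: prod_list_zero_iff)
  then show False using A(4)[of x] nz[of x] by simp
 qed
 have lnT: "ln (cmod (T x)) = ln A + (\<Sum>\<zeta>\<leftarrow>zs. ln (cmod (e1 x - \<zeta>)))" for x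
  unfolding A(4) using ln_prod_list[of zs "%\<zeta>. cmod (e1 x - \<zeta>)"] ne A(1) by (subst ln_mult) auto
 have sT: "(\<Sum>j<?K. ln (cmod (T (x + real j * \<omega>)))) = real ?K * ln A + (\<Sum>\<zeta>\<leftarrow>zs. \<Sum>j<?K. ln (cmod (e1 (x + real j * \<omega>) - \<zeta>)))" for x
  unfolding lnT sum.distrib sum_sum_list_swap by simp
 define th where "th \<zeta> = Arg \<zeta> / (2 * pi)" for \<zeta>
 have th: "\<zeta> = cmod \<zeta> * e1 (th \<zeta>)" for \<zeta>
 proof (cases "\<zeta> = 0")
  case False
  then show ?thesis unfolding th_def using Arg_eq[of \<zeta>] by (simp add: cis_conv_exp)
 qed simp
 define \<Theta> where "\<Theta> = (%(\<zeta>, j). th \<zeta> - real j * \<omega>) ` (set zs \<times> {..<?K})"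
 have "card \<Theta> <= card (set zs \<times> {..<?K})" unfolding \<Theta>_def by (rule card_image_le) auto
 also have "... = card (set zs) * ?K" by (simp add: card_cartesian_product)
 also have "... <= 2 * D * ?K" using card_length[of zs] A(2) by (intro mult_le_mono1) linarith
 finally have card: "card \<Theta> <= 2 * D * ?K" .
 have up: "(\<Sum>j<?K. ln (cmod (T (x + real j * \<omega>)))) <= real ?K * (ln A + 2 * real D * ?C)" for x
 proof -
  have "(\<Sum>\<zeta>\<leftarrow>zs. \<Sum>j<?K. ln (cmod (e1 (x + real j * \<omega>) - \<zeta>))) <= (\<Sum>\<zeta>\<leftarrow>zs. real ?K * ?C)"
   using A(3) ne by (intro sum_list_mono zero_log_upper[OF dio c _ _ b]) auto
  also have "... = real (length zs) * (real ?K * ?C)" by (simp add: sum_list_triv)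
  also have "... <= real (2 * D) * (real ?K * ?C)"
   using A(2) C0 by (intro mult_right_mono mult_nonneg_nonneg) auto
  finally show ?thesis unfolding sT by (simp add: algebra_simps)
 qed
 have low: "(\<Sum>j<?K. ln (cmod (T (x + real j * \<omega>)))) >= real ?K * (ln A - 2 * real D * (?C + \<kappa>))"
  if far: "\<forall>\<theta>\<in>\<Theta>. dist_int (x - \<theta>) >= exp (- \<kappa> * real b)" for x
 proof -
  have fj: "dist_int (x + real j * \<omega> - th \<zeta>) >= exp (- \<kappa> * real b)" if "\<zeta> \<in> set zs" "j < ?K" for \<zeta> j
  proof -
   have "th \<zeta> - real j * \<omega> \<in> \<Theta>" unfolding \<Theta>_def using that by force
   then show ?thesis using far by (force simp: algebra_simps)
  qed
  have "real (2 * D) * (real ?K * (?C + \<kappa>)) >= real (length zs) * (real ?K * (?C + \<kappa>))"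
   using A(2) C0 \<kappa> by (intro mult_right_mono mult_nonneg_nonneg) auto
  moreover have "- (real (length zs) * (real ?K * (?C + \<kappa>))) = (\<Sum>\<zeta>\<leftarrow>zs. - (real ?K * (?C + \<kappa>)))"
   by (simp add: sum_list_triv)
  moreover have "... <= (\<Sum>\<zeta>\<leftarrow>zs. \<Sum>j<?K. ln (cmod (e1 (x + real j * \<omega>) - \<zeta>)))"
   using A(3) ne by (intro sum_list_mono zero_log_lower[OF dio c _ _ b \<kappa> th fj]) auto
  ultimately have "- (real (2 * D) * (real ?K * (?C + \<kappa>))) <= (\<Sum>\<zeta>\<leftarrow>zs. \<Sum>j<?K. ln (cmod (e1 (x + real j * \<omega>) - \<zeta>)))"
   by linarith
  moreover have "real ?K * (ln A - 2 * real D * (?C + \<kappa>)) = real ?K * ln A - real (2 * D) * (real ?K * (?C + \<kappa>))"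
   by (simp add: algebra_simps)
  ultimately show ?thesis unfolding sT by linarith
 qed
 show ?thesis
  by (rule exI[of _ "ln A"], rule exI[of _ \<Theta>]) (use card up low in \<open>auto simp: \<Theta>_def\<close>)
qed

section \<open>Transfer matrices and large deviations\<close>

text \<open>Two by two matrices as quadruples of entries, row by row; the norm is the Hilbert--Schmidt norm
\<open>hs\<close>.\<close>

type_synonym mat2 = "real \<times> real \<times> real \<times> real"

definition mm :: "mat2 => mat2 => mat2" where
 "mm A B = (case A of (a, b, c, d) => case B of (p, q, r, s) =>
   (a * p + b * r, a * q + b * s, c * p + d * r, c * q + d * s))"

definition mv :: "mat2 => real \<times> real => real \<times> real" where
 "mv A v = (case A of (a, b, c, d) => case v of (x, y) => (a * x + b * y, c * x + d * y))"

definition hs :: "mat2 => real" where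
 "hs A = (case A of (a, b, c, d) => sqrt (a^2 + b^2 + c^2 + d^2))"

definition det2 :: "mat2 => real" where
 "det2 A = (case A of (a, b, c, d) => a * d - b * c)"

definition adj2 :: "mat2 => mat2" where
 "adj2 A = (case A of (a, b, c, d) => (d, - b, - c, a))"

lemma mm_assoc: "mm (mm A B) C = mm A (mm B C)"
 by (cases A; cases B; cases C) (simp add: mm_def algebra_simps)

lemma mv_mm: "mv (mm A B) v = mv A (mv B v)"
 by (cases A; cases B; cases v) (simp add: mm_def mv_def algebra_simps)

lemma mm_id [simp]: "mm A (1, 0, 0, 1) = A" "mm (1, 0, 0, 1) A = A"
 by (cases A; simp add: mm_def)+

lemma mv_id [simp]: "mv (1, 0, 0, 1) v = v"
 by (cases v) (simp add: mv_def)

lemma det2_mm: "det2 (mm A B) = det2 A * det2 B"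
 by (cases A; cases B) (simp add: mm_def det2_def algebra_simps)

lemma mm_adj2: "det2 A = 1 ==> mm (adj2 A) A = (1, 0, 0, 1)" "det2 A = 1 ==> mm A (adj2 A) = (1, 0, 0, 1)"
 by (cases A; simp add: mm_def det2_def adj2_def algebra_simps)+

lemma hs_adj2 [simp]: "hs (adj2 A) = hs A"
 by (cases A) (simp add: hs_def adj2_def add_ac)

lemma hs_nonneg [simp]: "hs A >= 0"
 by (cases A) (simp add: hs_def)

lemma cauchy_schwarz2: "((a::real) * x + b * y)^2 <= (a^2 + b^2) * (x^2 + y^2)"
proof -
 have "(a^2 + b^2) * (x^2 + y^2) - (a * x + b * y)^2 = (a * y - b * x)^2"
  by (simp add: power2_eq_square algebra_simps)
 then show ?thesis using zero_le_power2[of "a * y - b * x"] by linarith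
qed

lemma norm_mv_le: "norm (mv A v) <= hs A * norm v"
proof -
 obtain a b c d where A: "A = (a, b, c, d)" by (cases A)
 obtain x y where v: "v = (x, y)" by (cases v)
 have "(a * x + b * y)^2 + (c * x + d * y)^2 <= (a^2 + b^2 + c^2 + d^2) * (x^2 + y^2)"
  using cauchy_schwarz2[of a x b y] cauchy_schwarz2[of c x d y] by (simp add: algebra_simps)
 then have "sqrt ((a * x + b * y)^2 + (c * x + d * y)^2) <= sqrt ((a^2 + b^2 + c^2 + d^2) * (x^2 + y^2))"
  by (rule real_sqrt_le_mono)
 then show ?thesis unfolding A v by (simp add: mv_def hs_def norm_Pair real_sqrt_mult)
qed

lemma hs_mm_le: "hs (mm A B) <= hs A * hs B"
proof -
 obtain a b c d where A: "A = (a, b, c, d)" by (cases A)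
 obtain p q r s where B: "B = (p, q, r, s)" by (cases B)
 have "(a * p + b * r)^2 + (a * q + b * s)^2 + (c * p + d * r)^2 + (c * q + d * s)^2 <= (a^2 + b^2 + c^2 + d^2) * (p^2 + q^2 + r^2 + s^2)"
  using cauchy_schwarz2[of a p b r] cauchy_schwarz2[of a q b s] cauchy_schwarz2[of c p d r] cauchy_schwarz2[of c q d s]
  by (simp add: algebra_simps)
 then have "sqrt ((a * p + b * r)^2 + (a * q + b * s)^2 + (c * p + d * r)^2 + (c * q + d * s)^2) <= sqrt ((a^2 + b^2 + c^2 + d^2) * (p^2 + q^2 + r^2 + s^2))"
  by (rule real_sqrt_le_mono)
 then show ?thesis unfolding A B by (simp add: mm_def hs_def real_sqrt_mult)
qed

lemma hs_ge_sqrt2: "det2 A = 1 ==> (hs A)\<^sup>2 >= 2"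
proof -
 obtain a b c d where A: "A = (a, b, c, d)" by (cases A)
 assume "det2 A = 1"
 then have "a * d - b * c = 1" unfolding A det2_def by simp
 moreover have "a^2 + b^2 + c^2 + d^2 = (a - d)^2 + (b + c)^2 + 2 * (a * d - b * c)"
  by (simp add: power2_eq_square algebra_simps)
 ultimately have "a^2 + b^2 + c^2 + d^2 = (a - d)^2 + (b + c)^2 + 2" by simp
 then have "a^2 + b^2 + c^2 + d^2 >= 2" by simp
 then show ?thesis unfolding A hs_def by simp
qed

lemma hs_ge_1: "det2 A = 1 ==> hs A >= 1"
 using hs_ge_sqrt2[of A] power2_le_imp_le[of 1 "hs A"] by simp

definition step_mat :: "real => mat2" where
 "step_mat v = (v, - 1, 1, 0)"

lemma det2_step [simp]: "det2 (step_mat v) = 1"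
 by (simp add: det2_def step_mat_def)

lemma hs_step_le: "hs (step_mat v) <= \<bar>v\<bar> + 2"
proof -
 have "v^2 + 2 <= (\<bar>v\<bar> + 2)^2" by (simp add: power2_sum)
 then have "sqrt (v^2 + 2) <= \<bar>v\<bar> + 2" by (intro real_le_lsqrt) auto
 then show ?thesis by (simp add: hs_def step_mat_def add.commute)
qed

primrec tmat :: "(real => real) => real => real => nat => real => mat2" where
 "tmat V \<omega> E 0 x = (1, 0, 0, 1)"
| "tmat V \<omega> E (Suc n) x = mm (step_mat (V (x + real (Suc n) * \<omega>) - E)) (tmat V \<omega> E n x)"

lemma det2_tmat [simp]: "det2 (tmat V \<omega> E n x) = 1"
 by (induction n) (simp_all add: det2_mm, simp add: det2_def)

abbreviation expanding :: "(real => real) => real => real => real => bool" where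
 "expanding V \<omega> E \<gamma> \<equiv> \<forall>n\<ge>1. \<exists>x. ln (hs (tmat V \<omega> E n x)) >= \<gamma> * real n"

lemma tmat_add: "tmat V \<omega> E (m + n) x = mm (tmat V \<omega> E m (x + real n * \<omega>)) (tmat V \<omega> E n x)"
proof (induction m)
 case (Suc m)
 have "x + real n * \<omega> + real (Suc m) * \<omega> = x + real (Suc (m + n)) * \<omega>" by (simp add: algebra_simps)
 then show ?case using Suc by (simp only: add_Suc tmat.simps mm_assoc)
qed simp

lemma tmat_Suc': "tmat V \<omega> E (Suc n) x = mm (tmat V \<omega> E n (x + \<omega>)) (step_mat (V (x + \<omega>) - E))"
 using tmat_add[of V \<omega> E n 1 x] by simp

definition tm_entry :: "(real => real) => real => real => nat => real => real" where
 "tm_entry V \<omega> E n x = fst (tmat V \<omega> E n x)"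

lemma tmat_entries:
 "tmat V \<omega> E (Suc (Suc n)) x = (tm_entry V \<omega> E (Suc (Suc n)) x, - tm_entry V \<omega> E (Suc n) (x + \<omega>),
   tm_entry V \<omega> E (Suc n) x, - tm_entry V \<omega> E n (x + \<omega>))"
proof -
 have row: "fst (snd (snd (tmat V \<omega> E (Suc k) y))) = tm_entry V \<omega> E k y" for k y
  unfolding tm_entry_def by (cases "tmat V \<omega> E k y") (simp add: mm_def step_mat_def)
 have c1: "fst (snd (tmat V \<omega> E (Suc k) y)) = - tm_entry V \<omega> E k (y + \<omega>)" for k y
  unfolding tm_entry_def tmat_Suc' by (cases "tmat V \<omega> E k (y + \<omega>)") (simp add: mm_def step_mat_def)
 have c2: "snd (snd (snd (tmat V \<omega> E (Suc k) y))) = - fst (snd (snd (tmat V \<omega> E k (y + \<omega>))))" for k y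
  unfolding tmat_Suc' by (cases "tmat V \<omega> E k (y + \<omega>)") (simp add: mm_def step_mat_def)
 show ?thesis
  using row[of "Suc n" x] c1[of "Suc n" x] c2[of "Suc n" x] row[of n "x + \<omega>"]
  unfolding tm_entry_def by (metis prod.collapse)
qed

lemma hs_tmat_le:
 assumes "!!x. \<bar>V x - E\<bar> + 2 <= C"
 shows "hs (tmat V \<omega> E n x) <= 2 * C ^ n"
proof (induction n)
 case 0
 then show ?case by (simp add: hs_def real_sqrt_le_iff[of 2 4, simplified])
next
 case (Suc n)
 have C: "C >= 0" using assms[of 0] by linarith
 have "hs (tmat V \<omega> E (Suc n) x) <= hs (step_mat (V (x + real (Suc n) * \<omega>) - E)) * hs (tmat V \<omega> E n x)"
  by (simp only: tmat.simps hs_mm_le)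
 also have "... <= C * (2 * C ^ n)"
  using Suc hs_step_le[of "V (x + real (Suc n) * \<omega>) - E"] assms[of "x + real (Suc n) * \<omega>"] C
  by (intro mult_mono) auto
 finally show ?case by simp
qed

lemma tmat_shift_one:
 assumes "!!x. \<bar>V x - E\<bar> + 2 <= C"
 shows "\<bar>ln (hs (tmat V \<omega> E n (x + \<omega>))) - ln (hs (tmat V \<omega> E n x))\<bar> <= 2 * ln C"
proof -
 define A B where "A = step_mat (V (x + \<omega>) - E)" and "B = step_mat (V (x + real (Suc n) * \<omega>) - E)"
 have eq: "mm (tmat V \<omega> E n (x + \<omega>)) A = mm B (tmat V \<omega> E n x)"
  unfolding A_def B_def using tmat_Suc'[of V \<omega> E n x] by simp
 have dA: "det2 A = 1" "det2 B = 1" unfolding A_def B_def by simp_all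
 have hA: "hs A <= C" "hs B <= C"
  unfolding A_def B_def by (rule order_trans[OF hs_step_le assms])+
 have C: "C > 0" using assms[of 0] by linarith
 have pos: "hs (tmat V \<omega> E n y) > 0" for y using hs_ge_1[of "tmat V \<omega> E n y"] by simp
 have "tmat V \<omega> E n (x + \<omega>) = mm (mm B (tmat V \<omega> E n x)) (adj2 A)"
  unfolding eq[symmetric] mm_assoc mm_adj2(2)[OF dA(1)] by simp
 then have "hs (tmat V \<omega> E n (x + \<omega>)) <= hs (mm B (tmat V \<omega> E n x)) * hs A"
  using hs_mm_le[of "mm B (tmat V \<omega> E n x)" "adj2 A"] by simp
 also have "... <= (C * hs (tmat V \<omega> E n x)) * C"
 proof (intro mult_mono)
  show "hs (mm B (tmat V \<omega> E n x)) <= C * hs (tmat V \<omega> E n x)"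
   using hs_mm_le[of B "tmat V \<omega> E n x"] hA(2) mult_right_mono[of "hs B" C "hs (tmat V \<omega> E n x)"] by simp
 qed (use hA C in auto)
 finally have "ln (hs (tmat V \<omega> E n (x + \<omega>))) <= ln ((C * hs (tmat V \<omega> E n x)) * C)"
  using pos[of "x + \<omega>"] by (intro ln_mono) auto
 also have "... = 2 * ln C + ln (hs (tmat V \<omega> E n x))"
  using C pos[of x] by (simp add: ln_mult_pos)
 finally have 1: "ln (hs (tmat V \<omega> E n (x + \<omega>))) - ln (hs (tmat V \<omega> E n x)) <= 2 * ln C" by simp
 have "tmat V \<omega> E n x = mm (adj2 B) (mm (tmat V \<omega> E n (x + \<omega>)) A)"
  unfolding eq mm_assoc[symmetric] mm_adj2(1)[OF dA(2)] by simp
 then have "hs (tmat V \<omega> E n x) <= hs B * hs (mm (tmat V \<omega> E n (x + \<omega>)) A)"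
  using hs_mm_le[of "adj2 B" "mm (tmat V \<omega> E n (x + \<omega>)) A"] by simp
 also have "... <= C * (hs (tmat V \<omega> E n (x + \<omega>)) * C)"
 proof (intro mult_mono)
  show "hs (mm (tmat V \<omega> E n (x + \<omega>)) A) <= hs (tmat V \<omega> E n (x + \<omega>)) * C"
   using hs_mm_le[of "tmat V \<omega> E n (x + \<omega>)" A] hA(1) mult_left_mono[of "hs A" C "hs (tmat V \<omega> E n (x + \<omega>))"] by simp
 qed (use hA C in auto)
 finally have "ln (hs (tmat V \<omega> E n x)) <= ln (C * (hs (tmat V \<omega> E n (x + \<omega>)) * C))"
  using pos[of x] by (intro ln_mono) auto
 also have "... = 2 * ln C + ln (hs (tmat V \<omega> E n (x + \<omega>)))"
  using C pos[of "x + \<omega>"] by (simp add: ln_mult_pos)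
 finally show ?thesis using 1 by simp
qed

lemma tmat_shift:
 assumes "!!x. \<bar>V x - E\<bar> + 2 <= C"
 shows "\<bar>ln (hs (tmat V \<omega> E n (x + real j * \<omega>))) - ln (hs (tmat V \<omega> E n x))\<bar> <= 2 * real j * ln C"
proof (induction j)
 case (Suc j)
 have "x + real (Suc j) * \<omega> = (x + real j * \<omega>) + \<omega>" by (simp add: algebra_simps)
 then show ?case using Suc tmat_shift_one[of V E C \<omega> n "x + real j * \<omega>", OF assms]
  by (simp add: algebra_simps)
qed simp

lemma fourier_class_tmat:
 assumes V: "fourier_class \<rho> Bv (%x. of_real (V x))" and \<rho>: "\<rho> >= 0" and E: "\<bar>E\<bar> <= B" and Bv: "Bv >= 0"
 defines "C \<equiv> Bv + B + 2"
 shows "fourier_class \<rho> (C ^ n) (%x. of_real (fst (tmat V \<omega> E n x))) &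
  fourier_class \<rho> (C ^ n) (%x. of_real (fst (snd (tmat V \<omega> E n x)))) &
  fourier_class \<rho> (C ^ n) (%x. of_real (fst (snd (snd (tmat V \<omega> E n x))))) &
  fourier_class \<rho> (C ^ n) (%x. of_real (snd (snd (snd (tmat V \<omega> E n x)))))"
proof (induction n)
 case 0
 show ?case using fourier_class_const[of \<rho> 1] fourier_class_mono[OF fourier_class_const[of \<rho> 0], of 1] by simp
next
 case (Suc n)
 define y where "y = real (Suc n) * \<omega>"
 have B: "B >= 0" using E by simp
 have C1: "C >= 1" unfolding C_def using Bv B by simp
 have vE: "fourier_class \<rho> (Bv + B) (%x. of_real (V (x + y)) + of_real (- E))"
  by (rule fourier_class_mono[OF fourier_class_add[OF fourier_class_shift[OF V] fourier_class_const]]) (use E in simp)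
 have comb: "fourier_class \<rho> (C ^ Suc n) (%x. of_real ((V (x + y) - E) * f x - g x))"
  if f: "fourier_class \<rho> (C ^ n) (%x. of_real (f x))" and g: "fourier_class \<rho> (C ^ n) (%x. of_real (g x))" for f g
 proof -
  have "fourier_class \<rho> ((Bv + B) * C ^ n + cmod (- 1) * C ^ n)
    (%x. (of_real (V (x + y)) + of_real (- E)) * of_real (f x) + (- 1) * of_real (g x))"
   by (intro fourier_class_add fourier_class_mult vE f g \<rho> fourier_class_const)
  moreover have "(Bv + B) * C ^ n + cmod (- 1) * C ^ n <= C ^ Suc n"
  proof -
   have "(Bv + B + 1) * C ^ n <= C * C ^ n" using C1 unfolding C_def by (intro mult_right_mono) auto
   then show ?thesis by (simp add: algebra_simps)
  qed
  ultimately have "fourier_class \<rho> (C ^ Suc n)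
    (%x. (of_real (V (x + y)) + of_real (- E)) * of_real (f x) + (- 1) * of_real (g x))"
   by (rule fourier_class_mono)
  then show ?thesis by simp
 qed
 have up: "fourier_class \<rho> (C ^ Suc n) (%x. of_real (f x))"
  if f: "fourier_class \<rho> (C ^ n) (%x. of_real (f x))" for f
  using f by (rule fourier_class_mono) (rule power_increasing; use C1 in simp)
 have e: "tmat V \<omega> E (Suc n) x = ((V (x + y) - E) * fst (tmat V \<omega> E n x) - fst (snd (snd (tmat V \<omega> E n x))),
   (V (x + y) - E) * fst (snd (tmat V \<omega> E n x)) - snd (snd (snd (tmat V \<omega> E n x))),
   fst (tmat V \<omega> E n x), fst (snd (tmat V \<omega> E n x)))" for x
  unfolding y_def by (cases "tmat V \<omega> E n x") (simp add: mm_def step_mat_def)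
 show ?case unfolding e fst_conv snd_conv using Suc.IH by (intro conjI comb up) auto
qed

lemma fourier_class_bounded:
 assumes "fourier_class \<rho> B f" "\<rho> >= 0"
 shows "cmod (f x) <= B"
proof -
 obtain c S where c: "!!x. ((%k. c k * e1 (of_int k * x)) has_sum f x) UNIV"
   "((%k. cmod (c k) * wt \<rho> k) has_sum S) UNIV" "S <= B"
  using assms(1) unfolding fourier_class_def by blast
 have le: "cmod (c k * e1 (of_int k * x)) <= cmod (c k) * wt \<rho> k" for k
 proof -
  have "cmod (c k) * 1 <= cmod (c k) * wt \<rho> k"
   using assms(2) by (intro mult_left_mono) auto
  then show ?thesis by (simp add: norm_mult)
 qed
 have "(%k. cmod (c k * e1 (of_int k * x))) summable_on UNIV"
  by (rule summable_on_comparison_test[OF has_sum_imp_summable[OF c(2)]]) (use le in auto)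
 then obtain n where n: "((%k. cmod (c k * e1 (of_int k * x))) has_sum n) UNIV"
  by (auto simp: summable_on_def)
 have "cmod (f x) <= n" by (rule norm_has_sum_bound[OF n c(1)])
 also have "n <= S" using has_sum_mono[OF n c(2)] le by blast
 finally show ?thesis using c(3) by simp
qed

text \<open>A weaker but uniform form of the Diophantine condition: the logarithm is absorbed into one power of
\<open>n\<close>.\<close>

definition dioph :: "real => real => bool" where
 "dioph c \<omega> \<longleftrightarrow> (\<forall>n::nat. n >= 1 --> dist_int (real n * \<omega>) >= c / (real n)^2)"

text \<open>The squared norm of \<open>M\<^sub>n\<close> is a trigonometric polynomial of degree \<open>d0 * n\<close>
up to an error \<open>1 / 2\<close>, while it is at least 2. Its logarithm varies along \<open>b ^ 17\<close> steps by
only \<open>O(b ^ 17) \<le> O(n / b)\<close>, so the orbit average controls the value itself.\<close>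

theorem large_deviation:
 fixes V :: "real => real"
 assumes V: "fourier_class \<rho> Bv (%x. of_real (V x))" and \<rho>: "\<rho> > 0" and c: "c > 0" and ep: "ep > 0" and B: "B >= 0"
 obtains \<kappa> :: real and d b0 :: nat where "\<kappa> > 0" "b0 >= 2"
  "!!\<omega> E b n. dioph c \<omega> ==> \<bar>E\<bar> <= B ==> b >= b0 ==> n >= b ^ 18 ==>
   \<exists>a \<Theta>. finite \<Theta> & card \<Theta> <= d * n * b ^ 17 & (ALL x. 2 * ln (hs (tmat V \<omega> E n x)) <= a + ep * real n) &
    (ALL x. avoids \<Theta> \<kappa> b x --> 2 * ln (hs (tmat V \<omega> E n x)) >= a - ep * real n)"
proof -
 define C where "C = Bv + B + 2"
 have Bv: "Bv >= 0" using fourier_class_bounded[OF V, of 0] \<rho> norm_ge_zero order_trans by fastforce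
 have C2: "C >= 2" unfolding C_def using Bv B by simp
 then have lnC: "ln C >= 0" by simp
 define d0 where "d0 = nat \<lceil>(2 * ln C + 3) / \<rho>\<rceil>"
 have d0: "\<rho> * real d0 >= 2 * ln C + 3"
 proof -
  have "real d0 >= (2 * ln C + 3) / \<rho>" unfolding d0_def by linarith
  then show ?thesis using \<rho> by (simp add: field_simps)
 qed
 have d0pos: "real d0 > 0" using d0 lnC \<rho> by (metis add_nonneg_pos mult_nonneg_nonneg mult_zero_right not_less of_nat_0_le_iff order_le_less zero_le_numeral zero_less_numeral)
 define \<kappa> where "\<kappa> = ep / (4 * real d0)"
 have \<kappa>: "\<kappa> > 0" unfolding \<kappa>_def using ep d0pos by simp
 define C1 where "C1 = 2 / c + 8 / c^2 + 1"
 have C1: "C1 > 0" unfolding C1_def using c by (intro add_nonneg_pos) auto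
 define G where "G = 1 + 4 * ln C + 2 * real d0 * C1"
 have G: "G > 0" unfolding G_def using lnC C1 d0pos by (intro add_pos_nonneg) auto
 define b0 where "b0 = max 2 (max (nat \<lceil>2 * G / ep\<rceil>) (nat \<lceil>1 / \<kappa>\<rceil>))"
 show ?thesis
 proof (rule that[of \<kappa> b0 "2 * d0"])
  show "\<kappa> > 0" by (rule \<kappa>)
  show "b0 >= 2" unfolding b0_def by simp
  fix \<omega> E :: real and b n :: nat
  assume dio: "dioph c \<omega>" and E: "\<bar>E\<bar> <= B" and b: "b >= b0" and n: "n >= b ^ 18"
  have b2: "b >= 2" and bG: "real b >= 2 * G / ep" and b\<kappa>: "real b >= 1 / \<kappa>"
   using b unfolding b0_def by linarith+
  have bpos: "real b > 0" using b2 by simp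
  have n1: "n >= 1"
  proof -
   have "b ^ 18 >= 1" using b2 by simp
   then show ?thesis using n by linarith
  qed
  have VE: "\<bar>V x - E\<bar> + 2 <= C" for x
   using fourier_class_bounded[OF V, of x] \<rho> E unfolding C_def by simp
  let ?M = "%x. tmat V \<omega> E n x"
  define Q where "Q x = (hs (?M x))^2" for x
  have Q2: "Q x >= 2" for x unfolding Q_def by (rule hs_ge_sqrt2) simp
  have Qe: "complex_of_real (Q x) = of_real (fst (?M x)) * of_real (fst (?M x)) + of_real (fst (snd (?M x))) * of_real (fst (snd (?M x))) +
   of_real (fst (snd (snd (?M x)))) * of_real (fst (snd (snd (?M x)))) + of_real (snd (snd (snd (?M x)))) * of_real (snd (snd (snd (?M x))))" for x
   unfolding Q_def by (cases "?M x") (simp add: hs_def power2_eq_square)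
  have Qc: "fourier_class \<rho> (4 * (C ^ n * C ^ n)) (%x. of_real (Q x))"
  proof -
   note cl = fourier_class_tmat[OF V less_imp_le[OF \<rho>] E Bv, folded C_def, of n \<omega>]
   have "fourier_class \<rho> (C ^ n * C ^ n + C ^ n * C ^ n + C ^ n * C ^ n + C ^ n * C ^ n) (%x. of_real (Q x))"
    unfolding Qe using cl \<rho> by (intro fourier_class_add fourier_class_mult) auto
   then show ?thesis by simp
  qed
  obtain t where t: "!!D x. cmod (of_real (Q x) - (\<Sum>k = - int D..int D. t k * e1 (of_int k * x))) <= 4 * (C ^ n * C ^ n) * exp (- \<rho> * real D)"
   using fourier_class_truncate[OF Qc] \<rho> by auto
  define D where "D = d0 * n"
  define T where "T x = (\<Sum>k = - int D..int D. t k * e1 (of_int k * x))" for x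
  have QT: "cmod (of_real (Q x) - T x) <= 1 / 2" for x
  proof -
   have "C ^ n = exp (real n * ln C)" using C2 by (simp add: exp_of_nat_mult)
   then have "4 * (C ^ n * C ^ n) * exp (- \<rho> * real D) = 4 * exp (2 * real n * ln C - \<rho> * real D)"
    by (simp add: mult_exp_exp mult.assoc)
   also have "... <= 4 * exp (- 3)"
   proof -
    have "real n * (2 * ln C + 3) <= real n * (\<rho> * real d0)" using d0 by (intro mult_left_mono) auto
    moreover have "real n * 3 >= 3" using n1 by simp
    ultimately have "2 * real n * ln C - \<rho> * real D <= - 3" unfolding D_def by (simp add: algebra_simps)
    then show ?thesis by simp
   qed
   also have "... <= 1 / 2"
   proof -
    have "exp (3::real) = exp 1 ^ 3" by (simp add: exp_of_nat_mult[symmetric])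
    moreover have "exp (1::real) ^ 3 >= 2 ^ 3" using exp_ge_add_one_self[of 1] by (intro power_mono) auto
    ultimately have "exp (3::real) >= 8" by simp
    then have "inverse (exp (3::real)) <= inverse 8" by (intro le_imp_inverse_le) auto
    then show ?thesis by (simp add: exp_minus)
   qed
   finally show ?thesis using t[of x D] unfolding T_def by linarith
  qed
  have Tlow: "cmod (T x) >= Q x - 1 / 2" and Tup: "cmod (T x) <= Q x + 1 / 2" for x
  proof -
   have "cmod (complex_of_real (Q x)) = Q x" using Q2[of x] by simp
   then show "cmod (T x) >= Q x - 1 / 2" "cmod (T x) <= Q x + 1 / 2"
    using QT[of x] norm_triangle_ineq2[of "of_real (Q x)" "T x"] norm_triangle_ineq3[of "of_real (Q x)" "T x"] by auto
  qed
  have Tnz: "T x ~= 0" for x using Tlow[of x] Q2[of x] by auto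
  have lnTQ: "\<bar>ln (cmod (T x)) - ln (Q x)\<bar> <= 1" for x
  proof -
   have "cmod (T x) <= 2 * Q x" "Q x <= 2 * cmod (T x)" "cmod (T x) > 0"
    using Tlow[of x] Tup[of x] Q2[of x] by linarith+
   then have "ln (cmod (T x)) <= ln (2 * Q x)" "ln (Q x) <= ln (2 * cmod (T x))"
    using Q2[of x] by (intro ln_mono; simp)+
   moreover have "ln (2 * Q x) = ln 2 + ln (Q x)" "ln (2 * cmod (T x)) = ln 2 + ln (cmod (T x))"
    using Q2[of x] \<open>cmod (T x) > 0\<close> by (auto intro!: ln_mult_pos)
   moreover have "ln 2 <= (1::real)" using ln_le_minus_one[of 2] by simp
   ultimately show ?thesis by linarith
  qed
  have lnQ: "ln (Q x) = 2 * ln (hs (?M x))" for x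
   unfolding Q_def using hs_ge_1[of "?M x"] by (simp add: ln_realpow)
  have \<kappa>b: "exp (- \<kappa> * real b) <= 1 / 2"
  proof -
   have "\<kappa> * real b >= 1" using b\<kappa> \<kappa> by (simp add: field_simps)
   moreover have "exp (\<kappa> * real b) >= 1 + \<kappa> * real b" by (rule exp_ge_add_one_self)
   ultimately have "exp (\<kappa> * real b) >= 2" by linarith
   then have "inverse (exp (\<kappa> * real b)) <= inverse 2" by (intro le_imp_inverse_le) auto
   then show ?thesis by (simp add: exp_minus)
  qed
  obtain A \<Theta> where A: "finite \<Theta>" "card \<Theta> <= 2 * D * b ^ 17"
   "!!x. (\<Sum>j<b ^ 17. ln (cmod (T (x + real j * \<omega>)))) <= real (b ^ 17) * (A + 2 * real D * (C1 / real b))"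
   "!!x. avoids \<Theta> \<kappa> b x ==>
   (\<Sum>j<b ^ 17. ln (cmod (T (x + real j * \<omega>)))) >= real (b ^ 17) * (A - 2 * real D * (C1 / real b + \<kappa>))"
   using trig_log_average[where t = t and D = D and b = b and \<kappa> = \<kappa> and \<omega> = \<omega> and c = c, folded T_def C1_def]
    Tnz dio c b2 \<kappa> \<kappa>b unfolding dioph_def by blast
  let ?K = "b ^ 17"
  have K0: "real ?K > 0" using b2 by simp
  have Kn: "real ?K <= real n / real b"
  proof -
   have "b ^ 17 * b <= n" using n by (simp add: eval_nat_numeral mult_ac)
   then have "real (b ^ 17 * b) <= real n" using of_nat_le_iff by blast
   then show ?thesis using bpos by (simp add: field_simps)
  qed
  have nb: "1 <= real n / real b"
  proof -
   have "1 <= ?K" using b2 by simp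
   then have "1 <= real ?K" by (metis of_nat_1 of_nat_le_iff)
   then show ?thesis using Kn by linarith
  qed
  have avg_bd: "\<bar>ln (cmod (T (x + real j * \<omega>))) - 2 * ln (hs (?M x))\<bar> <= (1 + 4 * ln C) * (real n / real b)" if "j < ?K" for x j
  proof -
   have "\<bar>ln (hs (?M (x + real j * \<omega>))) - ln (hs (?M x))\<bar> <= 2 * real j * ln C"
    by (rule tmat_shift[OF VE])
   also have "... <= 2 * real ?K * ln C" using that lnC by (intro mult_right_mono) auto
   also have "... <= 2 * (real n / real b) * ln C" using Kn lnC by (intro mult_right_mono) auto
   finally have "\<bar>ln (cmod (T (x + real j * \<omega>))) - 2 * ln (hs (?M x))\<bar> <= 1 + 4 * (real n / real b) * ln C"
    using lnTQ[of "x + real j * \<omega>"] unfolding lnQ by linarith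
   also have "... <= (1 + 4 * ln C) * (real n / real b)" using nb by (simp add: algebra_simps)
   finally show ?thesis .
  qed
  have avg: "\<bar>(\<Sum>j<?K. ln (cmod (T (x + real j * \<omega>)))) - real ?K * (2 * ln (hs (?M x)))\<bar> <= real ?K * ((1 + 4 * ln C) * (real n / real b))" for x
  proof -
   have "(\<Sum>j<?K. ln (cmod (T (x + real j * \<omega>)))) - real ?K * (2 * ln (hs (?M x))) = (\<Sum>j<?K. ln (cmod (T (x + real j * \<omega>))) - 2 * ln (hs (?M x)))"
    by (simp add: sum_subtractf)
   also have "\<bar>...\<bar> <= (\<Sum>j<?K. \<bar>ln (cmod (T (x + real j * \<omega>))) - 2 * ln (hs (?M x))\<bar>)" by (rule sum_abs)
   also have "... <= (\<Sum>j<?K. (1 + 4 * ln C) * (real n / real b))" by (intro sum_mono avg_bd) auto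
   finally show ?thesis by simp
  qed
  have err: "(1 + 4 * ln C) * (real n / real b) + 2 * real D * (C1 / real b + \<kappa>) <= ep * real n"
  proof -
   have "(1 + 4 * ln C) * (real n / real b) + 2 * real D * (C1 / real b + \<kappa>) = G * (real n / real b) + 2 * real d0 * \<kappa> * real n"
    unfolding D_def G_def by (simp add: algebra_simps)
   also have "G / real b <= ep / 2" using bG bpos ep by (simp add: field_simps)
   then have "G * (real n / real b) <= ep / 2 * real n" using mult_right_mono[of "G / real b" "ep / 2" "real n"] by simp
   moreover have "2 * real d0 * \<kappa> * real n = ep / 2 * real n" unfolding \<kappa>_def using d0pos by simp
   ultimately show ?thesis by linarith
  qed
  have err2: "2 * real D * (C1 / real b) <= 2 * real D * (C1 / real b + \<kappa>)" using \<kappa> by (intro mult_left_mono) auto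
  show "\<exists>a \<Theta>. finite \<Theta> & card \<Theta> <= 2 * d0 * n * b ^ 17 & (ALL x. 2 * ln (hs (?M x)) <= a + ep * real n) &
    (ALL x. avoids \<Theta> \<kappa> b x --> 2 * ln (hs (?M x)) >= a - ep * real n)"
  proof (intro exI[of _ A] exI[of _ \<Theta>] conjI allI impI)
   show "card \<Theta> <= 2 * d0 * n * b ^ 17" using A(2) unfolding D_def by (simp add: mult.assoc)
   fix x
   have "real ?K * (2 * ln (hs (?M x))) <= real ?K * (A + 2 * real D * (C1 / real b)) + real ?K * ((1 + 4 * ln C) * (real n / real b))"
    using avg[of x] A(3)[of x] by linarith
   also have "... = real ?K * (A + 2 * real D * (C1 / real b) + (1 + 4 * ln C) * (real n / real b))" by (simp only: distrib_left)
   finally have "2 * ln (hs (?M x)) <= A + 2 * real D * (C1 / real b) + (1 + 4 * ln C) * (real n / real b)"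
    using K0 by (rule mult_left_le_imp_le)
   then show "2 * ln (hs (?M x)) <= A + ep * real n" using err err2 by linarith
   assume far: "\<forall>\<theta>\<in>\<Theta>. dist_int (x - \<theta>) >= exp (- \<kappa> * real b)"
   have "real ?K * (A - 2 * real D * (C1 / real b + \<kappa>)) <= real ?K * (2 * ln (hs (?M x))) + real ?K * ((1 + 4 * ln C) * (real n / real b))"
    using avg[of x] A(4)[OF far] by linarith
   also have "... = real ?K * (2 * ln (hs (?M x)) + (1 + 4 * ln C) * (real n / real b))" by (simp only: distrib_left)
   finally have "A - 2 * real D * (C1 / real b + \<kappa>) <= 2 * ln (hs (?M x)) + (1 + 4 * ln C) * (real n / real b)"
    using K0 by (rule mult_left_le_imp_le)
   then show "2 * ln (hs (?M x)) >= A - ep * real n" using err by linarith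
  qed (rule A(1))
 qed
qed

section \<open>Diophantine rotations and scales of expansion\<close>

lemma diophantine_imp_dioph:
 assumes "c > 0" "a > 0"
 obtains c' where "c' > 0" "!!\<omega>. \<omega> \<in> diophantine c a ==> dioph c' \<omega>"
proof -
 have "((%n::nat. ln (real n) powr a / real n) \<longlongrightarrow> 0) sequentially"
  by real_asymp
 then have "Bseq (%n::nat. ln (real n) powr a / real n)"
  using convergent_def convergent_imp_Bseq by blast
 then obtain K where K: "K > 0" "!!n::nat. \<bar>ln (real n) powr a / real n\<bar> <= K"
  unfolding Bseq_def by auto
 define c' where "c' = min (c / K) (c / (4 * ln 2 powr a))"
 have c': "c' > 0" unfolding c'_def using assms K by simp
 show ?thesis
 proof (rule that[OF c'])
  fix \<omega> assume \<omega>: "\<omega> \<in> diophantine c a"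
  show "dioph c' \<omega>" unfolding dioph_def
  proof (intro allI impI)
   fix n :: nat assume n: "n >= 1"
   show "dist_int (real n * \<omega>) >= c' / (real n)^2"
   proof (cases "n = 1")
    case True
    have "dist_int (real 2 * \<omega>) >= c / (real 2 * ln (real 2) powr a)"
     using \<omega> unfolding diophantine_def by blast
    moreover have "dist_int (real 2 * \<omega>) <= dist_int \<omega> + dist_int \<omega>"
     using dist_int_triangle[of \<omega> \<omega>] by simp
    moreover have "c / (real 2 * ln (real 2) powr a) = 2 * (c / (4 * ln 2 powr a))" by simp
    ultimately have "dist_int \<omega> >= c / (4 * ln 2 powr a)" by linarith
    then show ?thesis using True unfolding c'_def by simp
   next
    case False
    then have n2: "n >= 2" using n by simp
    have l: "ln (real n) powr a > 0" using n2 by simp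
    have "ln (real n) powr a <= K * real n" using K(2)[of n] n2 by (simp add: field_simps)
    then have "real n * ln (real n) powr a <= real n * (K * real n)" by (intro mult_left_mono) auto
    then have "c / (real n * (K * real n)) <= c / (real n * ln (real n) powr a)"
     using assms l n2 K by (intro divide_left_mono mult_pos_pos) auto
    also have "... <= dist_int (real n * \<omega>)" using \<omega> n2 unfolding diophantine_def by blast
    finally have "(c / K) / (real n)^2 <= dist_int (real n * \<omega>)" by (simp add: power2_eq_square mult_ac)
    moreover have "c' / (real n)^2 <= (c / K) / (real n)^2" unfolding c'_def by (intro divide_right_mono) auto
    ultimately show ?thesis by linarith
   qed
  qed
 qed
qed

lemma dioph_minus: "dioph c \<omega> ==> dioph c (- \<omega>)"
 unfolding dioph_def using dist_int_minus by simp

text \<open>Dirichlet gives a return time whose displacement is small, the Diophantine condition bounds that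
displacement below; steps of this size reach every point.\<close>

lemma orbit_dense:
 assumes dio: "dioph c \<omega>" and c: "c > 0" and \<eta>: "0 < \<eta>" "\<eta> <= 1"
 obtains q :: nat where "real q <= 8 / (c * \<eta> ^ 3)" "dist_int (real q * \<omega> - y) <= \<eta>"
proof -
 define M where "M = nat \<lceil>1 / \<eta>\<rceil>"
 have M1: "1 / \<eta> >= 1" using \<eta> by simp
 then have "\<lceil>1 / \<eta>\<rceil> >= 0" by linarith
 then have "real M = of_int \<lceil>1 / \<eta>\<rceil>" unfolding M_def by simp
 then have M: "real M >= 1 / \<eta>" "real M <= 1 / \<eta> + 1" by linarith+
 from M1 have M0: "M > 0" using M by (intro Nat.gr0I) auto
 obtain h k where hk: "0 < k" "k <= int M" "\<bar>of_int k * \<omega> - of_int h\<bar> < 1 / real M"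
  using Dirichlet_approx[OF M0] by metis
 define n where "n = nat k"
 have n: "n >= 1" "n <= M" "of_int k = real n" unfolding n_def using hk by auto
 define \<delta> where "\<delta> = real n * \<omega> - of_int h"
 have d1: "\<bar>\<delta>\<bar> <= \<eta>"
 proof -
  have "1 / real M <= \<eta>" using M(1) M0 \<eta> by (simp add: field_simps)
  then show ?thesis using hk(3) n(3) unfolding \<delta>_def by simp
 qed
 have d2: "\<bar>\<delta>\<bar> >= c / (real M)^2"
 proof -
  have "c / (real M)^2 <= c / (real n)^2" using n c by (intro divide_left_mono power_mono mult_pos_pos) auto
  also have "... <= dist_int (real n * \<omega>)" using dio n(1) unfolding dioph_def by blast
  also have "... <= \<bar>\<delta>\<bar>" unfolding \<delta>_def by (rule dist_int_le)
  finally show ?thesis .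
 qed
 have cM: "c / (real M)^2 > 0" using c M0 by simp
 have d0: "\<bar>\<delta>\<bar> > 0" using d2 cM by linarith
 have bound: "real (j * n) <= 8 / (c * \<eta> ^ 3)" if "real j * \<bar>\<delta>\<bar> <= 1" for j
 proof -
  have "real j * (c / (real M)^2) <= real j * \<bar>\<delta>\<bar>" using d2 by (intro mult_left_mono) auto
  then have "real j * (c / (real M)^2) <= 1" using that by linarith
  then have "real j <= (real M)^2 / c" using c M0 by (simp add: field_simps)
  then have "real j * real n <= (real M)^2 / c * real M" using n(2) c by (intro mult_mono) auto
  also have "... = real M ^ 3 / c" by (simp add: power2_eq_square power3_eq_cube)
  also have "... <= (2 / \<eta>) ^ 3 / c" using M M1 c by (intro divide_right_mono power_mono) auto
  also have "... = 8 / (c * \<eta> ^ 3)" by (simp add: power_divide mult.commute)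
  finally show ?thesis by simp
 qed
 define z where "z = frac y"
 have z: "0 <= z" "z < 1" unfolding z_def by (auto simp: frac_lt_1)
 have yz: "y = z + of_int \<lfloor>y\<rfloor>" unfolding z_def frac_def by simp
 show ?thesis
 proof (cases "\<delta> > 0")
  case True
  define j where "j = nat \<lfloor>z / \<delta>\<rfloor>"
  have q0: "z / \<delta> >= 0" using z True by simp
  have j: "real j <= z / \<delta>" "z / \<delta> < real j + 1" unfolding j_def using q0 by linarith+
  have j1: "real j * \<delta> <= z" "z < real j * \<delta> + \<delta>" using j True by (simp_all add: field_simps)
  have "real (j * n) <= 8 / (c * \<eta> ^ 3)" by (rule bound) (use j1 True z in simp)
  moreover have "dist_int (real (j * n) * \<omega> - y) <= \<bar>(real (j * n) * \<omega> - y) - of_int (int j * h - \<lfloor>y\<rfloor>)\<bar>"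
   by (rule dist_int_le)
  moreover have "(real (j * n) * \<omega> - y) - of_int (int j * h - \<lfloor>y\<rfloor>) = real j * \<delta> - z"
   unfolding \<delta>_def z_def frac_def by (simp add: algebra_simps)
  ultimately show ?thesis using j1 d1 True by (intro that[of "j * n"]) auto
 next
  case False
  then have dn: "\<delta> < 0" using d0 by auto
  define j where "j = nat \<lfloor>(1 - z) / \<bar>\<delta>\<bar>\<rfloor>"
  have q0: "(1 - z) / \<bar>\<delta>\<bar> >= 0" using z by simp
  have j: "real j <= (1 - z) / \<bar>\<delta>\<bar>" "(1 - z) / \<bar>\<delta>\<bar> < real j + 1" unfolding j_def using q0 by linarith+
  have j1: "real j * \<bar>\<delta>\<bar> <= 1 - z" "1 - z < real j * \<bar>\<delta>\<bar> + \<bar>\<delta>\<bar>" using j d0 by (simp_all add: field_simps)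
  have "real (j * n) <= 8 / (c * \<eta> ^ 3)" by (rule bound) (use j1 z in simp)
  moreover have "dist_int (real (j * n) * \<omega> - y) <= \<bar>(real (j * n) * \<omega> - y) - of_int (int j * h - \<lfloor>y\<rfloor> - 1)\<bar>"
   by (rule dist_int_le)
  moreover have "(real (j * n) * \<omega> - y) - of_int (int j * h - \<lfloor>y\<rfloor> - 1) = real j * \<delta> + 1 - z"
   unfolding \<delta>_def z_def frac_def by (simp add: algebra_simps)
  moreover have "real j * \<bar>\<delta>\<bar> = - (real j * \<delta>)" using dn by simp
  ultimately show ?thesis using j1 d1 by (intro that[of "j * n"]) auto
 qed
qed

lemma dist_int_eq_abs: "\<bar>t\<bar> <= 1 / 2 ==> dist_int t = \<bar>t\<bar>"
proof (cases "t = 1 / 2 | t = - 1 / 2")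
 case False
 assume "\<bar>t\<bar> <= 1 / 2"
 then have "\<bar>t\<bar> < 1 / 2" using False by auto
 then have "round t = 0" by (intro round_unique') simp
 then show ?thesis unfolding dist_int_def by simp
next
 case True
 then show ?thesis by (elim disjE; hypsubst; simp add: dist_int_def round_def)
qed

lemma avoid_points:
 fixes \<Theta> :: "real set"
 assumes fin: "finite \<Theta>" and \<tau>: "\<tau> > 0" and h: "3 * \<tau> * real (card \<Theta>) <= h" "h <= 1 / 2"
 obtains x where "u <= x" "x <= u + h" "!!\<theta>. \<theta> \<in> \<Theta> ==> dist_int (x - \<theta>) >= \<tau>"
proof -
 define p where "p i = u + 3 * \<tau> * real i" for i :: nat
 have "\<exists>i\<le>card \<Theta>. \<forall>\<theta>\<in>\<Theta>. dist_int (p i - \<theta>) >= \<tau>"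
 proof (rule ccontr)
  assume "~ ?thesis"
  then have "\<forall>i\<le>card \<Theta>. \<exists>\<theta>\<in>\<Theta>. dist_int (p i - \<theta>) < \<tau>" by (meson not_le)
  then obtain f where f: "!!i. i <= card \<Theta> ==> f i \<in> \<Theta> & dist_int (p i - f i) < \<tau>" by metis
  have "inj_on f {..card \<Theta>}"
  proof (rule linorder_inj_onI)
   fix i j assume ij: "i < j" "i \<in> {..card \<Theta>}" "j \<in> {..card \<Theta>}"
   show "f i ~= f j"
   proof
    assume eq: "f i = f j"
    have "dist_int (p j - p i) <= dist_int (p j - f j) + dist_int (- (p i - f i))"
     using dist_int_triangle[of "p j - f j" "- (p i - f i)"] eq by simp
    then have "dist_int (p j - p i) < 2 * \<tau>"
     using f[of i] f[of j] ij dist_int_minus[of "p i - f i"] by simp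
    moreover have pd: "p j - p i = 3 * \<tau> * real (j - i)" unfolding p_def using ij by (simp add: algebra_simps of_nat_diff)
    moreover have "3 * \<tau> * real (j - i) <= 3 * \<tau> * real (card \<Theta>)" using ij \<tau> by (intro mult_left_mono) auto
    moreover have "3 * \<tau> * real (j - i) >= 3 * \<tau> * 1" using ij \<tau> by (intro mult_left_mono) auto
    ultimately have *: "dist_int (p j - p i) < 2 * \<tau>" "p j - p i >= 3 * \<tau>" "p j - p i <= 1 / 2"
     using h by linarith+
    then have "dist_int (p j - p i) = p j - p i" using dist_int_eq_abs[of "p j - p i"] \<tau> by simp
    then show False using * \<tau> by linarith
   qed
  qed (auto)
  then have "card {..card \<Theta>} <= card \<Theta>"
   by (rule card_inj_on_le) (use f fin in auto)
  then show False by simp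
 qed
 then obtain i where i: "i <= card \<Theta>" "!!\<theta>. \<theta> \<in> \<Theta> ==> dist_int (p i - \<theta>) >= \<tau>" by blast
 have "3 * \<tau> * real i <= 3 * \<tau> * real (card \<Theta>)" using i \<tau> by (intro mult_left_mono) auto
 then have "p i <= u + h" unfolding p_def using h by simp
 then show ?thesis using i \<tau> by (intro that[of "p i"]) (auto simp: p_def)
qed

lemma hs_eq_norm: "hs A = norm A"
 by (cases A) (simp add: hs_def norm_Pair add.assoc)

lemma mm_diff: "mm A (B - C) = mm A B - mm A C" "mm (A - B) C = mm A C - mm B C"
 by (cases A; cases B; cases C; simp add: mm_def algebra_simps)+

lemma tmat_energy_lipschitz:
 assumes "!!x. \<bar>V x - E\<bar> + 2 <= C" "!!x. \<bar>V x - E'\<bar> + 2 <= C"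
 shows "hs (tmat V \<omega> E n x - tmat V \<omega> E' n x) <= 2 * real n * C ^ n * \<bar>E - E'\<bar>"
proof (induction n)
 case 0
 show ?case by (simp add: hs_def zero_prod_def)
next
 case (Suc n)
 let ?v = "V (x + real (Suc n) * \<omega>)"
 have C: "C >= 1" using assms(1)[of 0] by linarith
 have eq: "tmat V \<omega> E (Suc n) x - tmat V \<omega> E' (Suc n) x =
   mm (step_mat (?v - E)) (tmat V \<omega> E n x - tmat V \<omega> E' n x) + mm (step_mat (?v - E) - step_mat (?v - E')) (tmat V \<omega> E' n x)"
  by (simp add: mm_diff)
 have sd: "hs (step_mat (?v - E) - step_mat (?v - E')) = \<bar>E - E'\<bar>"
  by (simp add: step_mat_def hs_def zero_prod_def abs_minus_commute)
 have "hs (tmat V \<omega> E (Suc n) x - tmat V \<omega> E' (Suc n) x) <=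
   hs (mm (step_mat (?v - E)) (tmat V \<omega> E n x - tmat V \<omega> E' n x)) + hs (mm (step_mat (?v - E) - step_mat (?v - E')) (tmat V \<omega> E' n x))"
  unfolding eq unfolding hs_eq_norm by (rule norm_triangle_ineq)
 also have "... <= C * (2 * real n * C ^ n * \<bar>E - E'\<bar>) + \<bar>E - E'\<bar> * (2 * C ^ n)"
 proof (rule add_mono)
  show "hs (mm (step_mat (?v - E)) (tmat V \<omega> E n x - tmat V \<omega> E' n x)) <= C * (2 * real n * C ^ n * \<bar>E - E'\<bar>)"
   using order_trans[OF hs_step_le assms(1)] Suc C
   by (intro order_trans[OF hs_mm_le] mult_mono) auto
  show "hs (mm (step_mat (?v - E) - step_mat (?v - E')) (tmat V \<omega> E' n x)) <= \<bar>E - E'\<bar> * (2 * C ^ n)"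
   using hs_tmat_le[OF assms(2)] sd by (intro order_trans[OF hs_mm_le] mult_mono) auto
 qed
 also have "... <= C * (2 * real n * C ^ n * \<bar>E - E'\<bar>) + \<bar>E - E'\<bar> * (2 * C ^ Suc n)"
  using C by (intro add_left_mono mult_left_mono power_increasing) auto
 also have "... = 2 * real (Suc n) * C ^ Suc n * \<bar>E - E'\<bar>" by (simp add: algebra_simps)
 finally show ?case .
qed

text \<open>Let \<open>z = A1 w\<close> for a unit vector \<open>w\<close> that \<open>A2 A1\<close> expands to length
of order \<open>Y\<close>. The area form is invariant under \<open>A1\<close>, so the component of \<open>v\<close>
transversal to \<open>z\<close> is controlled by \<open>adj2 A1 v\<close>; the component along \<open>z\<close> is
seen by \<open>A2\<close>, which expands \<open>z\<close> by at least \<open>Y / X\<close>, up to a constant.\<close>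

lemma expanding_product_centre:
 assumes det: "det2 A1 = 1" and X: "hs A1 <= X" "hs A2 <= X" and Y: "Y > 0" "hs (mm A2 A1) >= Y"
 shows "norm v <= 3 * (X / Y) * (norm (mv (adj2 A1) v) + norm (mv A2 v))"
proof -
 obtain a b c d where A: "mm A2 A1 = (a, b, c, d)" by (cases "mm A2 A1")
 have Y2: "Y^2 <= a^2 + b^2 + c^2 + d^2"
 proof -
  have "Y^2 <= (hs (mm A2 A1))^2" using Y by (intro power_mono) auto
  then show ?thesis unfolding A hs_def by simp
 qed
 have "\<exists>w. (w = (1, 0) | w = (0, 1)) & (norm (mv (mm A2 A1) w))^2 >= Y^2 / 2"
 proof (cases "a^2 + c^2 >= Y^2 / 2")
  case True
  then have "(norm (mv (mm A2 A1) (1, 0)))^2 >= Y^2 / 2" unfolding A by (simp add: mv_def norm_Pair)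
  then show ?thesis by blast
 next
  case False
  then have "(norm (mv (mm A2 A1) (0, 1)))^2 >= Y^2 / 2" unfolding A using Y2 by (simp add: mv_def norm_Pair)
  then show ?thesis by blast
 qed
 then obtain w where w: "w = (1, 0) | w = (0, 1)" "(norm (mv (mm A2 A1) w))^2 >= Y^2 / 2" by blast
 have nw: "norm w = 1" using w(1) by (auto simp: norm_Pair)
 define z where "z = mv A1 w"
 define W where "W = norm (mv A2 z)"
 have W2: "W >= 2 * Y / 3"
 proof -
  have "(2 * Y / 3)^2 = 4 / 9 * Y^2" by (simp add: power2_eq_square)
  also have "... <= Y^2 / 2" using zero_le_power2[of Y] by linarith
  also have "... <= W^2" using w(2) unfolding W_def z_def mv_mm[symmetric] .
  finally show ?thesis unfolding W_def by (rule power2_le_imp_le) simp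
 qed
 have Wpos: "W > 0" using W2 Y by linarith
 have zX: "norm z <= X"
 proof -
  have "norm z <= hs A1 * norm w" unfolding z_def by (rule norm_mv_le)
  then show ?thesis using X(1) nw by simp
 qed
 have WX: "W <= X * norm z"
 proof -
  have "W <= hs A2 * norm z" unfolding W_def by (rule norm_mv_le)
  also have "... <= X * norm z" using X(2) by (intro mult_right_mono) auto
  finally show ?thesis .
 qed
 have X0: "X >= 0" using X(1) hs_nonneg order_trans by blast
 have Zpos: "norm z > 0" using WX Wpos X0 by (metis mult_zero_right norm_ge_zero not_less order_le_less)
 define u0 u1 where "u0 = mv (adj2 A1) v" and "u1 = mv A2 v"
 have vu: "v = mv A1 u0" unfolding u0_def mv_mm[symmetric] mm_adj2(2)[OF det] by simp
 define wd where "wd p q = fst p * snd q - snd p * fst q" for p q :: "real \<times> real"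
 have wd_mv: "wd (mv A1 p) (mv A1 q) = wd p q" for p q
 proof -
  have "wd (mv A1 p) (mv A1 q) = det2 A1 * wd p q"
   by (cases A1; cases p; cases q) (simp add: wd_def mv_def det2_def algebra_simps)
  then show ?thesis using det by simp
 qed
 have wdle: "\<bar>wd p q\<bar> <= norm p * norm q" for p q
 proof -
  obtain p1 p2 q1 q2 where pq: "p = (p1, p2)" "q = (q1, q2)" by (cases p; cases q)
  have "(p1 * q2 + (- p2) * q1)^2 <= (p1^2 + (- p2)^2) * (q2^2 + q1^2)" by (rule cauchy_schwarz2)
  then have "sqrt ((wd p q)^2) <= sqrt ((p1^2 + p2^2) * (q1^2 + q2^2))"
   unfolding pq wd_def by (intro real_sqrt_le_mono) (simp add: add.commute)
  then show ?thesis unfolding pq by (simp add: norm_Pair real_sqrt_mult)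
 qed
 have beta: "\<bar>wd v z\<bar> <= norm u0"
  using wdle[of u0 w] nw unfolding z_def by (subst vu) (simp add: wd_mv)
 define zp where "zp = (- snd z, fst z)"
 have nzp: "norm zp = norm z" unfolding zp_def by (cases z) (simp add: norm_Pair add.commute)
 have decomp: "(norm z)^2 *\<^sub>R v = (v \<bullet> z) *\<^sub>R z - (wd v z) *\<^sub>R zp"
  unfolding zp_def wd_def by (cases v; cases z) (simp add: norm_Pair power2_eq_square algebra_simps)
 have mvlin: "mv A2 (r *\<^sub>R p - s *\<^sub>R q) = r *\<^sub>R mv A2 p - s *\<^sub>R mv A2 q" "mv A2 (r *\<^sub>R p) = r *\<^sub>R mv A2 p" for r s p q
  by (cases A2; cases p; cases q; simp add: mv_def algebra_simps)+
 have "(norm z)^2 *\<^sub>R u1 = (v \<bullet> z) *\<^sub>R mv A2 z - (wd v z) *\<^sub>R mv A2 zp"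
  using arg_cong[OF decomp, of "mv A2"] by (simp only: mvlin u1_def)
 then have "(v \<bullet> z) *\<^sub>R mv A2 z = (norm z)^2 *\<^sub>R u1 + (wd v z) *\<^sub>R mv A2 zp" by simp
 then have "norm ((v \<bullet> z) *\<^sub>R mv A2 z) <= norm ((norm z)^2 *\<^sub>R u1) + norm ((wd v z) *\<^sub>R mv A2 zp)"
  using norm_triangle_ineq by metis
 then have "\<bar>v \<bullet> z\<bar> * W <= (norm z)^2 * norm u1 + \<bar>wd v z\<bar> * norm (mv A2 zp)" unfolding W_def by simp
 also have "... <= (norm z)^2 * norm u1 + norm u0 * (X * norm z)"
 proof (intro add_left_mono mult_mono beta)
  show "norm (mv A2 zp) <= X * norm z"
   using norm_mv_le[of A2 zp] X(2) nzp mult_right_mono[of "hs A2" X "norm z"] by simp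
 qed auto
 also have "... <= (X * norm z) * norm u1 + norm u0 * (X * norm z)"
  using zX by (intro add_right_mono mult_right_mono) (auto simp: power2_eq_square intro: mult_right_mono)
 also have "... = (X * (norm u0 + norm u1)) * norm z" by (simp add: algebra_simps)
 finally have al: "\<bar>v \<bullet> z\<bar> <= (X * (norm u0 + norm u1)) * norm z / W" using Wpos by (simp add: field_simps)
 have "(norm z)^2 * norm v <= \<bar>v \<bullet> z\<bar> * norm z + \<bar>wd v z\<bar> * norm z"
 proof -
  have "norm ((norm z)^2 *\<^sub>R v) <= norm ((v \<bullet> z) *\<^sub>R z) + norm ((wd v z) *\<^sub>R zp)"
   unfolding decomp by (rule norm_triangle_ineq4)
  then show ?thesis using nzp by simp
 qed
 then have "norm z * (norm z * norm v) <= norm z * (\<bar>v \<bullet> z\<bar> + \<bar>wd v z\<bar>)" by (simp add: power2_eq_square algebra_simps)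
 then have "norm z * norm v <= \<bar>v \<bullet> z\<bar> + \<bar>wd v z\<bar>" using Zpos by (rule mult_left_le_imp_le)
 also have "... <= (X * (norm u0 + norm u1)) * norm z / W + norm u0" using al beta by linarith
 also have "... <= (X * (norm u0 + norm u1)) * norm z / W + (X * norm u0) * norm z / W"
 proof (rule add_left_mono)
  have "norm u0 * W <= norm u0 * (X * norm z)" using WX by (intro mult_left_mono) auto
  then show "norm u0 <= (X * norm u0) * norm z / W" using Wpos by (simp add: field_simps)
 qed
 also have "(X * (norm u0 + norm u1)) * norm z / W + (X * norm u0) * norm z / W = norm z * (X * (2 * norm u0 + norm u1) / W)"
  unfolding add_divide_distrib[symmetric] times_divide_eq_right by (rule arg_cong[where f = "%t. t / W"]) (simp add: algebra_simps)
 finally have "norm v <= X * (2 * norm u0 + norm u1) / W" using Zpos by (simp only: mult_le_cancel_left_pos)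
 also have "... <= X * (2 * norm u0 + 2 * norm u1) / W"
  using X0 Wpos by (intro divide_right_mono mult_left_mono) auto
 also have "... <= X * (2 * norm u0 + 2 * norm u1) / (2 * Y / 3)"
  using X0 W2 Y by (intro divide_left_mono mult_nonneg_nonneg mult_pos_pos) auto
 also have "... = 3 * (X / Y) * (norm u0 + norm u1)" using Y by (simp add: field_simps)
 finally show ?thesis unfolding u0_def u1_def .
qed

text \<open>The typical values \<open>a i\<close> of \<open>2 * ln (hs M)\<close> at length \<open>2 ^ i * b ^
18\<close> at most double from \<open>i\<close> to \<open>i + 1\<close>, up to errors. A definite loss of rate cannot
occur \<open>I\<close> times in a row, since the rate stays near \<open>2 * \<gamma>\<close> or above.\<close>

theorem good_scale:
 fixes V :: "real => real"
 assumes V: "fourier_class \<rho> Bv (%x. of_real (V x))" and \<rho>: "\<rho> > 0" and c: "c > 0" and \<gamma>: "\<gamma> > 0" and B: "B >= 0"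
 obtains \<kappa> :: real and d b0 I :: nat where "\<kappa> > 0" "b0 >= 2"
  "!!\<omega> E b. dioph c \<omega> ==> \<bar>E\<bar> <= B ==> b >= b0 ==> expanding V \<omega> E \<gamma> ==>
   \<exists>m X Y \<Theta>. b ^ 18 <= m & m <= 2 ^ I * b ^ 18 & finite \<Theta> & card \<Theta> <= d * m * b ^ 17 & X >= 1 & Y > 0 &
    X / Y <= exp (- (\<gamma> / 2) * real m) & (ALL x. hs (tmat V \<omega> E m x) <= X) &
    (ALL x. avoids \<Theta> \<kappa> b x --> hs (tmat V \<omega> E (2 * m) x) >= Y)"
proof -
 define ep where "ep = \<gamma> / 10"
 have ep: "ep > 0" unfolding ep_def using \<gamma> by simp
 define C where "C = Bv + B + 2"
 have Bv: "Bv >= 0" using fourier_class_bounded[OF V, of 0] \<rho> norm_ge_zero order_trans by fastforce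
 have C2: "C >= 2" unfolding C_def using Bv B by simp
 then have lnC: "ln C >= 0" by simp
 obtain \<kappa> :: real and d b1 :: nat where ld: "\<kappa> > 0" "b1 >= 2"
  "!!\<omega> E b n. dioph c \<omega> ==> \<bar>E\<bar> <= B ==> b >= b1 ==> n >= b ^ 18 ==>
   \<exists>a \<Theta>. finite \<Theta> & card \<Theta> <= d * n * b ^ 17 & (ALL x. 2 * ln (hs (tmat V \<omega> E n x)) <= a + ep * real n) &
    (ALL x. avoids \<Theta> \<kappa> b x --> 2 * ln (hs (tmat V \<omega> E n x)) >= a - ep * real n)"
  using large_deviation[OF V \<rho> c ep B] by metis
 define U where "U = 2 * ln C + 2 + ep"
 define I where "I = nat \<lceil>U / ep\<rceil> + 1"
 have I: "real I * ep > U"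
 proof -
  have "real I > U / ep" unfolding I_def by linarith
  then show ?thesis using ep by (simp add: field_simps)
 qed
 have "\<forall>\<^sub>F b in sequentially. 3 * exp (- \<kappa> * real b) * (real d * (2 ^ I * real b ^ 18) * real b ^ 17) <= 1 / 2"
  using ld(1) by real_asymp
 then obtain b2 where b2: "!!b. b >= b2 ==> 3 * exp (- \<kappa> * real b) * (real d * (2 ^ I * real b ^ 18) * real b ^ 17) <= 1 / 2"
  unfolding eventually_sequentially by blast
 show ?thesis
 proof (rule that[of \<kappa> "max b1 b2" I "2 * d"])
  show "\<kappa> > 0" by (rule ld)
  show "2 <= max b1 b2" using ld(2) by simp
  fix \<omega> E :: real and b :: nat
  assume dio: "dioph c \<omega>" and E: "\<bar>E\<bar> <= B" and b: "b >= max b1 b2"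
   and L: "expanding V \<omega> E \<gamma>"
  have bb: "b >= b1" "b >= b2" "b >= 2" using b ld(2) by auto
  define m where "m i = 2 ^ i * b ^ 18" for i :: nat
  have m18: "m i >= b ^ 18" for i unfolding m_def by simp
  have m1: "m i >= 1" for i unfolding m_def using bb(3) by simp
  have VE: "\<bar>V x - E\<bar> + 2 <= C" for x
   using fourier_class_bounded[OF V, of x] \<rho> E unfolding C_def by simp
  have "ALL i. \<exists>a \<Theta>. finite \<Theta> & card \<Theta> <= d * m i * b ^ 17 & (ALL x. 2 * ln (hs (tmat V \<omega> E (m i) x)) <= a + ep * real (m i)) &
    (ALL x. avoids \<Theta> \<kappa> b x --> 2 * ln (hs (tmat V \<omega> E (m i) x)) >= a - ep * real (m i))"
   using ld(3)[OF dio E bb(1) m18] by blast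
  then obtain a \<Theta> where a: "!!i. finite (\<Theta> i)" "!!i. card (\<Theta> i) <= d * m i * b ^ 17"
   "!!i x. 2 * ln (hs (tmat V \<omega> E (m i) x)) <= a i + ep * real (m i)"
   "!!i x. (\<forall>\<theta>\<in>\<Theta> i. dist_int (x - \<theta>) >= exp (- \<kappa> * real b)) ==> 2 * ln (hs (tmat V \<omega> E (m i) x)) >= a i - ep * real (m i)"
   by metis
  have alow: "a i >= 2 * \<gamma> * real (m i) - ep * real (m i)" for i
  proof -
   obtain x where "ln (hs (tmat V \<omega> E (m i) x)) >= \<gamma> * real (m i)" using L m1 by blast
   then show ?thesis using a(3)[of i x] by simp
  qed
  have aup: "a 0 <= U * real (m 0)"
  proof -
   have "3 * exp (- \<kappa> * real b) * real (card (\<Theta> 0)) <= 3 * exp (- \<kappa> * real b) * (real d * (2 ^ I * real b ^ 18) * real b ^ 17)"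
   proof (intro mult_left_mono)
    have "real (card (\<Theta> 0)) <= real (d * m 0 * b ^ 17)" using a(2)[of 0] by (simp only: of_nat_le_iff)
    also have "... = real d * (1 * real b ^ 18) * real b ^ 17" unfolding m_def by simp
    also have "... <= real d * (2 ^ I * real b ^ 18) * real b ^ 17" by (intro mult_left_mono mult_right_mono) auto
    finally show "real (card (\<Theta> 0)) <= real d * (2 ^ I * real b ^ 18) * real b ^ 17" .
   qed auto
   also have "... <= 1 / 2" using b2[OF bb(2)] .
   finally have h: "3 * exp (- \<kappa> * real b) * real (card (\<Theta> 0)) <= 1 / 2" .
   obtain x where x: "!!\<theta>. \<theta> \<in> \<Theta> 0 ==> dist_int (x - \<theta>) >= exp (- \<kappa> * real b)"
    using avoid_points[OF a(1)[of 0] _ h, of 0] by auto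
   have "ln (hs (tmat V \<omega> E (m 0) x)) <= ln (2 * C ^ m 0)"
    using hs_tmat_le[OF VE] hs_ge_1[of "tmat V \<omega> E (m 0) x"] by (intro ln_mono) auto
   also have "... = ln 2 + real (m 0) * ln C" using C2 by (simp add: ln_mult_pos ln_realpow)
   also have "... <= 1 + real (m 0) * ln C" using ln_le_minus_one[of 2] by simp
   finally have "a 0 <= 2 * (1 + real (m 0) * ln C) + ep * real (m 0)" using a(4)[of 0 x] x by force
   also have "... <= 2 * (real (m 0) + real (m 0) * ln C) + ep * real (m 0)" using m1[of 0] by simp
   also have "... = U * real (m 0)" unfolding U_def by (simp add: algebra_simps)
   finally show ?thesis .
  qed
  have "\<exists>i<I. a (Suc i) >= 2 * a i - ep * real (m (Suc i))"
  proof (rule ccontr)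
   assume "~ ?thesis"
   then have dec: "a (Suc i) < 2 * a i - ep * real (m (Suc i))" if "i < I" for i using that by (auto simp: not_le)
   have "a i <= (U - real i * ep) * real (m i)" if "i <= I" for i
    using that
   proof (induction i)
    case 0
    then show ?case using aup by simp
   next
    case (Suc i)
    have mS: "real (m (Suc i)) = 2 * real (m i)" unfolding m_def by simp
    have "a (Suc i) <= 2 * ((U - real i * ep) * real (m i)) - ep * real (m (Suc i))"
     using dec[of i] Suc by simp
    also have "... = (U - real (Suc i) * ep) * real (m (Suc i))" unfolding mS by (simp add: algebra_simps)
    finally show ?case .
   qed
   then have "a I <= (U - real I * ep) * real (m I)" by simp
   also have "... < 0" using I m1[of I] by (simp add: mult_neg_pos)
   finally have "a I < 0" .
   moreover have "a I >= (2 * \<gamma> - ep) * real (m I)" using alow[of I] by (simp add: algebra_simps)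
   moreover have "(2 * \<gamma> - ep) * real (m I) >= 0" unfolding ep_def using \<gamma> by (intro mult_nonneg_nonneg) auto
   ultimately show False by linarith
  qed
  then obtain i where i: "i < I" "a (Suc i) >= 2 * a i - ep * real (m (Suc i))" by blast
  have mS: "m (Suc i) = 2 * m i" unfolding m_def by simp
  define X Y where "X = exp ((a i + ep * real (m i)) / 2)" and "Y = exp ((a (Suc i) - ep * real (m (Suc i))) / 2)"
  have hX: "hs (tmat V \<omega> E (m i) x) <= X" for x
  proof -
   have "ln (hs (tmat V \<omega> E (m i) x)) <= (a i + ep * real (m i)) / 2" using a(3)[of i x] by simp
   then show ?thesis unfolding X_def using hs_ge_1[of "tmat V \<omega> E (m i) x"] by (simp add: ln_le_cancel_iff[symmetric] del: ln_le_cancel_iff)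
  qed
  have hY: "hs (tmat V \<omega> E (2 * m i) x) >= Y" if "\<forall>\<theta>\<in>\<Theta> (Suc i). dist_int (x - \<theta>) >= exp (- \<kappa> * real b)" for x
  proof -
   have "ln (hs (tmat V \<omega> E (2 * m i) x)) >= (a (Suc i) - ep * real (m (Suc i))) / 2" using a(4)[OF that] unfolding mS by simp
   moreover have "hs (tmat V \<omega> E (2 * m i) x) > 0" using hs_ge_1[of "tmat V \<omega> E (2 * m i) x"] by simp
   ultimately show ?thesis unfolding Y_def by (simp only: ln_ge_iff)
  qed
  have XY: "X / Y <= exp (- (\<gamma> / 2) * real (m i))"
  proof -
   have "X / Y = exp ((a i + ep * real (m i)) / 2 - (a (Suc i) - ep * real (m (Suc i))) / 2)"
    unfolding X_def Y_def by (simp add: exp_diff)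
   moreover have g0: "\<gamma> * real (m i) >= 0" using \<gamma> by (intro mult_nonneg_nonneg) auto
   have eps: "ep * real (m i) = \<gamma> * real (m i) / 10" "ep * real (m (Suc i)) = \<gamma> * real (m i) / 5"
    unfolding mS ep_def by simp_all
   have al: "a i >= 2 * (\<gamma> * real (m i)) - \<gamma> * real (m i) / 10" using alow[of i] unfolding eps by (simp add: mult.assoc)
   have "(a i + ep * real (m i)) / 2 - (a (Suc i) - ep * real (m (Suc i))) / 2 <= - (\<gamma> / 2) * real (m i)"
    using i(2) al g0 unfolding eps by (simp add: field_simps)
   ultimately show ?thesis by simp
  qed
  have mI: "m i <= 2 ^ I * b ^ 18" unfolding m_def using i(1) by (intro mult_le_mono1 power_increasing) auto
  have X1: "X >= 1" using hX[of 0] hs_ge_1[of "tmat V \<omega> E (m i) 0"] by simp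
  have card: "card (\<Theta> (Suc i)) <= 2 * d * m i * b ^ 17" using a(2)[of "Suc i"] unfolding mS by (simp add: mult_ac)
  show "\<exists>m X Y \<Theta>. b ^ 18 <= m & m <= 2 ^ I * b ^ 18 & finite \<Theta> & card \<Theta> <= 2 * d * m * b ^ 17 & X >= 1 & Y > 0 &
    X / Y <= exp (- (\<gamma> / 2) * real m) & (ALL x. hs (tmat V \<omega> E m x) <= X) &
    (ALL x. avoids \<Theta> \<kappa> b x --> hs (tmat V \<omega> E (2 * m) x) >= Y)"
   by (rule exI[of _ "m i"], rule exI[of _ X], rule exI[of _ Y], rule exI[of _ "\<Theta> (Suc i)"])
    (use m18 mI a(1) card X1 XY hX hY in \<open>auto simp: Y_def\<close>)
 qed
qed

section \<open>Large corner entries and approximate solutions\<close>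

lemma norm_e1_minus_le: "cmod (e1 x - e1 y) <= 2 * pi * \<bar>x - y\<bar>"
proof -
 have "e1 x - e1 y = e1 y * (e1 (x - y) - 1)"
  using e1_add[of y "x - y"] by (simp add: right_diff_distrib)
 then have "cmod (e1 x - e1 y) = cmod (cis (2 * pi * (x - y)) - 1)" by (simp add: norm_mult)
 also have "... <= \<bar>2 * pi * (x - y)\<bar>"
 proof -
  have "(cmod (cis t - 1))^2 <= t^2" for t :: real
  proof -
   have "(cmod (cis t - 1))^2 = (cos t - 1)^2 + (sin t)^2" by (simp add: cmod_power2)
   also have "... = 2 - 2 * cos (2 * (t / 2))"
    using sin_cos_squared_add[of t] by (simp add: power2_eq_square algebra_simps)
   also have "... = (2 * sin (t / 2))^2" unfolding cos_double_sin by (simp add: power2_eq_square)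
   also have "... = 4 * \<bar>sin (t / 2)\<bar>\<^sup>2" by (simp add: power2_eq_square)
   also have "... <= 4 * \<bar>t / 2\<bar>^2" by (intro mult_left_mono power_mono abs_sin_x_le_abs_x) auto
   finally show ?thesis by (simp add: power_divide)
  qed
  then have "(cmod (cis (2 * pi * (x - y)) - 1))^2 <= \<bar>2 * pi * (x - y)\<bar>\<^sup>2" by simp
  then show ?thesis by (rule power2_le_imp_le) simp
 qed
 finally show ?thesis by (simp add: abs_mult)
qed

lemma fourier_class_periodic:
 assumes "fourier_class \<rho> B f"
 shows "f (x + of_int k) = f x"
proof -
 obtain c where c: "!!x. ((%k. c k * e1 (of_int k * x)) has_sum f x) UNIV"
  using assms unfolding fourier_class_def by blast
 have "e1 (of_int j * (x + of_int k)) = e1 (of_int j * x)" for j :: int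
 proof -
  have "e1 (of_int j * (x + of_int k)) = e1 (of_int j * x) * e1 (of_int (j * k))"
   unfolding e1_add[symmetric] by (simp add: algebra_simps)
  then show ?thesis by (simp only: e1_of_int mult_1_right)
 qed
 then have "((%j. c j * e1 (of_int j * x)) has_sum f (x + of_int k)) UNIV"
  using c[of "x + of_int k"] by (simp only:)
 then show ?thesis using c[of x] has_sum_unique by blast
qed

text \<open>The other entries of a transfer matrix are, up to sign, corner entries for windows shortened by one or two
sites.\<close>

lemma tm_entry_ge_half_hs:
 assumes "n >= 2"
 shows "\<exists>n' x'. n' <= n & n <= n' + 2 & \<bar>tm_entry V \<omega> E n' x'\<bar> >= hs (tmat V \<omega> E n x) / 2"
proof -
 obtain k where k: "n = Suc (Suc k)" using le_Suc_ex[OF assms] by auto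
 define p q r s where "p = tm_entry V \<omega> E (Suc (Suc k)) x" and "q = tm_entry V \<omega> E (Suc k) (x + \<omega>)"
  and "r = tm_entry V \<omega> E (Suc k) x" and "s = tm_entry V \<omega> E k (x + \<omega>)"
 define h where "h = hs (tmat V \<omega> E n x)"
 have h: "h = sqrt (p^2 + q^2 + r^2 + s^2)" unfolding h_def k tmat_entries hs_def p_def q_def r_def s_def by simp
 have h0: "h >= 0" unfolding h_def by simp
 have "\<bar>p\<bar> >= h / 2 | \<bar>q\<bar> >= h / 2 | \<bar>r\<bar> >= h / 2 | \<bar>s\<bar> >= h / 2"
 proof (rule ccontr)
  assume "~ ?thesis"
  then have lt: "\<bar>p\<bar> < h / 2" "\<bar>q\<bar> < h / 2" "\<bar>r\<bar> < h / 2" "\<bar>s\<bar> < h / 2" by auto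
  have "t^2 < (h / 2)\<^sup>2" if "\<bar>t\<bar> < h / 2" for t
   using power_strict_mono[OF that, of 2] by simp
  from this[OF lt(1)] this[OF lt(2)] this[OF lt(3)] this[OF lt(4)]
  have "p^2 + q^2 + r^2 + s^2 < 4 * (h / 2)^2" by linarith
  moreover have "4 * (h / 2)^2 = h^2" by (simp add: power_divide)
  moreover have "h^2 = p^2 + q^2 + r^2 + s^2" unfolding h by simp
  ultimately show False by simp
 qed
 then consider "\<bar>p\<bar> >= h / 2" | "\<bar>q\<bar> >= h / 2" | "\<bar>r\<bar> >= h / 2" | "\<bar>s\<bar> >= h / 2" by blast
 then have "\<exists>n' x'. n' <= n & n <= n' + 2 & \<bar>tm_entry V \<omega> E n' x'\<bar> >= h / 2"
 proof cases
  case 1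
  then show ?thesis unfolding p_def by (intro exI[of _ "Suc (Suc k)"] exI[of _ x]) (auto simp: k)
 next
  case 2
  then show ?thesis unfolding q_def by (intro exI[of _ "Suc k"] exI[of _ "x + \<omega>"]) (auto simp: k)
 next
  case 3
  then show ?thesis unfolding r_def by (intro exI[of _ "Suc k"] exI[of _ x]) (auto simp: k)
 next
  case 4
  then show ?thesis unfolding s_def by (intro exI[of _ k] exI[of _ "x + \<omega>"]) (auto simp: k)
 qed
 then show ?thesis unfolding h_def .
qed

text \<open>After truncation the entry is a trigonometric polynomial of degree \<open>O(n)\<close>, whose coefficients
are bounded by its supremum; so it is Lipschitz with constant \<open>O(n\<^sup>2)\<close> times the supremum and stays
comparable to it near a maximum.\<close>

theorem entry_large:
 fixes V :: "real => real"
 assumes V: "fourier_class \<rho> Bv (%x. of_real (V x))" and \<rho>: "\<rho> > 0" and \<gamma>: "\<gamma> > 0" and B: "B >= 0"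
 obtains CF :: real and n0 :: nat where "CF >= 1"
  "!!\<omega> E n. \<bar>E\<bar> <= B ==> n >= n0 ==> \<exists>x. ln (hs (tmat V \<omega> E n x)) >= \<gamma> * real n ==>
   \<exists>n' y. n' <= n & n <= n' + 2 & (ALL x. dist_int (x - y) <= 1 / (CF * (real n)^2) --> \<bar>tm_entry V \<omega> E n' x\<bar> >= exp (\<gamma> * real n) / 8)"
proof -
 define C where "C = Bv + B + 2"
 have Bv: "Bv >= 0" using fourier_class_bounded[OF V, of 0] \<rho> norm_ge_zero order_trans by fastforce
 have C2: "C >= 2" unfolding C_def using Bv B by simp
 then have lnC: "ln C >= 0" by simp
 define d0 where "d0 = nat \<lceil>(ln C + 3) / \<rho>\<rceil>"
 have d0: "\<rho> * real d0 >= ln C + 3"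
 proof -
  have "real d0 >= (ln C + 3) / \<rho>" unfolding d0_def by linarith
  then show ?thesis using \<rho> by (simp add: field_simps)
 qed
 have d01: "d0 >= 1"
 proof (rule ccontr)
  assume "~ d0 >= 1"
  then have "d0 = 0" by simp
  then show False using d0 lnC by simp
 qed
 define CF where "CF = 192 * (real d0)^2"
 have d1: "(real d0)^2 >= 1" using d01 by simp
 define n0 where "n0 = max 2 (nat \<lceil>2 / \<gamma>\<rceil>)"
 show ?thesis
 proof (rule that[of CF n0])
  show "CF >= 1" unfolding CF_def using d1 by simp
  fix \<omega> E :: real and n :: nat
  assume E: "\<bar>E\<bar> <= B" and n: "n >= n0" and ex: "\<exists>x. ln (hs (tmat V \<omega> E n x)) >= \<gamma> * real n"
  have n2: "n >= 2" and ng: "real n >= 2 / \<gamma>" using n unfolding n0_def by linarith+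
  have gn: "\<gamma> * real n >= 2" using ng \<gamma> by (simp add: field_simps)
  have eg: "exp (\<gamma> * real n) >= 5"
   using exp_lower_Taylor_quadratic[of "\<gamma> * real n"] gn power_mono[of 2 "\<gamma> * real n" 2] by simp
  obtain x0 where x0: "ln (hs (tmat V \<omega> E n x0)) >= \<gamma> * real n" using ex by blast
  have h: "hs (tmat V \<omega> E n x0) >= exp (\<gamma> * real n)"
  proof -
   have "hs (tmat V \<omega> E n x0) > 0" using hs_ge_1[of "tmat V \<omega> E n x0"] by simp
   then show ?thesis using x0 by (simp only: ln_ge_iff)
  qed
  obtain n' x1 where n': "n' <= n" "n <= n' + 2" "\<bar>tm_entry V \<omega> E n' x1\<bar> >= hs (tmat V \<omega> E n x0) / 2"
   using tm_entry_ge_half_hs[OF n2] by blast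
  define f where "f x = tm_entry V \<omega> E n' x" for x
  have fc: "fourier_class \<rho> (C ^ n) (%x. of_real (f x))"
  proof (rule fourier_class_mono)
   show "fourier_class \<rho> (C ^ n') (%x. of_real (f x))"
    unfolding f_def tm_entry_def C_def using fourier_class_tmat[OF V less_imp_le[OF \<rho>] E Bv] by blast
   show "C ^ n' <= C ^ n" using n' C2 by (intro power_increasing) auto
  qed
  have bdd: "bdd_above (range (%x. \<bar>f x\<bar>))"
   using fourier_class_bounded[OF fc less_imp_le[OF \<rho>]] by (intro bdd_aboveI[of _ "C ^ n"]) auto
  define S where "S = (SUP x. \<bar>f x\<bar>)"
  have fS: "\<bar>f x\<bar> <= S" for x unfolding S_def by (rule cSUP_upper[OF _ bdd]) simp
  have Sg: "S >= exp (\<gamma> * real n) / 2" using fS[of x1] n'(3) h unfolding f_def by linarith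
  then have S2: "S >= 5 / 2" using eg by linarith
  obtain y where y: "\<bar>f y\<bar> > 3 / 4 * S"
  proof -
   have "3 / 4 * S < S" using S2 by simp
   then have "\<exists>z\<in>UNIV. 3 / 4 * S < \<bar>f z\<bar>"
    unfolding S_def using less_cSUP_iff[OF _ bdd, of "3 / 4 * (SUP x. \<bar>f x\<bar>)"] by simp
   then show ?thesis using that by auto
  qed
  obtain t where t: "!!D x. cmod (of_real (f x) - (\<Sum>k = - int D..int D. t k * e1 (of_int k * x))) <= C ^ n * exp (- \<rho> * real D)"
   using fourier_class_truncate[OF fc] \<rho> by auto
  define D where "D = d0 * n"
  define T where "T x = (\<Sum>k = - int D..int D. t k * e1 (of_int k * x))" for x
  have fT: "cmod (of_real (f x) - T x) <= 1 / 8" for x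
  proof -
   have "C ^ n = exp (real n * ln C)" using C2 by (simp add: exp_of_nat_mult)
   then have "C ^ n * exp (- \<rho> * real D) = exp (real n * ln C - \<rho> * real D)"
    by (simp add: mult_exp_exp mult.assoc)
   also have "... <= exp (- 3)"
   proof -
    have "real n * (ln C + 3) <= real n * (\<rho> * real d0)" using d0 by (intro mult_left_mono) auto
    moreover have "real n * 3 >= 3" using n2 by simp
    ultimately have "real n * ln C - \<rho> * real D <= - 3" unfolding D_def by (simp add: algebra_simps)
    then show ?thesis by simp
   qed
   also have "... <= 1 / 8"
   proof -
    have "exp (3::real) = exp 1 ^ 3" by (simp add: exp_of_nat_mult[symmetric])
    moreover have "exp (1::real) ^ 3 >= 2 ^ 3" using exp_ge_add_one_self[of 1] by (intro power_mono) auto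
    ultimately have "exp (3::real) >= 8" by simp
    then have "inverse (exp (3::real)) <= inverse 8" by (intro le_imp_inverse_le) auto
    then show ?thesis by (simp add: exp_minus)
   qed
   finally show ?thesis using t[of x D] unfolding T_def by linarith
  qed
  have TS: "cmod (T x) <= S + 1 / 8" for x
   using fT[of x] fS[of x] norm_triangle_ineq3[of "of_real (f x)" "T x"] by simp
  have coef: "cmod (t k) <= S + 1 / 8" if "\<bar>k\<bar> <= int D" for k
   by (rule trig_coefficient_bound[OF _ that]) (use TS in \<open>simp add: T_def\<close>)
  have D1: "real D >= 1"
  proof -
   have "1 * 1 <= d0 * n" using d01 n2 by (intro mult_le_mono) auto
   then show ?thesis unfolding D_def by linarith
  qed
  have Tlip: "cmod (T x - T z) <= (S + 1 / 8) * (24 * (real D)^2 * \<bar>x - z\<bar>)" for x z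
  proof -
   have "T x - T z = (\<Sum>k = - int D..int D. t k * (e1 (of_int k * x) - e1 (of_int k * z)))"
    unfolding T_def by (simp add: sum_subtractf right_diff_distrib)
   also have "cmod ... <= (\<Sum>k = - int D..int D. cmod (t k * (e1 (of_int k * x) - e1 (of_int k * z))))" by (rule norm_sum)
   also have "... <= (\<Sum>k = - int D..int D. (S + 1 / 8) * (8 * (real D * \<bar>x - z\<bar>)))"
   proof (intro sum_mono)
    fix k assume k: "k \<in> {- int D..int D}"
    have "cmod (e1 (of_int k * x) - e1 (of_int k * z)) <= 2 * pi * \<bar>of_int k * x - of_int k * z\<bar>" by (rule norm_e1_minus_le)
    also have "\<bar>of_int k * x - of_int k * z\<bar> = \<bar>of_int k\<bar> * \<bar>x - z\<bar>" by (simp add: abs_mult flip: right_diff_distrib)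
    also have "2 * pi * (\<bar>of_int k\<bar> * \<bar>x - z\<bar>) <= 8 * (real D * \<bar>x - z\<bar>)"
    proof (intro mult_mono)
     show "2 * pi <= 8" using pi_less_4 by simp
     show "\<bar>real_of_int k\<bar> <= real D" using k by auto
    qed auto
    finally have "cmod (e1 (of_int k * x) - e1 (of_int k * z)) <= 8 * (real D * \<bar>x - z\<bar>)" .
    moreover have "cmod (t k) <= S + 1 / 8" using k by (intro coef) auto
    ultimately show "cmod (t k * (e1 (of_int k * x) - e1 (of_int k * z))) <= (S + 1 / 8) * (8 * (real D * \<bar>x - z\<bar>))"
     unfolding norm_mult using S2 by (intro mult_mono) auto
   qed
   also have "... = (2 * real D + 1) * ((S + 1 / 8) * (8 * (real D * \<bar>x - z\<bar>)))" by simp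
   also have "... <= (3 * real D) * ((S + 1 / 8) * (8 * (real D * \<bar>x - z\<bar>)))"
    using D1 S2 by (intro mult_right_mono mult_nonneg_nonneg) auto
   also have "... = (S + 1 / 8) * (24 * (real D)^2 * \<bar>x - z\<bar>)" by (simp add: power2_eq_square)
   finally show ?thesis .
  qed
  have near: "\<bar>f x\<bar> >= exp (\<gamma> * real n) / 8" if xy: "\<bar>x - y\<bar> <= 1 / (CF * (real n)^2)" for x
  proof -
   have "24 * (real D)^2 * \<bar>x - y\<bar> <= 24 * (real D)^2 * (1 / (CF * (real n)^2))" using xy by (intro mult_left_mono) auto
   also have "... = 1 / 8" unfolding D_def CF_def using n2 d01 by (simp add: power_mult_distrib)
   finally have "(S + 1 / 8) * (24 * (real D)^2 * \<bar>x - y\<bar>) <= (S + 1 / 8) * (1 / 8)" using S2 by (intro mult_left_mono) auto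
   then have "cmod (T x - T y) <= (S + 1 / 8) / 8" using Tlip[of x y] by linarith
   moreover have "complex_of_real (f y) - of_real (f x) = (of_real (f y) - T y) - (T x - T y) - (of_real (f x) - T x)" by simp
   then have "cmod (complex_of_real (f y) - of_real (f x)) <= cmod (of_real (f y) - T y) + cmod (T x - T y) + cmod (of_real (f x) - T x)"
    using norm_triangle_ineq4[of "of_real (f y) - T y - (T x - T y)" "of_real (f x) - T x"]
     norm_triangle_ineq4[of "of_real (f y) - T y" "T x - T y"] by simp
   moreover have "cmod (complex_of_real (f y) - of_real (f x)) = \<bar>f y - f x\<bar>" by (simp flip: of_real_diff)
   ultimately have "\<bar>f y - f x\<bar> <= 1 / 8 + (S + 1 / 8) / 8 + 1 / 8" using fT[of x] fT[of y] by linarith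
   moreover have "S / 2 <= v" if "u <= 1 / 8 + (S + 1 / 8) / 8 + 1 / 8" "3 / 4 * S < t" "t - v <= u" for t u v
    using that S2 by (simp add: field_simps)
   ultimately have "\<bar>f x\<bar> >= S / 2" using y abs_triangle_ineq2[of "f y" "f x"] by blast
   then show ?thesis using Sg by linarith
  qed
  show "\<exists>n' y. n' <= n & n <= n' + 2 & (ALL x. dist_int (x - y) <= 1 / (CF * (real n)^2) --> \<bar>tm_entry V \<omega> E n' x\<bar> >= exp (\<gamma> * real n) / 8)"
  proof (rule exI[of _ n'], rule exI[of _ y], intro conjI allI impI)
   fix x assume "dist_int (x - y) <= 1 / (CF * (real n)^2)"
   then have "\<bar>(x + of_int (- round (x - y))) - y\<bar> <= 1 / (CF * (real n)^2)" unfolding dist_int_def by (simp add: algebra_simps)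
   then have "\<bar>f (x + of_int (- round (x - y)))\<bar> >= exp (\<gamma> * real n) / 8" by (rule near)
   moreover have "f (x + of_int (- round (x - y))) = f x"
    using fourier_class_periodic[OF fc, of x "- round (x - y)"] by (simp only: of_real_eq_iff)
   ultimately show "\<bar>tm_entry V \<omega> E n' x\<bar> >= exp (\<gamma> * real n) / 8" unfolding f_def by simp
  qed (use n' in auto)
 qed
qed

definition pot :: "(real => real) => real => real => int => real" where
 "pot V \<omega> x n = V (x + of_int n * \<omega>)"

definition res :: "(int => real) => real => (int => real) => int => real" where
 "res U E \<psi> n = - \<psi> (n - 1) - \<psi> (n + 1) + (U n - E) * \<psi> n"

definition pr :: "(int => real) => int => real \<times> real" where
 "pr \<psi> n = (\<psi> (n + 1), \<psi> n)"

lemma mv_diff: "mv A (p - q) = mv A p - mv A q"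
 by (cases A; cases p; cases q) (simp add: mv_def algebra_simps)

lemma mat_diff_mv: "mv (A - B) p = mv A p - mv B p"
 by (cases A; cases B; cases p) (simp add: mv_def algebra_simps)

lemma pr_step: "pr \<psi> n = mv (step_mat (U n - E)) (pr \<psi> (n - 1)) - (res U E \<psi> n, 0)"
 unfolding pr_def step_mat_def mv_def res_def by simp

lemma propagate:
 assumes C: "!!x. \<bar>V x - E\<bar> + 2 <= C"
  and r: "!!n. s < n ==> n <= s + int k ==> \<bar>res (pot V \<omega> x) E \<psi> n\<bar> <= r" and r0: "r >= 0"
 shows "norm (pr \<psi> (s + int k) - mv (tmat V \<omega> E k (x + of_int s * \<omega>)) (pr \<psi> s)) <= real k * C ^ k * r"
 using r
proof (induction k)
 case (Suc k)
 have C1: "C >= 1" using C[of 0] by linarith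
 let ?A = "step_mat (pot V \<omega> x (s + int (Suc k)) - E)"
 let ?T = "tmat V \<omega> E k (x + of_int s * \<omega>)"
 have U: "V (x + of_int s * \<omega> + real (Suc k) * \<omega>) = pot V \<omega> x (s + int (Suc k))"
  unfolding pot_def by (simp add: algebra_simps)
 have eq: "pr \<psi> (s + int (Suc k)) - mv (tmat V \<omega> E (Suc k) (x + of_int s * \<omega>)) (pr \<psi> s) =
   mv ?A (pr \<psi> (s + int k) - mv ?T (pr \<psi> s)) - (res (pot V \<omega> x) E \<psi> (s + int (Suc k)), 0)"
  using pr_step[of \<psi> "s + int (Suc k)" "pot V \<omega> x" E] by (simp add: mv_mm mv_diff U[simplified])
 have IH: "norm (pr \<psi> (s + int k) - mv ?T (pr \<psi> s)) <= real k * C ^ k * r"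
  by (rule Suc.IH) (use Suc.prems in auto)
 have "norm (mv ?A (pr \<psi> (s + int k) - mv ?T (pr \<psi> s))) <= hs ?A * norm (pr \<psi> (s + int k) - mv ?T (pr \<psi> s))"
  by (rule norm_mv_le)
 also have "... <= C * (real k * C ^ k * r)"
  using IH C1 order_trans[OF hs_step_le C[of "x + of_int (s + int (Suc k)) * \<omega>"]] by (intro mult_mono) (auto simp: pot_def)
 finally have 1: "norm (mv ?A (pr \<psi> (s + int k) - mv ?T (pr \<psi> s))) <= C * (real k * C ^ k * r)" .
 have 2: "norm (res (pot V \<omega> x) E \<psi> (s + int (Suc k)), 0::real) <= r"
  using Suc.prems[of "s + int (Suc k)"] by (simp add: norm_Pair)
 have "norm (pr \<psi> (s + int (Suc k)) - mv (tmat V \<omega> E (Suc k) (x + of_int s * \<omega>)) (pr \<psi> s)) <= C * (real k * C ^ k * r) + r"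
  unfolding eq using norm_triangle_ineq4 1 2 by (meson add_mono order_trans)
 also have "... <= C * (real k * C ^ k * r) + C ^ Suc k * r"
 proof -
  have "1 <= C ^ Suc k" using C1 by (rule one_le_power)
  then have "1 * r <= C ^ Suc k * r" using r0 by (intro mult_right_mono)
  then show ?thesis by simp
 qed
 also have "... = real (Suc k) * C ^ Suc k * r" by (simp add: algebra_simps)
 finally show ?case .
qed simp

lemma propagate_back:
 assumes C: "!!x. \<bar>V x - E\<bar> + 2 <= C"
  and r: "!!n. s < n ==> n <= s + int k ==> \<bar>res (pot V \<omega> x) E \<psi> n\<bar> <= r" and r0: "r >= 0"
 defines "T \<equiv> tmat V \<omega> E k (x + of_int s * \<omega>)"
 shows "norm (pr \<psi> s - mv (adj2 T) (pr \<psi> (s + int k))) <= hs T * (real k * C ^ k * r)"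
proof -
 have "mv (adj2 T) (mv T (pr \<psi> s)) = pr \<psi> s"
  unfolding mv_mm[symmetric] T_def by (subst mm_adj2(1)) auto
 then have "pr \<psi> s - mv (adj2 T) (pr \<psi> (s + int k)) = - mv (adj2 T) (pr \<psi> (s + int k) - mv T (pr \<psi> s))"
  by (simp add: mv_diff)
 then have "norm (pr \<psi> s - mv (adj2 T) (pr \<psi> (s + int k))) = norm (mv (adj2 T) (pr \<psi> (s + int k) - mv T (pr \<psi> s)))"
  by (simp only: norm_minus_cancel)
 also have "... <= hs (adj2 T) * norm (pr \<psi> (s + int k) - mv T (pr \<psi> s))" by (rule norm_mv_le)
 also have "... <= hs T * (real k * C ^ k * r)"
  unfolding hs_adj2 using propagate[where s = s and k = k and \<omega> = \<omega> and x = x and \<psi> = \<psi>, OF C r r0] unfolding T_def by (intro mult_left_mono) auto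
 finally show ?thesis .
qed

section \<open>Estimates at one scale\<close>

text \<open>What is used about the scale \<open>m\<close>, for all energies within \<open>w\<close> of
\<open>E0\<close> and for approximate solutions with defect at most \<open>r\<close>. The constant \<open>K\<close>
may be huge because \<open>r\<close> is at the disposal of the user. \<open>centre\<close>: decay in the middle of a
window avoiding \<open>\<Theta>\<close>. \<open>left_end\<close>, \<open>right_end\<close>: forced growth away from a
Dirichlet end at phase near \<open>ys\<close>. \<open>edge\<close>: solutions decaying from the same end do not exist
at two consecutive phases.\<close>

locale scale =
 fixes V :: "real => real" and \<omega> E0 w C \<theta> K \<tau> \<eta> ys :: real and m nf J :: nat and \<Theta> :: "real set"
 assumes C2: "C >= 2" and w: "w >= 0"
  and m2: "m >= 2" and J1: "J >= 1" and nf: "nf <= J * m" "J * m <= nf + 2"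
  and \<theta>: "\<theta> > 0" "64 * \<theta> <= 1" and K: "K >= 1"
  and J\<theta>: "(2 * \<theta>) ^ J * (8 * C ^ m) <= \<theta>"
  and fin: "finite \<Theta>"
  and grow: "!!x s k \<psi> E r. \<bar>E - E0\<bar> <= w ==> k <= J * m ==> r >= 0 ==>
    (!!n. s < n ==> n <= s + int k ==> \<bar>res (pot V \<omega> x) E \<psi> n\<bar> <= r) ==>
    norm (pr \<psi> (s + int k)) <= 2 * C ^ k * norm (pr \<psi> s) + K * r & norm (pr \<psi> s) <= 2 * C ^ k * norm (pr \<psi> (s + int k)) + K * r"
  and centre: "!!x s \<psi> E r. \<bar>E - E0\<bar> <= w ==> r >= 0 ==>
    (!!t. t \<in> \<Theta> ==> dist_int (x + of_int (s - int m) * \<omega> - t) >= \<tau>) ==>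
    (!!n. s - int m < n ==> n <= s + int m ==> \<bar>res (pot V \<omega> x) E \<psi> n\<bar> <= r) ==>
    norm (pr \<psi> s) <= \<theta> * (norm (pr \<psi> (s - int m)) + norm (pr \<psi> (s + int m))) + K * r"
  and left_end: "!!x a \<psi> E r. \<bar>E - E0\<bar> <= w ==> r >= 0 ==> dist_int (x + of_int (a - 1) * \<omega> - ys) <= \<eta> ==> \<psi> (a - 1) = 0 ==>
    (!!n. a <= n ==> n < a + int nf ==> \<bar>res (pot V \<omega> x) E \<psi> n\<bar> <= r) ==>
    \<bar>\<psi> a\<bar> * (64 * C ^ (m + 2)) <= \<bar>\<psi> (a + int nf)\<bar> + K * r"
  and right_end: "!!x b \<psi> E r. \<bar>E - E0\<bar> <= w ==> r >= 0 ==> dist_int (x + of_int (b - int nf) * \<omega> - ys) <= \<eta> ==> \<psi> (b + 1) = 0 ==>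
    (!!n. b - int nf < n ==> n <= b ==> \<bar>res (pot V \<omega> x) E \<psi> n\<bar> <= r) ==>
    \<bar>\<psi> b\<bar> * (64 * C ^ (m + 2)) <= \<bar>\<psi> (b - int nf)\<bar> + K * r"
  and edge: "!!x a \<psi> \<psi>' E E' r. \<bar>E - E0\<bar> <= w ==> \<bar>E' - E0\<bar> <= w ==> r >= 0 ==> K * r <= \<theta> / 4 ==>
    \<psi> (a - 1) = 0 ==> \<psi> a = 1 ==> \<psi>' (a - 1) = 0 ==> \<psi>' a = 1 ==>
    (!!n. a <= n ==> n < a + int m ==> \<bar>res (pot V \<omega> x) E \<psi> n\<bar> <= r) ==>
    (!!n. a <= n ==> n < a + int m ==> \<bar>res (pot V \<omega> (x + \<omega>)) E' \<psi>' n\<bar> <= r) ==>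
    norm (pr \<psi> (a - 1 + int m)) <= 4 * \<theta> ==> norm (pr \<psi>' (a - 1 + int m)) <= 4 * \<theta> ==> False"

abbreviation "good_scale_at V \<omega> E0 b C \<kappa> CW CE d I J \<equiv> \<exists>m nf \<theta> K ys \<Theta>. scale V \<omega> E0 (exp (- CW * real m)) C \<theta> K (exp (- \<kappa> * real b)) (1 / (CE * (real m)^2)) ys m nf J \<Theta> &
  b ^ 18 <= m & m <= 2 ^ I * b ^ 18 & card \<Theta> <= d * m * b ^ 17"

lemma norm_fst_le: "\<bar>fst p\<bar> <= norm p" for p :: "real \<times> real"
 using norm_fst_le[of "fst p" "snd p"] by simp

lemma norm_snd_le: "\<bar>snd p\<bar> <= norm p" for p :: "real \<times> real"
 using norm_snd_le[of "snd p" "fst p"] by simp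

lemma abs_fst_le_hs: "\<bar>fst A\<bar> <= hs A"
 using Product_Vector.norm_fst_le[of "fst A" "snd A"] by (simp add: hs_eq_norm)

lemma mv_scale: "mv A (r *\<^sub>R p) = r *\<^sub>R mv A p"
 by (cases A; cases p) (simp add: mv_def algebra_simps)

text \<open>Both \<open>M(x + \<omega>) (1, 0)\<close> and, through the cocycle relation, \<open>M(x + \<omega>) A (1,
0)\<close> are small. These two vectors are a basis, but a matrix of determinant 1 has norm at least \<open>sqrt
2\<close>.\<close>

lemma no_two_edges:
 assumes C: "!!x. \<bar>V x - E\<bar> + 2 <= C" and t: "15 * C * t < 1" "t >= 0"
  and e: "norm (mv (tmat V \<omega> E m x) (1, 0)) <= t" "norm (mv (tmat V \<omega> E m (x + \<omega>)) (1, 0)) <= t"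
 shows False
proof -
 define T T0 where "T = tmat V \<omega> E m (x + \<omega>)" and "T0 = tmat V \<omega> E m x"
 define A B where "A = step_mat (V (x + \<omega>) - E)" and "B = step_mat (V (x + real (Suc m) * \<omega>) - E)"
 have C2: "C >= 2" using C[of 0] by linarith
 have eq: "mm T A = mm B T0"
  unfolding A_def B_def T_def T0_def using tmat_Suc'[of V \<omega> E m x] by simp
 have "mv T (mv A (1, 0)) = mv B (mv T0 (1, 0))" unfolding mv_mm[symmetric] eq ..
 then have 1: "norm (mv T (mv A (1, 0))) <= C * t"
  using norm_mv_le[of B "mv T0 (1, 0)"] e(1) order_trans[OF hs_step_le C[of "x + real (Suc m) * \<omega>"]] t(2) C2
  unfolding T0_def[symmetric] B_def[symmetric] by (smt (verit) hs_nonneg mult_mono norm_ge_zero)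
 define v where "v = V (x + \<omega>) - E"
 have vC: "\<bar>v\<bar> <= C" using C[of "x + \<omega>"] unfolding v_def by linarith
 have "(0, 1) = mv A (1, 0) - v *\<^sub>R (1, 0)" unfolding A_def v_def step_mat_def mv_def by simp
 then have "mv T (0, 1) = mv T (mv A (1, 0)) - v *\<^sub>R mv T (1, 0)" by (simp only: mv_diff mv_scale)
 then have "norm (mv T (0, 1)) <= norm (mv T (mv A (1, 0))) + \<bar>v\<bar> * norm (mv T (1, 0))"
  by (metis norm_scaleR norm_triangle_ineq4)
 also have "... <= C * t + C * t"
  using 1 vC e(2) t(2) C2 unfolding T_def[symmetric] by (intro add_mono mult_mono) auto
 finally have 2: "norm (mv T (0, 1)) <= 2 * C * t" by simp
 have "t * 2 <= t * C" using C2 t(2) by (intro mult_left_mono)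
 then have 3: "norm (mv T (1, 0)) <= 2 * C * t" using e(2) t(2) unfolding T_def[symmetric] by (simp add: algebra_simps)
 have hT: "(hs T)^2 = (norm (mv T (1, 0)))^2 + (norm (mv T (0, 1)))^2"
  by (cases T) (simp add: hs_def mv_def norm_Pair)
 have "(norm (mv T (1, 0)))^2 <= (2 * C * t)^2" "(norm (mv T (0, 1)))^2 <= (2 * C * t)^2"
  using 2 3 by (intro power_mono; simp)+
 moreover have "(2 * C * t)^2 <= (1 / 5)^2" using t C2 by (intro power_mono) auto
 ultimately have "(hs T)^2 < 2" unfolding hT by (simp add: power_divide)
 moreover have "(hs T)^2 >= 2" unfolding T_def by (rule hs_ge_sqrt2) simp
 ultimately show False by simp
qed

text \<open>The width \<open>w = exp (- CW * m)\<close> is so small that changing the energy within \<open>w\<close>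
alters transfer matrices over \<open>2 * J * m\<close> sites by less than \<open>\<theta> / 4\<close>. The multiple
\<open>J\<close> makes the growth over \<open>J * m\<close> sites, \<open>exp (\<gamma> * J * m)\<close>, beat the a
priori bound \<open>C ^ m\<close>.\<close>

theorem scale_exists:
 fixes V :: "real => real"
 assumes V: "fourier_class \<rho> Bv (%x. of_real (V x))" and \<rho>: "\<rho> > 0" and c: "c > 0" and \<gamma>: "\<gamma> > 0" and B: "B >= 0"
 obtains C \<kappa> CW CE :: real and d b0 I J :: nat where "\<kappa> > 0" "CW > 0" "CE >= 1" "b0 >= 2"
  "!!\<omega> E0 b. dioph c \<omega> ==> \<bar>E0\<bar> <= B ==> b >= b0 ==> expanding V \<omega> E0 \<gamma> ==>
   good_scale_at V \<omega> E0 b C \<kappa> CW CE d I J"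
proof -
 define C where "C = Bv + B + 3"
 have Bv: "Bv >= 0" using fourier_class_bounded[OF V, of 0] \<rho> norm_ge_zero order_trans by fastforce
 have C3: "C >= 3" unfolding C_def using Bv B by simp
 define L where "L = ln C"
 have L0: "L >= 0" unfolding L_def using C3 by simp
 have CL: "C ^ n = exp (L * real n)" for n unfolding L_def using C3 by (simp add: exp_of_nat2_mult)
 obtain \<kappa> :: real and d b1 I :: nat where gs: "\<kappa> > 0" "b1 >= 2"
  "!!\<omega> E b. dioph c \<omega> ==> \<bar>E\<bar> <= B ==> b >= b1 ==> expanding V \<omega> E \<gamma> ==>
   \<exists>m X Y \<Theta>. b ^ 18 <= m & m <= 2 ^ I * b ^ 18 & finite \<Theta> & card \<Theta> <= d * m * b ^ 17 & X >= 1 & Y > 0 &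
    X / Y <= exp (- (\<gamma> / 2) * real m) & (ALL x. hs (tmat V \<omega> E m x) <= X) &
    (ALL x. avoids \<Theta> \<kappa> b x --> hs (tmat V \<omega> E (2 * m) x) >= Y)"
  using good_scale[OF V \<rho> c \<gamma> B] by metis
 obtain CF :: real and n0 :: nat where el: "CF >= 1"
  "!!\<omega> E n. \<bar>E\<bar> <= B ==> n >= n0 ==> \<exists>x. ln (hs (tmat V \<omega> E n x)) >= \<gamma> * real n ==>
   \<exists>n' y. n' <= n & n <= n' + 2 & (ALL x. dist_int (x - y) <= 1 / (CF * (real n)^2) --> \<bar>tm_entry V \<omega> E n' x\<bar> >= exp (\<gamma> * real n) / 8)"
  using entry_large[OF V \<rho> \<gamma> B] by metis
 define J where "J = nat \<lceil>2 * L / \<gamma>\<rceil> + 2"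
 have J: "real J * \<gamma> >= 2 * L + 2 * \<gamma>"
 proof -
  have "real J >= 2 * L / \<gamma> + 2" unfolding J_def by linarith
  then have "real J * \<gamma> >= (2 * L / \<gamma> + 2) * \<gamma>" using \<gamma> by (intro mult_right_mono) auto
  then show ?thesis using \<gamma> by (simp add: distrib_right)
 qed
 have J1: "J >= 1" unfolding J_def by simp
 define CW where "CW = 2 * real J * L + \<gamma>"
 have CW: "CW > 0" unfolding CW_def using L0 \<gamma> by (intro add_nonneg_pos) auto
 define CE where "CE = CF * (real J)^2"
 have CE: "CE >= 1"
 proof -
  have "1 * 1 <= CF * (real J)^2" using el(1) J1 by (intro mult_mono) auto
  then show ?thesis unfolding CE_def by simp
 qed
 define th where "th m = 12 * exp (- (\<gamma> / 2) * real m)" for m :: nat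
 define Good where "Good m \<longleftrightarrow> 15 * C * (5 * th m) < 1 & 64 * th m <= 1 & (2 * th m) ^ J * (8 * C ^ m) <= th m & exp (\<gamma> / 2 * real m) >= 2 &
   4 * real J * real m * C ^ (2 * (J * m)) * exp (- CW * real m) <= th m / 4 & exp (\<gamma> * real (J * m)) / 8 - 1 >= 64 * C ^ (m + 2)" for m
 have ev: "\<forall>\<^sub>F m in sequentially. Good m"
 proof -
  have "\<forall>\<^sub>F m in sequentially. 15 * C * (5 * th m) < 1" unfolding th_def using \<gamma> by real_asymp
  moreover have "\<forall>\<^sub>F m in sequentially. 64 * th m <= 1" unfolding th_def using \<gamma> by real_asymp
  moreover have "\<forall>\<^sub>F m::nat in sequentially. exp (\<gamma> / 2 * real m) >= 2" using \<gamma> by real_asymp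
  moreover have "\<forall>\<^sub>F m in sequentially. (2 * th m) ^ J * (8 * C ^ m) <= th m"
  proof -
   define a where "a = real J * (\<gamma> / 2) - L - \<gamma> / 2"
   have a: "a > 0" unfolding a_def using J \<gamma> by (simp add: field_simps)
   have "\<forall>\<^sub>F m::nat in sequentially. 24 ^ J * 8 * exp (- a * real m) <= 12" using a by real_asymp
   then show ?thesis
   proof eventually_elim
    fix m :: nat assume 1: "24 ^ J * 8 * exp (- a * real m) <= 12"
    have "(2 * th m) ^ J * (8 * C ^ m) = 24 ^ J * (exp (- (\<gamma> / 2) * real m) ^ J * (8 * exp (L * real m)))"
     unfolding th_def CL by (simp add: power_mult_distrib)
    also have "exp (- (\<gamma> / 2) * real m) ^ J = exp (real J * (- (\<gamma> / 2) * real m))" by (rule exp_of_nat_mult[symmetric])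
    also have "24 ^ J * (exp (real J * (- (\<gamma> / 2) * real m)) * (8 * exp (L * real m))) = 24 ^ J * 8 * exp (- a * real m) * exp (- (\<gamma> / 2) * real m)"
     unfolding a_def by (simp add: mult_exp_exp algebra_simps)
    also have "... <= 12 * exp (- (\<gamma> / 2) * real m)" using 1 by (intro mult_right_mono) auto
    finally show "(2 * th m) ^ J * (8 * C ^ m) <= th m" unfolding th_def .
   qed
  qed
  moreover have "\<forall>\<^sub>F m in sequentially. 4 * real J * real m * C ^ (2 * (J * m)) * exp (- CW * real m) <= th m / 4"
  proof -
   have "\<forall>\<^sub>F m::nat in sequentially. 4 * real J * real m * exp (- (\<gamma> / 2) * real m) <= 3" using \<gamma> by real_asymp
   then show ?thesis
   proof eventually_elim
    fix m :: nat assume 1: "4 * real J * real m * exp (- (\<gamma> / 2) * real m) <= 3"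
    have "4 * real J * real m * C ^ (2 * (J * m)) * exp (- CW * real m) = (4 * real J * real m * exp (- (\<gamma> / 2) * real m)) * exp (- (\<gamma> / 2) * real m)"
     unfolding CL CW_def by (simp add: mult_exp_exp mult.assoc) (simp add: algebra_simps)
    also have "... <= 3 * exp (- (\<gamma> / 2) * real m)" using 1 by (intro mult_right_mono) auto
    finally show "4 * real J * real m * C ^ (2 * (J * m)) * exp (- CW * real m) <= th m / 4" unfolding th_def by simp
   qed
  qed
  moreover have "\<forall>\<^sub>F m in sequentially. exp (\<gamma> * real (J * m)) / 8 - 1 >= 64 * C ^ (m + 2)"
  proof -
   define a where "a = \<gamma> * real J - L"
   have a: "a > 0" unfolding a_def using J \<gamma> L0 by (simp add: field_simps)
   have "\<forall>\<^sub>F m::nat in sequentially. 8 * (64 * C^2 + 1) <= exp (a * real m)" using a by real_asymp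
   then show ?thesis
   proof eventually_elim
    fix m :: nat assume 1: "8 * (64 * C^2 + 1) <= exp (a * real m)"
    have "8 * (64 * C ^ (m + 2) + 1) <= 8 * (64 * C^2 + 1) * C ^ m"
    proof -
     have "C ^ m >= 1" using C3 by (intro one_le_power) auto
     then show ?thesis by (simp add: power_add power2_eq_square algebra_simps)
    qed
    also have "... <= exp (a * real m) * C ^ m" using 1 C3 by (intro mult_right_mono) auto
    also have "... = exp (\<gamma> * real (J * m))" unfolding CL a_def by (simp add: mult_exp_exp algebra_simps)
    finally show "exp (\<gamma> * real (J * m)) / 8 - 1 >= 64 * C ^ (m + 2)" by simp
   qed
  qed
  ultimately show ?thesis unfolding Good_def by eventually_elim auto
 qed
 then obtain m0 where m0: "!!m. m >= m0 ==> Good m" unfolding eventually_sequentially by blast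
 define b0 where "b0 = max b1 (max m0 n0)"
 have main: "good_scale_at V \<omega> E0 b C \<kappa> CW CE d I J"
  if dio: "dioph c \<omega>" and E0: "\<bar>E0\<bar> <= B" and b: "b >= b0"
   and Ly: "expanding V \<omega> E0 \<gamma>" for \<omega> E0 b
 proof -
  have bb: "b >= b1" "b >= m0" "b >= n0" "b >= 2" using b gs(2) unfolding b0_def by auto
  obtain m X Y \<Theta> where g: "b ^ 18 <= m" "m <= 2 ^ I * b ^ 18" "finite \<Theta>" "card \<Theta> <= d * m * b ^ 17" "X >= 1" "Y > 0"
    "X / Y <= exp (- (\<gamma> / 2) * real m)" "!!x. hs (tmat V \<omega> E0 m x) <= X"
    "!!x. avoids \<Theta> \<kappa> b x ==> hs (tmat V \<omega> E0 (2 * m) x) >= Y"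
   using gs(3)[OF dio E0 bb(1) Ly] by blast
  have "b ^ 1 <= b ^ 18" using bb(4) by (intro power_increasing) auto
  then have mb: "m >= b" using g(1) by simp
  have m2: "m >= 2" using mb bb(4) by simp
  have Gm: "Good m" by (rule m0) (use mb bb in simp)
  define n where "n = J * m"
  have nm: "n >= m" unfolding n_def using J1 by simp
  obtain nf ys where nf: "nf <= n" "n <= nf + 2" "!!x. dist_int (x - ys) <= 1 / (CF * (real n)^2) ==> \<bar>tm_entry V \<omega> E0 nf x\<bar> >= exp (\<gamma> * real n) / 8"
  proof -
   have "n >= n0" "n >= 1" using nm mb bb m2 by auto
   then show ?thesis using el(2)[OF E0, of n \<omega>] Ly that by blast
  qed
  define w where "w = exp (- CW * real m)"
  have w0: "w > 0" unfolding w_def by simp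
  have w1: "w <= 1" unfolding w_def using CW by simp
  define \<theta> where "\<theta> = th m"
  have \<theta>0: "\<theta> > 0" unfolding \<theta>_def th_def by simp
  have Gm': "15 * C * (5 * \<theta>) < 1" "64 * \<theta> <= 1" "(2 * \<theta>) ^ J * (8 * C ^ m) <= \<theta>" "exp (\<gamma> / 2 * real m) >= 2"
   "4 * real J * real m * C ^ (2 * (J * m)) * w <= \<theta> / 4" "exp (\<gamma> * real n) / 8 - 1 >= 64 * C ^ (m + 2)"
   using Gm unfolding Good_def \<theta>_def w_def n_def by auto
  have C1: "C >= 1" using C3 by simp
  have VE: "\<bar>V x - E\<bar> + 2 <= C" if "\<bar>E - E0\<bar> <= w" for E x
   using fourier_class_bounded[OF V, of x] \<rho> E0 that w1 unfolding C_def by simp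
  have VE0: "\<bar>V x - E0\<bar> + 2 <= C" for x using VE[of E0 x] w0 by simp
  have lip: "hs (tmat V \<omega> E k x - tmat V \<omega> E0 k x) <= \<theta> / 4" if E: "\<bar>E - E0\<bar> <= w" and k: "k <= 2 * n" for E k x
  proof -
   have "hs (tmat V \<omega> E k x - tmat V \<omega> E0 k x) <= 2 * real k * C ^ k * \<bar>E - E0\<bar>"
    by (rule tmat_energy_lipschitz) (use VE[OF E] VE0 in auto)
   also have "... <= 2 * real (2 * n) * C ^ (2 * n) * w"
    using k E C1 by (intro mult_mono power_increasing) auto
   also have "... = 4 * real J * real m * C ^ (2 * (J * m)) * w" unfolding n_def by simp
   finally show ?thesis using Gm'(5) by linarith
  qed
  define K where "K = 4 * (real n * C ^ (2 * n)) + 1"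
  have K1: "K >= 1" unfolding K_def using C1 by simp
  have nC0: "real n * C ^ (2 * n) >= 0" using C1 by simp
  have Kk: "real k * C ^ k <= real n * C ^ (2 * n)" if "k <= n" for k
   using that C1 by (intro mult_mono power_increasing) auto
  have Kk2: "2 * C ^ k * (real k * C ^ k) <= 2 * (real n * C ^ (2 * n))" if "k <= n" for k
  proof -
   have "2 * C ^ k * (real k * C ^ k) = 2 * (real k * C ^ (k + k))" by (simp only: power_add) simp
   also have "... = 2 * (real k * C ^ (2 * k))" by (simp only: mult_2)
   also have "... <= 2 * (real n * C ^ (2 * n))" using that C1 by (intro mult_left_mono mult_mono power_increasing) auto
   finally show ?thesis .
  qed
  have KK: "real k * C ^ k <= K" if "k <= n" for k using Kk[OF that] nC0 unfolding K_def by linarith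
  have KK2: "2 * C ^ k * (real k * C ^ k) <= K" if "k <= n" for k using Kk2[OF that] nC0 unfolding K_def by linarith
  have KK3: "3 * (real n * C ^ (2 * n)) <= K" using nC0 unfolding K_def by linarith
  have mn: "m <= n" by (rule nm)
  have fT: "\<bar>fst (tmat V \<omega> E nf z)\<bar> >= 64 * C ^ (m + 2)" if E: "\<bar>E - E0\<bar> <= w" and z: "dist_int (z - ys) <= 1 / (CE * (real m)^2)" for E z
  proof -
   have "dist_int (z - ys) <= 1 / (CF * (real n)^2)" using z unfolding CE_def n_def by (simp add: power_mult_distrib mult_ac)
   from nf(3)[OF this] have 1: "\<bar>fst (tmat V \<omega> E0 nf z)\<bar> >= 64 * C ^ (m + 2) + 1" using Gm'(6) unfolding tm_entry_def by linarith
   have "\<bar>fst (tmat V \<omega> E nf z) - fst (tmat V \<omega> E0 nf z)\<bar> <= hs (tmat V \<omega> E nf z - tmat V \<omega> E0 nf z)"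
    using abs_fst_le_hs[of "tmat V \<omega> E nf z - tmat V \<omega> E0 nf z"] by (simp only: fst_diff)
   then have "\<bar>fst (tmat V \<omega> E nf z) - fst (tmat V \<omega> E0 nf z)\<bar> <= 1" using lip[OF E, of nf z] nf(1) Gm'(2) by simp
   then show ?thesis using 1 by linarith
  qed
  have sc: "scale V \<omega> E0 w C \<theta> K (exp (- \<kappa> * real b)) (1 / (CE * (real m)^2)) ys m nf J \<Theta>"
  proof (unfold_locales)
   show "2 <= C" using C3 by simp
   show "0 <= w" using w0 by simp
   show "2 <= m" by (rule m2)
   show "1 <= J" by (rule J1)
   show "nf <= J * m" "J * m <= nf + 2" using nf unfolding n_def by auto
   show "0 < \<theta>" "64 * \<theta> <= 1" using \<theta>0 Gm' by auto
   show "1 <= K" by (rule K1)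
   show "(2 * \<theta>) ^ J * (8 * C ^ m) <= \<theta>" by (rule Gm')
   show "finite \<Theta>" by (rule g)
  next
   fix x s k \<psi> E r
   assume E: "\<bar>E - E0\<bar> <= w" and k: "k <= J * m" and r0: "r >= 0"
    and r: "!!n. s < n ==> n <= s + int k ==> \<bar>res (pot V \<omega> x) E \<psi> n\<bar> <= r"
   let ?T = "tmat V \<omega> E k (x + of_int s * \<omega>)"
   have kn: "k <= n" using k unfolding n_def .
   have hT: "hs ?T <= 2 * C ^ k" by (rule hs_tmat_le) (rule VE[OF E])
   have 1: "norm (pr \<psi> (s + int k) - mv ?T (pr \<psi> s)) <= real k * C ^ k * r"
    by (rule propagate[OF VE[OF E] r r0])
   have "norm (pr \<psi> (s + int k)) <= norm (mv ?T (pr \<psi> s)) + norm (pr \<psi> (s + int k) - mv ?T (pr \<psi> s))"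
    by (metis add.commute diff_add_cancel norm_triangle_ineq)
   also have "... <= 2 * C ^ k * norm (pr \<psi> s) + K * r"
   proof (rule add_mono)
    show "norm (mv ?T (pr \<psi> s)) <= 2 * C ^ k * norm (pr \<psi> s)"
     using norm_mv_le[of ?T "pr \<psi> s"] mult_right_mono[OF hT, of "norm (pr \<psi> s)"] by simp
    have "real k * C ^ k * r <= K * r" by (rule mult_right_mono[OF KK[OF kn] r0])
    then show "norm (pr \<psi> (s + int k) - mv ?T (pr \<psi> s)) <= K * r" using 1 by linarith
   qed
   finally have A: "norm (pr \<psi> (s + int k)) <= 2 * C ^ k * norm (pr \<psi> s) + K * r" .
   have 2: "norm (pr \<psi> s - mv (adj2 ?T) (pr \<psi> (s + int k))) <= hs ?T * (real k * C ^ k * r)"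
    by (rule propagate_back[OF VE[OF E] r r0])
   have "norm (pr \<psi> s) <= norm (mv (adj2 ?T) (pr \<psi> (s + int k))) + norm (pr \<psi> s - mv (adj2 ?T) (pr \<psi> (s + int k)))"
    by (metis add.commute diff_add_cancel norm_triangle_ineq)
   also have "... <= 2 * C ^ k * norm (pr \<psi> (s + int k)) + K * r"
   proof (rule add_mono)
    show "norm (mv (adj2 ?T) (pr \<psi> (s + int k))) <= 2 * C ^ k * norm (pr \<psi> (s + int k))"
     using norm_mv_le[of "adj2 ?T" "pr \<psi> (s + int k)"] mult_right_mono[OF hT, of "norm (pr \<psi> (s + int k))"] by simp
    have "hs ?T * (real k * C ^ k * r) <= 2 * C ^ k * (real k * C ^ k * r)"
     using hT r0 C1 by (intro mult_right_mono) auto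
    also have "... <= K * r"
     using mult_right_mono[OF KK2[OF kn] r0] by (simp only: mult.assoc)
    finally show "norm (pr \<psi> s - mv (adj2 ?T) (pr \<psi> (s + int k))) <= K * r" using 2 by linarith
   qed
   finally show "norm (pr \<psi> (s + int k)) <= 2 * C ^ k * norm (pr \<psi> s) + K * r & norm (pr \<psi> s) <= 2 * C ^ k * norm (pr \<psi> (s + int k)) + K * r"
    using A by simp
  next
   fix x s \<psi> E r
   assume E: "\<bar>E - E0\<bar> <= w" and r0: "r >= 0"
    and far: "!!t. t \<in> \<Theta> ==> dist_int (x + of_int (s - int m) * \<omega> - t) >= exp (- \<kappa> * real b)"
    and r: "!!n. s - int m < n ==> n <= s + int m ==> \<bar>res (pot V \<omega> x) E \<psi> n\<bar> <= r"
   let ?y = "x + of_int (s - int m) * \<omega>"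
   let ?A1 = "tmat V \<omega> E m ?y" and ?A2 = "tmat V \<omega> E m (x + of_int s * \<omega>)"
   have y: "?y + real m * \<omega> = x + of_int s * \<omega>" by (simp add: algebra_simps)
   have prod: "mm ?A2 ?A1 = tmat V \<omega> E (2 * m) ?y"
    using tmat_add[of V \<omega> E m m ?y] unfolding y by (simp only: mult_2)
   have X2: "hs (tmat V \<omega> E m z) <= 2 * X" for z
   proof -
    have "norm (tmat V \<omega> E m z) <= norm (tmat V \<omega> E0 m z) + norm (tmat V \<omega> E m z - tmat V \<omega> E0 m z)"
     by (metis add.commute diff_add_cancel norm_triangle_ineq)
    then show ?thesis using lip[OF E, of m z] g(5) g(8)[of z] mn Gm'(2) unfolding hs_eq_norm by simp
   qed
   have Y2: "Y >= 2"
   proof -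
    have "X <= exp (- (\<gamma> / 2) * real m) * Y" using g(6,7) by (simp add: pos_divide_le_eq)
    then have "exp (\<gamma> / 2 * real m) * X <= exp (\<gamma> / 2 * real m) * (exp (- (\<gamma> / 2) * real m) * Y)" by (intro mult_left_mono) auto
    also have "... = Y" by (simp add: mult.assoc[symmetric] mult_exp_exp)
    finally have "exp (\<gamma> / 2 * real m) * X <= Y" .
    moreover have "2 * 1 <= exp (\<gamma> / 2 * real m) * X" using Gm'(4) g(5) by (intro mult_mono) auto
    ultimately show ?thesis by simp
   qed
   have hY: "hs (mm ?A2 ?A1) >= Y / 2"
   proof -
    have "norm (tmat V \<omega> E0 (2 * m) ?y) <= norm (tmat V \<omega> E (2 * m) ?y) + norm (tmat V \<omega> E (2 * m) ?y - tmat V \<omega> E0 (2 * m) ?y)"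
     by (metis norm_minus_commute norm_triangle_sub)
    moreover have "hs (tmat V \<omega> E0 (2 * m) ?y) >= Y" using g(9)[of ?y] far by blast
    ultimately show ?thesis using lip[OF E, of "2 * m" ?y] mn Gm'(2) Y2 unfolding prod hs_eq_norm by simp
   qed
   have "norm (pr \<psi> s) <= 3 * (2 * X / (Y / 2)) * (norm (mv (adj2 ?A1) (pr \<psi> s)) + norm (mv ?A2 (pr \<psi> s)))"
    by (rule expanding_product_centre) (use X2 hY Y2 in auto)
   also have "... <= \<theta> * (norm (mv (adj2 ?A1) (pr \<psi> s)) + norm (mv ?A2 (pr \<psi> s)))"
   proof (rule mult_right_mono)
    show "3 * (2 * X / (Y / 2)) <= \<theta>" using g(7) unfolding \<theta>_def th_def by simp
   qed simp
   also have "... <= \<theta> * ((norm (pr \<psi> (s - int m)) + 2 * (real n * C ^ (2 * n)) * r) + (norm (pr \<psi> (s + int m)) + real n * C ^ (2 * n) * r))"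
   proof (intro mult_left_mono add_mono)
    have ss: "s - int m + int m = s" by simp
    have "norm (pr \<psi> (s - int m) - mv (adj2 ?A1) (pr \<psi> s)) <= hs ?A1 * (real m * C ^ m * r)"
     using propagate_back[where s = "s - int m" and k = m and x = x and \<psi> = \<psi> and \<omega> = \<omega>, OF VE[OF E] r r0] unfolding ss by simp
    also have "... <= 2 * C ^ m * (real m * C ^ m * r)"
     using hs_tmat_le[where V = V and \<omega> = \<omega> and n = m and x = ?y, OF VE[OF E]] r0 C1 by (intro mult_right_mono) auto
    also have "... <= 2 * (real n * C ^ (2 * n)) * r" using mult_right_mono[OF Kk2[OF mn] r0] by (simp add: mult_ac)
    finally have "norm (pr \<psi> (s - int m) - mv (adj2 ?A1) (pr \<psi> s)) <= 2 * (real n * C ^ (2 * n)) * r" .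
    moreover have "norm (mv (adj2 ?A1) (pr \<psi> s)) <= norm (pr \<psi> (s - int m)) + norm (pr \<psi> (s - int m) - mv (adj2 ?A1) (pr \<psi> s))"
     by (metis norm_minus_commute norm_triangle_sub)
    ultimately show "norm (mv (adj2 ?A1) (pr \<psi> s)) <= norm (pr \<psi> (s - int m)) + 2 * (real n * C ^ (2 * n)) * r" by linarith
    have "norm (pr \<psi> (s + int m) - mv ?A2 (pr \<psi> s)) <= real m * C ^ m * r"
     by (rule propagate[OF VE[OF E] _ r0]) (use r in auto)
    also have "... <= real n * C ^ (2 * n) * r" using Kk[OF mn] r0 by (intro mult_right_mono) auto
    finally have "norm (pr \<psi> (s + int m) - mv ?A2 (pr \<psi> s)) <= real n * C ^ (2 * n) * r" .
    moreover have "norm (mv ?A2 (pr \<psi> s)) <= norm (pr \<psi> (s + int m)) + norm (pr \<psi> (s + int m) - mv ?A2 (pr \<psi> s))"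
     by (metis norm_minus_commute norm_triangle_sub)
    ultimately show "norm (mv ?A2 (pr \<psi> s)) <= norm (pr \<psi> (s + int m)) + real n * C ^ (2 * n) * r" by linarith
   qed (use \<theta>0 in auto)
   also have "... = \<theta> * (norm (pr \<psi> (s - int m)) + norm (pr \<psi> (s + int m))) + \<theta> * (3 * (real n * C ^ (2 * n)) * r)"
    by (simp add: algebra_simps)
   also have "\<theta> * (3 * (real n * C ^ (2 * n)) * r) <= 1 * (3 * (real n * C ^ (2 * n)) * r)"
    using Gm'(2) nC0 r0 by (intro mult_right_mono mult_nonneg_nonneg) auto
   also have "1 * (3 * (real n * C ^ (2 * n)) * r) <= K * r"
    unfolding mult_1 by (rule mult_right_mono[OF KK3 r0])
   finally show "norm (pr \<psi> s) <= \<theta> * (norm (pr \<psi> (s - int m)) + norm (pr \<psi> (s + int m))) + K * r" by simp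
  next
   fix x a \<psi> E r
   assume E: "\<bar>E - E0\<bar> <= w" and r0: "r >= 0" and near: "dist_int (x + of_int (a - 1) * \<omega> - ys) <= 1 / (CE * (real m)^2)"
    and z: "\<psi> (a - 1) = 0" and r: "!!n. a <= n ==> n < a + int nf ==> \<bar>res (pot V \<omega> x) E \<psi> n\<bar> <= r"
   let ?y = "x + of_int (a - 1) * \<omega>"
   let ?T = "tmat V \<omega> E nf ?y"
   have "norm (pr \<psi> (a - 1 + int nf) - mv ?T (pr \<psi> (a - 1))) <= real nf * C ^ nf * r"
    by (rule propagate[OF VE[OF E] _ r0]) (use r in auto)
   then have "\<bar>fst (pr \<psi> (a - 1 + int nf) - mv ?T (pr \<psi> (a - 1)))\<bar> <= real nf * C ^ nf * r"
    using norm_fst_le order_trans by blast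
   moreover have "fst (pr \<psi> (a - 1 + int nf) - mv ?T (pr \<psi> (a - 1))) = \<psi> (a + int nf) - fst ?T * \<psi> a"
    using z by (cases ?T) (simp add: pr_def mv_def)
   moreover have "real nf * C ^ nf * r <= K * r" by (rule mult_right_mono[OF KK[OF nf(1)] r0])
   ultimately have "\<bar>fst ?T * \<psi> a\<bar> <= \<bar>\<psi> (a + int nf)\<bar> + K * r" by linarith
   moreover have "64 * C ^ (m + 2) * \<bar>\<psi> a\<bar> <= \<bar>fst ?T\<bar> * \<bar>\<psi> a\<bar>" using fT[OF E near] by (intro mult_right_mono) auto
   ultimately show "\<bar>\<psi> a\<bar> * (64 * C ^ (m + 2)) <= \<bar>\<psi> (a + int nf)\<bar> + K * r" by (simp add: abs_mult mult_ac)
  next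
   fix x b' \<psi> E r
   assume E: "\<bar>E - E0\<bar> <= w" and r0: "r >= 0" and near: "dist_int (x + of_int (b' - int nf) * \<omega> - ys) <= 1 / (CE * (real m)^2)"
    and z: "\<psi> (b' + 1) = 0" and r: "!!n. b' - int nf < n ==> n <= b' ==> \<bar>res (pot V \<omega> x) E \<psi> n\<bar> <= r"
   let ?y = "x + of_int (b' - int nf) * \<omega>"
   let ?T = "tmat V \<omega> E nf ?y"
   have bb: "b' - int nf + int nf = b'" by simp
   have "norm (pr \<psi> (b' - int nf) - mv (adj2 ?T) (pr \<psi> b')) <= hs ?T * (real nf * C ^ nf * r)"
    using propagate_back[where s = "b' - int nf" and k = nf and x = x and \<psi> = \<psi> and \<omega> = \<omega>, OF VE[OF E] _ r0] r unfolding bb by simp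
   also have "... <= 2 * C ^ nf * (real nf * C ^ nf * r)"
    using hs_tmat_le[where V = V and \<omega> = \<omega> and n = nf and x = ?y, OF VE[OF E]] r0 C1 by (intro mult_right_mono) auto
   also have "... <= K * r"
    using mult_right_mono[OF KK2[OF nf(1)] r0] by (simp only: mult.assoc)
   finally have "\<bar>snd (pr \<psi> (b' - int nf) - mv (adj2 ?T) (pr \<psi> b'))\<bar> <= K * r"
    using norm_snd_le order_trans by blast
   moreover have "snd (pr \<psi> (b' - int nf) - mv (adj2 ?T) (pr \<psi> b')) = \<psi> (b' - int nf) - fst ?T * \<psi> b'"
    using z by (cases ?T) (simp add: pr_def mv_def adj2_def)
   ultimately have "\<bar>fst ?T * \<psi> b'\<bar> <= \<bar>\<psi> (b' - int nf)\<bar> + K * r" by linarith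
   moreover have "64 * C ^ (m + 2) * \<bar>\<psi> b'\<bar> <= \<bar>fst ?T\<bar> * \<bar>\<psi> b'\<bar>" using fT[OF E near] by (intro mult_right_mono) auto
   ultimately show "\<bar>\<psi> b'\<bar> * (64 * C ^ (m + 2)) <= \<bar>\<psi> (b' - int nf)\<bar> + K * r" by (simp add: abs_mult mult_ac)
  next
   fix x a \<psi> \<psi>' E E' r
   assume E: "\<bar>E - E0\<bar> <= w" "\<bar>E' - E0\<bar> <= w" and r0: "r >= 0" and Kr: "K * r <= \<theta> / 4"
    and z: "\<psi> (a - 1) = 0" "\<psi> a = 1" "\<psi>' (a - 1) = 0" "\<psi>' a = 1"
    and r: "!!n. a <= n ==> n < a + int m ==> \<bar>res (pot V \<omega> x) E \<psi> n\<bar> <= r"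
     "!!n. a <= n ==> n < a + int m ==> \<bar>res (pot V \<omega> (x + \<omega>)) E' \<psi>' n\<bar> <= r"
    and sm: "norm (pr \<psi> (a - 1 + int m)) <= 4 * \<theta>" "norm (pr \<psi>' (a - 1 + int m)) <= 4 * \<theta>"
   have one: "norm (mv (tmat V \<omega> E0 m (x' + of_int (a - 1) * \<omega>)) (1, 0)) <= 5 * \<theta>"
    if E: "\<bar>E - E0\<bar> <= w" and z: "\<psi> (a - 1) = 0" "\<psi> a = 1"
     and r: "!!n. a <= n ==> n < a + int m ==> \<bar>res (pot V \<omega> x') E \<psi> n\<bar> <= r"
     and sm: "norm (pr \<psi> (a - 1 + int m)) <= 4 * \<theta>" for x' E \<psi>
   proof -
    let ?T = "tmat V \<omega> E m (x' + of_int (a - 1) * \<omega>)" and ?S = "tmat V \<omega> E0 m (x' + of_int (a - 1) * \<omega>)"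
    have p: "pr \<psi> (a - 1) = (1, 0)" using z by (simp add: pr_def)
    have "norm (pr \<psi> (a - 1 + int m) - mv ?T (pr \<psi> (a - 1))) <= real m * C ^ m * r"
     by (rule propagate[OF VE[OF E] _ r0]) (use r in auto)
    also have "... <= K * r" by (rule mult_right_mono[OF KK[OF mn] r0])
    finally have 1: "norm (pr \<psi> (a - 1 + int m) - mv ?T (1, 0)) <= \<theta> / 4" using Kr unfolding p by linarith
    have "norm (mv (?T - ?S) (1, 0)) <= hs (?T - ?S) * norm (1::real, 0::real)" by (rule norm_mv_le)
    then have "norm (mv ?T (1, 0) - mv ?S (1, 0)) <= hs (?T - ?S)" unfolding mat_diff_mv by (simp add: norm_Pair)
    moreover have "hs (?T - ?S) <= \<theta> / 4" by (rule lip[OF E]) (use mn in simp)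
    ultimately have 2: "norm (mv ?T (1, 0) - mv ?S (1, 0)) <= \<theta> / 4" by linarith
    have "norm (mv ?S (1, 0)) <= norm (pr \<psi> (a - 1 + int m)) + norm (pr \<psi> (a - 1 + int m) - mv ?T (1, 0)) + norm (mv ?T (1, 0) - mv ?S (1, 0))"
     by (smt (verit) norm_triangle_sub norm_minus_commute)
    then show ?thesis using 1 2 sm \<theta>0 by linarith
   qed
   let ?y = "x + of_int (a - 1) * \<omega>"
   have "norm (mv (tmat V \<omega> E0 m ?y) (1, 0)) <= 5 * \<theta>" by (rule one[OF E(1) z(1,2) r(1) sm(1)])
   moreover have "norm (mv (tmat V \<omega> E0 m (?y + \<omega>)) (1, 0)) <= 5 * \<theta>"
    using one[OF E(2) z(3,4) r(2) sm(2)] by (simp add: algebra_simps)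
   ultimately show False
    using \<theta>0 by (intro no_two_edges[OF VE0 Gm'(1)]) auto
  qed
  show ?thesis
   by (rule exI[of _ m], rule exI[of _ nf], rule exI[of _ \<theta>], rule exI[of _ K], rule exI[of _ ys], rule exI[of _ \<Theta>])
    (use sc g in \<open>auto simp: w_def\<close>)
 qed
 have b02: "b0 >= 2" using gs(2) unfolding b0_def by simp
 show ?thesis by (rule that[OF gs(1) CW CE b02]) (rule main)
qed

section \<open>Approximate eigenvalues on finitely supported sequences\<close>

definition fsupp :: "int set => (int => real) => bool" where
 "fsupp I f \<longleftrightarrow> finite {n. f n ~= 0} & (ALL n. n \<notin> I --> f n = 0)"

definition ip :: "(int => real) => (int => real) => real" where
 "ip f g = (\<Sum>n | f n ~= 0. f n * g n)"

abbreviation nsq :: "(int => real) => real" where "nsq f \<equiv> ip f f"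

definition ham :: "int set => (int => real) => real => (int => real) => int => real" where
 "ham I U E \<psi> n = (if n \<in> I then res U E \<psi> n else 0)"

text \<open>Membership of \<open>E\<close> in the spectrum of the restriction to \<open>I\<close>, in terms of real
finitely supported sequences only.\<close>

definition approx_eig :: "int set => (int => real) => real => bool" where
 "approx_eig I U E \<longleftrightarrow> (\<forall>e>0. \<exists>\<psi>. fsupp I \<psi> & nsq \<psi> > 0 & nsq (ham I U E \<psi>) <= e * nsq \<psi>)"

lemma ip_eq:
 assumes "finite F" "!!n. n \<notin> F ==> f n = 0"
 shows "ip f g = (\<Sum>n\<in>F. f n * g n)"
 unfolding ip_def by (rule sum.mono_neutral_left) (use assms in auto)

lemma fsuppI:
 assumes "finite F" "!!n. n \<notin> F ==> f n = 0" "!!n. n \<notin> I ==> f n = 0"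
 shows "fsupp I f"
proof -
 have "{n. f n ~= 0} \<subseteq> F" using assms(2) by blast
 then show ?thesis unfolding fsupp_def using assms(1,3) finite_subset by blast
qed

lemma fsupp_comb:
 assumes "fsupp I f" "fsupp I g"
 shows "fsupp I (%n. a * f n + b * g n)"
proof (rule fsuppI[of "{n. f n ~= 0} \<union> {n. g n ~= 0}"])
 show "finite ({n. f n ~= 0} \<union> {n. g n ~= 0})" using assms unfolding fsupp_def by blast
 show "a * f n + b * g n = 0" if "n \<notin> I" for n using assms that unfolding fsupp_def by simp
qed simp

lemma ip_commute:
 assumes "fsupp I f" "fsupp I g"
 shows "ip f g = ip g f"
proof -
 let ?F = "{n. f n ~= 0} \<union> {n. g n ~= 0}"
 have "ip f g = (\<Sum>n\<in>?F. f n * g n)" by (rule ip_eq) (use assms in \<open>auto simp: fsupp_def\<close>)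
 also have "... = (\<Sum>n\<in>?F. g n * f n)" by (simp only: mult.commute)
 also have "... = ip g f" by (rule ip_eq[symmetric]) (use assms in \<open>auto simp: fsupp_def\<close>)
 finally show ?thesis .
qed

lemma ip_comb_left:
 assumes "fsupp I f" "fsupp I g"
 shows "ip (%n. a * f n + b * g n) h = a * ip f h + b * ip g h"
proof -
 let ?F = "{n. f n ~= 0} \<union> {n. g n ~= 0}"
 have "ip (%n. a * f n + b * g n) h = (\<Sum>n\<in>?F. (a * f n + b * g n) * h n)" "ip f h = (\<Sum>n\<in>?F. f n * h n)" "ip g h = (\<Sum>n\<in>?F. g n * h n)"
  by (rule ip_eq; use assms in \<open>auto simp: fsupp_def\<close>)+
 then show ?thesis by (simp add: sum.distrib sum_distrib_left algebra_simps)
qed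

lemma ip_comb_right:
 assumes "fsupp I f" "fsupp I g" "fsupp I h"
 shows "ip h (%n. a * f n + b * g n) = a * ip h f + b * ip h g"
 unfolding ip_commute[OF assms(3) fsupp_comb[OF assms(1,2)]] ip_comb_left[OF assms(1,2)]
 using ip_commute[OF assms(3,1)] ip_commute[OF assms(3,2)] by simp

lemma nsq_nonneg: "nsq f >= 0"
 unfolding ip_def by (intro sum_nonneg) auto

lemma nsq_ge: "fsupp I f ==> (f n)\<^sup>2 <= nsq f"
proof (cases "f n = 0")
 case False
 assume "fsupp I f"
 then show ?thesis unfolding ip_def fsupp_def power2_eq_square
  using False by (intro member_le_sum[of n "{n. f n ~= 0}" "%n. f n * f n"]) auto
qed (simp add: nsq_nonneg)

lemma fsupp_ham: "fsupp I f ==> fsupp I (ham I U E f)"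
proof -
 assume f: "fsupp I f"
 let ?F = "{n. f n ~= 0}"
 show ?thesis
 proof (rule fsuppI[of "?F \<union> (%n. n + 1) ` ?F \<union> (%n. n - 1) ` ?F"])
  show "finite (?F \<union> (%n. n + 1) ` ?F \<union> (%n. n - 1) ` ?F)" using f by (simp add: fsupp_def)
  fix n assume "n \<notin> ?F \<union> (%n. n + 1) ` ?F \<union> (%n. n - 1) ` ?F"
  then have "f n = 0" "f (n - 1) = 0" "f (n + 1) = 0" by (auto simp: image_iff)
  then show "ham I U E f n = 0" by (simp add: ham_def res_def)
 qed (simp add: ham_def)
qed

lemma ham_comb: "ham I U E (%n. a * f n + b * g n) = (%n. a * ham I U E f n + b * ham I U E g n)"
 by (rule ext) (simp add: ham_def res_def algebra_simps)

lemma ham_energy: "fsupp I f ==> ham I U (E + \<mu>) f = (%n. 1 * ham I U E f n + (- \<mu>) * f n)"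
 by (rule ext) (auto simp: ham_def res_def fsupp_def algebra_simps)

lemma ham_symmetric:
 assumes f: "fsupp I f" and g: "fsupp I g"
 shows "ip (ham I U E f) g = ip f (ham I U E g)"
proof -
 let ?S = "{n. f n ~= 0} \<union> {n. g n ~= 0}"
 have "finite ?S" using f g by (simp add: fsupp_def)
 then have fA: "finite (abs ` ?S)" by simp
 define M where "M = Max (insert 0 (abs ` ?S)) + 1"
 have bd: "\<bar>n\<bar> <= M - 1" if "n \<in> ?S" for n
  unfolding M_def using fA that by (auto intro!: Max_ge)
 have f0: "f n = 0" if "\<bar>n\<bar> >= M" for n using bd[of n] that by force
 have g0: "g n = 0" if "\<bar>n\<bar> >= M" for n using bd[of n] that by force
 have M0: "M >= 1" unfolding M_def using fA Max_ge[of "insert 0 (abs ` ?S)" 0] by simp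
 have out: "f n = 0" "g n = 0" if "n \<notin> {- M..M}" for n using that f0[of n] g0[of n] by auto
 have cut: "ham I U E f n * g n = res U E f n * g n" "f n * ham I U E g n = f n * res U E g n" for n
  using f g by (auto simp: ham_def fsupp_def)
 have h0: "ham I U E f n = 0" if "n \<notin> {- M - 1..M + 1}" for n
  using that f0[of n] f0[of "n - 1"] f0[of "n + 1"] by (auto simp: ham_def res_def)
 have "ip (ham I U E f) g = (\<Sum>n\<in>{- M - 1..M + 1}. ham I U E f n * g n)" by (rule ip_eq) (use h0 in auto)
 also have "... = (\<Sum>n\<in>{- M..M}. ham I U E f n * g n)"
  by (rule sum.mono_neutral_right) (use out in auto)
 finally have L: "ip (ham I U E f) g = (\<Sum>n\<in>{- M..M}. res U E f n * g n)" unfolding cut .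
 have R: "ip f (ham I U E g) = (\<Sum>n\<in>{- M..M}. f n * res U E g n)"
  unfolding cut[symmetric] by (rule ip_eq) (use out in auto)
 have sh: "(\<Sum>n\<in>{- M..M}. u (n - 1) * v n) = (\<Sum>n\<in>{- M..M}. u n * v (n + 1))"
  if "!!n. \<bar>n\<bar> >= M ==> u n = 0" "!!n. \<bar>n\<bar> >= M ==> v n = 0" for u v :: "int => real"
 proof -
  have "(\<Sum>n\<in>{- M..M}. u (n - 1) * v n) = (\<Sum>n\<in>{- M + 1..M}. u (n - 1) * v n)"
   by (rule sum.mono_neutral_right) (use that M0 in auto)
  also have "... = (\<Sum>n\<in>{- M..M - 1}. u n * v (n + 1))"
   by (rule sum.reindex_bij_witness[of _ "%n. n + 1" "%n. n - 1"]) auto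
  also have "... = (\<Sum>n\<in>{- M..M}. u n * v (n + 1))"
   by (rule sum.mono_neutral_left) (use that M0 in auto)
  finally show ?thesis .
 qed
 have 1: "(\<Sum>n\<in>{- M..M}. f (n - 1) * g n) = (\<Sum>n\<in>{- M..M}. f n * g (n + 1))" by (rule sh[OF f0 g0])
 have 2: "(\<Sum>n\<in>{- M..M}. g (n - 1) * f n) = (\<Sum>n\<in>{- M..M}. g n * f (n + 1))" by (rule sh[OF g0 f0])
 have "(\<Sum>n\<in>{- M..M}. res U E f n * g n) = - (\<Sum>n\<in>{- M..M}. f (n - 1) * g n) - (\<Sum>n\<in>{- M..M}. g n * f (n + 1)) + (\<Sum>n\<in>{- M..M}. (U n - E) * f n * g n)"
  unfolding res_def by (simp add: sum.distrib sum_subtractf sum_negf algebra_simps)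
 also have "... = - (\<Sum>n\<in>{- M..M}. f n * g (n + 1)) - (\<Sum>n\<in>{- M..M}. g (n - 1) * f n) + (\<Sum>n\<in>{- M..M}. (U n - E) * f n * g n)"
  unfolding 1 2 ..
 also have "... = (\<Sum>n\<in>{- M..M}. f n * res U E g n)"
  unfolding res_def by (simp add: sum.distrib sum_subtractf sum_negf algebra_simps)
 finally show ?thesis unfolding L R .
qed

lemma nsq_eq_sum: "finite F ==> (!!n. n \<notin> F ==> f n = 0) ==> nsq f = (\<Sum>n\<in>F. (f n)^2)"
 unfolding power2_eq_square by (rule ip_eq)

lemma nsq_shift:
 assumes "fsupp I f"
 shows "nsq (%n. f (n + k)) = nsq f"
proof -
 let ?F = "{n. f n ~= 0}"
 have fin: "finite ?F" using assms by (simp add: fsupp_def)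
 have "nsq (%n. f (n + k)) = (\<Sum>n\<in>(%n. n - k) ` ?F. (f (n + k))^2)"
 proof (rule nsq_eq_sum)
  fix n assume "n \<notin> (%n. n - k) ` ?F"
  show "f (n + k) = 0"
  proof (rule ccontr)
   assume "f (n + k) ~= 0"
   then have "n + k - k \<in> (%n. n - k) ` ?F" by (intro imageI) simp
   then show False using \<open>n \<notin> _\<close> by simp
  qed
 qed (use fin in simp)
 also have "... = (\<Sum>n\<in>?F. (f n)^2)" by (subst sum.reindex) (auto simp: inj_on_def)
 also have "... = nsq f" by (rule nsq_eq_sum[symmetric]) (use fin in auto)
 finally show ?thesis .
qed

lemma ham_bounded:
 assumes U: "!!n. \<bar>U n - E\<bar> <= M" and f: "fsupp I f"
 shows "nsq (ham I U E f) <= 3 * (2 + M^2) * nsq f"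
proof -
 let ?S = "{n. f n ~= 0}" let ?F = "?S \<union> (%n. n + 1) ` ?S \<union> (%n. n - 1) ` ?S"
 have fin: "finite ?F" using f by (simp add: fsupp_def)
 have z: "f n = 0 & f (n - 1) = 0 & f (n + 1) = 0" if "n \<notin> ?F" for n
  using that by (auto simp: image_iff)
 have M2: "M^2 >= 0" by simp
 have n1: "nsq (%n. f (n - 1)) = nsq f" "nsq (%n. f (n + 1)) = nsq f"
  using nsq_shift[OF f, of "- 1"] nsq_shift[OF f, of 1] by simp_all
 have "nsq (ham I U E f) = (\<Sum>n\<in>?F. (ham I U E f n)^2)"
 proof (rule nsq_eq_sum[OF fin])
  fix n assume "n \<notin> ?F"
  from z[OF this] show "ham I U E f n = 0" unfolding ham_def res_def by simp
 qed
 also have "... <= (\<Sum>n\<in>?F. 3 * ((f (n - 1))^2 + (f (n + 1))^2 + M^2 * (f n)^2))"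
 proof (rule sum_mono)
  fix n
  have sq: "(- a - b + c)^2 <= 3 * (a^2 + b^2 + c^2)" for a b c :: real
  proof -
   have "3 * (a^2 + b^2 + c^2) - (- a - b + c)^2 = (a - b)^2 + (a + c)^2 + (b + c)^2"
    by (simp add: power2_eq_square algebra_simps)
   then show ?thesis using zero_le_power2[of "a - b"] zero_le_power2[of "a + c"] zero_le_power2[of "b + c"] by linarith
  qed
  have "\<bar>U n - E\<bar>^2 <= M^2" by (rule power_mono[OF U]) simp
  then have "((U n - E) * f n)^2 <= M^2 * (f n)^2"
   unfolding power_mult_distrib by (intro mult_right_mono) auto
  then have "(res U E f n)^2 <= 3 * ((f (n - 1))^2 + (f (n + 1))^2 + M^2 * (f n)^2)"
   unfolding res_def by (intro order_trans[OF sq] mult_left_mono add_mono order_refl) simp_all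
  then show "(ham I U E f n)^2 <= 3 * ((f (n - 1))^2 + (f (n + 1))^2 + M^2 * (f n)^2)"
   by (auto simp: ham_def intro!: add_nonneg_nonneg)
 qed
 also have "... = 3 * ((\<Sum>n\<in>?F. (f (n - 1))^2) + (\<Sum>n\<in>?F. (f (n + 1))^2) + M^2 * (\<Sum>n\<in>?F. (f n)^2))"
  by (simp add: sum.distrib sum_distrib_left algebra_simps)
 also have "(\<Sum>n\<in>?F. (f (n - 1))^2) = nsq (%n. f (n - 1))" by (rule nsq_eq_sum[symmetric, OF fin]) (use z in blast)
 also have "(\<Sum>n\<in>?F. (f (n + 1))^2) = nsq (%n. f (n + 1))" by (rule nsq_eq_sum[symmetric, OF fin]) (use z in blast)
 also have "(\<Sum>n\<in>?F. (f n)^2) = nsq f" by (rule nsq_eq_sum[symmetric, OF fin]) (use z in blast)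
 finally show ?thesis unfolding n1 by (simp add: algebra_simps)
qed

lemma quadratic_discriminant:
 fixes a b c :: real
 assumes "!!t. a + 2 * t * b + t^2 * c >= 0" "c >= 0"
 shows "b^2 <= a * c"
proof (cases "c = 0")
 case True
 have "b = 0"
 proof (rule ccontr)
  assume b: "b ~= 0"
  have "a + 2 * (- (a + 1) / (2 * b)) * b >= 0" using assms(1)[of "- (a + 1) / (2 * b)"] True by simp
  then show False using b by (simp add: field_simps)
 qed
 then show ?thesis using True by simp
next
 case False
 then have c: "c > 0" using assms(2) by simp
 have "a + 2 * (- b / c) * b + (- b / c)^2 * c >= 0" by (rule assms(1))
 also have "a + 2 * (- b / c) * b + (- b / c)^2 * c = a - b^2 / c" using c by (simp add: power2_eq_square field_simps)
 finally show ?thesis using c by (simp add: field_simps)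
qed

text \<open>An approximate eigenfunction with error \<open>\<sigma>\<close> forces spectrum within
\<open>\<sigma>\<close>. Let \<open>s\<^sup>2\<close> be the infimum of \<open>\<parallel>T f\<parallel>\<^sup>2 /
\<parallel>f\<parallel>\<^sup>2\<close>. For near minimizers \<open>f\<close>, \<open>T\<^sup>2 f - s\<^sup>2
f\<close> is small by Cauchy--Schwarz for the nonnegative form \<open>\<parallel>T f\<parallel>\<^sup>2 - s\<^sup>2 *
\<parallel>f\<parallel>\<^sup>2\<close>; factor it as \<open>(T + s) (T - s)\<close>.\<close>

theorem approx_eig_near:
 assumes U: "!!n. \<bar>U n - E\<bar> <= M" and \<psi>: "fsupp I \<psi>" "nsq \<psi> > 0" "nsq (ham I U E \<psi>) <= \<sigma>^2 * nsq \<psi>" and \<sigma>: "\<sigma> >= 0"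
 obtains E1 where "\<bar>E1 - E\<bar> <= \<sigma>" "approx_eig I U E1"
proof -
 let ?T = "ham I U E"
 define B where "B = 3 * (2 + M^2)"
 have B0: "B > 0" unfolding B_def by (intro mult_pos_pos add_pos_nonneg) auto
 have Tb: "nsq (?T f) <= B * nsq f" if "fsupp I f" for f unfolding B_def by (rule ham_bounded[OF U that])
 define A where "A = {nsq (?T f) / nsq f | f. fsupp I f & nsq f > 0}"
 have Ane: "A ~= {}" unfolding A_def using \<psi> by blast
 have Alow: "!!a. a \<in> A ==> 0 <= a" unfolding A_def using nsq_nonneg by (auto intro!: divide_nonneg_nonneg)
 have Abdd: "bdd_below A" using Alow by (rule bdd_belowI)
 define s2 where "s2 = Inf A"
 have s20: "s2 >= 0" unfolding s2_def by (rule cInf_greatest[OF Ane Alow])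
 define s where "s = sqrt s2"
 have ss: "s * s = s2" "s >= 0" unfolding s_def using s20 by auto
 have sle: "s <= \<sigma>"
 proof -
  have "s2 <= nsq (?T \<psi>) / nsq \<psi>" unfolding s2_def A_def by (rule cInf_lower[OF _ Abdd[unfolded A_def]]) (use \<psi> in blast)
  also have "... <= \<sigma>^2" using \<psi> by (simp add: pos_divide_le_eq)
  finally show ?thesis unfolding s_def by (rule real_le_lsqrt[OF \<sigma>])
 qed
 have low: "s2 * nsq f <= nsq (?T f)" if f: "fsupp I f" for f
 proof (cases "nsq f > 0")
  case True
  then have "s2 <= nsq (?T f) / nsq f" unfolding s2_def A_def by (intro cInf_lower[OF _ Abdd[unfolded A_def]]) (use f in blast)
  then show ?thesis using True by (simp add: pos_le_divide_eq)
 next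
  case False
  then have "nsq f = 0" using nsq_nonneg[of f] by linarith
  then show ?thesis using nsq_nonneg[of "?T f"] by simp
 qed
 have almost: "\<exists>f. fsupp I f & nsq f > 0 & nsq (?T f) <= (s2 + e) * nsq f" if e: "e > 0" for e
 proof -
  obtain a where "a \<in> A" "a < s2 + e" using cInf_lessD[OF Ane, of "s2 + e"] e unfolding s2_def by auto
  then obtain f where f: "fsupp I f" "nsq f > 0" "nsq (?T f) / nsq f < s2 + e" unfolding A_def by blast
  have "nsq (?T f) < (s2 + e) * nsq f" using f by (simp add: pos_divide_less_eq)
  then show ?thesis using f by (intro exI[of _ f]) auto
 qed
 have en: "nsq (ham I U (E + \<mu>) f) = nsq (?T f) - 2 * \<mu> * ip (?T f) f + \<mu>^2 * nsq f" if f: "fsupp I f" for f \<mu>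
 proof -
  note fT = fsupp_ham[OF f, of U E]
  show ?thesis unfolding ham_energy[OF f] ip_comb_left[OF fT f] ip_comb_right[OF fT f fT] ip_comb_right[OF fT f f]
   using ip_commute[OF f fT] by (simp add: power2_eq_square algebra_simps)
 qed
 have dich: "(\<exists>f. fsupp I f & nsq f > 0 & nsq (ham I U (E + s) f) <= e * (B + 1) * nsq f) |
   (\<exists>f. fsupp I f & nsq f > 0 & nsq (ham I U (E + (- s)) f) <= e * (B + 1) * nsq f)" if e: "e > 0" for e
 proof -
  obtain f where f: "fsupp I f" "nsq f > 0" "nsq (?T f) <= (s2 + e^2) * nsq f" using almost[of "e^2"] e by auto
  note fT = fsupp_ham[OF f(1), of U E]
  note fTT = fsupp_ham[OF fT, of U E]
  define P where "P = (%n. 1 * ?T (?T f) n + (- s2) * f n)"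
  have fP: "fsupp I P" unfolding P_def by (rule fsupp_comb[OF fTT f(1)])
  note fTP = fsupp_ham[OF fP, of U E]
  have bP: "ip (?T f) (?T P) - s2 * ip f P = nsq P"
  proof -
   have "ip (?T f) (?T P) = ip (?T (?T f)) P" by (rule ham_symmetric[OF fT fP, symmetric])
   then have "ip (?T f) (?T P) - s2 * ip f P = 1 * ip (?T (?T f)) P + (- s2) * ip f P" by simp
   also have "... = nsq P" unfolding ip_comb_left[OF fTT f(1), symmetric] P_def[symmetric] ..
   finally show ?thesis .
  qed
  have "(ip (?T f) (?T P) - s2 * ip f P)^2 <= (nsq (?T f) - s2 * nsq f) * (nsq (?T P) - s2 * nsq P)"
  proof (rule quadratic_discriminant)
   fix t :: real
   let ?g = "%n. 1 * f n + t * P n"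
   have g: "fsupp I ?g" by (rule fsupp_comb[OF f(1) fP])
   have "nsq (?T ?g) - s2 * nsq ?g >= 0" using low[OF g] by simp
   moreover have "nsq (?T ?g) = nsq (?T f) + 2 * t * ip (?T f) (?T P) + t^2 * nsq (?T P)"
    unfolding ham_comb ip_comb_left[OF fT fTP] ip_comb_right[OF fT fTP fT] ip_comb_right[OF fT fTP fTP]
    using ip_commute[OF fT fTP] by (simp add: power2_eq_square algebra_simps)
   moreover have "nsq ?g = nsq f + 2 * t * ip f P + t^2 * nsq P"
    unfolding ip_comb_left[OF f(1) fP] ip_comb_right[OF f(1) fP f(1)] ip_comb_right[OF f(1) fP fP]
    using ip_commute[OF f(1) fP] by (simp add: power2_eq_square algebra_simps)
   ultimately show "nsq (?T f) - s2 * nsq f + 2 * t * (ip (?T f) (?T P) - s2 * ip f P) + t^2 * (nsq (?T P) - s2 * nsq P) >= 0"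
    by (simp add: algebra_simps)
  qed (use low[OF fP] in simp)
  also have "... <= (e^2 * nsq f) * (B * nsq P)"
  proof (rule mult_mono)
   show "nsq (?T f) - s2 * nsq f <= e^2 * nsq f" using f(3) by (simp add: algebra_simps)
   show "nsq (?T P) - s2 * nsq P <= B * nsq P" using Tb[OF fP] mult_nonneg_nonneg[OF s20 nsq_nonneg[of P]] by linarith
   show "0 <= e^2 * nsq f" using f(2) by simp
   show "0 <= nsq (?T P) - s2 * nsq P" using low[OF fP] by simp
  qed
  finally have "nsq P * nsq P <= (e^2 * nsq f * B) * nsq P" unfolding bP by (simp add: power2_eq_square mult_ac)
  then have PB: "nsq P <= e^2 * nsq f * B"
   using nsq_nonneg[of P] f(2) B0 by (cases "nsq P = 0") auto
  define h where "h = ham I U (E + (- s)) f"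
  have fh: "fsupp I h" unfolding h_def by (rule fsupp_ham[OF f(1)])
  have "ham I U (E + s) h = P"
  proof
   fix n
   have he: "h = (%n. 1 * ?T f n + s * f n)" unfolding h_def ham_energy[OF f(1)] by simp
   have Te: "?T h = (%n. 1 * ?T (?T f) n + s * ?T f n)" unfolding he by (rule ham_comb)
   have "ham I U (E + s) h n = ?T h n - s * h n" unfolding ham_energy[OF fh] by simp
   also have "... = ?T (?T f) n - (s * s) * f n" unfolding Te unfolding he by (simp add: algebra_simps)
   finally show "ham I U (E + s) h n = P n" unfolding P_def ss by simp
  qed
  show ?thesis
  proof (cases "nsq h >= e * nsq f")
   case True
   have "nsq h > 0" using True e f(2) by (meson mult_pos_pos order_less_le_trans)
   moreover have "nsq (ham I U (E + s) h) <= e * (B + 1) * nsq h"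
   proof -
    have "nsq P <= e * B * (e * nsq f)" using PB by (simp add: power2_eq_square mult_ac)
    also have "... <= e * B * nsq h" using True e B0 by (intro mult_left_mono) auto
    also have "... <= e * (B + 1) * nsq h" using e nsq_nonneg[of h] by (intro mult_right_mono mult_left_mono) auto
    finally show ?thesis unfolding \<open>ham I U (E + s) h = P\<close> .
   qed
   ultimately show ?thesis using fh by blast
  next
   case False
   have "e * 1 * nsq f <= e * (B + 1) * nsq f" using e B0 f(2) by (intro mult_right_mono mult_left_mono) auto
   then have "nsq (ham I U (E + (- s)) f) <= e * (B + 1) * nsq f" using False unfolding h_def by simp
   then show ?thesis using f by blast
  qed
 qed
 show ?thesis
 proof (cases "approx_eig I U (E + s)")
  case True
  show ?thesis by (rule that[OF _ True]) (use ss sle in simp)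
 next
  case False
  then obtain e0 where e0: "e0 > 0" "!!f. fsupp I f ==> nsq f > 0 ==> ~ nsq (ham I U (E + s) f) <= e0 * nsq f"
   unfolding approx_eig_def by blast
  have "approx_eig I U (E + (- s))" unfolding approx_eig_def
  proof (intro allI impI)
   fix e :: real assume e: "e > 0"
   define e' where "e' = min e e0 / (B + 1)"
   have e': "e' > 0" unfolding e'_def using e e0 B0 by simp
   have eB: "e' * (B + 1) = min e e0" unfolding e'_def using B0 by simp
   have "~ (\<exists>f. fsupp I f & nsq f > 0 & nsq (ham I U (E + s) f) <= e' * (B + 1) * nsq f)"
   proof
    assume "\<exists>f. fsupp I f & nsq f > 0 & nsq (ham I U (E + s) f) <= e' * (B + 1) * nsq f"
    then obtain f where f: "fsupp I f" "nsq f > 0" "nsq (ham I U (E + s) f) <= min e e0 * nsq f" unfolding eB by blast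
    have "min e e0 * nsq f <= e0 * nsq f" using f(2) by (intro mult_right_mono) auto
    then show False using e0(2)[OF f(1,2)] f(3) by linarith
   qed
   then obtain f where f: "fsupp I f" "nsq f > 0" "nsq (ham I U (E + (- s)) f) <= min e e0 * nsq f"
    using dich[OF e'] unfolding eB by blast
   have "min e e0 * nsq f <= e * nsq f" using f(2) by (intro mult_right_mono) auto
   with f(3) have "nsq (ham I U (E + (- s)) f) <= e * nsq f" by (rule order_trans)
   then show "\<exists>\<psi>. fsupp I \<psi> & 0 < nsq \<psi> & nsq (ham I U (E + (- s)) \<psi>) <= e * nsq \<psi>"
    using f(1,2) by blast
  qed
  show ?thesis by (rule that[OF _ \<open>approx_eig I U (E + (- s))\<close>]) (use ss sle in simp)
 qed
qed

section \<open>The spectrum consists of approximate eigenvalues\<close>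

definition l2_bound :: "(int => real) => real => bool" where
 "l2_bound f B \<longleftrightarrow> (ALL F. finite F --> (\<Sum>n\<in>F. (f n)^2) <= B)"

abbreviation cut :: "int => (int => real) => int => real" where
 "cut M f n \<equiv> (if \<bar>n\<bar> <= M then f n else 0)"

lemma fsupp_cut: "(!!n. n \<notin> I ==> f n = 0) ==> fsupp I (cut M f)"
 by (rule fsuppI[of "{- M..M}"]) auto

lemma nsq_cut: "l2_bound f B ==> nsq (cut M f) <= B"
proof -
 assume f: "l2_bound f B"
 have "nsq (cut M f) = (\<Sum>n\<in>{- M..M}. (cut M f n)^2)" by (rule nsq_eq_sum) auto
 also have "... = (\<Sum>n\<in>{- M..M}. (f n)^2)" by (rule sum.cong) auto
 finally show ?thesis using f unfolding l2_bound_def by simp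
qed

lemma sum_le_nsq: "fsupp I f ==> finite F ==> (\<Sum>n\<in>F. (f n)^2) <= nsq f"
proof -
 assume f: "fsupp I f" "finite F"
 have "nsq f = (\<Sum>n\<in>F \<union> {n. f n ~= 0}. (f n)^2)" by (rule nsq_eq_sum) (use f in \<open>auto simp: fsupp_def\<close>)
 moreover have "(\<Sum>n\<in>F. (f n)^2) <= (\<Sum>n\<in>F \<union> {n. f n ~= 0}. (f n)^2)"
  by (rule sum_mono2) (use f in \<open>auto simp: fsupp_def\<close>)
 ultimately show ?thesis by simp
qed

lemma finite_int_bound: "finite F ==> \<exists>M. \<forall>n\<in>F. \<bar>n\<bar> <= (M::int)"
 by (rule exI[of _ "Max (insert 0 (abs ` F))"]) (auto intro!: Max_ge)

text \<open>A local operator bounded on finitely supported sequences has the same bound on square-summable ones: cut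
off beyond the finite set on which the sum is taken.\<close>

lemma l2_bound_transfer:
 assumes f: "l2_bound f B" "!!n. n \<notin> I ==> f n = 0"
  and op: "!!g. fsupp I g ==> fsupp I (Q g)" "!!g. fsupp I g ==> nsq (Q g) <= q * nsq g"
  and loc: "!!n M. \<bar>n\<bar> + 2 <= M ==> Q (cut M f) n = Q f n" and q: "q >= 0"
 shows "l2_bound (Q f) (q * B)"
 unfolding l2_bound_def
proof (intro allI impI)
 fix F :: "int set" assume F: "finite F"
 then obtain M where M: "\<forall>n\<in>F. \<bar>n\<bar> <= M" using finite_int_bound by blast
 have c: "fsupp I (cut (M + 2) f)" by (rule fsupp_cut[OF f(2)])
 have "(\<Sum>n\<in>F. (Q f n)^2) = (\<Sum>n\<in>F. (Q (cut (M + 2) f) n)^2)"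
 proof (rule sum.cong[OF refl])
  fix n assume "n \<in> F"
  then have "\<bar>n\<bar> + 2 <= M + 2" using M by auto
  then show "(Q f n)^2 = (Q (cut (M + 2) f) n)^2" using loc[of n "M + 2"] by simp
 qed
 also have "... <= nsq (Q (cut (M + 2) f))" by (rule sum_le_nsq[OF op(1)[OF c] F])
 also have "... <= q * nsq (cut (M + 2) f)" by (rule op(2)[OF c])
 also have "... <= q * B" by (intro mult_left_mono nsq_cut[OF f(1)] q)
 finally show "(\<Sum>n\<in>F. (Q f n)^2) <= q * B" .
qed

lemma ham_cut: "\<bar>n\<bar> + 1 <= M ==> ham I U E (cut M f) n = ham I U E f n"
proof -
 assume "\<bar>n\<bar> + 1 <= M"
 then have "cut M f n = f n" "cut M f (n - 1) = f (n - 1)" "cut M f (n + 1) = f (n + 1)" by auto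
 then show ?thesis unfolding ham_def res_def by presburger
qed

lemma ham_local: "g n = f n ==> g (n - 1) = f (n - 1) ==> g (n + 1) = f (n + 1) ==> ham I U E g n = ham I U E f n"
 unfolding ham_def res_def by presburger

lemma ham_ham_cut: "\<bar>n\<bar> + 2 <= M ==> ham I U E (ham I U E (cut M f)) n = ham I U E (ham I U E f) n"
 by (rule ham_local; rule ham_cut) auto

lemma l2_bound_ham:
 assumes "!!n. \<bar>U n - E\<bar> <= M" "l2_bound f B" "!!n. n \<notin> I ==> f n = 0"
 shows "l2_bound (ham I U E f) (3 * (2 + M^2) * B)"
 by (rule l2_bound_transfer[OF assms(2,3) fsupp_ham ham_bounded[where U=U and M=M, OF assms(1)] ham_cut]) auto

lemma l2_bound_abs: "l2_bound f B ==> \<bar>f n\<bar> <= sqrt B"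
 unfolding l2_bound_def by (drule spec[of _ "{n}"]) (simp add: real_le_rsqrt)

lemma ham_suminf:
 assumes "!!n. summable (%k. g k n)"
 shows "summable (%k. ham I U E (g k) n)" "ham I U E (%n. \<Sum>k. g k n) n = (\<Sum>k. ham I U E (g k) n)"
proof -
 have "(%k. ham I U E (g k) n) sums ham I U E (%n. \<Sum>k. g k n) n"
 proof (cases "n \<in> I")
  case True
  have "(%k. - g k (n - 1) - g k (n + 1) + (U n - E) * g k n) sums
    (- (\<Sum>k. g k (n - 1)) - (\<Sum>k. g k (n + 1)) + (U n - E) * (\<Sum>k. g k n))"
   by (intro sums_add sums_diff sums_minus sums_mult summable_sums assms)
  then show ?thesis using True by (simp add: ham_def res_def)
 qed (simp add: ham_def)
 then show "summable (%k. ham I U E (g k) n)" "ham I U E (%n. \<Sum>k. g k n) n = (\<Sum>k. ham I U E (g k) n)"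
  by (simp_all add: sums_iff)
qed

lemma L2_set_sum_le: "finite F ==> L2_set (%n. \<Sum>k<K. g k n) F <= (\<Sum>k<K::nat. L2_set (g k) F)"
proof (induction K)
 case (Suc K)
 have "L2_set (%n. \<Sum>k<Suc K. g k n) F <= L2_set (%n. \<Sum>k<K. g k n) F + L2_set (g K) F"
  using L2_set_triangle_ineq[of "%n. \<Sum>k<K. g k n" "g K" F] by simp
 then show ?case using Suc by simp
qed (simp add: L2_set_def)

text \<open>With \<open>\<alpha>\<close> small, \<open>R = 1 - \<alpha> T\<^sup>2\<close> is a strict contraction, so
the Neumann series \<open>\<alpha> \<Sum> R ^ k\<close> inverts \<open>T\<^sup>2\<close>; it is summed pointwise.
Injectivity holds since \<open>T f = 0\<close> makes \<open>f\<close> a fixed point of \<open>R\<close>.\<close>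

theorem bounded_below_inverse:
 assumes U: "!!n. \<bar>U n - E\<bar> <= M"
  and e: "e > 0" "!!f. fsupp I f ==> nsq (ham I U E f) >= e * nsq f"
 obtains C where "C >= 0"
  "!!\<eta> B. l2_bound \<eta> B ==> (!!n. n \<notin> I ==> \<eta> n = 0) ==>
   \<exists>f. l2_bound f (C * B) & (ALL n. n \<notin> I --> f n = 0) & ham I U E f = \<eta>"
  "!!f B. l2_bound f B ==> (!!n. n \<notin> I ==> f n = 0) ==> ham I U E f = (%n. 0) ==> f = (%n. 0)"
proof -
 let ?T = "ham I U E"
 define B0 where "B0 = 3 * (2 + M^2) + e"
 have B0: "B0 > 0" "B0 >= e" unfolding B0_def using e(1) by (auto intro!: add_nonneg_pos)
 have Tb: "nsq (?T f) <= B0 * nsq f" if "fsupp I f" for f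
 proof -
  have "3 * (2 + M^2) * nsq f <= B0 * nsq f" unfolding B0_def using e nsq_nonneg[of f] by (intro mult_right_mono) auto
  then show ?thesis using ham_bounded[where U=U and M=M, OF U that] by linarith
 qed
 define \<alpha> where "\<alpha> = 1 / B0"
 define q where "q = 1 - \<alpha> * e"
 have \<alpha>0: "\<alpha> > 0" "\<alpha> * B0 = 1" unfolding \<alpha>_def using B0 by auto
 have q: "0 <= q" "q < 1" unfolding q_def \<alpha>_def using B0 e by auto
 define R where "R = (%f n. 1 * f n + (- \<alpha>) * ?T (?T f) n)"
 have R1: "fsupp I (R f)" if "fsupp I f" for f unfolding R_def by (intro fsupp_comb fsupp_ham that)
 have R2: "nsq (R f) <= q * nsq f" if f: "fsupp I f" for f
 proof -
  note fT = fsupp_ham[OF f, of U E]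
  note fTT = fsupp_ham[OF fT, of U E]
  have "ip (?T (?T f)) f = nsq (?T f)" by (rule ham_symmetric[OF fT f])
  moreover have "ip f (?T (?T f)) = nsq (?T f)" using ham_symmetric[OF f fT, of U E] by simp
  ultimately have "nsq (R f) = nsq f - 2 * \<alpha> * nsq (?T f) + \<alpha> * (\<alpha> * nsq (?T (?T f)))"
   unfolding R_def ip_comb_left[OF f fTT] ip_comb_right[OF f fTT f] ip_comb_right[OF f fTT fTT]
   by (simp add: algebra_simps)
  also have "\<alpha> * (\<alpha> * nsq (?T (?T f))) <= \<alpha> * (\<alpha> * (B0 * nsq (?T f)))"
   using \<alpha>0 Tb[OF fT] by (intro mult_left_mono) auto
  also have "\<alpha> * (\<alpha> * (B0 * nsq (?T f))) = \<alpha> * (\<alpha> * B0) * nsq (?T f)" by (simp only: mult_ac)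
  also have "nsq f - 2 * \<alpha> * nsq (?T f) + \<alpha> * (\<alpha> * B0) * nsq (?T f) = nsq f - \<alpha> * nsq (?T f)"
   unfolding \<alpha>0(2) by simp
  also have "... <= nsq f - \<alpha> * (e * nsq f)" using e(2)[OF f] \<alpha>0 by simp
  also have "... = q * nsq f" unfolding q_def by (simp add: algebra_simps)
  finally show ?thesis by simp
 qed
 have Rs: "R f n = 0" if "!!n. n \<notin> I ==> f n = 0" "n \<notin> I" for f n using that by (simp add: R_def ham_def)
 have Rb: "l2_bound (R f) (q * B)" if "l2_bound f B" "!!n. n \<notin> I ==> f n = 0" for f B
  by (rule l2_bound_transfer[OF that R1 R2 _ q(1)]) (simp_all add: R_def ham_ham_cut)
 have inj: "f = (%n. 0)" if f: "l2_bound f B" "!!n. n \<notin> I ==> f n = 0" and T0: "?T f = (%n. 0)" for f B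
 proof -
  have "?T (%n. 0) = (%n. 0)" by (intro ext) (simp add: ham_def res_def)
  then have "R f = f" by (intro ext) (simp add: R_def T0)
  have "l2_bound f (q ^ k * B)" for k
  proof (induction k)
   case (Suc k)
   show ?case using Rb[OF Suc f(2)] \<open>R f = f\<close> by (simp add: mult_ac)
  qed (use f in simp)
  then have "\<bar>f n\<bar> <= sqrt (q ^ k * B)" for n k using l2_bound_abs by blast
  moreover have "(%k. sqrt (q ^ k * B)) \<longlonglongrightarrow> sqrt (0 * B)"
   by (intro tendsto_real_sqrt tendsto_mult LIMSEQ_power_zero tendsto_const) (use q in simp)
  ultimately have "\<bar>f n\<bar> <= sqrt (0 * B)" for n by (intro LIMSEQ_le_const) auto
  then show ?thesis by auto
 qed
 define s where "s = sqrt q"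
 have s: "0 <= s" "s < 1" "s^2 = q" unfolding s_def using q by auto
 define C where "C = 3 * (2 + M^2) * (\<alpha> / (1 - s))^2"
 have C0: "C >= 0" unfolding C_def by (intro mult_nonneg_nonneg add_nonneg_nonneg) auto
 have sol: "\<exists>f. l2_bound f (C * B) & (ALL n. n \<notin> I --> f n = 0) & ?T f = \<eta>"
  if \<eta>: "l2_bound \<eta> B" "!!n. n \<notin> I ==> \<eta> n = 0" for \<eta> B
 proof -
  have B: "B >= 0" using \<eta>(1) unfolding l2_bound_def by (drule_tac spec[of _ "{}"]) simp
  define \<phi> where "\<phi> = (%k. (R ^^ k) \<eta>)"
  have \<phi>: "l2_bound (\<phi> k) (q ^ k * B) & (ALL n. n \<notin> I --> \<phi> k n = 0)" for k
  proof (induction k)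
   case (Suc k)
   have "\<phi> (Suc k) = R (\<phi> k)" unfolding \<phi>_def by simp
   then show ?case using Rb[of "\<phi> k" "q ^ k * B"] Rs[of "\<phi> k"] Suc by (simp add: mult_ac)
  qed (use \<eta> in \<open>simp add: \<phi>_def\<close>)
  have sq: "sqrt (q ^ k * B) = s ^ k * sqrt B" for k unfolding s_def by (simp add: real_sqrt_mult real_sqrt_power)
  have abs: "\<bar>\<phi> k n\<bar> <= s ^ k * sqrt B" for k n using l2_bound_abs[of "\<phi> k" "q ^ k * B" n] \<phi>[of k] unfolding sq by simp
  have gs: "summable (%k. s ^ k * sqrt B)" using s by (intro summable_mult2 summable_geometric) simp
  have sm: "summable (%k. \<phi> k n)" for n
   by (rule summable_comparison_test'[OF gs]) (use abs in auto)
  define g where "g = (%n. \<Sum>k. \<phi> k n)"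
  have TTg: "?T (?T g) n = \<eta> n / \<alpha>" for n
  proof -
   note h1 = ham_suminf[of \<phi>, OF sm, of I U E]
   note h2 = ham_suminf[of "%k. ?T (\<phi> k)", OF h1(1), of I U E]
   have st: "?T (?T (\<phi> k)) n = (\<phi> k n - \<phi> (Suc k) n) / \<alpha>" for k
   proof -
    have "\<phi> (Suc k) n = \<phi> k n - \<alpha> * ?T (?T (\<phi> k)) n" unfolding \<phi>_def by (simp add: R_def)
    then show ?thesis using \<alpha>0 by simp
   qed
   have "(%k. (\<phi> k n - \<phi> (Suc k) n) / \<alpha>) sums ((\<phi> 0 n - 0) / \<alpha>)"
    by (intro sums_divide telescope_sums' summable_LIMSEQ_zero[OF sm])
   then have "(\<Sum>k. ?T (?T (\<phi> k)) n) = \<eta> n / \<alpha>" unfolding st by (simp add: sums_iff \<phi>_def)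
   then show ?thesis unfolding g_def h1(2) h2(2) .
  qed
  define f where "f = (%n. \<alpha> * g n)"
  have fs: "f n = 0" if "n \<notin> I" for n unfolding f_def g_def using \<phi> that by simp
  have hs: "?T (%n. \<alpha> * h n) = (%n. \<alpha> * ?T h n)" for h
   using ham_comb[of I U E \<alpha> h 0 h] by simp
  have Tf: "?T (?T f) = \<eta>" unfolding f_def hs using TTg \<alpha>0 by (intro ext) simp
  have "l2_bound f ((\<alpha> / (1 - s))^2 * B)" unfolding l2_bound_def
  proof (intro allI impI)
   fix F :: "int set" assume F: "finite F"
   have part: "(\<Sum>n\<in>F. (\<Sum>k<K. \<phi> k n)^2) <= (sqrt B / (1 - s))^2" for K
   proof -
    have "L2_set (\<phi> k) F <= s ^ k * sqrt B" for k
    proof -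
     have "(\<Sum>n\<in>F. (\<phi> k n)^2) <= q ^ k * B" using \<phi>[of k] F unfolding l2_bound_def by blast
     then show ?thesis unfolding L2_set_def sq[symmetric] by simp
    qed
    then have "(\<Sum>k<K. L2_set (\<phi> k) F) <= (\<Sum>k<K. s ^ k * sqrt B)" by (rule sum_mono)
    also have "... <= (\<Sum>k. s ^ k * sqrt B)" by (rule sum_le_suminf[OF gs]) (use s B in auto)
    also have "... = sqrt B / (1 - s)" using s by (simp add: suminf_mult2[symmetric] suminf_geometric)
    finally have "L2_set (%n. \<Sum>k<K. \<phi> k n) F <= sqrt B / (1 - s)" using L2_set_sum_le[OF F, of \<phi> K] by linarith
    then have "(L2_set (%n. \<Sum>k<K. \<phi> k n) F)^2 <= (sqrt B / (1 - s))^2" by (intro power_mono) (auto simp: L2_set_nonneg)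
    then show ?thesis unfolding L2_set_def by (simp add: sum_nonneg)
   qed
   have "(%K. \<Sum>n\<in>F. (\<Sum>k<K. \<phi> k n)^2) \<longlonglongrightarrow> (\<Sum>n\<in>F. (g n)^2)"
    unfolding g_def by (intro tendsto_sum tendsto_power summable_LIMSEQ sm)
   then have "(\<Sum>n\<in>F. (g n)^2) <= (sqrt B / (1 - s))^2" by (rule LIMSEQ_le_const2) (use part in auto)
   then have "\<alpha>^2 * (\<Sum>n\<in>F. (g n)^2) <= \<alpha>^2 * (sqrt B / (1 - s))^2" by (rule mult_left_mono) simp
   also have "... = (\<alpha> / (1 - s))^2 * B" using B by (simp add: power_divide)
   finally show "(\<Sum>n\<in>F. (f n)^2) <= (\<alpha> / (1 - s))^2 * B"
    unfolding f_def by (simp add: power_mult_distrib sum_distrib_left)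
  qed
  from l2_bound_ham[where U=U and M=M, OF U this fs] have "l2_bound (?T f) (C * B)" unfolding C_def by (simp add: mult.assoc)
  then show ?thesis using Tf by (intro exI[of _ "?T f"]) (auto simp: ham_def)
 qed
 show ?thesis by (rule that[OF C0 sol inj])
qed

lemma ell2_parts:
 assumes "\<phi> \<in> ell2 I"
 shows "l2_bound (%n. Re (\<phi> n)) ((ell2_norm \<phi>)^2)" "l2_bound (%n. Im (\<phi> n)) ((ell2_norm \<phi>)^2)"
proof -
 have s: "(%n. (cmod (\<phi> n))^2) summable_on UNIV" using assms by (simp add: ell2_def)
 have N: "(ell2_norm \<phi>)^2 = (\<Sum>\<^sub>\<infinity>n. (cmod (\<phi> n))^2)" unfolding ell2_norm_def by (simp add: infsum_nonneg)
 have "(\<Sum>n\<in>F. (cmod (\<phi> n))^2) <= (ell2_norm \<phi>)^2" if "finite F" for F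
  unfolding N by (rule finite_sum_le_infsum[OF s that]) auto
 moreover have "(\<Sum>n\<in>F. (Re (\<phi> n))^2) <= (\<Sum>n\<in>F. (cmod (\<phi> n))^2)" "(\<Sum>n\<in>F. (Im (\<phi> n))^2) <= (\<Sum>n\<in>F. (cmod (\<phi> n))^2)" for F
  by (intro sum_mono; simp add: cmod_power2)+
 ultimately show "l2_bound (%n. Re (\<phi> n)) ((ell2_norm \<phi>)^2)" "l2_bound (%n. Im (\<phi> n)) ((ell2_norm \<phi>)^2)"
  unfolding l2_bound_def by (meson order_trans)+
qed

lemma ell2_of_parts:
 assumes "l2_bound f B1" "l2_bound g B2" "!!n. n \<notin> I ==> f n = 0" "!!n. n \<notin> I ==> g n = 0"
 shows "(%n. Complex (f n) (g n)) \<in> ell2 I" "ell2_norm (%n. Complex (f n) (g n)) <= sqrt (B1 + B2)"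
proof -
 have b: "(\<Sum>n\<in>F. (cmod (Complex (f n) (g n)))^2) <= B1 + B2" if "finite F" for F
  using assms(1,2) that unfolding l2_bound_def by (simp add: cmod_power2 sum.distrib add_mono)
 have s: "(%n. (cmod (Complex (f n) (g n)))^2) summable_on UNIV"
  by (rule nonneg_bdd_above_summable_on) (use b in \<open>auto intro!: bdd_aboveI2[of _ _ "B1 + B2"]\<close>)
 then show "(%n. Complex (f n) (g n)) \<in> ell2 I" unfolding ell2_def using assms(3,4) by (simp add: complex_eq_iff)
 show "ell2_norm (%n. Complex (f n) (g n)) <= sqrt (B1 + B2)"
  unfolding ell2_norm_def by (rule real_sqrt_le_mono, rule infsum_le_finite_sums[OF s]) (use b in auto)
qed

lemma dirichlet_parts:
 assumes "\<phi> \<in> ell2 I"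
 shows "dirichlet I (schroedinger V x \<omega>) \<phi> n - of_real E * \<phi> n =
  Complex (ham I (pot V \<omega> x) E (%n. Re (\<phi> n)) n) (ham I (pot V \<omega> x) E (%n. Im (\<phi> n)) n)"
 using assms by (auto simp: dirichlet_def schroedinger_def ham_def res_def pot_def ell2_def complex_eq_iff algebra_simps)

lemma approx_eig_imp_spec:
 assumes "approx_eig I (pot V \<omega> x) E"
 shows "of_real E \<in> spec (ell2 I) (dirichlet I (schroedinger V x \<omega>))"
proof (rule ccontr)
 assume "~ ?thesis"
 then obtain C where C: "!!\<phi>. \<phi> \<in> ell2 I ==> ell2_norm \<phi> <= C * ell2_norm (%n. dirichlet I (schroedinger V x \<omega>) \<phi> n - of_real E * \<phi> n)"
  unfolding spec_def by blast
 have "C^2 + 1 > 0" by (simp add: add_nonneg_pos)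
 then obtain \<psi> where \<psi>: "fsupp I \<psi>" "nsq \<psi> > 0" "nsq (ham I (pot V \<omega> x) E \<psi>) <= (1 / (C^2 + 1)) * nsq \<psi>"
  using assms unfolding approx_eig_def by (metis zero_less_divide_1_iff)
 have N: "ell2_norm (%n. Complex (f n) 0) = sqrt (nsq f)" if "fsupp I f" for f
 proof -
  have "(\<Sum>\<^sub>\<infinity>n. (f n)^2) = (\<Sum>\<^sub>\<infinity>n\<in>{n. f n ~= 0}. (f n)^2)" by (rule infsum_cong_neutral) auto
  also have "... = (\<Sum>n | f n ~= 0. (f n)^2)" by (rule infsum_finite) (use that in \<open>simp add: fsupp_def\<close>)
  also have "... = nsq f" by (rule nsq_eq_sum[symmetric]) (use that in \<open>auto simp: fsupp_def\<close>)
  finally show ?thesis unfolding ell2_norm_def by (simp add: cmod_power2)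
 qed
 have b: "l2_bound \<psi> (nsq \<psi>)" "l2_bound (%n. 0) 0" unfolding l2_bound_def using sum_le_nsq[OF \<psi>(1)] by auto
 have in2: "(%n. Complex (\<psi> n) 0) \<in> ell2 I" by (rule ell2_of_parts(1)[OF b]) (use \<psi> in \<open>auto simp: fsupp_def\<close>)
 have h0: "ham I (pot V \<omega> x) E (%n. 0) n = 0" for n by (simp add: ham_def res_def)
 have "sqrt (nsq \<psi>) <= C * sqrt (nsq (ham I (pot V \<omega> x) E \<psi>))"
  using C[OF in2] unfolding dirichlet_parts[OF in2] using N[OF \<psi>(1)] N[OF fsupp_ham[OF \<psi>(1)]] by (simp add: h0)
 then have "(sqrt (nsq \<psi>))^2 <= (C * sqrt (nsq (ham I (pot V \<omega> x) E \<psi>)))^2" by (intro power_mono) (auto simp: nsq_nonneg)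
 then have "nsq \<psi> <= C^2 * nsq (ham I (pot V \<omega> x) E \<psi>)" by (simp add: power_mult_distrib nsq_nonneg)
 also have "... <= C^2 * ((1 / (C^2 + 1)) * nsq \<psi>)" by (rule mult_left_mono[OF \<psi>(3)]) simp
 finally have "nsq \<psi> * (C^2 + 1) <= C^2 * nsq \<psi>" using \<open>C\<^sup>2 + 1 > 0\<close> by (simp add: field_simps)
 then show False using \<psi>(2) by (simp add: algebra_simps)
qed

text \<open>Otherwise \<open>T - E\<close> is bounded below, and the previous theorem, applied to real and imaginary
parts, inverts it.\<close>

theorem spec_imp_approx_eig:
 assumes U: "!!t. \<bar>V t\<bar> <= A" and sp: "of_real E \<in> spec (ell2 I) (dirichlet I (schroedinger V x \<omega>))"
 shows "approx_eig I (pot V \<omega> x) E"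
proof (rule ccontr)
 assume "~ ?thesis"
 then obtain e where e: "e > 0" "!!f. fsupp I f ==> nsq f > 0 ==> nsq (ham I (pot V \<omega> x) E f) > e * nsq f"
  unfolding approx_eig_def by (meson not_le)
 let ?H = "ham I (pot V \<omega> x) E"
 have e2: "nsq (?H f) >= e * nsq f" if "fsupp I f" for f
  using e(2)[OF that] nsq_nonneg[of f] nsq_nonneg[of "?H f"] by (cases "nsq f = 0") auto
 have U': "\<bar>pot V \<omega> x n - E\<bar> <= A + \<bar>E\<bar>" for n using U[of "x + of_int n * \<omega>"] unfolding pot_def by linarith
 obtain C where C: "C >= 0"
  "!!\<eta> B. l2_bound \<eta> B ==> (!!n. n \<notin> I ==> \<eta> n = 0) ==>
   \<exists>f. l2_bound f (C * B) & (ALL n. n \<notin> I --> f n = 0) & ?H f = \<eta>"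
  "!!f B. l2_bound f B ==> (!!n. n \<notin> I ==> f n = 0) ==> ?H f = (%n. 0) ==> f = (%n. 0)"
  using bounded_below_inverse[where U="pot V \<omega> x", OF U' e(1) e2] by blast
 let ?S = "%\<phi> n. dirichlet I (schroedinger V x \<omega>) \<phi> n - of_real E * \<phi> n"
 have S: "?S \<phi> = (%n. Complex (?H (%n. Re (\<phi> n)) n) (?H (%n. Im (\<phi> n)) n))" if "\<phi> \<in> ell2 I" for \<phi>
  by (rule ext, rule dirichlet_parts[OF that])
 have z: "Re (\<phi> n) = 0" "Im (\<phi> n) = 0" if "\<phi> \<in> ell2 I" "n \<notin> I" for \<phi> n using that by (auto simp: ell2_def)
 have into: "?S \<phi> \<in> ell2 I" if \<phi>: "\<phi> \<in> ell2 I" for \<phi>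
  unfolding S[OF \<phi>]
  by (rule ell2_of_parts(1)[OF l2_bound_ham[where U="pot V \<omega> x", OF U' ell2_parts(1)[OF \<phi>] z(1)[OF \<phi>]] l2_bound_ham[where U="pot V \<omega> x", OF U' ell2_parts(2)[OF \<phi>] z(2)[OF \<phi>]]])
   (auto simp: ham_def)
 have surj: "\<exists>\<phi>\<in>ell2 I. ?S \<phi> = \<eta> & ell2_norm \<phi> <= sqrt (2 * C) * ell2_norm \<eta>" if \<eta>: "\<eta> \<in> ell2 I" for \<eta>
 proof -
  obtain f where f: "l2_bound f (C * (ell2_norm \<eta>)^2)" "!!n. n \<notin> I ==> f n = 0" "?H f = (%n. Re (\<eta> n))"
   using C(2)[OF ell2_parts(1)[OF \<eta>] z(1)[OF \<eta>]] by blast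
  obtain g where g: "l2_bound g (C * (ell2_norm \<eta>)^2)" "!!n. n \<notin> I ==> g n = 0" "?H g = (%n. Im (\<eta> n))"
   using C(2)[OF ell2_parts(2)[OF \<eta>] z(2)[OF \<eta>]] by blast
  let ?\<phi> = "%n. Complex (f n) (g n)"
  have i: "?\<phi> \<in> ell2 I" "ell2_norm ?\<phi> <= sqrt (C * (ell2_norm \<eta>)^2 + C * (ell2_norm \<eta>)^2)"
   using ell2_of_parts[where I=I, OF f(1) g(1) f(2) g(2)] by blast+
  have "?S ?\<phi> n = \<eta> n" for n
   unfolding fun_cong[OF S[OF i(1)], of n] by (simp add: f(3) g(3))
  then have "?S ?\<phi> = \<eta>" by (rule ext)
  moreover have "C * (ell2_norm \<eta>)^2 + C * (ell2_norm \<eta>)^2 = 2 * C * (ell2_norm \<eta>)^2" by simp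
  moreover have "ell2_norm \<eta> >= 0" unfolding ell2_norm_def by (intro real_sqrt_ge_zero infsum_nonneg) auto
  ultimately show ?thesis using i by (intro bexI[of _ ?\<phi>]) (auto simp: real_sqrt_mult)
 qed
 have inj: "\<phi> = \<phi>'" if \<phi>: "\<phi> \<in> ell2 I" "\<phi>' \<in> ell2 I" and eq: "?S \<phi> = ?S \<phi>'" for \<phi> \<phi>'
 proof -
  have d: "l2_bound (%n. 1 * f n + (- 1) * g n) (2 * B1 + 2 * B2)" if "l2_bound f B1" "l2_bound g B2" for f g :: "int => real" and B1 B2
   unfolding l2_bound_def
  proof (intro allI impI)
   fix F :: "int set" assume "finite F"
   then have "(\<Sum>n\<in>F. (f n)^2) <= B1" "(\<Sum>n\<in>F. (g n)^2) <= B2" using that unfolding l2_bound_def by auto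
   moreover have "(\<Sum>n\<in>F. (1 * f n + (- 1) * g n)^2) <= (\<Sum>n\<in>F. 2 * (f n)^2 + 2 * (g n)^2)"
   proof (rule sum_mono)
    fix n
    have "2 * (f n)^2 + 2 * (g n)^2 - (1 * f n + (- 1) * g n)^2 = (f n + g n)^2" by (simp add: power2_eq_square algebra_simps)
    then show "(1 * f n + (- 1) * g n)^2 <= 2 * (f n)^2 + 2 * (g n)^2" using zero_le_power2[of "f n + g n"] by linarith
   qed
   ultimately show "(\<Sum>n\<in>F. (1 * f n + (- 1) * g n)^2) <= 2 * B1 + 2 * B2"
    by (simp add: sum.distrib sum_distrib_left[symmetric])
  qed
  have eqs: "?H (%n. Re (\<phi> n)) n = ?H (%n. Re (\<phi>' n)) n" "?H (%n. Im (\<phi> n)) n = ?H (%n. Im (\<phi>' n)) n" for n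
   using fun_cong[OF eq, of n] unfolding dirichlet_parts[OF \<phi>(1)] dirichlet_parts[OF \<phi>(2)] by simp_all
  have "(%n. 1 * Re (\<phi> n) + (- 1) * Re (\<phi>' n)) = (%n. 0)"
   by (rule C(3)[OF d[OF ell2_parts(1)[OF \<phi>(1)] ell2_parts(1)[OF \<phi>(2)]]]) (use z[OF \<phi>(1)] z[OF \<phi>(2)] in simp, simp only: ham_comb eqs, simp)
  moreover have "(%n. 1 * Im (\<phi> n) + (- 1) * Im (\<phi>' n)) = (%n. 0)"
   by (rule C(3)[OF d[OF ell2_parts(2)[OF \<phi>(1)] ell2_parts(2)[OF \<phi>(2)]]]) (use z[OF \<phi>(1)] z[OF \<phi>(2)] in simp, simp only: ham_comb eqs, simp)
  ultimately show ?thesis by (auto simp: fun_eq_iff complex_eq_iff)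
 qed
 have "bij_betw ?S (ell2 I) (ell2 I)" unfolding bij_betw_def
 proof
  show "inj_on ?S (ell2 I)" by (rule inj_onI) (rule inj)
  show "?S ` ell2 I = ell2 I"
  proof
   show "?S ` ell2 I \<subseteq> ell2 I" using into by blast
   show "ell2 I \<subseteq> ?S ` ell2 I"
   proof
    fix \<eta> assume "\<eta> \<in> ell2 I"
    from surj[OF this] obtain \<phi> where "\<phi> \<in> ell2 I" "?S \<phi> = \<eta>" by blast
    then show "\<eta> \<in> ?S ` ell2 I" by (intro image_eqI[where x=\<phi>]) (rule sym)
   qed
  qed
 qed
 moreover have "ell2_norm \<phi> <= sqrt (2 * C) * ell2_norm (?S \<phi>)" if "\<phi> \<in> ell2 I" for \<phi>
 proof -
  from surj[OF into[OF that]] obtain \<phi>' where \<phi>': "\<phi>' \<in> ell2 I" "?S \<phi>' = ?S \<phi>" "ell2_norm \<phi>' <= sqrt (2 * C) * ell2_norm (?S \<phi>)" by blast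
  have "\<phi>' = \<phi>" by (rule inj[OF \<phi>'(1) that \<phi>'(2)])
  with \<phi>'(3) show ?thesis by (simp only:)
 qed
 ultimately show False using sp unfolding spec_def by blast
qed

lemma dirichlet_UNIV: "dirichlet UNIV T = T"
 by (intro ext) (simp add: dirichlet_def)

section \<open>Cuts and decay towards them\<close>

text \<open>The recurrence forbids interior maxima and the bound at 0 forbids a maximum there, so the sequence decays
geometrically from its far end \<open>R\<close>.\<close>

lemma recurrence_from_cut:
 fixes x :: "nat => real"
 assumes \<theta>: "0 <= \<theta>" "64 * \<theta> <= 1" and \<rho>: "\<rho> >= 0" and J: "1 <= J" "J <= R"
  and step: "!!k. 1 <= k ==> k < R ==> x k <= \<theta> * (x (k - 1) + x (k + 1)) + \<rho>"
  and x0: "x 0 <= x J / 32 + \<rho>" and X: "!!k. k <= R ==> x k <= X" "X >= 0"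
 shows "x 0 <= (1 / 32) ^ (R - J) * X + 2 * \<rho>"
proof -
 have "\<forall>i\<le>R - j. x i <= (1 / 32) ^ j * X + 2 * \<rho>" if "j <= R - J" for j
  using that
 proof (induction j)
  case 0
  then show ?case using X \<rho> by (auto intro!: add_increasing2)
 next
  case (Suc j)
  define Y where "Y = (1 / 32) ^ j * X + 2 * \<rho>"
  have IH: "x i <= Y" if "i <= R - j" for i using Suc that unfolding Y_def by auto
  have Y0: "Y >= 0" unfolding Y_def using X \<rho> by auto
  have Yn: "Y / 32 + \<rho> <= (1 / 32) ^ Suc j * X + 2 * \<rho>" unfolding Y_def using \<rho> by (simp add: field_simps)
  show ?case
  proof (intro allI impI)
   fix i assume i: "i <= R - Suc j"
   show "x i <= (1 / 32) ^ Suc j * X + 2 * \<rho>"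
   proof (cases "i = 0")
    case True
    have "x J <= Y" using Suc.prems by (intro IH) auto
    then have "x 0 <= Y / 32 + \<rho>" using x0 by linarith
    then show ?thesis using True Yn by simp
   next
    case False
    then have "x i <= \<theta> * (x (i - 1) + x (i + 1)) + \<rho>" using i Suc.prems J by (intro step) auto
    also have "... <= \<theta> * (Y + Y) + \<rho>"
     using i Suc.prems False by (intro add_mono mult_left_mono \<theta>(1) IH order_refl) auto
    also have "\<theta> * (Y + Y) <= Y / 32"
     using mult_right_mono[OF \<theta>(2) Y0] by (simp add: algebra_simps)
    finally show ?thesis using Yn by linarith
   qed
  qed
 qed
 from this[of "R - J"] J show ?thesis by auto
qed

lemma recurrence_two_sided:
 fixes y :: "int => real" and R :: nat
 assumes \<theta>: "0 <= \<theta>" "64 * \<theta> <= 1" and \<rho>: "\<rho> >= 0"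
  and step: "!!k. \<bar>k\<bar> < int R ==> y k <= \<theta> * (y (k - 1) + y (k + 1)) + \<rho>"
  and X: "!!k. \<bar>k\<bar> <= int R ==> y k <= X" "X >= 0"
 shows "y 0 <= (1 / 32) ^ R * X + 2 * \<rho>"
proof -
 have "ALL i. \<bar>i\<bar> <= int R - int j --> y i <= (1 / 32) ^ j * X + 2 * \<rho>" if "j <= R" for j
  using that
 proof (induction j)
  case 0
  then show ?case using X \<rho> by (auto intro!: add_increasing2)
 next
  case (Suc j)
  define Y where "Y = (1 / 32) ^ j * X + 2 * \<rho>"
  have IH: "y i <= Y" if "\<bar>i\<bar> <= int R - int j" for i using Suc that unfolding Y_def by auto
  have Y0: "Y >= 0" unfolding Y_def using X \<rho> by auto
  show ?case
  proof (intro allI impI)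
   fix i assume i: "\<bar>i\<bar> <= int R - int (Suc j)"
   then have "y i <= \<theta> * (y (i - 1) + y (i + 1)) + \<rho>" by (intro step) auto
   also have "... <= \<theta> * (Y + Y) + \<rho>"
    using i by (intro add_mono mult_left_mono \<theta>(1) IH order_refl) auto
   also have "\<theta> * (Y + Y) <= Y / 32"
    using mult_right_mono[OF \<theta>(2) Y0] by (simp add: algebra_simps)
   also have "Y / 32 + \<rho> <= (1 / 32) ^ Suc j * X + 2 * \<rho>" unfolding Y_def using \<rho> by (simp add: field_simps)
   finally show "y i <= (1 / 32) ^ Suc j * X + 2 * \<rho>" by simp
  qed
 qed
 from this[of R] show ?thesis by auto
qed

text \<open>Without a bound at 0 the sequence may decay from 0 as well; then \<open>v 1\<close> is of order
\<open>\<theta> * v 0\<close> unless the contribution of the far end dominates.\<close>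

lemma recurrence_from_edge:
 fixes v :: "nat => real"
 assumes \<theta>: "0 <= \<theta>" "64 * \<theta> <= 1" and \<rho>: "\<rho> >= 0" and R: "1 <= R" and v0: "!!k. v k >= 0"
  and step: "!!k. 1 <= k ==> k < R ==> v k <= \<theta> * (v (k - 1) + v (k + 1)) + \<rho>"
  and X: "v R <= X" "X >= 0"
 shows "v 1 <= 2 * \<theta> * v 0 + (2 * \<theta>) ^ (R - 1) * X + 4 * \<rho>"
proof -
 have "v (R - j) <= 2 * \<theta> * v (R - j - 1) + (2 * \<theta>) ^ j * X + 4 * \<rho>" if "j <= R - 1" for j
  using that
 proof (induction j)
  case 0
  have "0 <= 2 * \<theta> * v (R - 1)" using \<theta> v0 by simp
  then show ?case using X \<rho> by simp
 next
  case (Suc j)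
  define k where "k = R - Suc j"
  have k: "1 <= k" "k < R" "R - j = k + 1" "R - Suc j = k" unfolding k_def using Suc.prems R by auto
  define e where "e = (2 * \<theta>) ^ j * X + 4 * \<rho>"
  have e0: "e >= 0" unfolding e_def using \<theta> X \<rho> by auto
  have IH: "v (k + 1) <= 2 * \<theta> * v k + e" using Suc unfolding k e_def by simp
  have "v k <= \<theta> * (v (k - 1) + v (k + 1)) + \<rho>" by (rule step[OF k(1,2)])
  also have "... <= \<theta> * (v (k - 1) + (2 * \<theta> * v k + e)) + \<rho>" using IH \<theta> by (intro add_mono mult_left_mono) auto
  also have "... = \<theta> * v (k - 1) + 2 * \<theta> * \<theta> * v k + \<theta> * e + \<rho>" by (simp add: algebra_simps)
  also have "2 * \<theta> * \<theta> * v k <= 1 / 2 * v k"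
  proof (rule mult_right_mono[OF _ v0])
   have "\<theta> * \<theta> <= 1 / 64 * (1 / 64)" using \<theta> by (intro mult_mono) auto
   then show "2 * \<theta> * \<theta> <= 1 / 2" by simp
  qed
  finally have "v k <= 2 * \<theta> * v (k - 1) + 2 * \<theta> * e + 2 * \<rho>" by simp
  also have "2 * \<theta> * e = (2 * \<theta>) ^ Suc j * X + 8 * (\<theta> * \<rho>)" unfolding e_def by (simp add: algebra_simps)
  also have "\<theta> * \<rho> <= 1 / 64 * \<rho>" using \<theta> \<rho> by (intro mult_right_mono) auto
  finally have "v k <= 2 * \<theta> * v (k - 1) + (2 * \<theta>) ^ Suc j * X + 4 * \<rho>" using \<rho> by linarith
  then show ?case unfolding k(4) .
 qed
 from this[of "R - 1"] R show ?thesis by simp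
qed

text \<open>An island \<open>[lo, hi]\<close> around \<open>E0\<close> with collars of width \<open>\<delta>\<close>
for the operators on \<open>\<Omega>\<close>; \<open>gap\<close> says that approximate eigenfunctions with error
\<open>\<sigma>\<close> and energy in the inner halves of the collars have energy within \<open>2 * \<sigma>\<close>
of the island. \<open>P\<close> bounds the time to come close to \<open>ys\<close>, \<open>W\<close> the length of a
window containing a cut, \<open>R\<close> is the number of windows over which decay is iterated, intervals have length
between \<open>Q\<close> and \<open>8 * Q\<close>, and \<open>h\<close> is the radius of phases that share a
cut.\<close>

locale island = scale +
 fixes \<Omega> :: "int set" and lo hi \<delta> LV h Mb :: real and P W R :: nat and Q :: int
 assumes \<tau>: "\<tau> > 0" and Lip: "!!s t. \<bar>V s - V t\<bar> <= LV * \<bar>s - t\<bar>" and LV: "LV > 0"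
  and per: "!!s. V (s + 1) = V s" and bdV: "!!s E. \<bar>E - E0\<bar> <= w ==> \<bar>V s - E\<bar> <= Mb"
  and gap: "!!x E \<psi> \<sigma>. fsupp \<Omega> \<psi> ==> nsq \<psi> > 0 ==> nsq (ham \<Omega> (pot V \<omega> x) E \<psi>) <= \<sigma>^2 * nsq \<psi> ==>
    0 < \<sigma> ==> \<sigma> <= \<delta> / 16 ==> lo - \<delta> / 2 <= E ==> E <= hi + \<delta> / 2 ==> lo - 2 * \<sigma> <= E & E <= hi + 2 * \<sigma>"
  and near: "!!E. lo - \<delta> / 2 <= E ==> E <= hi + \<delta> / 2 ==> \<bar>E - E0\<bar> <= w"
  and \<delta>: "\<delta> > 0" and dense: "!!y. \<exists>q::nat. q <= P & dist_int (real q * \<omega> - y) <= \<eta> / 2"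
  and h: "0 < h" "h <= \<eta> / 2" "h <= 1 / 2"
  and sep: "!!k::int. k ~= 0 ==> \<bar>k\<bar> <= int W ==> dist_int (of_int k * \<omega>) >= 2 * (\<tau> + h)"
  and W: "(P + 1) * ((2 * R + 1) * card \<Theta> + 1) <= W"
  and QW: "int (R + 2) * int m + int W <= Q" and JR: "J + 2 <= R"
  and avoid: "3 * \<tau> * ((9 * real_of_int Q + 1) * real (card \<Theta>)) <= h / 2"
  and small: "2 ^ 12 * (real_of_int Q)^2 * (1 / 32) ^ (R - J) <= \<delta>"
begin

definition isl :: "real => real => bool" where
 "isl t E \<longleftrightarrow> lo - t * \<delta> <= E & E <= hi + t * \<delta>"

definition good :: "real => int => bool" where
 "good x s \<longleftrightarrow> (\<forall>t\<in>\<Theta>. dist_int (x + of_int (s - int m) * \<omega> - t) >= \<tau>)"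

text \<open>Right ends with forced growth to their left, surrounded on both sides by \<open>R\<close> good windows:
those inside give decay of eigenfunctions of the interval, and the outer ones let a function be truncated
here.\<close>

definition right_cut :: "real => int => bool" where
 "right_cut x b \<longleftrightarrow> (ALL k. \<bar>k\<bar> <= int R --> good x (b + k * int m)) & dist_int (x + of_int (b - int nf) * \<omega> - ys) <= \<eta>"

definition left_cut :: "real => int => bool" where
 "left_cut x a \<longleftrightarrow> (ALL k. \<bar>k\<bar> <= int R --> good x (a - 1 + k * int m)) & dist_int (x + of_int (a - 1) * \<omega> - ys) <= \<eta>"

lemma isl_near: "isl t E ==> t <= 1 / 2 ==> \<bar>E - E0\<bar> <= w"
proof (rule near)
 assume E: "isl t E" "t <= 1 / 2"
 have "t * \<delta> <= 1 / 2 * \<delta>" using E \<delta> by (intro mult_right_mono) auto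
 then show "lo - \<delta> / 2 <= E" "E <= hi + \<delta> / 2" using E(1) unfolding isl_def by linarith+
qed

lemma isl_shift: "isl t E ==> \<bar>E' - E\<bar> <= u * \<delta> ==> isl (t + u) E'"
 unfolding isl_def by (simp add: algebra_simps) linarith

lemma C_pow: "C ^ k >= 1" using C2 by simp

lemma Q_ge: "Q >= 4" and m_Q: "int (R + 2) * int m <= Q"
proof -
 have "int (R + 2) * int m >= 2 * 2" using m2 by (intro mult_mono) auto
 then show "Q >= 4" using QW by linarith
 show "int (R + 2) * int m <= Q" using QW by linarith
qed

text \<open>The window contains one more candidate near \<open>ys\<close> than there are pairs of a window index and a
point of \<open>\<Theta>\<close>. Each pair spoils at most one candidate, because distinct candidates differ by a
rotation of at least \<open>2 * (\<tau> + h)\<close>.\<close>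

lemma cut_exists:
 obtains b where "m0 <= b" "b <= m0 + int W"
  "!!x. \<bar>x - y\<bar> <= h ==> (ALL k. \<bar>k\<bar> <= int R --> good x (b + o1 + k * int m)) & dist_int (x + of_int (b + o2) * \<omega> - ys) <= \<eta>"
proof -
 define n where "n = (2 * R + 1) * card \<Theta>"
 let ?base = "%i::nat. m0 + int i * int (P + 1)"
 have "\<exists>q::nat. q <= P & dist_int (real q * \<omega> - (ys - y - of_int (?base i + o2) * \<omega>)) <= \<eta> / 2" for i by (rule dense)
 then obtain q :: "nat => nat" where q: "!!i. q i <= P"
  "!!i. dist_int (real (q i) * \<omega> - (ys - y - of_int (?base i + o2) * \<omega>)) <= \<eta> / 2" by metis
 define B where "B i = ?base i + int (q i)" for i
 have Bd: "dist_int (y + of_int (B i + o2) * \<omega> - ys) <= \<eta> / 2" for i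
 proof -
  have "y + of_int (B i + o2) * \<omega> - ys = real (q i) * \<omega> - (ys - y - of_int (?base i + o2) * \<omega>)"
   unfolding B_def by (simp add: algebra_simps)
  then show ?thesis using q(2)[of i] by (simp only:)
 qed
 have Bmono: "B i < B j" if "i < j" for i j
 proof -
  have "int i * int (P + 1) + int (P + 1) <= int j * int (P + 1)"
   using that mult_right_mono[of "int i + 1" "int j" "int (P + 1)"] by (simp add: algebra_simps)
  then show ?thesis unfolding B_def using q(1)[of i] by linarith
 qed
 have Brange: "m0 <= B i" "B i <= m0 + int W" if "i <= n" for i
 proof -
  show "m0 <= B i" unfolding B_def by simp
  have "i * (P + 1) + P <= n * (P + 1) + (P + 1)" using that by (intro add_mono mult_right_mono) auto
  also have "... <= W" using W unfolding n_def by (simp add: algebra_simps)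
  finally have "int (i * (P + 1) + P) <= int W" by (simp only: of_nat_le_iff)
  moreover have "int (i * (P + 1) + P) = int i * int (P + 1) + int P" by (simp only: of_nat_add of_nat_mult)
  ultimately show "B i <= m0 + int W" unfolding B_def using q(1)[of i] by linarith
 qed
 define D where "D = {- int R..int R} \<times> \<Theta>"
 have "card {- int R..int R} = 2 * R + 1" by (simp add: nat_add_distrib nat_mult_distrib)
 then have finD: "finite D" "card D = n" unfolding D_def n_def using fin by (simp_all only: card_cartesian_product finite_cartesian_product finite_atLeastAtMost_int)
 have "\<exists>i\<le>n. \<forall>(k, t)\<in>D. dist_int (y + of_int (B i + o1 + k * int m - int m) * \<omega> - t) >= \<tau> + h"
 proof (rule ccontr)
  assume "~ ?thesis"
  then have "ALL i. \<exists>d. i <= n --> d \<in> D & dist_int (y + of_int (B i + o1 + fst d * int m - int m) * \<omega> - snd d) < \<tau> + h"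
   by (fastforce simp: not_le)
  then obtain d where d: "!!i. i <= n ==> d i \<in> D"
   "!!i. i <= n ==> dist_int (y + of_int (B i + o1 + fst (d i) * int m - int m) * \<omega> - snd (d i)) < \<tau> + h" by metis
  have "inj_on d {..n}"
  proof (rule linorder_inj_onI)
   fix i j assume ij: "i < j" "i \<in> {..n}" "j \<in> {..n}"
   show "d i ~= d j"
   proof
    assume e: "d i = d j"
    let ?u = "%i. y + of_int (B i + o1 + fst (d j) * int m - int m) * \<omega> - snd (d j)"
    have "dist_int (?u j) < \<tau> + h" "dist_int (?u i) < \<tau> + h" using d(2)[of i] d(2)[of j] ij e by auto
    moreover have "dist_int (?u j - ?u i) <= dist_int (?u j) + dist_int (?u i)"
     using dist_int_triangle[of "?u j" "- ?u i"] dist_int_minus[of "?u i"] by simp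
    moreover have "?u j - ?u i = of_int (B j - B i) * \<omega>" by (simp add: algebra_simps)
    moreover have "dist_int (of_int (B j - B i) * \<omega>) >= 2 * (\<tau> + h)"
     using Bmono[OF ij(1)] Brange[of i] Brange[of j] ij by (intro sep) auto
    ultimately show False by simp
   qed
  qed (rule linear)
  then have "card {..n} <= card D" using d(1) finD by (intro card_inj_on_le[of d]) auto
  then show False using finD by simp
 qed
 then obtain i where i: "i <= n" "!!k t. \<bar>k\<bar> <= int R ==> t \<in> \<Theta> ==> dist_int (y + of_int (B i + o1 + k * int m - int m) * \<omega> - t) >= \<tau> + h"
  unfolding D_def by fastforce
 show ?thesis
 proof (rule that[OF Brange[OF i(1)]], intro conjI allI impI)
  fix x assume x: "\<bar>x - y\<bar> <= h"
  have dx: "dist_int (x - y) <= h" "dist_int (y - x) <= h"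
   using dist_int_le_abs[of "x - y"] dist_int_le_abs[of "y - x"] x by auto
  show "good x (B i + o1 + k * int m)" if "\<bar>k\<bar> <= int R" for k unfolding good_def
  proof
   fix t assume t: "t \<in> \<Theta>"
   let ?v = "of_int (B i + o1 + k * int m - int m) * \<omega> - t"
   have "dist_int (y + ?v) <= dist_int (x + ?v) + dist_int (y - x)"
   proof -
    have e: "y + ?v = (x + ?v) + (y - x)" by simp
    show ?thesis unfolding e by (rule dist_int_triangle)
   qed
   then show "dist_int (x + of_int (B i + o1 + k * int m - int m) * \<omega> - t) >= \<tau>"
    using i(2)[OF that t] dx by (simp add: add_diff_eq)
  qed
  let ?v = "of_int (B i + o2) * \<omega> - ys"
  have "dist_int (x + ?v) <= dist_int (y + ?v) + dist_int (x - y)"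
  proof -
   have e: "x + ?v = (y + ?v) + (x - y)" by simp
   show ?thesis unfolding e by (rule dist_int_triangle)
  qed
  then show "dist_int (x + of_int (B i + o2) * \<omega> - ys) <= \<eta>"
   using Bd[of i] dx h by (simp add: add_diff_eq)
 qed
qed

lemma right_cut_exists:
 obtains b where "m0 <= b" "b <= m0 + int W" "!!x. \<bar>x - y\<bar> <= h ==> right_cut x b"
 using cut_exists[of m0 y 0 "- int nf"] unfolding right_cut_def by (metis add_0_right diff_conv_add_uminus)

lemma left_cut_exists:
 obtains a where "m0 <= a" "a <= m0 + int W" "!!x. \<bar>x - y\<bar> <= h ==> left_cut x a"
 using cut_exists[of m0 y "- 1" "- 1"] unfolding left_cut_def by (metis diff_conv_add_uminus)

lemma norm_pr_le: "norm (pr \<psi> n) <= \<bar>\<psi> (n + 1)\<bar> + \<bar>\<psi> n\<bar>"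
 unfolding pr_def using norm_Pair_le[of "\<psi> (n + 1)" "\<psi> n"] by simp

lemma le_norm_pr: "\<bar>\<psi> n\<bar> <= norm (pr \<psi> n)" "\<bar>\<psi> (n + 1)\<bar> <= norm (pr \<psi> n)"
 unfolding pr_def using norm_fst_le[of "(\<psi> (n + 1), \<psi> n)"] norm_snd_le[of "(\<psi> (n + 1), \<psi> n)"] by simp_all

lemma centre_good:
 assumes "\<bar>E - E0\<bar> <= w" "r >= 0" "good x s"
  "!!n. s - int m < n ==> n <= s + int m ==> \<bar>res (pot V \<omega> x) E \<psi> n\<bar> <= r"
 shows "norm (pr \<psi> s) <= \<theta> * (norm (pr \<psi> (s - int m)) + norm (pr \<psi> (s + int m))) + K * r"
 by (rule centre[OF assms(1,2) _ assms(4)]) (use assms(3) in \<open>auto simp: good_def\<close>)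

lemma decay_two_sided:
 assumes E: "\<bar>E - E0\<bar> <= w" and r: "r >= 0" and g: "!!k. \<bar>k\<bar> <= int R ==> good x (s + k * int m)"
  and res: "!!n. s - int R * int m < n ==> n <= s + int R * int m ==> \<bar>res (pot V \<omega> x) E \<psi> n\<bar> <= r"
  and X: "!!n. s - int R * int m <= n ==> n <= s + int R * int m + 1 ==> \<bar>\<psi> n\<bar> <= X"
 shows "norm (pr \<psi> s) <= (1 / 32) ^ (R - J) * (2 * X) + 2 * (K * r)"
proof -
 have X0: "X >= 0" using X[of s] by (auto intro: order_trans[OF abs_ge_zero])
 define y where "y = (%k. norm (pr \<psi> (s + k * int m)))"
 have "y 0 <= (1 / 32) ^ R * (2 * X) + 2 * (K * r)"
 proof (rule recurrence_two_sided[of \<theta>])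
  fix k assume k: "\<bar>k\<bar> < int R"
  have km: "k * int m + int m <= int R * int m" "- (int R * int m) <= k * int m - int m"
   using k mult_right_mono[of "k + 1" "int R" "int m"] mult_right_mono[of "- int R" "k - 1" "int m"] by (simp_all add: algebra_simps)
  have "norm (pr \<psi> (s + k * int m)) <= \<theta> * (norm (pr \<psi> (s + k * int m - int m)) + norm (pr \<psi> (s + k * int m + int m))) + K * r"
   by (rule centre_good[OF E r g]) (use k km in \<open>auto intro!: res\<close>)
  then show "y k <= \<theta> * (y (k - 1) + y (k + 1)) + K * r" unfolding y_def by (simp add: algebra_simps)
 next
  fix k assume k: "\<bar>k\<bar> <= int R"
  then have km: "k * int m <= int R * int m" "- (int R * int m) <= k * int m"
   using mult_right_mono[of "k" "int R" "int m"] mult_right_mono[of "- int R" "k" "int m"] by simp_all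
  then have "\<bar>\<psi> (s + k * int m + 1)\<bar> <= X" "\<bar>\<psi> (s + k * int m)\<bar> <= X" by (intro X; linarith)+
  then show "y k <= 2 * X" unfolding y_def using norm_pr_le[of \<psi> "s + k * int m"] by linarith
 qed (use \<theta> K r X0 in auto)
 also have "(1 / 32) ^ R * (2 * X) <= (1 / 32) ^ (R - J) * (2 * X)"
  using X0 by (intro mult_right_mono power_decreasing) auto
 finally show ?thesis unfolding y_def by simp
qed

text \<open>The common core of decay towards a right and a left cut: forced growth at the end bounds the value there
by a fraction of the value \<open>J\<close> windows away.\<close>

lemma decay_from_cut:
 fixes u :: "nat => real"
 assumes r: "r >= 0" and out: "u 0 * (64 * C ^ (m + 2)) <= q + K * r" and q: "q <= 2 * C ^ (J * m - nf) * u J + K * r"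
  and X: "!!k. 0 <= u k & u k <= X" and step: "!!k. 1 <= k ==> k < R ==> u k <= \<theta> * (u (k - 1) + u (k + 1)) + K * r"
 shows "u 0 <= (1 / 32) ^ (R - J) * X + 2 * (K * r)"
proof -
 have Kr: "K * r >= 0" using K r by simp
 have "2 * C ^ (J * m - nf) * u J <= 2 * C ^ (m + 2) * u J"
  using nf C2 X by (intro mult_right_mono mult_left_mono power_increasing) auto
 then have "u 0 * (64 * C ^ (m + 2)) <= 2 * C ^ (m + 2) * u J + 2 * (K * r)" using out q by simp
 also have "2 * (K * r) <= (64 * C ^ (m + 2)) * (K * r)"
  using Kr C_pow[of "m + 2"] by (intro mult_right_mono) linarith+
 also have "2 * C ^ (m + 2) * u J + (64 * C ^ (m + 2)) * (K * r) = (u J / 32 + K * r) * (64 * C ^ (m + 2))" by (simp add: algebra_simps)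
 finally have "u 0 <= u J / 32 + K * r" using C_pow[of "m + 2"] by (simp add: mult_le_cancel_right)
 then show ?thesis
  by (intro recurrence_from_cut[of \<theta> "K * r" J] step) (use \<theta> Kr J1 JR X order_trans[of 0 "u 0" X] in auto)
qed

lemma decay_right_cut:
 assumes E: "\<bar>E - E0\<bar> <= w" and r: "r >= 0" and cut: "right_cut x b" and b1: "\<psi> (b + 1) = 0"
  and res: "!!n. b - int R * int m < n ==> n <= b ==> \<bar>res (pot V \<omega> x) E \<psi> n\<bar> <= r"
  and X: "!!n. \<bar>\<psi> n\<bar> <= X"
 shows "\<bar>\<psi> b\<bar> <= (1 / 32) ^ (R - J) * (2 * X) + 2 * (K * r)"
proof -
 define u where "u = (%k::nat. norm (pr \<psi> (b - int k * int m)))"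
 have Jm: "int nf <= int (J * m)" "int (J * m) <= int nf + 2" "int J * int m <= int R * int m"
  using nf JR by (simp_all only: of_nat_le_iff of_nat_mult[symmetric]) (simp_all add: mult_le_mono)
 have u0: "u 0 = \<bar>\<psi> b\<bar>" unfolding u_def pr_def using b1 by (simp add: norm_Pair)
 have out: "u 0 * (64 * C ^ (m + 2)) <= \<bar>\<psi> (b - int nf)\<bar> + K * r" unfolding u0
   by (rule right_end[where x=x and E=E]) (use E r cut b1 res Jm in \<open>auto simp: right_cut_def\<close>)
 have "\<bar>\<psi> (b - int nf)\<bar> <= norm (pr \<psi> (b - int nf))" by (rule le_norm_pr)
 also have "... <= 2 * C ^ (J * m - nf) * u J + K * r"
 proof -
  have e: "b - int nf = b - int J * int m + int (J * m - nf)" using nf by (simp add: of_nat_diff)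
  have "norm (pr \<psi> (b - int J * int m + int (J * m - nf))) <= 2 * C ^ (J * m - nf) * norm (pr \<psi> (b - int J * int m)) + K * r"
  proof (rule conjunct1[OF grow[OF E _ r]])
   fix n assume n: "b - int J * int m < n" "n <= b - int J * int m + int (J * m - nf)"
   then have "n <= b" unfolding e[symmetric] by simp
   then show "\<bar>res (pot V \<omega> x) E \<psi> n\<bar> <= r" using n Jm by (intro res) auto
  qed simp
  then show ?thesis unfolding e[symmetric] u_def .
 qed
 finally have q: "\<bar>\<psi> (b - int nf)\<bar> <= 2 * C ^ (J * m - nf) * u J + K * r" .
 have "u 0 <= (1 / 32) ^ (R - J) * (2 * X) + 2 * (K * r)"
 proof (rule decay_from_cut[OF r out q])
  show "0 <= u k & u k <= 2 * X" for k
   unfolding u_def using norm_pr_le[of \<psi> "b - int k * int m"] X[of "b - int k * int m"] X[of "b - int k * int m + 1"] by auto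
  fix k :: nat assume k: "1 <= k" "k < R"
  have km: "int k * int m + int m <= int R * int m" "int m <= int k * int m"
   using k mult_right_mono[of "int k + 1" "int R" "int m"] mult_right_mono[of 1 "int k" "int m"] by (simp_all add: algebra_simps)
  have "good x (b + (- int k) * int m)" using cut k unfolding right_cut_def by (metis abs_minus abs_of_nat less_imp_le of_nat_le_iff)
  then have "good x (b - int k * int m)" by simp
  then have "norm (pr \<psi> (b - int k * int m)) <= \<theta> * (norm (pr \<psi> (b - int k * int m - int m)) + norm (pr \<psi> (b - int k * int m + int m))) + K * r"
   by (rule centre_good[OF E r]) (rule res; use km in linarith)
  moreover have "b - int k * int m - int m = b - int (k + 1) * int m" "b - int k * int m + int m = b - int (k - 1) * int m"
   using k by (simp_all add: algebra_simps of_nat_diff)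
  ultimately have "norm (pr \<psi> (b - int k * int m)) <= \<theta> * (norm (pr \<psi> (b - int (k + 1) * int m)) + norm (pr \<psi> (b - int (k - 1) * int m))) + K * r"
   by (simp only:)
  then show "u k <= \<theta> * (u (k - 1) + u (k + 1)) + K * r" unfolding u_def by (simp only: add.commute)
 qed
 then show ?thesis unfolding u0 .
qed

lemma decay_left_cut:
 assumes E: "\<bar>E - E0\<bar> <= w" and r: "r >= 0" and cut: "left_cut x a" and a1: "\<psi> (a - 1) = 0"
  and res: "!!n. a <= n ==> n < a + int R * int m ==> \<bar>res (pot V \<omega> x) E \<psi> n\<bar> <= r"
  and X: "!!n. \<bar>\<psi> n\<bar> <= X"
 shows "\<bar>\<psi> a\<bar> <= (1 / 32) ^ (R - J) * (2 * X) + 2 * (K * r)"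
proof -
 define u where "u = (%k::nat. norm (pr \<psi> (a - 1 + int k * int m)))"
 have Jm: "int nf <= int (J * m)" "int (J * m) <= int nf + 2" "int J * int m <= int R * int m"
  using nf JR by (simp_all only: of_nat_le_iff of_nat_mult[symmetric]) (simp_all add: mult_le_mono)
 have u0: "u 0 = \<bar>\<psi> a\<bar>" unfolding u_def pr_def using a1 by (simp add: norm_Pair)
 have out: "u 0 * (64 * C ^ (m + 2)) <= \<bar>\<psi> (a + int nf)\<bar> + K * r" unfolding u0
   by (rule left_end[where x=x and E=E]) (use E r cut a1 res Jm in \<open>auto simp: left_cut_def\<close>)
 have "\<bar>\<psi> (a + int nf)\<bar> <= norm (pr \<psi> (a - 1 + int nf))" using le_norm_pr(2)[of \<psi> "a - 1 + int nf"] by (simp add: add.commute)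
 also have "... <= 2 * C ^ (J * m - nf) * u J + K * r"
 proof -
  have e: "a - 1 + int J * int m = a - 1 + int nf + int (J * m - nf)" using nf by (simp add: of_nat_diff)
  have "norm (pr \<psi> (a - 1 + int nf)) <= 2 * C ^ (J * m - nf) * norm (pr \<psi> (a - 1 + int nf + int (J * m - nf))) + K * r"
  proof (rule conjunct2[OF grow[OF E _ r]])
   fix n assume n: "a - 1 + int nf < n" "n <= a - 1 + int nf + int (J * m - nf)"
   have "n <= a - 1 + int J * int m" using n(2) unfolding e[symmetric] .
   then show "\<bar>res (pot V \<omega> x) E \<psi> n\<bar> <= r" using n Jm by (intro res) auto
  qed simp
  then show ?thesis unfolding e[symmetric] u_def .
 qed
 finally have q: "\<bar>\<psi> (a + int nf)\<bar> <= 2 * C ^ (J * m - nf) * u J + K * r" .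
 have "u 0 <= (1 / 32) ^ (R - J) * (2 * X) + 2 * (K * r)"
 proof (rule decay_from_cut[OF r out q])
  show "0 <= u k & u k <= 2 * X" for k
   unfolding u_def using norm_pr_le[of \<psi> "a - 1 + int k * int m"] X[of "a - 1 + int k * int m"] X[of "a - 1 + int k * int m + 1"] by auto
  fix k :: nat assume k: "1 <= k" "k < R"
  have km: "int k * int m + int m <= int R * int m" "int m <= int k * int m"
   using k mult_right_mono[of "int k + 1" "int R" "int m"] mult_right_mono[of 1 "int k" "int m"] by (simp_all add: algebra_simps)
  have "good x (a - 1 + int k * int m)" using cut k unfolding left_cut_def by (metis abs_of_nat less_imp_le of_nat_le_iff)
  then have "norm (pr \<psi> (a - 1 + int k * int m)) <= \<theta> * (norm (pr \<psi> (a - 1 + int k * int m - int m)) + norm (pr \<psi> (a - 1 + int k * int m + int m))) + K * r"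
   by (rule centre_good[OF E r]) (rule res; use km in linarith)
  moreover have "a - 1 + int k * int m + int m = a - 1 + int (k + 1) * int m" "a - 1 + int k * int m - int m = a - 1 + int (k - 1) * int m"
   using k by (simp_all add: algebra_simps of_nat_diff)
  ultimately show "u k <= \<theta> * (u (k - 1) + u (k + 1)) + K * r" unfolding u_def by simp
 qed
 then show ?thesis unfolding u0 .
qed

end

section \<open>Eigenvalues of an interval as the phase moves\<close>

lemma nsq_ham_perturb:
 assumes \<psi>: "fsupp I \<psi>" and U: "!!n. \<bar>U' n - U n\<bar> <= \<rho>"
 shows "nsq (ham I U' E \<psi>) <= 2 * nsq (ham I U E \<psi>) + 2 * \<rho>^2 * nsq \<psi>"
proof -
 let ?h = "ham I U E \<psi>" let ?h' = "ham I U' E \<psi>"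
 let ?F = "{n. \<psi> n ~= 0} \<union> {n. ?h n ~= 0}"
 have fin: "finite ?F" using \<psi> fsupp_ham[OF \<psi>, of U E] by (simp add: fsupp_def)
 have e: "?h' n = ?h n + (U' n - U n) * \<psi> n" for n
  using \<psi> by (auto simp: ham_def res_def fsupp_def algebra_simps)
 have "nsq ?h' = (\<Sum>n\<in>?F. (?h' n)^2)" by (rule nsq_eq_sum[OF fin]) (simp add: e)
 also have "... <= (\<Sum>n\<in>?F. 2 * (?h n)^2 + 2 * \<rho>^2 * (\<psi> n)^2)"
 proof (rule sum_mono)
  fix n
  have "\<bar>U' n - U n\<bar>\<^sup>2 <= \<rho>^2" by (rule power_mono[OF U]) simp
  then have "((U' n - U n) * \<psi> n)^2 <= \<rho>^2 * (\<psi> n)^2" unfolding power_mult_distrib by (intro mult_right_mono) auto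
  moreover have "(?h n + (U' n - U n) * \<psi> n)^2 + (?h n - (U' n - U n) * \<psi> n)^2 = 2 * (?h n)^2 + 2 * ((U' n - U n) * \<psi> n)^2"
   by (simp add: power2_eq_square algebra_simps)
  ultimately show "(?h' n)^2 <= 2 * (?h n)^2 + 2 * \<rho>^2 * (\<psi> n)^2"
   unfolding e using zero_le_power2[of "?h n - (U' n - U n) * \<psi> n"] by linarith
 qed
 also have "... = 2 * (\<Sum>n\<in>?F. (?h n)^2) + 2 * \<rho>^2 * (\<Sum>n\<in>?F. (\<psi> n)^2)"
  by (simp add: sum.distrib sum_distrib_left)
 also have "(\<Sum>n\<in>?F. (?h n)^2) = nsq ?h" by (rule nsq_eq_sum[OF fin, symmetric]) simp
 also have "(\<Sum>n\<in>?F. (\<psi> n)^2) = nsq \<psi>" by (rule nsq_eq_sum[OF fin, symmetric]) simp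
 finally show ?thesis .
qed

lemma approx_eig_perturb:
 assumes a: "approx_eig I U E" and U: "!!n. \<bar>U' n - U n\<bar> <= \<rho>" "\<rho> > 0" and M: "!!n. \<bar>U' n - E\<bar> <= M"
 obtains E1 where "\<bar>E1 - E\<bar> <= 2 * \<rho>" "approx_eig I U' E1"
proof -
 obtain \<psi> where \<psi>: "fsupp I \<psi>" "nsq \<psi> > 0" "nsq (ham I U E \<psi>) <= \<rho>^2 * nsq \<psi>"
  using a U(2) unfolding approx_eig_def by (meson zero_less_power)
 have "nsq (ham I U' E \<psi>) <= (2 * \<rho>)^2 * nsq \<psi>"
  using nsq_ham_perturb[where U=U and U'=U' and E=E, OF \<psi>(1) U(1)] \<psi>(3) by (simp add: power_mult_distrib)
 then show ?thesis using approx_eig_near[where U=U' and E=E, OF M \<psi>(1,2)] that U(2) by (metis less_eq_real_def mult_nonneg_nonneg zero_le_numeral)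
qed

lemma approx_eig_normalised:
 assumes a: "approx_eig {a..b} U E" and r: "r > 0"
 obtains \<psi> p where "!!n. n \<notin> {a..b} ==> \<psi> n = 0" "a <= p" "p <= b" "\<psi> p = 1" "!!n. \<bar>\<psi> n\<bar> <= 1"
  "!!n. a <= n ==> n <= b ==> \<bar>res U E \<psi> n\<bar> <= r"
proof -
 define e where "e = r^2 / (\<bar>of_int (b - a + 1)\<bar> + 1)"
 have "e > 0" unfolding e_def using r by (intro divide_pos_pos) auto
 then obtain f where f: "fsupp {a..b} f" "nsq f > 0" "nsq (ham {a..b} U E f) <= e * nsq f"
  using a unfolding approx_eig_def by meson
 have f0: "f n = 0" if "n \<notin> {a..b}" for n using f(1) that unfolding fsupp_def by blast
 have N: "nsq f = (\<Sum>n\<in>{a..b}. (f n)^2)" by (rule nsq_eq_sum) (use f0 in auto)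
 have ab: "a <= b" using f(2) unfolding N by (cases "a <= b") auto
 let ?A = "(%n. \<bar>f n\<bar>) ` {a..b}"
 have "Max ?A \<in> ?A" by (rule Max_in) (use ab in auto)
 then obtain p where p0: "p \<in> {a..b}" "Max ?A = \<bar>f p\<bar>" by (rule imageE)
 have "\<bar>f n\<bar> <= \<bar>f p\<bar>" if "n \<in> {a..b}" for n
  unfolding p0(2)[symmetric] by (rule Max_ge) (use that in auto)
 note p = p0(1) this
 have "nsq f <= (\<Sum>n\<in>{a..b}. (f p)^2)" unfolding N by (rule sum_mono) (use p(2) in \<open>simp add: abs_le_square_iff\<close>)
 also have "... = of_int (b - a + 1) * (f p)^2" using ab by simp
 finally have Nle: "nsq f <= of_int (b - a + 1) * (f p)^2" .
 have fp: "f p ~= 0" using Nle f(2) by (intro notI) simp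
 have hn: "\<bar>res U E f n\<bar> <= r * \<bar>f p\<bar>" if "n \<in> {a..b}" for n
 proof -
  have "(res U E f n)^2 = (ham {a..b} U E f n)^2" using that by (simp add: ham_def)
  also have "... <= nsq (ham {a..b} U E f)" by (rule nsq_ge[OF fsupp_ham[OF f(1)]])
  also have "... <= e * (of_int (b - a + 1) * (f p)^2)" using f(3) Nle \<open>e > 0\<close> by (meson mult_left_mono order_trans less_imp_le)
  also have "... = (e * of_int (b - a + 1)) * (f p)^2" by simp
  also have "e * of_int (b - a + 1) <= r^2"
  proof -
   have "r^2 * of_int (b - a + 1) <= r^2 * (\<bar>of_int (b - a + 1)\<bar> + 1)" by (intro mult_left_mono) auto
   then show ?thesis unfolding e_def times_divide_eq_left by (subst pos_divide_le_eq) (auto simp: add_nonneg_pos)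
  qed
  finally have "(res U E f n)^2 <= (r * \<bar>f p\<bar>)^2" by (simp add: mult_right_mono power_mult_distrib)
  then show ?thesis using r by (simp add: abs_le_square_iff[symmetric] abs_mult)
 qed
 define \<psi> where "\<psi> n = f n / f p" for n
 show ?thesis
 proof (rule that)
  show "a <= p" "p <= b" using p(1) by auto
  show "\<psi> p = 1" unfolding \<psi>_def using fp by simp
  show "\<psi> n = 0" if "n \<notin> {a..b}" for n unfolding \<psi>_def using f0[OF that] by simp
  show "\<bar>\<psi> n\<bar> <= 1" for n unfolding \<psi>_def using p(2)[of n] f0[of n] fp by (cases "n \<in> {a..b}") auto
  show "\<bar>res U E \<psi> n\<bar> <= r" if "a <= n" "n <= b" for n
  proof -
   have "res U E \<psi> n = res U E f n / f p" unfolding \<psi>_def res_def by (simp add: field_simps fp)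
   then show ?thesis using hn[of n] that fp by (simp add: pos_divide_le_eq)
  qed
 qed
qed

lemma nsq_ham_le:
 assumes f: "!!n. n \<notin> {a..b} ==> f n = 0" and ab: "a <= b" and s: "!!n. n \<in> I ==> a - 1 <= n ==> n <= b + 1 ==> \<bar>res U E f n\<bar> <= s"
  and s0: "s >= 0"
 shows "nsq (ham I U E f) <= of_int (b - a + 3) * s^2"
proof -
 have "nsq (ham I U E f) = (\<Sum>n\<in>{a - 1..b + 1}. (ham I U E f n)^2)"
  by (rule nsq_eq_sum) (use f in \<open>auto simp: ham_def res_def\<close>)
 also have "... <= (\<Sum>n\<in>{a - 1..b + 1}. s^2)"
 proof (rule sum_mono)
  fix n assume "n \<in> {a - 1..b + 1}"
  then have "\<bar>ham I U E f n\<bar> <= s" using s[of n] s0 by (auto simp: ham_def)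
  then show "(ham I U E f n)^2 <= s^2" using s0 by (simp add: abs_le_square_iff[symmetric])
 qed
 also have "... = of_int (b - a + 3) * s^2" using ab by simp
 finally show ?thesis .
qed

text \<open>Averaging over all windows: the sum over \<open>p\<close> of the mass in the window around
\<open>p\<close> is the window length times the total mass.\<close>

lemma window_max:
 assumes \<psi>: "fsupp I \<psi>" "nsq \<psi> > 0" and g: "fsupp I g" "\<kappa> * nsq g <= nsq \<psi>" and \<kappa>: "\<kappa> >= 0"
 obtains p where "\<psi> p ~= 0" "!!n. \<bar>n - p\<bar> <= int w ==> (\<psi> n)\<^sup>2 + \<kappa> * (g n)^2 <= 2 * (2 * real w + 1) * (\<psi> p)^2"
proof -
 let ?F = "{n. \<psi> n ~= 0}" let ?s = "%n. (\<psi> n)^2 + \<kappa> * (g n)^2"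
 have s0: "?s n >= 0" for n using \<kappa> by simp
 have fin: "finite ?F" using \<psi>(1) by (simp add: fsupp_def)
 have ne: "?F ~= {}" using \<psi>(2) unfolding ip_def by force
 have N: "nsq \<psi> = (\<Sum>p\<in>?F. (\<psi> p)^2)" by (rule nsq_eq_sum[OF fin]) simp
 have "\<exists>p\<in>?F. ALL n. \<bar>n - p\<bar> <= int w --> ?s n <= 2 * (2 * real w + 1) * (\<psi> p)^2"
 proof (rule ccontr)
  assume "~ ?thesis"
  then have bad: "\<exists>n. \<bar>n - p\<bar> <= int w & 2 * (2 * real w + 1) * (\<psi> p)^2 < ?s n" if "p \<in> ?F" for p
   using that by (meson not_le)
  have big: "2 * (2 * real w + 1) * (\<psi> p)^2 < (\<Sum>j\<in>{- int w..int w}. ?s (p + j))" if p: "p \<in> ?F" for p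
  proof -
   obtain n where n: "\<bar>n - p\<bar> <= int w" "2 * (2 * real w + 1) * (\<psi> p)^2 < ?s n" using bad[OF p] by blast
   have "?s (p + (n - p)) <= (\<Sum>j\<in>{- int w..int w}. ?s (p + j))"
    by (rule member_le_sum) (use n s0 in auto)
   then show ?thesis using n by simp
  qed
  have shift: "(\<Sum>p\<in>?F. ?s (p + j)) <= 2 * nsq \<psi>" for j
  proof -
   have le: "(\<Sum>p\<in>?F. (f (p + j))^2) <= nsq f" if f: "fsupp I f" for f
   proof -
    have "(\<Sum>p\<in>?F. (f (p + j))^2) = (\<Sum>n\<in>(%p. p + j) ` ?F. (f n)^2)" by (subst sum.reindex) auto
    also have "... <= nsq f" by (rule sum_le_nsq[OF f]) (use fin in simp)
    finally show ?thesis .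
   qed
   have "(\<Sum>p\<in>?F. ?s (p + j)) = (\<Sum>p\<in>?F. (\<psi> (p + j))^2) + \<kappa> * (\<Sum>p\<in>?F. (g (p + j))^2)"
    by (simp add: sum.distrib sum_distrib_left)
   also have "... <= nsq \<psi> + \<kappa> * nsq g" by (intro add_mono mult_left_mono le \<psi> g \<kappa>)
   finally show ?thesis using g(2) by linarith
  qed
  have "(\<Sum>p\<in>?F. 2 * (2 * real w + 1) * (\<psi> p)^2) < (\<Sum>p\<in>?F. \<Sum>j\<in>{- int w..int w}. ?s (p + j))"
   by (rule sum_strict_mono[OF fin ne big])
  also have "... = (\<Sum>j\<in>{- int w..int w}. \<Sum>p\<in>?F. ?s (p + j))" by (rule sum.swap)
  also have "... <= (\<Sum>j\<in>{- int w..int w}. 2 * nsq \<psi>)" by (rule sum_mono[OF shift])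
  also have "... = (2 * real w + 1) * (2 * nsq \<psi>)" by (simp add: algebra_simps)
  also have "... = (\<Sum>p\<in>?F. 2 * (2 * real w + 1) * (\<psi> p)^2)" unfolding N by (simp add: sum_distrib_left algebra_simps)
  finally show False by simp
 qed
 then show ?thesis using that by blast
qed

lemma pot_periodic:
 assumes "!!s. V (s + 1) = V s"
 shows "pot V \<omega> (x + of_int j) = pot V \<omega> x"
proof
 fix n
 have "V (x + of_int n * \<omega> + of_int j) = V (x + of_int n * \<omega>)" by (rule periodic_of_int) (rule assms)
 then show "pot V \<omega> (x + of_int j) n = pot V \<omega> x n" unfolding pot_def by (simp add: add_ac)
qed

text \<open>A state at energy at the island, supported near the left end \<open>A\<close> and approximately an
eigenfunction on the half line. Unlike an eigenvector of an interval it does not refer to a cut, so it can be handed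
on from phase to phase.\<close>

definition edge_state :: "(real => real) => real => real => real => real => int => int => real => bool" where
 "edge_state V \<omega> lo hi \<delta> Q A y \<longleftrightarrow> (\<exists>E f. lo - \<delta> / 4 <= E & E <= hi + \<delta> / 4 & (ALL n. n \<notin> {A..A + 5 * Q} --> f n = 0) &
   nsq f > 0 & nsq (ham {A..} (pot V \<omega> y) E f) <= (\<delta> / 16)^2 * nsq f)"

context island
begin

abbreviation "rQ \<equiv> real_of_int Q"
abbreviation "\<zeta> \<equiv> (1 / 32 :: real) ^ (R - J)"

lemma \<zeta>: "0 < \<zeta>" "\<zeta> <= 1" by (auto intro: power_le_one)

lemma small_Q: "t >= 0 ==> t <= 256 ==> t * rQ * \<zeta> <= \<delta> / 16" "t >= 0 ==> t <= 256 ==> t * (rQ)^2 * \<zeta> <= \<delta> / 16"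
proof -
 assume t: "t >= 0" "t <= 256"
 have Q1: "rQ >= 1" using Q_ge by linarith
 have "t * (rQ)^2 * \<zeta> <= 256 * (rQ)^2 * \<zeta>" using t \<zeta> by (intro mult_right_mono) auto
 also have "... <= \<delta> / 16" using small by simp
 finally show 2: "t * (rQ)^2 * \<zeta> <= \<delta> / 16" .
 have "rQ * 1 <= rQ * rQ" using Q1 by (intro mult_left_mono) auto
 then have "t * rQ * \<zeta> <= t * (rQ)^2 * \<zeta>" using t \<zeta> by (intro mult_right_mono mult_left_mono) (auto simp: power2_eq_square)
 then show "t * rQ * \<zeta> <= \<delta> / 16" using 2 by linarith
qed

definition ends :: "real => int => int => bool" where
 "ends x a b \<longleftrightarrow> right_cut x b & (left_cut x a | a - 1 \<notin> \<Omega>) & {a..b} \<subseteq> \<Omega> & Q <= b - a & b - a <= 8 * Q"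

definition clear :: "real => int => int => bool" where
 "clear x l u \<longleftrightarrow> (ALL s. l <= s --> s <= u --> good x s)"

lemma Rm: "int R * int m + 2 * int m <= Q" using m_Q by (simp add: algebra_simps)

lemma isl_mono: "isl t E ==> t <= u ==> isl u E"
proof -
 assume E: "isl t E" and "t <= u"
 then have "t * \<delta> <= u * \<delta>" using \<delta> by (intro mult_right_mono) auto
 then show ?thesis using E unfolding isl_def by linarith
qed

lemma potC: "isl t E ==> t <= 1 / 2 ==> \<bar>pot V \<omega> x n - E\<bar> <= Mb"
 unfolding pot_def by (intro bdV isl_near)

text \<open>An eigenvector of the interval is tiny at its cuts, so extended by zero it is an approximate eigenfunction
on \<open>\<Omega>\<close>, and \<open>gap\<close> moves its energy out of the collars.\<close>

lemma refine:
 assumes e: "ends x a b" and ap: "approx_eig {a..b} (pot V \<omega> x) E" and E: "isl (1 / 2) E"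
 shows "isl (1 / 8) E"
proof -
 define r where "r = \<zeta> / (2 * K)"
 have r: "r > 0" "2 * (K * r) = \<zeta>" unfolding r_def using \<zeta> K by auto
 have r\<zeta>: "r <= \<zeta>" unfolding r_def using \<zeta> K by (simp add: pos_divide_le_eq)
 obtain \<psi> p where \<psi>: "!!n. n \<notin> {a..b} ==> \<psi> n = 0" "a <= p" "p <= b" "\<psi> p = 1" "!!n. \<bar>\<psi> n\<bar> <= 1"
  "!!n. a <= n ==> n <= b ==> \<bar>res (pot V \<omega> x) E \<psi> n\<bar> <= r" using approx_eig_normalised[OF ap r(1)] by blast
 have w: "\<bar>E - E0\<bar> <= w" by (rule isl_near[OF E]) simp
 have ba: "Q <= b - a" "b - a <= 8 * Q" and sub: "{a..b} \<subseteq> \<Omega>" using e unfolding ends_def by auto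
 have b: "\<bar>\<psi> b\<bar> <= 3 * \<zeta>"
 proof -
  have "\<bar>\<psi> b\<bar> <= \<zeta> * (2 * 1) + 2 * (K * r)"
   by (rule decay_right_cut[OF w _ _ _ _ \<psi>(5)]) (use e r \<psi>(1)[of "b + 1"] ba Rm m2 in \<open>auto simp: ends_def intro!: \<psi>(6)\<close>)
  then show ?thesis using r by simp
 qed
 have a: "\<bar>\<psi> a\<bar> <= 3 * \<zeta>" if "a - 1 \<in> \<Omega>"
 proof -
  have "\<bar>\<psi> a\<bar> <= \<zeta> * (2 * 1) + 2 * (K * r)"
   by (rule decay_left_cut[OF w _ _ _ _ \<psi>(5)]) (use e that r \<psi>(1)[of "a - 1"] ba Rm m2 in \<open>auto simp: ends_def intro!: \<psi>(6)\<close>)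
  then show ?thesis using r by simp
 qed
 have res: "\<bar>res (pot V \<omega> x) E \<psi> n\<bar> <= 3 * \<zeta>" if n: "n \<in> \<Omega>" "a - 1 <= n" "n <= b + 1" for n
 proof -
  consider "n = a - 1" | "n = b + 1" | "a <= n" "n <= b" using n by linarith
  then show ?thesis
  proof cases
   case 1
   then have "\<psi> (n - 1) = 0" "\<psi> n = 0" "n + 1 = a" by (auto intro!: \<psi>(1))
   then show ?thesis using a n 1 by (simp add: res_def)
  next
   case 2
   then have "\<psi> (n + 1) = 0" "\<psi> n = 0" "n - 1 = b" by (auto intro!: \<psi>(1))
   then show ?thesis using b by (simp add: res_def)
  next
   case 3
   then show ?thesis using \<psi>(6)[of n] r\<zeta> \<zeta> by linarith
  qed
 qed
 have f: "fsupp \<Omega> \<psi>" by (rule fsuppI[of "{a..b}"]) (use \<psi>(1) sub in blast)+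
 have n1: "nsq \<psi> >= 1" using nsq_ge[OF f, of p] \<psi>(4) by simp
 define \<sigma> where "\<sigma> = 9 * rQ * \<zeta>"
 have \<sigma>: "0 < \<sigma>" "\<sigma> <= \<delta> / 16" unfolding \<sigma>_def using small_Q(1)[of 9] \<zeta> Q_ge by auto
 have "nsq (ham \<Omega> (pot V \<omega> x) E \<psi>) <= of_int (b - a + 3) * (3 * \<zeta>)^2"
  by (rule nsq_ham_le[OF \<psi>(1)]) (use res \<psi>(2,3) \<zeta> in auto)
 also have "... <= (9 * rQ * rQ) * (3 * \<zeta>)^2"
 proof (rule mult_right_mono)
  have "b - a + 3 <= 9 * Q * 1" using ba Q_ge by linarith
  also have "... <= 9 * Q * Q" using Q_ge by (intro mult_left_mono) auto
  finally show "real_of_int (b - a + 3) <= 9 * rQ * rQ" by (metis of_int_le_iff of_int_mult of_int_numeral)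
 qed simp
 also have "... = \<sigma>^2" unfolding \<sigma>_def by (simp add: power2_eq_square)
 also have "... <= \<sigma>^2 * nsq \<psi>" using n1 by (simp add: mult_le_cancel_left1)
 finally have "lo - 2 * \<sigma> <= E & E <= hi + 2 * \<sigma>"
  using E n1 unfolding isl_def by (intro gap[OF f _ _ \<sigma>]) auto
 then show ?thesis using \<sigma> unfolding isl_def by auto
qed

text \<open>In steps of the phase that move eigenvalues by at most \<open>\<delta> / 16\<close>, an eigenvalue at the
island remains in the collars and \<open>refine\<close> brings it back.\<close>

lemma track:
 assumes e: "!!x. \<bar>x - y\<bar> <= h ==> ends x a b" and ap: "approx_eig {a..b} (pot V \<omega> y) E" and E: "isl (1 / 2) E"
  and x: "\<bar>x - y\<bar> <= h"
 obtains E' where "isl (1 / 8) E'" "approx_eig {a..b} (pot V \<omega> x) E'"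
proof -
 define n where "n = nat \<lceil>32 * LV * h / \<delta>\<rceil> + 1"
 have n1: "n >= 1" unfolding n_def by simp
 have "real n >= 32 * LV * h / \<delta>" unfolding n_def by linarith
 then have nb: "LV * h / real n <= \<delta> / 32" using \<delta> n1 by (simp add: field_simps)
 let ?x = "%i::nat. y + (x - y) * real i / real n"
 have xi: "\<bar>?x i - y\<bar> <= h" if "i <= n" for i
 proof -
  have "\<bar>?x i - y\<bar> = \<bar>x - y\<bar> * (real i / real n)" by (simp add: abs_mult)
  also have "... <= \<bar>x - y\<bar> * 1" using that n1 by (intro mult_left_mono) auto
  finally show ?thesis using x unfolding mult_1_right by (rule order_trans)
 qed
 have "\<exists>E. isl (1 / 2) E & approx_eig {a..b} (pot V \<omega> (?x i)) E" if "i <= n" for i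
  using that
 proof (induction i)
  case 0
  then show ?case using ap E by auto
 next
  case (Suc i)
  then obtain E where E: "isl (1 / 2) E" "approx_eig {a..b} (pot V \<omega> (?x i)) E" by auto
  have E8: "isl (1 / 8) E" by (rule refine[OF e[OF xi] E(2,1)]) (use Suc in simp)
  have d: "\<bar>pot V \<omega> (?x (Suc i)) k - pot V \<omega> (?x i) k\<bar> <= \<delta> / 32" for k
  proof -
   have "?x (Suc i) + of_int k * \<omega> - (?x i + of_int k * \<omega>) = (x - y) / real n"
    by (simp add: algebra_simps add_divide_distrib diff_divide_distrib)
   then have "\<bar>pot V \<omega> (?x (Suc i)) k - pot V \<omega> (?x i) k\<bar> <= LV * \<bar>(x - y) / real n\<bar>" unfolding pot_def using Lip by metis
   also have "... = LV * \<bar>x - y\<bar> / real n" by (simp add: abs_mult)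
   also have "... <= LV * h / real n" using x LV by (intro divide_right_mono mult_left_mono) auto
   finally show ?thesis using nb by linarith
  qed
  have "\<delta> / 32 > 0" using \<delta> by simp
  from approx_eig_perturb[OF E(2) d this potC[OF E(1) order_refl]]
  obtain E1 where E1: "\<bar>E1 - E\<bar> <= 2 * (\<delta> / 32)" "approx_eig {a..b} (pot V \<omega> (?x (Suc i))) E1" by blast
  have "isl (1 / 8 + 1 / 16) E1" by (rule isl_shift[OF E8]) (use E1 in simp)
  then have "isl (1 / 2) E1" by (rule isl_mono) simp
  then show ?case using E1 by blast
 qed
 from this[of n] obtain E' where E': "isl (1 / 2) E'" "approx_eig {a..b} (pot V \<omega> x) E'" using n1 by auto
 show ?thesis by (rule that[OF refine[OF e[OF x] E'(2,1)] E'(2)])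
qed

text \<open>At a point where the eigenvector attains its maximum 1, \<open>centre\<close> would give \<open>1 \<le> 4
* \<theta>\<close> plus a small error. Near a cut, the value at the end is at most \<open>1 / (64 * C ^ (m +
2))\<close> and grows by at most \<open>2 * C ^ m\<close> within \<open>m\<close> sites.\<close>

lemma eigenvector_position:
 assumes e: "ends x a b" and g: "clear x (a - 1) b" and ap: "approx_eig {a..b} (pot V \<omega> x) E" and E: "isl (1 / 2) E"
  and r: "r > 0" "K * r <= 1 / 64"
 obtains \<psi> p where "!!n. n \<notin> {a..b} ==> \<psi> n = 0" "a <= p" "p < a - 1 + int m" "\<psi> p = 1" "!!n. \<bar>\<psi> n\<bar> <= 1"
  "!!n. a <= n ==> n <= b ==> \<bar>res (pot V \<omega> x) E \<psi> n\<bar> <= r" "~ left_cut x a"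
proof -
 obtain \<psi> p where \<psi>: "!!n. n \<notin> {a..b} ==> \<psi> n = 0" "a <= p" "p <= b" "\<psi> p = 1" "!!n. \<bar>\<psi> n\<bar> <= 1"
  "!!n. a <= n ==> n <= b ==> \<bar>res (pot V \<omega> x) E \<psi> n\<bar> <= r" using approx_eig_normalised[OF ap r(1)] by blast
 have w: "\<bar>E - E0\<bar> <= w" by (rule isl_near[OF E]) simp
 have r0: "r >= 0" using r by simp
 have ba: "Q <= b - a" "b - a <= 8 * Q" using e unfolding ends_def by auto
 have P1: "norm (pr \<psi> p) >= 1" using le_norm_pr(1)[of \<psi> p] \<psi>(4) by simp
 have P2: "norm (pr \<psi> n) <= 2" for n using norm_pr_le[of \<psi> n] \<psi>(5)[of n] \<psi>(5)[of "n + 1"] by linarith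
 have nfQ: "int nf <= Q" "int m <= Q"
 proof -
  have "int nf <= int (J * m)" using nf by (simp only: of_nat_le_iff)
  also have "... <= int R * int m" using JR by (simp add: mult_right_mono)
  finally show "int nf <= Q" using Rm by linarith
  show "int m <= Q" using Rm m2 by (smt (verit) mult_nonneg_nonneg of_nat_0_le_iff)
 qed
 have mJ: "m <= J * m" using J1 by simp
 have left: "p < a - 1 + int m"
 proof (rule ccontr)
  assume p: "~ p < a - 1 + int m"
  show False
  proof (cases "p <= b - int m")
   case True
   have "norm (pr \<psi> p) <= \<theta> * (norm (pr \<psi> (p - int m)) + norm (pr \<psi> (p + int m))) + K * r"
    by (rule centre_good[OF w r0]) (use g p True \<psi>(2,3) in \<open>auto simp: clear_def intro!: \<psi>(6)\<close>)
   also have "... <= \<theta> * (2 + 2) + K * r" using \<theta> by (intro add_mono mult_left_mono P2 order_refl) auto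
   also have "\<theta> * (2 + 2) = 4 * \<theta>" by simp
   finally show False using P1 r \<theta> by linarith
  next
   case False
   define k where "k = nat (b - p)"
   have k: "b = p + int k" "k <= m" unfolding k_def using False \<psi>(3) by auto
   have "norm (pr \<psi> p) <= 2 * C ^ k * norm (pr \<psi> (p + int k)) + K * r"
    by (rule conjunct2[OF grow[OF w order_trans[OF k(2) mJ] r0]]) (use k \<psi>(2) in \<open>auto intro!: \<psi>(6)\<close>)
   also have "norm (pr \<psi> (p + int k)) = \<bar>\<psi> b\<bar>" unfolding k(1)[symmetric] pr_def using \<psi>(1)[of "b + 1"] by (simp add: norm_Pair)
   finally have 1: "1 <= 2 * (C ^ k * \<bar>\<psi> b\<bar>) + K * r" using P1 by simp
   have "\<bar>\<psi> b\<bar> * (64 * C ^ (m + 2)) <= \<bar>\<psi> (b - int nf)\<bar> + K * r"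
    by (rule right_end[where x=x and E=E, OF w r0]) (use e \<psi>(1)[of "b + 1"] nfQ ba in \<open>auto simp: ends_def right_cut_def intro!: \<psi>(6)\<close>)
   moreover have "64 * (C ^ k * \<bar>\<psi> b\<bar>) <= 64 * (C ^ (m + 2) * \<bar>\<psi> b\<bar>)"
    using k C2 by (intro mult_left_mono mult_right_mono power_increasing) auto
   ultimately have "64 * (C ^ k * \<bar>\<psi> b\<bar>) <= 1 + K * r" using \<psi>(5)[of "b - int nf"] by (simp add: mult_ac)
   then show False using 1 r by linarith
  qed
 qed
 have "~ left_cut x a"
 proof
  assume lc: "left_cut x a"
  define k where "k = nat (p - (a - 1))"
  have k: "p = a - 1 + int k" "k <= m" unfolding k_def using left \<psi>(2) by auto
  have "norm (pr \<psi> (a - 1 + int k)) <= 2 * C ^ k * norm (pr \<psi> (a - 1)) + K * r"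
   by (rule conjunct1[OF grow[OF w order_trans[OF k(2) mJ] r0]]) (use k \<psi>(3) in \<open>auto intro!: \<psi>(6)\<close>)
  also have "norm (pr \<psi> (a - 1)) = \<bar>\<psi> a\<bar>" unfolding pr_def using \<psi>(1)[of "a - 1"] by (simp add: norm_Pair)
  finally have 1: "1 <= 2 * (C ^ k * \<bar>\<psi> a\<bar>) + K * r" using P1 k by simp
  have "\<bar>\<psi> a\<bar> * (64 * C ^ (m + 2)) <= \<bar>\<psi> (a + int nf)\<bar> + K * r"
   by (rule left_end[where x=x and E=E, OF w r0]) (use lc \<psi>(1)[of "a - 1"] nfQ ba in \<open>auto simp: left_cut_def intro!: \<psi>(6)\<close>)
  moreover have "64 * (C ^ k * \<bar>\<psi> a\<bar>) <= 64 * (C ^ (m + 2) * \<bar>\<psi> a\<bar>)"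
   using k C2 by (intro mult_left_mono mult_right_mono power_increasing) auto
  ultimately have "64 * (C ^ k * \<bar>\<psi> a\<bar>) <= 1 + K * r" using \<psi>(5)[of "a + int nf"] by (simp add: mult_ac)
  then show False using 1 r by linarith
 qed
 then show ?thesis using that \<psi> left by blast
qed

end

section \<open>Edge states\<close>

context island
begin

definition left_edge :: "real => int => bool" where
 "left_edge x A \<longleftrightarrow> (\<exists>E \<psi>. \<bar>E - E0\<bar> <= w & \<psi> (A - 1) = 0 & \<psi> A = 1 &
   (ALL n. A <= n --> n < A + int m --> \<bar>res (pot V \<omega> x) E \<psi> n\<bar> <= \<theta> / (4 * K)) & norm (pr \<psi> (A - 1 + int m)) <= 4 * \<theta>)"

lemma left_edge_shift: "left_edge x A ==> left_edge (x + \<omega>) A ==> False"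
proof -
 assume l: "left_edge x A" "left_edge (x + \<omega>) A"
 obtain E \<psi> where 1: "\<bar>E - E0\<bar> <= w" "\<psi> (A - 1) = 0" "\<psi> A = 1"
   "!!n. A <= n ==> n < A + int m ==> \<bar>res (pot V \<omega> x) E \<psi> n\<bar> <= \<theta> / (4 * K)" "norm (pr \<psi> (A - 1 + int m)) <= 4 * \<theta>"
  using l(1) unfolding left_edge_def by blast
 obtain E' \<psi>' where 2: "\<bar>E' - E0\<bar> <= w" "\<psi>' (A - 1) = 0" "\<psi>' A = 1"
   "!!n. A <= n ==> n < A + int m ==> \<bar>res (pot V \<omega> (x + \<omega>)) E' \<psi>' n\<bar> <= \<theta> / (4 * K)" "norm (pr \<psi>' (A - 1 + int m)) <= 4 * \<theta>"
  using l(2) unfolding left_edge_def by blast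
 have "0 <= \<theta> / (4 * K)" "K * (\<theta> / (4 * K)) <= \<theta> / 4" using \<theta> K by auto
 from edge[OF 1(1) 2(1) this 1(2,3) 2(2,3) 1(4) 2(4) 1(5) 2(5)] show False .
qed

lemma res_truncate:
 assumes "a <= b" "a - 1 <= n" "n <= b + 1"
  and "!!n. a <= n ==> n <= b ==> \<bar>res U E \<psi> n\<bar> <= r"
  and "a <= n --> \<bar>\<psi> (b + 1)\<bar> <= s" "b < n --> \<bar>\<psi> b\<bar> <= s" "n <= b --> \<bar>\<psi> (a - 1)\<bar> <= s" "n <= a - 1 --> \<bar>\<psi> a\<bar> <= s"
  and "r >= 0" "a < b" "s >= 0"
 shows "\<bar>res U E (%n. if a <= n & n <= b then \<psi> n else 0) n\<bar> <= r + s"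
proof -
 let ?f = "%n. if a <= n & n <= b then \<psi> n else 0"
 have e: "res U E ?f n = - ?f (n - 1) - ?f (n + 1) + (U n - E) * ?f n" by (rule res_def)
 note n0 = assms(1,10)
 consider "n = a - 1" | "n = a" | "a < n" "n < b" | "n = b" | "n = b + 1" using assms(1,2,3) by linarith
 then show ?thesis
 proof cases
  case 1
  then have f: "?f (n - 1) = 0" "?f n = 0" "?f (n + 1) = \<psi> a" using n0 by auto
  have "\<bar>\<psi> a\<bar> <= s" using assms(8) 1 by simp
  then show ?thesis unfolding e f using assms(9) by simp
 next
  case 2
  then have f: "?f (n - 1) = 0" "?f n = \<psi> a" "?f (n + 1) = \<psi> (a + 1)" using n0 by auto
  have "\<bar>\<psi> (a - 1)\<bar> <= s" using assms(7) 2 n0 by simp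
  moreover have "\<bar>- \<psi> (a - 1) - \<psi> (a + 1) + (U n - E) * \<psi> a\<bar> <= r" using assms(4)[of a] 2 n0 by (simp add: res_def)
  ultimately show ?thesis unfolding e f by linarith
 next
  case 3
  then have f: "?f (n - 1) = \<psi> (n - 1)" "?f n = \<psi> n" "?f (n + 1) = \<psi> (n + 1)" by auto
  have "\<bar>- \<psi> (n - 1) - \<psi> (n + 1) + (U n - E) * \<psi> n\<bar> <= r" using assms(4)[of n] 3 by (simp add: res_def)
  then show ?thesis unfolding e f using assms(11) by linarith
 next
  case 4
  then have f: "?f (n - 1) = \<psi> (b - 1)" "?f n = \<psi> b" "?f (n + 1) = 0" using n0 by auto
  have "\<bar>\<psi> (b + 1)\<bar> <= s" using assms(5) 4 n0 by simp
  moreover have "\<bar>- \<psi> (b - 1) - \<psi> (b + 1) + (U n - E) * \<psi> b\<bar> <= r" using assms(4)[of b] 4 n0 by (simp add: res_def)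
  ultimately show ?thesis unfolding e f by linarith
 next
  case 5
  then have f: "?f (n - 1) = \<psi> b" "?f n = 0" "?f (n + 1) = 0" using n0 by auto
  have "\<bar>\<psi> b\<bar> <= s" using assms(6) 5 n0 by simp
  then show ?thesis unfolding e f using assms(9) by simp
 qed
qed

text \<open>The eigenvector sits within \<open>m\<close> sites of \<open>A\<close>, hence is at least of order
\<open>C ^ -m\<close> at \<open>A\<close>, and decays from there: the first window gives \<open>left_edge\<close>, and
the tiny values near \<open>A + 5 * Q\<close> permit truncation.\<close>

lemma edge_step:
 assumes e: "ends x A b" and A1: "A - 1 \<notin> \<Omega>" and g: "clear x (A - 1) b" and ap: "approx_eig {A..b} (pot V \<omega> x) E" and E: "isl (1 / 2) E"
  and b: "A + 6 * Q <= b"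
 shows "left_edge x A & edge_state V \<omega> lo hi \<delta> Q A x"
proof -
 define t where "t = 1 / (16 * C ^ m)"
 have Cm: "C ^ m >= 1" by (rule C_pow)
 have t: "0 < t" "t <= 1 / 16" "C ^ m * t = 1 / 16" unfolding t_def using Cm C2 by (simp_all add: field_simps)
 define r where "r = \<zeta> * \<theta> * t / K"
 have Kr: "K * r = \<zeta> * \<theta> * t" unfolding r_def using K by simp
 have r: "r > 0" unfolding r_def using \<zeta> \<theta> K t by simp
 have \<zeta>t: "\<zeta> * (\<theta> * t) <= 1 * (\<theta> * t)" "\<theta> * t <= 1 / 64 * t" "\<theta> * t <= \<theta> * (1 / 16)" "\<zeta> * (\<theta> * t) <= \<zeta> * (1 / 64 * (1 / 16))"
  using \<zeta> \<theta> t by (intro mult_right_mono mult_left_mono mult_mono; simp)+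
 have Kr4: "K * r <= \<theta> * t" "K * r <= 1 / 64" "2 * (K * r) <= \<zeta>"
  unfolding Kr mult.assoc using \<zeta>t t \<zeta> by linarith+
 have r\<zeta>: "r <= \<zeta>"
 proof -
  have "1 * r <= K * r" using K r by (intro mult_right_mono) auto
  then show ?thesis using Kr4 r by linarith
 qed
 obtain \<psi> p where \<psi>: "!!n. n \<notin> {A..b} ==> \<psi> n = 0" "A <= p" "p < A - 1 + int m" "\<psi> p = 1" "!!n. \<bar>\<psi> n\<bar> <= 1"
  "!!n. A <= n ==> n <= b ==> \<bar>res (pot V \<omega> x) E \<psi> n\<bar> <= r" "~ left_cut x A"
  using eigenvector_position[OF e g ap E r Kr4(2)] by blast
 have w: "\<bar>E - E0\<bar> <= w" by (rule isl_near[OF E]) simp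
 have r0: "r >= 0" using r by simp
 have P2: "norm (pr \<psi> n) <= 2" for n using norm_pr_le[of \<psi> n] \<psi>(5)[of n] \<psi>(5)[of "n + 1"] by linarith
 have mJ: "m <= J * m" using J1 by simp
 have bd: "b - A <= 8 * Q" using e unfolding ends_def by auto
 have mQ: "int m <= Q" using Rm m2 by (smt (verit) mult_nonneg_nonneg of_nat_0_le_iff)
 have A0: "\<psi> (A - 1) = 0" using \<psi>(1) by simp
 define v where "v = (%k::nat. norm (pr \<psi> (A - 1 + int k * int m)))"
 have v0: "v 0 = \<bar>\<psi> A\<bar>" unfolding v_def pr_def using A0 by (simp add: norm_Pair)
 have v1: "v 1 <= 2 * \<theta> * v 0 + (2 * \<theta>) ^ (R - 1) * 2 + 4 * (K * r)"
 proof (rule recurrence_from_edge)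
  fix k :: nat assume k: "1 <= k" "k < R"
  have km: "int k * int m + int m <= int R * int m" "int m <= int k * int m"
   using k mult_right_mono[of "int k + 1" "int R" "int m"] mult_right_mono[of 1 "int k" "int m"] by (simp_all add: algebra_simps)
  have "good x (A - 1 + int k * int m)" using g km Rm b m2 Q_ge unfolding clear_def by auto
  then have "norm (pr \<psi> (A - 1 + int k * int m)) <= \<theta> * (norm (pr \<psi> (A - 1 + int k * int m - int m)) + norm (pr \<psi> (A - 1 + int k * int m + int m))) + K * r"
   by (rule centre_good[OF w r0]) (rule \<psi>(6); use km Rm b m2 Q_ge in linarith)
  moreover have "A - 1 + int k * int m + int m = A - 1 + int (k + 1) * int m" "A - 1 + int k * int m - int m = A - 1 + int (k - 1) * int m"
   using k by (simp_all add: algebra_simps of_nat_diff)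
  ultimately show "v k <= \<theta> * (v (k - 1) + v (k + 1)) + K * r" unfolding v_def by simp
 qed (use \<theta> K r JR P2 in \<open>auto simp: v_def\<close>)
 have v0t: "v 0 >= 4 * t"
 proof -
  define k where "k = nat (p - (A - 1))"
  have k: "p = A - 1 + int k" "k <= m" unfolding k_def using \<psi>(2,3) by auto
  have "1 <= norm (pr \<psi> (A - 1 + int k))" using le_norm_pr(1)[of \<psi> p] \<psi>(4) k by simp
  also have "... <= 2 * C ^ k * norm (pr \<psi> (A - 1)) + K * r"
   by (rule conjunct1[OF grow[OF w order_trans[OF k(2) mJ] r0]]) (rule \<psi>(6); use k mQ b Q_ge in linarith)
  also have "norm (pr \<psi> (A - 1)) = v 0" unfolding v_def by simp
  also have "2 * C ^ k * v 0 <= 2 * C ^ m * v 0" using k C2 by (intro mult_right_mono mult_left_mono power_increasing) (auto simp: v_def)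
  finally have "1 / 2 <= 2 * C ^ m * v 0" using Kr4(2) by linarith
  then have "t * (1 / 2) <= t * (2 * C ^ m * v 0)" using t by (intro mult_left_mono) auto
  also have "... = 2 * (C ^ m * t) * v 0" by simp
  finally show ?thesis unfolding t(3) by simp
 qed
 have small1: "(2 * \<theta>) ^ (R - 1) * 2 <= \<theta> * v 0"
 proof -
  have "(2 * \<theta>) ^ (R - 1) <= (2 * \<theta>) ^ J" using JR \<theta> by (intro power_decreasing) auto
  also have "... <= 2 * \<theta> * t"
  proof -
   have "t * ((2 * \<theta>) ^ J * (8 * C ^ m)) <= t * \<theta>" using J\<theta> t by (intro mult_left_mono) auto
   moreover have "t * ((2 * \<theta>) ^ J * (8 * C ^ m)) = (2 * \<theta>) ^ J * (8 * (C ^ m * t))" by (simp only: mult_ac)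
   ultimately have "(2 * \<theta>) ^ J * (8 * (1 / 16)) <= t * \<theta>" unfolding t(3) by (simp only:)
   then have "(2 * \<theta>) ^ J <= 2 * (t * \<theta>)" by linarith
   then show ?thesis by (simp only: mult_ac)
  qed
  finally have "(2 * \<theta>) ^ (R - 1) * 2 <= \<theta> * (4 * t)" by linarith
  also have "... <= \<theta> * v 0" using v0t \<theta> by (intro mult_left_mono) auto
  finally show ?thesis .
 qed
 have small2: "4 * (K * r) <= \<theta> * v 0"
 proof -
  have "4 * (K * r) <= \<theta> * (4 * t)" using Kr4(1) by simp
  also have "... <= \<theta> * v 0" using v0t \<theta> by (intro mult_left_mono) auto
  finally show ?thesis .
 qed
 have v14: "v 1 <= 4 * \<theta> * v 0" using v1 small1 small2 by linarith
 have \<psi>A: "\<bar>\<psi> A\<bar> > 0" using v0t t unfolding v0 by linarith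
 have LE: "left_edge x A" unfolding left_edge_def
 proof (rule exI[of _ E], rule exI[of _ "%n. \<psi> n / \<psi> A"], intro conjI allI impI)
  show "\<bar>E - E0\<bar> <= w" by (rule w)
  show "\<psi> (A - 1) / \<psi> A = 0" using A0 by simp
  show "\<psi> A / \<psi> A = 1" using \<psi>A by simp
  show "norm (pr (%n. \<psi> n / \<psi> A) (A - 1 + int m)) <= 4 * \<theta>"
  proof -
   have "pr (%n. \<psi> n / \<psi> A) (A - 1 + int m) = (1 / \<psi> A) *\<^sub>R pr \<psi> (A - 1 + int m)" unfolding pr_def by simp
   then have "norm (pr (%n. \<psi> n / \<psi> A) (A - 1 + int m)) = v 1 / \<bar>\<psi> A\<bar>" unfolding v_def by simp
   then show ?thesis using v14 \<psi>A unfolding v0 by (simp add: pos_divide_le_eq)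
  qed
  fix n assume n: "A <= n" "n < A + int m"
  have "res (pot V \<omega> x) E (%n. \<psi> n / \<psi> A) n = res (pot V \<omega> x) E \<psi> n / \<psi> A"
   unfolding res_def using \<psi>A by (simp add: diff_divide_distrib add_divide_distrib)
  moreover have "\<bar>res (pot V \<omega> x) E \<psi> n\<bar> <= r" by (rule \<psi>(6)) (use n mQ b Q_ge in linarith)+
  ultimately have "\<bar>res (pot V \<omega> x) E (%n. \<psi> n / \<psi> A) n\<bar> * \<bar>\<psi> A\<bar> <= r" using \<psi>A by simp
  also have "r <= \<theta> / (4 * K) * \<bar>\<psi> A\<bar>"
  proof -
   have "4 * K * r <= \<theta> * \<bar>\<psi> A\<bar>" using small2 unfolding v0 by simp
   then show ?thesis using K by (simp add: field_simps)
  qed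
  finally show "\<bar>res (pot V \<omega> x) E (%n. \<psi> n / \<psi> A) n\<bar> <= \<theta> / (4 * K)" using \<psi>A by (rule mult_right_le_imp_le)
 qed
 define s where "s = A + 5 * Q"
 have mid: "norm (pr \<psi> s) <= \<zeta> * (2 * 1) + 2 * (K * r)"
 proof (rule decay_two_sided[OF w r0, where x=x and s=s])
  fix k assume k: "\<bar>k\<bar> <= int R"
  then have km: "k * int m <= int R * int m" "- (int R * int m) <= k * int m"
   using mult_right_mono[of "k" "int R" "int m"] mult_right_mono[of "- int R" "k" "int m"] by simp_all
  then have "A - 1 <= s + k * int m" "s + k * int m <= b" unfolding s_def using Rm b m2 Q_ge by linarith+
  then show "good x (s + k * int m)" using g unfolding clear_def by blast
 next
  fix n assume "s - int R * int m < n" "n <= s + int R * int m"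
  then show "\<bar>res (pot V \<omega> x) E \<psi> n\<bar> <= r" unfolding s_def using Rm b m2 Q_ge by (intro \<psi>(6)) linarith+
 qed (rule \<psi>(5))
 then have \<psi>s: "\<bar>\<psi> s\<bar> <= 3 * \<zeta>" "\<bar>\<psi> (s + 1)\<bar> <= 3 * \<zeta>" using le_norm_pr[of \<psi> s] Kr4 by linarith+
 define f where "f = (%n. if A <= n & n <= s then \<psi> n else 0)"
 have As: "A < s" unfolding s_def using Q_ge by simp
 have ff: "fsupp {A..} f" by (rule fsuppI[of "{A..s}"]) (auto simp: f_def)
 have n1: "nsq f >= 1" using nsq_ge[OF ff, of p] \<psi>(2,3,4) mQ Q_ge by (simp add: f_def s_def)
 have "nsq (ham {A..} (pot V \<omega> x) E f) <= of_int (s - A + 3) * (4 * \<zeta>)^2"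
 proof (rule nsq_ham_le)
  fix n assume n: "n \<in> {A..}" "A - 1 <= n" "n <= s + 1"
  have "\<bar>res (pot V \<omega> x) E f n\<bar> <= r + 3 * \<zeta>" unfolding f_def
   by (rule res_truncate) (use n As \<psi>s A0 r \<zeta> b Q_ge in \<open>auto simp: s_def intro!: \<psi>(6)\<close>)
  then show "\<bar>res (pot V \<omega> x) E f n\<bar> <= 4 * \<zeta>" using r\<zeta> by linarith
 qed (use As \<zeta> in \<open>auto simp: f_def\<close>)
 also have "... <= (9 * rQ * rQ) * (4 * \<zeta>)^2"
 proof (rule mult_right_mono)
  have "s - A + 3 <= 9 * Q * 1" unfolding s_def using Q_ge by linarith
  also have "... <= 9 * Q * Q" using Q_ge by (intro mult_left_mono) auto
  finally show "real_of_int (s - A + 3) <= 9 * rQ * rQ" by (metis of_int_le_iff of_int_mult of_int_numeral)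
 qed simp
 also have "... = (12 * rQ * \<zeta>)^2" by (simp add: power2_eq_square)
 also have "... <= (\<delta> / 16)^2" using small_Q(1)[of 12] \<zeta> Q_ge by (intro power_mono) auto
 also have "... <= (\<delta> / 16)^2 * nsq f" using n1 by (simp add: mult_le_cancel_left1)
 finally have "nsq (ham {A..} (pot V \<omega> x) E f) <= (\<delta> / 16)^2 * nsq f" .
 moreover have "isl (1 / 4) E" by (rule isl_mono[OF refine[OF e ap E]]) simp
 ultimately have "edge_state V \<omega> lo hi \<delta> Q A x" unfolding edge_state_def isl_def
  using n1 by (intro exI[of _ E] exI[of _ f]) (auto simp: f_def s_def)
 then show ?thesis using LE by blast
qed

lemma clear_near:
 assumes "u' - l' <= 9 * Q"
 obtains x where "u <= x" "x <= u + h / 2" "clear x l' u'"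
proof -
 define S where "S = (%(s, t). t - of_int (s - int m) * \<omega>) ` ({l'..u'} \<times> \<Theta>)"
 have fS: "finite S" unfolding S_def using fin by simp
 have "card S <= card ({l'..u'} \<times> \<Theta>)" unfolding S_def by (rule card_image_le) (use fin in simp)
 also have "... = nat (u' - l' + 1) * card \<Theta>" by (simp add: card_cartesian_product)
 finally have "real (card S) <= real (nat (u' - l' + 1)) * real (card \<Theta>)" by (metis of_nat_le_iff of_nat_mult)
 also have "... <= (9 * rQ + 1) * real (card \<Theta>)"
 proof (rule mult_right_mono)
  have "int (nat (u' - l' + 1)) <= 9 * Q + 1" using assms Q_ge by auto
  then show "real (nat (u' - l' + 1)) <= 9 * rQ + 1" by linarith
 qed simp
 finally have "3 * \<tau> * real (card S) <= 3 * \<tau> * ((9 * rQ + 1) * real (card \<Theta>))" using \<tau> by (intro mult_left_mono) auto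
 then have "3 * \<tau> * real (card S) <= h / 2" using avoid by linarith
 from avoid_points[OF fS \<tau> this] h obtain x where x: "u <= x" "x <= u + h / 2" "!!\<theta>. \<theta> \<in> S ==> dist_int (x - \<theta>) >= \<tau>" by auto
 have "clear x l' u'" unfolding clear_def good_def
 proof (intro allI impI ballI)
  fix s t assume "l' <= s" "s <= u'" "t \<in> \<Theta>"
  then have "t - of_int (s - int m) * \<omega> \<in> S" unfolding S_def by force
  from x(3)[OF this] show "dist_int (x + of_int (s - int m) * \<omega> - t) >= \<tau>" by (simp add: algebra_simps)
 qed
 then show ?thesis using that x by blast
qed

lemma clear_mono: "clear x l u ==> l <= l' ==> u' <= u ==> clear x l' u'"
 unfolding clear_def by auto

lemma edge_state_step:
 assumes st: "edge_state V \<omega> lo hi \<delta> Q A y" and A: "A - 1 \<notin> \<Omega>" "{A..A + 8 * Q} \<subseteq> \<Omega>"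
  and x: "\<bar>x - y\<bar> <= h" "clear x (A - 1) (A + 8 * Q)"
 shows "left_edge x A & edge_state V \<omega> lo hi \<delta> Q A x"
proof -
 obtain E f where f: "isl (1 / 4) E" "!!n. n \<notin> {A..A + 5 * Q} ==> f n = 0" "nsq f > 0"
  "nsq (ham {A..} (pot V \<omega> y) E f) <= (\<delta> / 16)^2 * nsq f"
  using st unfolding edge_state_def isl_def by auto
 obtain b where b: "A + 6 * Q <= b" "b <= A + 6 * Q + int W" "!!x. \<bar>x - y\<bar> <= h ==> right_cut x b"
  using right_cut_exists by blast
 have "int W <= Q" using QW mult_nonneg_nonneg[of "int (R + 2)" "int m"] by linarith
 then have b7: "b <= A + 7 * Q" using b(2) by simp
 have ends: "ends x A b" if "\<bar>x - y\<bar> <= h" for x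
  unfolding ends_def using b(3)[OF that] b A b7 Q_ge by auto
 have ff: "fsupp {A..b} f" by (rule fsuppI[of "{A..A + 5 * Q}"]) (use f(2) b(1) Q_ge in auto)
 have "ham {A..b} (pot V \<omega> y) E f = ham {A..} (pot V \<omega> y) E f"
 proof
  fix n show "ham {A..b} (pot V \<omega> y) E f n = ham {A..} (pot V \<omega> y) E f n"
  proof (cases "n <= b")
   case False
   then have "f n = 0" "f (n - 1) = 0" "f (n + 1) = 0" using b(1) Q_ge by (auto intro!: f(2))
   then show ?thesis by (simp add: ham_def res_def)
  qed (simp add: ham_def)
 qed
 then have "nsq (ham {A..b} (pot V \<omega> y) E f) <= (\<delta> / 16)^2 * nsq f" using f(4) by simp
 from approx_eig_near[where U="pot V \<omega> y" and E=E, OF potC[OF f(1)] ff f(3) this] \<delta>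
 obtain E1 where E1: "\<bar>E1 - E\<bar> <= \<delta> / 16" "approx_eig {A..b} (pot V \<omega> y) E1" by auto
 have "isl (1 / 4 + 1 / 16) E1" by (rule isl_shift[OF f(1)]) (use E1 in simp)
 then have "isl (1 / 2) E1" by (rule isl_mono) simp
 from track[OF ends E1(2) this x(1)] obtain E' where E': "isl (1 / 8) E'" "approx_eig {A..b} (pot V \<omega> x) E'" by blast
 show ?thesis
  by (rule edge_step[OF ends[OF x(1)] A(1) _ E'(2)]) (use b b7 Q_ge clear_mono[OF x(2)] isl_mono[OF E'(1)] in auto)
qed

text \<open>Edge states are carried in steps of size between \<open>h / 2\<close> and \<open>h\<close> through clear
phases to a phase \<open>z\<close> and to \<open>z + \<omega>\<close>, both clear, where they contradict
\<open>left_edge_shift\<close>. By periodicity only motion to the right is needed.\<close>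

theorem no_left_edge_state:
 assumes st: "edge_state V \<omega> lo hi \<delta> Q A y" and A: "A - 1 \<notin> \<Omega>" "{A..A + 8 * Q} \<subseteq> \<Omega>"
 shows False
proof -
 have reach: "left_edge t A"
  if "edge_state V \<omega> lo hi \<delta> Q A y" "y <= t" "t - y <= real n * (h / 2)" "clear t (A - 1) (A + 8 * Q)" for n y t
  using that
 proof (induction n arbitrary: y)
  case 0
  then show ?case using edge_state_step[OF 0(1) A _ 0(4)] h by auto
 next
  case (Suc n)
  show ?case
  proof (cases "t - y <= h")
   case True
   then show ?thesis using edge_state_step[OF Suc.prems(1) A _ Suc.prems(4)] Suc.prems by auto
  next
   case False
   obtain x where x: "y + h / 2 <= x" "x <= y + h / 2 + h / 2" "clear x (A - 1) (A + 8 * Q)"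
    using clear_near[of "A + 8 * Q" "A - 1" "y + h / 2"] Q_ge by auto
   have "edge_state V \<omega> lo hi \<delta> Q A x" using edge_state_step[OF Suc.prems(1) A _ x(3)] x h by auto
   then show ?thesis
    by (rule Suc.IH) (use x False h Suc.prems in \<open>auto simp: algebra_simps\<close>)
  qed
 qed
 have reach': "left_edge t A" if "edge_state V \<omega> lo hi \<delta> Q A y" "y <= t" "clear t (A - 1) (A + 8 * Q)" for y t
 proof -
  obtain n :: nat where "(t - y) / (h / 2) <= real n" using real_arch_simple by blast
  then have "t - y <= real n * (h / 2)" using h by (simp add: field_simps)
  then show ?thesis using reach[OF that(1,2) _ that(3)] by blast
 qed
 obtain z where z: "y <= z" "clear z (A - 1) (A + 8 * Q + 1)"
  using clear_near[of "A + 8 * Q + 1" "A - 1" y] Q_ge by auto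
 have 1: "left_edge z A" by (rule reach'[OF st z(1) clear_mono[OF z(2)]]) auto
 have cl: "clear (z + \<omega>) (A - 1) (A + 8 * Q)" unfolding clear_def good_def
 proof (intro allI impI ballI)
  fix s t assume s: "A - 1 <= s" "s <= A + 8 * Q" "t \<in> \<Theta>"
  have "good z (s + 1)" using z(2) s unfolding clear_def by auto
  then have "dist_int (z + of_int (s + 1 - int m) * \<omega> - t) >= \<tau>" unfolding good_def using s by blast
  then show "dist_int (z + \<omega> + of_int (s - int m) * \<omega> - t) >= \<tau>" by (simp add: algebra_simps)
 qed
 define j where "j = \<lfloor>z + \<omega> - y\<rfloor>"
 have st': "edge_state V \<omega> lo hi \<delta> Q A (y + of_int j)" using st unfolding edge_state_def pot_periodic[where V=V, OF per] .
 have "left_edge (z + \<omega>) A" by (rule reach'[OF st' _ cl]) (simp add: j_def, linarith)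
 with 1 show False by (rule left_edge_shift)
qed

lemma no_state_between_cuts:
 assumes cuts: "!!x. \<bar>x - y\<bar> <= h ==> left_cut x a & right_cut x b" and sub: "{a..b} \<subseteq> \<Omega>" and ab: "Q <= b - a" "b - a <= 8 * Q"
  and ap: "approx_eig {a..b} (pot V \<omega> y) E" and E: "isl (1 / 2) E"
 shows False
proof -
 have ends: "ends x a b" if "\<bar>x - y\<bar> <= h" for x unfolding ends_def using cuts[OF that] sub ab by auto
 obtain x where x: "y <= x" "x <= y + h / 2" "clear x (a - 1) b" using clear_near[of b "a - 1" y] ab Q_ge by auto
 have xy: "\<bar>x - y\<bar> <= h" using x h by auto
 from track[OF ends ap E xy] obtain E' where E': "isl (1 / 8) E'" "approx_eig {a..b} (pot V \<omega> x) E'" by blast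
 have "isl (1 / 2) E'" by (rule isl_mono[OF E'(1)]) simp
 have K0: "K > 0" using K by simp
 have "1 / (64 * K) > 0" "K * (1 / (64 * K)) <= 1 / 64" using K0 by auto
 from eigenvector_position[OF ends[OF xy] x(3) E'(2) \<open>isl (1 / 2) E'\<close> this] cuts[OF xy] show False by blast
qed

end

section \<open>Localization of an approximate eigenfunction\<close>

lemma nsq_reflect: "fsupp I f ==> nsq (%n. f (- n)) = nsq f"
proof -
 assume f: "fsupp I f"
 let ?F = "{n. f n ~= 0}"
 have fin: "finite ?F" using f by (simp add: fsupp_def)
 have "nsq (%n. f (- n)) = (\<Sum>n\<in>uminus ` ?F. (f (- n))^2)"
 proof (rule nsq_eq_sum)
  fix n assume n: "n \<notin> uminus ` ?F"
  show "f (- n) = 0"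
  proof (rule ccontr)
   assume "f (- n) ~= 0"
   then have "- (- n) \<in> uminus ` ?F" by (intro imageI) simp
   then show False using n by simp
  qed
 qed (use fin in simp)
 also have "... = (\<Sum>n\<in>?F. (f n)^2)" by (subst sum.reindex) (auto simp: inj_on_def)
 also have "... = nsq f" by (rule nsq_eq_sum[symmetric]) (use fin in auto)
 finally show ?thesis .
qed

lemma ham_reflect: "ham (uminus ` I) (pot V (- \<omega>) y) E (%n. f (- n)) n = ham I (pot V \<omega> y) E f (- n)"
proof -
 have "n \<in> uminus ` I \<longleftrightarrow> - n \<in> I" by (metis image_iff minus_minus)
 moreover have "- (n - 1) = - n + 1" "- (n + 1) = - n - 1" by simp_all
 ultimately show ?thesis by (simp add: ham_def res_def pot_def)
qed

lemma edge_state_reflect: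
 assumes "lo - \<delta> / 4 <= E" "E <= hi + \<delta> / 4" "!!n. n \<notin> {B - 5 * Q..B} ==> f n = 0" "nsq f > 0"
  and "nsq (ham {..B} (pot V \<omega> y) E f) <= (\<delta> / 16)^2 * nsq f"
 shows "edge_state V (- \<omega>) lo hi \<delta> Q (- B) y"
proof -
 have ff: "fsupp {..B} f" by (rule fsuppI[of "{B - 5 * Q..B}"]) (use assms(3) in auto)
 have i: "uminus ` {..B} = {- B..}" by force
 have "nsq (ham {- B..} (pot V (- \<omega>) y) E (%n. f (- n))) = nsq (ham {..B} (pot V \<omega> y) E f)"
  unfolding i[symmetric] ham_reflect by (rule nsq_reflect[OF fsupp_ham[OF ff]])
 moreover have "nsq (%n. f (- n)) = nsq f" by (rule nsq_reflect[OF ff])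
 ultimately show ?thesis unfolding edge_state_def using assms
  by (intro exI[of _ E] exI[of _ "%n. f (- n)"]) auto
qed

context island
begin

lemma truncated_state:
 assumes E: "isl 0 E" and p: "a <= p" "p <= b" "\<phi> p = 1" and ab: "a < b" "b - a <= 5 * Q"
  and res: "!!n. a <= n ==> n <= b ==> \<bar>res (pot V \<omega> y) E \<phi> n\<bar> <= \<zeta>"
  and L: "\<bar>\<phi> (a - 1)\<bar> <= 9 * rQ * \<zeta>" "a - 1 \<in> I ==> \<bar>\<phi> a\<bar> <= 9 * rQ * \<zeta>"
  and R: "\<bar>\<phi> (b + 1)\<bar> <= 9 * rQ * \<zeta>" "b + 1 \<in> I ==> \<bar>\<phi> b\<bar> <= 9 * rQ * \<zeta>"
 defines "f \<equiv> %n. if a <= n & n <= b then \<phi> n else 0"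
 shows "nsq f > 0" "nsq (ham I (pot V \<omega> y) E f) <= (\<delta> / 16)^2 * nsq f"
proof -
 have Q1: "rQ >= 1" using Q_ge by linarith
 have \<zeta>Q: "\<zeta> <= rQ * \<zeta>" using mult_right_mono[OF Q1, of \<zeta>] \<zeta> by simp
 have ff: "fsupp {a..b} f" by (rule fsuppI[of "{a..b}"]) (auto simp: f_def)
 have n1: "nsq f >= 1" using nsq_ge[OF ff, of p] p by (simp add: f_def)
 then show "nsq f > 0" by simp
 have "nsq (ham I (pot V \<omega> y) E f) <= of_int (b - a + 3) * (10 * rQ * \<zeta>)^2"
 proof (rule nsq_ham_le)
  fix n assume n: "n \<in> I" "a - 1 <= n" "n <= b + 1"
  have "\<bar>res (pot V \<omega> y) E f n\<bar> <= \<zeta> + 9 * rQ * \<zeta>" unfolding f_def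
  proof (rule res_truncate[OF _ n(2,3) res])
   show "b < n --> \<bar>\<phi> b\<bar> <= 9 * rQ * \<zeta>"
   proof
    assume "b < n"
    then have "b + 1 \<in> I" using n by (metis antisym_conv zless_imp_add1_zle)
    then show "\<bar>\<phi> b\<bar> <= 9 * rQ * \<zeta>" by (rule R(2))
   qed
   show "n <= a - 1 --> \<bar>\<phi> a\<bar> <= 9 * rQ * \<zeta>"
   proof
    assume "n <= a - 1"
    then have "a - 1 \<in> I" using n by (metis antisym)
    then show "\<bar>\<phi> a\<bar> <= 9 * rQ * \<zeta>" by (rule L(2))
   qed
   show "a <= n --> \<bar>\<phi> (b + 1)\<bar> <= 9 * rQ * \<zeta>" using R(1) by simp
   show "n <= b --> \<bar>\<phi> (a - 1)\<bar> <= 9 * rQ * \<zeta>" using L(1) by simp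
  qed (use ab \<zeta> Q1 in auto)
  then show "\<bar>res (pot V \<omega> y) E f n\<bar> <= 10 * rQ * \<zeta>" using \<zeta>Q by linarith
 qed (use ab \<zeta> Q1 in \<open>auto simp: f_def\<close>)
 also have "... <= (9 * rQ * rQ) * (10 * rQ * \<zeta>)^2"
 proof (rule mult_right_mono)
  have "b - a + 3 <= 9 * Q * 1" using ab Q_ge by linarith
  also have "... <= 9 * Q * Q" using Q_ge by (intro mult_left_mono) auto
  finally show "real_of_int (b - a + 3) <= 9 * rQ * rQ" by (metis of_int_le_iff of_int_mult of_int_numeral)
 qed simp
 also have "... = (30 * (rQ)^2 * \<zeta>)^2" by (simp add: power2_eq_square)
 also have "... <= (\<delta> / 16)^2" using small_Q(2)[of 30] \<zeta> Q_ge by (intro power_mono) auto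
 also have "... <= (\<delta> / 16)^2 * nsq f" using n1 by (simp add: mult_le_cancel_left1)
 finally show "nsq (ham I (pot V \<omega> y) E f) <= (\<delta> / 16)^2 * nsq f" .
qed

text \<open>Around a windowed maximum \<open>p\<close> the function is at most \<open>4 * Q\<close> times its value at
\<open>p\<close> and its defect is negligible. So it is tiny at cuts on both sides of \<open>p\<close> and may be
truncated there. If neither end of the lattice is within \<open>3 * Q\<close> of \<open>p\<close>, this contradicts
\<open>no_state_between_cuts\<close>.\<close>

theorem state_at_an_end:
 assumes ap: "approx_eig \<Omega> (pot V \<omega> y) E" and E: "isl 0 E" and \<Omega>: "\<Omega> = UNIV | (\<exists>A B. \<Omega> = {A..B} & 8 * Q <= B - A)"
 obtains A B where "\<Omega> = {A..B}" "8 * Q <= B - A" "edge_state V \<omega> lo hi \<delta> Q A y | edge_state V (- \<omega>) lo hi \<delta> Q (- B) y"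
proof -
 have Q1: "rQ >= 1" "Q >= 1" using Q_ge by linarith+
 have \<zeta>Q: "\<zeta> <= rQ * \<zeta>" using mult_right_mono[OF Q1(1), of \<zeta>] \<zeta> by simp
 define r where "r = \<zeta> / (2 * K)"
 have r: "r > 0" "2 * (K * r) = \<zeta>" unfolding r_def using \<zeta> K by auto
 have r\<zeta>: "r <= \<zeta>" unfolding r_def using \<zeta> K by (simp add: pos_divide_le_eq)
 define \<kappa> where "\<kappa> = (4 * rQ / r)^2"
 have \<kappa>: "\<kappa> > 0" unfolding \<kappa>_def using r Q1 by simp
 obtain \<psi> where \<psi>: "fsupp \<Omega> \<psi>" "nsq \<psi> > 0" "nsq (ham \<Omega> (pot V \<omega> y) E \<psi>) <= (1 / \<kappa>) * nsq \<psi>"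
  using ap \<kappa> unfolding approx_eig_def by (meson zero_less_divide_1_iff)
 have "\<kappa> * nsq (ham \<Omega> (pot V \<omega> y) E \<psi>) <= nsq \<psi>" using \<psi>(3) \<kappa> by (simp add: field_simps)
 from window_max[OF \<psi>(1,2) fsupp_ham[OF \<psi>(1)] this, of "nat (3 * Q)"] \<kappa>
 obtain p where p: "\<psi> p ~= 0" "!!n. \<bar>n - p\<bar> <= 3 * Q ==> (\<psi> n)\<^sup>2 + \<kappa> * (ham \<Omega> (pot V \<omega> y) E \<psi> n)^2 <= 2 * (2 * real (nat (3 * Q)) + 1) * (\<psi> p)^2"
  using Q1 by auto
 have "2 * (2 * real (nat (3 * Q)) + 1) <= 16 * (rQ)^2"
 proof -
  have gen: "12 * q + 2 <= 16 * q^2" if "q >= 1" for q :: real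
  proof -
   have "q * 1 <= q * q" using that by (intro mult_left_mono) auto
   then show ?thesis using that unfolding power2_eq_square by linarith
  qed
  have "real (nat (3 * Q)) = 3 * rQ" using Q1 by simp
  then have "2 * (2 * real (nat (3 * Q)) + 1) = 12 * rQ + 2" by simp
  then show ?thesis using gen[OF Q1(1)] by (simp only:)
 qed
 then have "2 * (2 * real (nat (3 * Q)) + 1) * (\<psi> p)^2 <= 16 * (rQ)^2 * (\<psi> p)^2" by (rule mult_right_mono) simp
 then have win: "(\<psi> n)^2 + \<kappa> * (ham \<Omega> (pot V \<omega> y) E \<psi> n)^2 <= 16 * (rQ)^2 * (\<psi> p)^2" if "\<bar>n - p\<bar> <= 3 * Q" for n
  using p(2)[OF that] by linarith
 define \<phi> where "\<phi> = (%n. \<psi> n / \<psi> p)"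
 have \<phi>p: "\<phi> p = 1" unfolding \<phi>_def using p(1) by simp
 have \<phi>0: "\<phi> n = 0" if "n \<notin> \<Omega>" for n unfolding \<phi>_def using \<psi>(1) that by (simp add: fsupp_def)
 have \<phi>X: "\<bar>\<phi> n\<bar> <= 4 * rQ" if n: "\<bar>n - p\<bar> <= 3 * Q" for n
 proof -
  have "\<kappa> * (ham \<Omega> (pot V \<omega> y) E \<psi> n)^2 >= 0" using \<kappa> by simp
  then have "(\<psi> n)^2 <= (4 * rQ * \<psi> p)^2" using win[OF n] by (simp add: power_mult_distrib)
  then have "\<bar>\<psi> n\<bar> <= 4 * rQ * \<bar>\<psi> p\<bar>" using Q1 by (simp add: abs_le_square_iff[symmetric] abs_mult)
  then show ?thesis unfolding \<phi>_def using p(1) by (simp add: pos_divide_le_eq)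
 qed
 have \<phi>res: "\<bar>res (pot V \<omega> y) E \<phi> n\<bar> <= r" if n: "\<bar>n - p\<bar> <= 3 * Q" "n \<in> \<Omega>" for n
 proof -
  let ?g = "ham \<Omega> (pot V \<omega> y) E \<psi> n"
  have "\<kappa> * ?g^2 <= 16 * (rQ)^2 * (\<psi> p)^2" using win[OF n(1)] zero_le_power2[of "\<psi> n"] by linarith
  also have "... = \<kappa> * (r * \<psi> p)^2" unfolding \<kappa>_def using r Q1 by (simp add: power_mult_distrib power_divide)
  finally have "?g^2 <= (r * \<psi> p)^2" using \<kappa> by simp
  then have "\<bar>?g\<bar> <= r * \<bar>\<psi> p\<bar>" using r by (simp add: abs_le_square_iff[symmetric] abs_mult)
  moreover have "res (pot V \<omega> y) E \<phi> n = ?g / \<psi> p" unfolding \<phi>_def ham_def res_def using n(2) p(1) by (simp add: diff_divide_distrib add_divide_distrib)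
  ultimately show ?thesis using p(1) by (simp add: pos_divide_le_eq)
 qed
 have w: "\<bar>E - E0\<bar> <= w" by (rule isl_near[OF E]) simp
 have conv: "n \<in> \<Omega>" if "u \<in> \<Omega>" "v \<in> \<Omega>" "u <= n" "n <= v" for u v n
  using \<Omega> that by auto
 have p\<Omega>: "p \<in> \<Omega>" using \<phi>0[of p] \<phi>p by auto
 have mid: "\<bar>\<phi> s\<bar> <= 9 * rQ * \<zeta>" "\<bar>\<phi> (s + 1)\<bar> <= 9 * rQ * \<zeta>"
  if s: "!!k. \<bar>k\<bar> <= int R ==> good y (s + k * int m)" "p - 3 * Q <= s - int R * int m" "s + int R * int m + 1 <= p + 3 * Q"
   "s - int R * int m \<in> \<Omega>" "s + int R * int m \<in> \<Omega>" for s
 proof -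
  have "norm (pr \<phi> s) <= \<zeta> * (2 * (4 * rQ)) + 2 * (K * r)"
  proof (rule decay_two_sided[OF w less_imp_le[OF r(1)] s(1)])
   fix n assume n: "s - int R * int m < n" "n <= s + int R * int m"
   show "\<bar>res (pot V \<omega> y) E \<phi> n\<bar> <= r"
    by (rule \<phi>res) (use n s conv[OF s(4,5)] in auto)
  qed (use s in \<open>auto intro!: \<phi>X\<close>)
  also have "... = 8 * (rQ * \<zeta>) + \<zeta>" unfolding r(2) by simp
  also have "... <= 9 * rQ * \<zeta>" using \<zeta>Q by linarith
  finally have "norm (pr \<phi> s) <= 9 * rQ * \<zeta>" .
  then show "\<bar>\<phi> s\<bar> <= 9 * rQ * \<zeta>" "\<bar>\<phi> (s + 1)\<bar> <= 9 * rQ * \<zeta>" using le_norm_pr[of \<phi> s] by linarith+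
 qed
 have WQ: "int W <= Q" using QW mult_nonneg_nonneg[of "int (R + 2)" "int m"] by linarith
 have Rm0: "0 <= int R * int m" by simp
 obtain b where b: "p + Q <= b" "b <= p + Q + int W" "!!x. \<bar>x - y\<bar> <= h ==> right_cut x b" using right_cut_exists by blast
 obtain a where a: "p - 2 * Q <= a" "a <= p - 2 * Q + int W" "!!x. \<bar>x - y\<bar> <= h ==> left_cut x a" using left_cut_exists by blast
 have ybb: "right_cut y b" and yaa: "left_cut y a" using a(3)[of y] b(3)[of y] h by auto
 have bs: "\<bar>\<phi> b\<bar> <= 9 * rQ * \<zeta>" "\<bar>\<phi> (b + 1)\<bar> <= 9 * rQ * \<zeta>" if "p + 3 * Q \<in> \<Omega>"
 proof -
  have "b - int R * int m \<in> \<Omega>" "b + int R * int m \<in> \<Omega>"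
   by (rule conv[OF p\<Omega> that]; use b WQ Rm Rm0 m2 in linarith)+
  note s = this
  show "\<bar>\<phi> b\<bar> <= 9 * rQ * \<zeta>" "\<bar>\<phi> (b + 1)\<bar> <= 9 * rQ * \<zeta>"
   using ybb b WQ Rm Rm0 m2 s by (intro mid; auto simp: right_cut_def)+
 qed
 have as: "\<bar>\<phi> (a - 1)\<bar> <= 9 * rQ * \<zeta>" "\<bar>\<phi> a\<bar> <= 9 * rQ * \<zeta>" if "p - 3 * Q \<in> \<Omega>"
 proof -
  have "a - 1 - int R * int m \<in> \<Omega>" "a - 1 + int R * int m \<in> \<Omega>"
   by (rule conv[OF that p\<Omega>]; use a WQ Rm Rm0 m2 in linarith)+
  note s = this
  have "\<bar>\<phi> (a - 1)\<bar> <= 9 * rQ * \<zeta>" "\<bar>\<phi> (a - 1 + 1)\<bar> <= 9 * rQ * \<zeta>"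
   using yaa a WQ Rm Rm0 m2 s by (intro mid; auto simp: left_cut_def)+
  then show "\<bar>\<phi> (a - 1)\<bar> <= 9 * rQ * \<zeta>" "\<bar>\<phi> a\<bar> <= 9 * rQ * \<zeta>" by simp_all
 qed
 have resz: "\<bar>res (pot V \<omega> y) E \<phi> n\<bar> <= \<zeta>" if "\<bar>n - p\<bar> <= 3 * Q" "n \<in> \<Omega>" for n using \<phi>res[OF that] r\<zeta> by linarith
 have z9: "0 <= 9 * rQ * \<zeta>" using Q1 \<zeta> by simp
 consider (both) "p - 3 * Q \<in> \<Omega>" "p + 3 * Q \<in> \<Omega>" | (left) "p - 3 * Q \<notin> \<Omega>" | (right) "p + 3 * Q \<notin> \<Omega>" by blast
 then show ?thesis
 proof cases
  case both
  define f where "f = (%n. if a <= n & n <= b then \<phi> n else 0)"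
  have sub: "{a..b} \<subseteq> \<Omega>" using conv[OF both] a b WQ by fastforce
  have f: "nsq f > 0" "nsq (ham {a..b} (pot V \<omega> y) E f) <= (\<delta> / 16)^2 * nsq f"
   unfolding f_def
   by (rule truncated_state[where y=y and I="{a..b}" and a=a and p=p and b=b, OF E]; use a b WQ \<phi>p Q1 as[OF both(1)] bs[OF both(2)] sub in \<open>auto intro!: resz\<close>)+
  have ff: "fsupp {a..b} f" by (rule fsuppI[of "{a..b}"]) (auto simp: f_def)
  have "\<bar>pot V \<omega> y n - E\<bar> <= Mb" for n by (rule potC[OF E]) simp
  from approx_eig_near[where U="pot V \<omega> y" and E=E, OF this ff f] \<delta>
  obtain E1 where E1: "\<bar>E1 - E\<bar> <= \<delta> / 16" "approx_eig {a..b} (pot V \<omega> y) E1" by auto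
  have "isl (0 + 1 / 16) E1" by (rule isl_shift[OF E]) (use E1 in simp)
  then have "isl (1 / 2) E1" by (rule isl_mono) simp
  have False by (rule no_state_between_cuts[OF _ sub _ _ E1(2) \<open>isl (1 / 2) E1\<close>]) (use a b WQ in auto)
  then show ?thesis ..
 next
  case left
  then obtain A B where AB: "\<Omega> = {A..B}" "8 * Q <= B - A" using \<Omega> by blast
  have pA: "p - 3 * Q < A" "A <= p" using left p\<Omega> Q1(2) unfolding AB by auto
  have pr: "p + 3 * Q \<in> \<Omega>" unfolding AB using pA AB(2) Q1 by auto
  have f: "nsq (%n. if A <= n & n <= b then \<phi> n else 0) > 0"
   "nsq (ham {A..} (pot V \<omega> y) E (%n. if A <= n & n <= b then \<phi> n else 0)) <= (\<delta> / 16)^2 * nsq (%n. if A <= n & n <= b then \<phi> n else 0)"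
   by (rule truncated_state[where y=y and I="{A..}" and a=A and p=p and b=b, OF E]; use pA b AB WQ \<phi>p Q1 bs[OF pr] \<phi>0[of "A - 1"] z9 in \<open>auto intro!: resz\<close>)+
  have "edge_state V \<omega> lo hi \<delta> Q A y" unfolding edge_state_def
   by (rule exI[of _ E], rule exI[of _ "%n. if A <= n & n <= b then \<phi> n else 0"])
    (use f E \<delta> b pA WQ in \<open>auto simp: isl_def\<close>)
  then show ?thesis using that AB by blast
 next
  case right
  then obtain A B where AB: "\<Omega> = {A..B}" "8 * Q <= B - A" using \<Omega> by blast
  have pB: "B < p + 3 * Q" "p <= B" using right p\<Omega> Q1(2) unfolding AB by auto
  have pl: "p - 3 * Q \<in> \<Omega>" unfolding AB using pB AB(2) Q1 by auto
  have f: "nsq (%n. if a <= n & n <= B then \<phi> n else 0) > 0"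
   "nsq (ham {..B} (pot V \<omega> y) E (%n. if a <= n & n <= B then \<phi> n else 0)) <= (\<delta> / 16)^2 * nsq (%n. if a <= n & n <= B then \<phi> n else 0)"
   by (rule truncated_state[where y=y and I="{..B}" and a=a and p=p and b=B, OF E]; use pB a AB WQ \<phi>p Q1 as[OF pl] \<phi>0[of "B + 1"] z9 in \<open>auto intro!: resz\<close>)+
  have "edge_state V (- \<omega>) lo hi \<delta> Q (- B) y"
   by (rule edge_state_reflect[OF _ _ _ f]) (use E \<delta> a pB WQ in \<open>auto simp: isl_def\<close>)
  then show ?thesis using that AB by blast
 qed
qed

end

section \<open>Spectral distance, reflection and the Lyapunov exponent\<close>

lemma near_finite_spectrum:
 assumes V: "!!t. \<bar>V t\<bar> <= A" and \<psi>: "fsupp {- int N..int N} \<psi>" "nsq \<psi> > 0"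
  and h: "nsq (ham {- int N..int N} (pot V \<omega> x) E \<psi>) <= \<sigma>^2 * nsq \<psi>" and \<sigma>: "\<sigma> >= 0"
 obtains E1 where "E1 \<in> finite_spectrum V N \<omega>" "\<bar>E1 - E\<bar> <= \<sigma>"
proof -
 have U: "\<bar>pot V \<omega> x n - E\<bar> <= A + \<bar>E\<bar>" for n using V[of "x + of_int n * \<omega>"] unfolding pot_def by linarith
 obtain E1 where E1: "\<bar>E1 - E\<bar> <= \<sigma>" "approx_eig {- int N..int N} (pot V \<omega> x) E1"
  using approx_eig_near[where U="pot V \<omega> x" and E=E, OF U \<psi> h \<sigma>] by blast
 show ?thesis by (rule that[OF _ E1(1)]) (use approx_eig_imp_spec[OF E1(2)] in \<open>auto simp: finite_spectrum_def\<close>)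
qed

text \<open>The spectrum at \<open>x0\<close> serves every phase \<open>x\<close>: translate along the orbit of
\<open>x0\<close> to a phase so close to \<open>x\<close> that the potential changes by less than
\<open>\<sigma>\<close>.\<close>

lemma near_full_spectrum:
 assumes V: "!!t. \<bar>V t\<bar> <= A" "!!s. V (s + 1) = V s" and Lip: "!!s t. \<bar>V s - V t\<bar> <= LV * \<bar>s - t\<bar>" "LV > 0"
  and dio: "dioph c \<omega>" "c > 0" and \<psi>: "fsupp UNIV \<psi>" "nsq \<psi> > 0"
  and h: "nsq (ham UNIV (pot V \<omega> x) E \<psi>) <= \<sigma>^2 * nsq \<psi>" and \<sigma>: "\<sigma> > 0"
 obtains E1 where "E1 \<in> full_spectrum V x0 \<omega>" "\<bar>E1 - E\<bar> <= 2 * \<sigma>"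
proof -
 define \<eta> where "\<eta> = min 1 (\<sigma> / LV)"
 have \<eta>: "0 < \<eta>" "\<eta> <= 1" "LV * \<eta> <= \<sigma>" unfolding \<eta>_def using \<sigma> Lip(2) by (auto simp: min_def field_simps)
 obtain q :: nat where q: "dist_int (real q * \<omega> - (x - x0)) <= \<eta>" using orbit_dense[OF dio \<eta>(1,2)] by blast
 define j where "j = round (real q * \<omega> - (x - x0))"
 define t where "t = real q * \<omega> - (x - x0) - of_int j"
 have t: "\<bar>t\<bar> <= \<eta>" using q unfolding t_def j_def dist_int_def .
 have shift: "pot V \<omega> x0 n = pot V \<omega> (x + t) (n - int q)" for n
 proof -
  have "V (x + t + of_int (n - int q) * \<omega> + of_int j) = V (x + t + of_int (n - int q) * \<omega>)" by (rule periodic_of_int) (rule V(2))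
  moreover have "x + t + of_int (n - int q) * \<omega> + of_int j = x0 + of_int n * \<omega>" unfolding t_def by (simp add: algebra_simps)
  ultimately show ?thesis unfolding pot_def by simp
 qed
 have U: "\<bar>pot V \<omega> (x + t) n - pot V \<omega> x n\<bar> <= \<sigma>" for n
 proof -
  have "\<bar>pot V \<omega> (x + t) n - pot V \<omega> x n\<bar> <= LV * \<bar>t\<bar>"
   unfolding pot_def using Lip(1)[of "x + t + of_int n * \<omega>" "x + of_int n * \<omega>"] by simp
  also have "... <= LV * \<eta>" using t Lip(2) by (intro mult_left_mono) auto
  finally show ?thesis using \<eta> by simp
 qed
 define \<psi>' where "\<psi>' = (%n. \<psi> (n + (- int q)))"
 have f': "fsupp UNIV \<psi>'" unfolding \<psi>'_def
 proof (rule fsuppI[of "(%n. n + int q) ` {n. \<psi> n ~= 0}"])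
  fix n assume n: "n \<notin> (%n. n + int q) ` {n. \<psi> n ~= 0}"
  show "\<psi> (n + - int q) = 0"
  proof (rule ccontr)
   assume "\<psi> (n + - int q) ~= 0"
   then have "(n + - int q) + int q \<in> (%n. n + int q) ` {n. \<psi> n ~= 0}" by (intro imageI) simp
   then show False using n by simp
  qed
 qed (use \<psi>(1) in \<open>simp_all add: fsupp_def\<close>)
 have n': "nsq \<psi>' = nsq \<psi>" unfolding \<psi>'_def by (rule nsq_shift[OF \<psi>(1)])
 have "ham UNIV (pot V \<omega> x0) E \<psi>' = (%n. ham UNIV (pot V \<omega> (x + t)) E \<psi> (n + (- int q)))"
  unfolding ham_def res_def \<psi>'_def shift by (rule ext) (simp add: algebra_simps)
 then have "nsq (ham UNIV (pot V \<omega> x0) E \<psi>') = nsq (ham UNIV (pot V \<omega> (x + t)) E \<psi>)"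
  using nsq_shift[OF fsupp_ham[OF \<psi>(1)]] by metis
 also have "... <= 2 * nsq (ham UNIV (pot V \<omega> x) E \<psi>) + 2 * \<sigma>^2 * nsq \<psi>"
  by (rule nsq_ham_perturb[OF \<psi>(1) U])
 also have "... <= (2 * \<sigma>)^2 * nsq \<psi>'"
 proof -
  have "(2 * \<sigma>)^2 * nsq \<psi> = 4 * (\<sigma>^2 * nsq \<psi>)" by (simp add: power_mult_distrib)
  then show ?thesis using h unfolding n' by linarith
 qed
 finally have h': "nsq (ham UNIV (pot V \<omega> x0) E \<psi>') <= (2 * \<sigma>)^2 * nsq \<psi>'" .
 have U0: "\<bar>pot V \<omega> x0 n - E\<bar> <= A + \<bar>E\<bar>" for n using V(1)[of "x0 + of_int n * \<omega>"] unfolding pot_def by linarith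
 have "nsq \<psi>' > 0" "2 * \<sigma> >= 0" using \<psi>(2) \<sigma> unfolding n' by auto
 from approx_eig_near[where U="pot V \<omega> x0" and E=E, OF U0 f' this(1) h' this(2)]
 obtain E1 where E1: "\<bar>E1 - E\<bar> <= 2 * \<sigma>" "approx_eig UNIV (pot V \<omega> x0) E1" by blast
 show ?thesis by (rule that[OF _ E1(1)]) (use approx_eig_imp_spec[OF E1(2)] in \<open>auto simp: full_spectrum_def dirichlet_UNIV\<close>)
qed

lemma approx_eig_energy_bound:
 assumes V: "!!t. \<bar>V t\<bar> <= A" and ap: "approx_eig I (pot V \<omega> x) E"
 shows "\<bar>E\<bar> <= 3 * A + 4"
proof -
 let ?U = "pot V \<omega> x"
 obtain f where f: "fsupp I f" "nsq f > 0" "nsq (ham I ?U E f) <= 1 * nsq f"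
  using ap unfolding approx_eig_def by (meson zero_less_one)
 let ?h = "ham I ?U 0 f"
 note g = fsupp_ham[OF f(1), of ?U 0]
 have A0: "A >= 0" using V[of 0] by linarith
 have b: "nsq ?h <= 3 * (2 + A^2) * nsq f"
  by (rule ham_bounded) (use V f in \<open>auto simp: pot_def\<close>)
 have e: "ham I ?U E f = (%n. 1 * ?h n + (- E) * f n)" using ham_energy[OF f(1), of ?U 0 E] by simp
 have "nsq (ham I ?U E f) = nsq ?h - 2 * E * ip ?h f + E^2 * nsq f"
  unfolding e ip_comb_left[OF g f(1)] ip_comb_right[OF g f(1) g] ip_comb_right[OF g f(1) f(1)]
  using ip_commute[OF f(1) g] by (simp add: power2_eq_square algebra_simps)
 moreover have "nsq (%n. 2 * ?h n + (- E) * f n) = 4 * nsq ?h - 4 * E * ip ?h f + E^2 * nsq f"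
  unfolding ip_comb_left[OF g f(1)] ip_comb_right[OF g f(1) g] ip_comb_right[OF g f(1) f(1)]
  using ip_commute[OF f(1) g] by (simp add: power2_eq_square algebra_simps)
 ultimately have "E^2 * nsq f <= 2 * nsq ?h + 2 * nsq (ham I ?U E f)"
  using nsq_nonneg[of "%n. 2 * ?h n + (- E) * f n"] by linarith
 also have "... <= 2 * (3 * (2 + A^2) * nsq f) + 2 * (1 * nsq f)" using b f(3) by linarith
 also have "... = (14 + 6 * A^2) * nsq f" by (simp add: algebra_simps)
 finally have "E^2 <= 14 + 6 * A^2" using f(2) by simp
 also have "... <= (3 * A + 4)^2" using A0 by (simp add: power2_eq_square algebra_simps)
 finally show ?thesis using A0 by (simp add: abs_le_square_iff[symmetric])
qed

text \<open>Transposition conjugated with the diagonal matrix of entries \<open>1, -1\<close>; it fixes one-step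
matrices and reverses products.\<close>

definition reverse2 :: "mat2 => mat2" where
 "reverse2 M = (case M of (a, b, c, d) => (a, - c, - b, d))"

lemma reverse2_mm: "reverse2 (mm A B) = mm (reverse2 B) (reverse2 A)"
 by (cases A; cases B) (simp add: reverse2_def mm_def algebra_simps)

lemma hs_reverse2: "hs (reverse2 A) = hs A"
 by (cases A) (simp add: reverse2_def hs_def add_ac)

lemma tmat_reverse: "tmat V (- \<omega>) E n (x + real (Suc n) * \<omega>) = reverse2 (tmat V \<omega> E n x)"
proof (induction n)
 case (Suc n)
 have "x + real (Suc (Suc n)) * \<omega> + - \<omega> = x + real (Suc n) * \<omega>" by (simp add: algebra_simps)
 then have "tmat V (- \<omega>) E (Suc n) (x + real (Suc (Suc n)) * \<omega>) =
   mm (tmat V (- \<omega>) E n (x + real (Suc n) * \<omega>)) (step_mat (V (x + real (Suc n) * \<omega>) - E))"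
  unfolding tmat_Suc' by (simp only:)
 also have "... = reverse2 (tmat V \<omega> E (Suc n) x)"
  unfolding Suc by (simp add: reverse2_mm) (simp add: reverse2_def step_mat_def)
 finally show ?case .
qed (simp add: reverse2_def)

lemma growth_reverse:
 "expanding V \<omega> E \<gamma> ==> expanding V (- \<omega>) E \<gamma>"
 using tmat_reverse hs_reverse2 by metis

text \<open>Fekete's lemma.\<close>

lemma subadditive_limit:
 fixes b :: "nat => real"
 assumes sub: "!!m n. b (m + n) <= b m + b n" and b0: "!!n. b n >= 0"
 obtains l where "(%n. b n / real n) \<longlonglongrightarrow> l" "!!n. n >= 1 ==> l <= b n / real n"
proof -
 define S where "S = (%n. b n / real n) ` {1..}"
 have Sne: "S ~= {}" unfolding S_def by auto
 have S0: "!!s. s \<in> S ==> 0 <= s" unfolding S_def using b0 by auto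
 then have bdd: "bdd_below S" by (rule bdd_belowI)
 define l where "l = Inf S"
 have low: "l <= b n / real n" if "n >= 1" for n
  unfolding l_def by (rule cInf_lower[OF _ bdd]) (use that in \<open>auto simp: S_def\<close>)
 have mult: "b (q * n + r) <= real q * b n + b r" for q n r
 proof (induction q)
  case (Suc q)
  have "b (Suc q * n + r) <= b n + b (q * n + r)" using sub[of n "q * n + r"] by (simp add: add_ac)
  then show ?case using Suc by (simp add: algebra_simps)
 qed simp
 have "(%n. b n / real n) \<longlonglongrightarrow> l"
 proof (rule LIMSEQ_I)
  fix e :: real assume e: "e > 0"
  obtain s where "s \<in> S" "s < l + e / 2" using cInf_lessD[OF Sne, of "l + e / 2"] e unfolding l_def by auto
  then obtain n where n: "n >= 1" "b n / real n < l + e / 2" unfolding S_def by auto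
  define D where "D = Max (b ` {..<n})"
  have D: "b r <= D" if "r < n" for r unfolding D_def using that by (intro Max_ge) auto
  have D0: "D >= 0" using D[of 0] b0[of 0] n by linarith
  obtain k0 :: nat where k0: "2 * D / e < real k0" using reals_Archimedean2 by blast
  have "norm (b k / real k - l) < e" if k: "k >= k0 + 1" for k
  proof -
   have kp: "real k > 0" using k by simp
   have "b k = b (k div n * n + k mod n)" by simp
   also have "... <= real (k div n) * b n + b (k mod n)" by (rule mult)
   also have "b (k mod n) <= D" using n by (intro D) simp
   also have "real (k div n) * b n <= (real k / real n) * b n"
    using of_nat_div_le_of_nat[of k n, where ?'a=real] b0 by (intro mult_right_mono) auto
   finally have "b k <= real k * (b n / real n) + D" by simp
   also have "... <= real k * (b n / real n) + real k * (e / 2)"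
   proof -
    have "2 * D / e < real k" using k0 k by simp
    then show ?thesis using e by (simp add: field_simps)
   qed
   also have "... = real k * (b n / real n + e / 2)" by (simp add: algebra_simps)
   finally have "b k / real k <= b n / real n + e / 2" using kp by (simp add: pos_divide_le_eq mult.commute)
   moreover have "l <= b k / real k" using k by (intro low) auto
   ultimately show ?thesis using n(2) by (simp add: abs_if)
  qed
  then show "\<exists>no. \<forall>k\<ge>no. norm (b k / real k - l) < e" by blast
 qed
 then show ?thesis using low that by blast
qed

abbreviation ent :: "real ^ 2 ^ 2 => 2 => 2 => real" where "ent A i j \<equiv> vec_nth (vec_nth A i) j"

lemma transfer_matrix_entries:
 "ent (transfer_matrix V n x \<omega> E) 1 1 = fst (tmat V \<omega> E n x) & ent (transfer_matrix V n x \<omega> E) 1 2 = fst (snd (tmat V \<omega> E n x)) &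
  ent (transfer_matrix V n x \<omega> E) 2 1 = fst (snd (snd (tmat V \<omega> E n x))) & ent (transfer_matrix V n x \<omega> E) 2 2 = snd (snd (snd (tmat V \<omega> E n x)))"
proof (induction n)
 case (Suc n)
 then show ?case by (cases "tmat V \<omega> E n x") (simp add: matrix_matrix_mult_def sum_2 step_mat_def mm_def)
qed (simp add: mat_def)

text \<open>The two norms differ by a bounded factor, so both define the same Lyapunov exponent; the Hilbert--Schmidt
norm is easier to handle.\<close>

lemma onorm_hs_bounds:
 fixes A :: "real ^ 2 ^ 2"
 defines "h \<equiv> sqrt ((ent A 1 1)^2 + (ent A 1 2)^2 + (ent A 2 1)^2 + (ent A 2 2)^2)"
 shows "onorm ((*v) A) <= h" "h <= 2 * onorm ((*v) A)"
proof -
 have n2: "(norm v)^2 = (vec_nth v 1)^2 + (vec_nth v 2)^2" for v :: "real ^ 2"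
  by (simp add: norm_vec_def L2_set_def sum_2 real_sqrt_pow2 add_nonneg_nonneg)
 have h0: "h >= 0" unfolding h_def by simp
 have h2: "h^2 = (ent A 1 1)^2 + (ent A 1 2)^2 + (ent A 2 1)^2 + (ent A 2 2)^2" unfolding h_def by simp
 show "onorm ((*v) A) <= h"
 proof (rule onorm_le)
  fix v :: "real ^ 2"
  have "(norm (A *v v))^2 = (ent A 1 1 * vec_nth v 1 + ent A 1 2 * vec_nth v 2)^2 + (ent A 2 1 * vec_nth v 1 + ent A 2 2 * vec_nth v 2)^2"
   unfolding n2 by (simp add: matrix_vector_mult_def sum_2)
  also have "... <= ((ent A 1 1)^2 + (ent A 1 2)^2) * ((vec_nth v 1)^2 + (vec_nth v 2)^2) + ((ent A 2 1)^2 + (ent A 2 2)^2) * ((vec_nth v 1)^2 + (vec_nth v 2)^2)"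
   by (intro add_mono cauchy_schwarz2)
  also have "... = (h * norm v)^2" unfolding power_mult_distrib h2 n2 by (simp add: algebra_simps)
  finally show "norm (A *v v) <= h * norm v" using h0 by (intro power2_le_imp_le[of "norm (A *v v)"]) auto
 qed
 have bl: "bounded_linear ((*v) A)" by (rule matrix_vector_mul_bounded_linear)
 have col: "(norm (A *v axis j 1))^2 <= (onorm ((*v) A))^2" for j :: 2
  using onorm[OF bl, of "axis j 1"] by (intro power_mono) (auto simp: norm_axis_1)
 have "vec_nth (A *v axis j 1) i = ent A i j" for i j :: 2
  by (simp add: matrix_vector_mult_basis column_def)
 then have "h^2 = (norm (A *v axis 1 1))^2 + (norm (A *v axis 2 1))^2" unfolding n2 h2 by simp
 also have "... <= 4 * (onorm ((*v) A))^2"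
  using col[of 1] col[of 2] zero_le_power2[of "onorm ((*v) A)"] by linarith
 also have "... = (2 * onorm ((*v) A))^2" by (simp add: power_mult_distrib)
 finally show "h <= 2 * onorm ((*v) A)" using onorm_pos_le[OF bl] by (intro power2_le_imp_le[of h]) auto
qed

lemma onorm_diff_le:
 fixes A B :: "real ^ 2 ^ 2"
 shows "\<bar>onorm ((*v) A) - onorm ((*v) B)\<bar> <= sqrt ((ent A 1 1 - ent B 1 1)^2 + (ent A 1 2 - ent B 1 2)^2 + (ent A 2 1 - ent B 2 1)^2 + (ent A 2 2 - ent B 2 2)^2)"
proof -
 have bl: "bounded_linear ((*v) M)" for M :: "real ^ 2 ^ 2" by (rule matrix_vector_mul_bounded_linear)
 have tri: "onorm ((*v) M) <= onorm ((*v) N) + onorm ((*v) (M - N))" for M N :: "real ^ 2 ^ 2"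
 proof -
  have "(*v) M = (%v. N *v v + (M - N) *v v)" by (rule ext) (simp add: matrix_vector_mult_diff_rdistrib)
  then show ?thesis using onorm_triangle[OF bl bl, of N "M - N"] by simp
 qed
 have neg: "onorm ((*v) (B - A)) = onorm ((*v) (A - B))"
 proof -
  have "(*v) (B - A) = (%v. - ((A - B) *v v))" by (rule ext) (simp add: matrix_vector_mult_diff_rdistrib)
  then show ?thesis by (simp add: onorm_neg)
 qed
 have "\<bar>onorm ((*v) A) - onorm ((*v) B)\<bar> <= onorm ((*v) (A - B))" using tri[of A B] tri[of B A] neg by linarith
 also have "... <= sqrt ((ent A 1 1 - ent B 1 1)^2 + (ent A 1 2 - ent B 1 2)^2 + (ent A 2 1 - ent B 2 1)^2 + (ent A 2 2 - ent B 2 2)^2)"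
  using onorm_hs_bounds(1)[of "A - B"] by simp
 finally show ?thesis .
qed

lemma continuous_tmat:
 assumes "continuous_on UNIV V"
 shows "continuous_on UNIV (%x. tmat V \<omega> E n x)"
proof (induction n)
 case (Suc n)
 have [continuous_intros]: "continuous_on UNIV (%x. V (x + t))" for t
  by (rule continuous_on_compose2[OF assms]) (auto intro!: continuous_intros)
 show ?case using Suc unfolding tmat.simps mm_def step_mat_def case_prod_beta
  by (auto intro!: continuous_intros)
qed simp

text \<open>By subadditivity the averages of \<open>ln (hs M\<^sub>n) / n\<close> converge to their infimum. So each
of them is at least the Lyapunov exponent, and some phase does at least as well as the average.\<close>

theorem lyapunov_imp_growth:
 fixes V :: "real => real"
 assumes V: "continuous_on UNIV V" "!!s. V (s + 1) = V s" and L: "lyapunov V \<omega> E >= \<gamma>"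
 shows "expanding V \<omega> E \<gamma>"
proof -
 let ?M = "%n x. transfer_matrix V n x \<omega> E" let ?T = "%n x. tmat V \<omega> E n x"
 have hsM: "hs (?T n x) = sqrt ((ent (?M n x) 1 1)^2 + (ent (?M n x) 1 2)^2 + (ent (?M n x) 2 1)^2 + (ent (?M n x) 2 2)^2)" for n x
  using transfer_matrix_entries[of V n x \<omega> E] by (simp add: hs_def split: prod.splits)
 let ?o = "%n x. onorm ((*v) (?M n x))"
 have bnd: "?o n x <= hs (?T n x)" "hs (?T n x) <= 2 * ?o n x" for n x
  unfolding hsM by (rule onorm_hs_bounds)+
 have hs1: "hs (?T n x) >= 1" for n x by (rule hs_ge_1) simp
 have hsn: "hs (?T n x) ~= 0" for n x using hs1[of n x] by linarith
 have ct: "continuous_on UNIV (?T n)" for n by (rule continuous_tmat[OF V(1)])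
 have ch: "continuous_on UNIV (%x. hs (?T n x))" for n
  unfolding hs_def case_prod_beta by (intro continuous_intros ct)
 have clh: "continuous_on UNIV (%x. ln (hs (?T n x)))" for n
  by (intro continuous_on_ln ch) (use hsn in simp)
 have o0: "?o n x > 0" for n x using bnd(2)[of n x] hs1[of n x] by linarith
 have on: "?o n x ~= 0" for n x using o0[of n x] by linarith
 have co: "continuous_on UNIV (?o n)" for n
 proof -
  have "(?o n \<longlongrightarrow> ?o n a) (at a)" for a
  proof -
   have "((%x. sqrt ((ent (?M n x) 1 1 - ent (?M n a) 1 1)^2 + (ent (?M n x) 1 2 - ent (?M n a) 1 2)^2 + (ent (?M n x) 2 1 - ent (?M n a) 2 1)^2 + (ent (?M n x) 2 2 - ent (?M n a) 2 2)^2)) \<longlongrightarrow>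
     sqrt ((ent (?M n a) 1 1 - ent (?M n a) 1 1)^2 + (ent (?M n a) 1 2 - ent (?M n a) 1 2)^2 + (ent (?M n a) 2 1 - ent (?M n a) 2 1)^2 + (ent (?M n a) 2 2 - ent (?M n a) 2 2)^2)) (at a)"
    unfolding transfer_matrix_entries[THEN conjunct1] transfer_matrix_entries[THEN conjunct2, THEN conjunct1]
     transfer_matrix_entries[THEN conjunct2, THEN conjunct2, THEN conjunct1] transfer_matrix_entries[THEN conjunct2, THEN conjunct2, THEN conjunct2]
    by (intro tendsto_intros ct[unfolded continuous_on_def, rule_format, simplified])
   then have lim0: "((%x. sqrt ((ent (?M n x) 1 1 - ent (?M n a) 1 1)^2 + (ent (?M n x) 1 2 - ent (?M n a) 1 2)^2 + (ent (?M n x) 2 1 - ent (?M n a) 2 1)^2 + (ent (?M n x) 2 2 - ent (?M n a) 2 2)^2)) \<longlongrightarrow> 0) (at a)" by simp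
   have "((%x. ?o n x - ?o n a) \<longlongrightarrow> 0) (at a)"
    by (rule Lim_null_comparison[OF _ lim0]) (use onorm_diff_le in \<open>auto intro!: always_eventually\<close>)
   then show ?thesis by (simp add: LIM_zero_iff)
  qed
  then show ?thesis unfolding continuous_on_def by simp
 qed
 have clo: "continuous_on UNIV (%x. ln (?o n x))" for n by (intro continuous_on_ln co) (use on in simp)
 have int: "f integrable_on {0..1}" if "continuous_on UNIV f" for f :: "real => real"
  by (rule integrable_continuous_real) (rule continuous_on_subset[OF that], simp)
 define b where "b n = integral {0..1} (%x. ln (hs (?T n x)))" for n
 define a where "a n = integral {0..1} (%x. ln (?o n x))" for n
 have perT: "?T n (x + 1) = ?T n x" for n x
 proof (induction n)
  case (Suc n)
  have "V (x + 1 + real (Suc n) * \<omega>) = V (x + real (Suc n) * \<omega>)" using V(2)[of "x + real (Suc n) * \<omega>"] by (simp only: add.commute add.left_commute add.assoc)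
  then show ?case using Suc by simp
 qed simp
 have b0: "b n >= 0" for n unfolding b_def using int[OF clh] by (rule integral_nonneg) (simp add: hs1)
 have sub: "b (m + n) <= b m + b n" for m n
 proof -
  have "b (m + n) <= integral {0..1} (%x. ln (hs (?T n (x + real m * \<omega>))) + ln (hs (?T m x)))"
   unfolding b_def
  proof (rule integral_le)
   show "(%x. ln (hs (?T n (x + real m * \<omega>))) + ln (hs (?T m x))) integrable_on {0..1}"
    by (rule int) (intro continuous_intros clh continuous_on_compose2[OF clh], auto)
   fix x :: real
   have "hs (?T (m + n) x) <= hs (?T n (x + real m * \<omega>)) * hs (?T m x)"
    using hs_mm_le tmat_add[of V \<omega> E n m x] by (metis add.commute)
   then have "ln (hs (?T (m + n) x)) <= ln (hs (?T n (x + real m * \<omega>)) * hs (?T m x))"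
    using hs1[of "m + n" x] by (subst ln_le_cancel_iff) auto
   also have "... = ln (hs (?T n (x + real m * \<omega>))) + ln (hs (?T m x))"
    using hs1[of n "x + real m * \<omega>"] hs1[of m x] by (intro ln_mult_pos) auto
   finally show "ln (hs (?T (m + n) x)) <= ln (hs (?T n (x + real m * \<omega>))) + ln (hs (?T m x))" .
  qed (rule int[OF clh])
  also have "... = integral {0..1} (%x. ln (hs (?T n (x + real m * \<omega>)))) + integral {0..1} (%x. ln (hs (?T m x)))"
   by (rule integral_add) (intro int clh continuous_on_compose2[OF clh] continuous_intros; simp)+
  also have "integral {0..1} (%x. ln (hs (?T n (x + real m * \<omega>)))) = integral {0..1} (%x. ln (hs (?T n x)))"
   by (rule integral_periodic_shift[OF clh]) (simp add: perT)
  finally show ?thesis unfolding b_def by simp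
 qed
 obtain l where l: "(%n. b n / real n) \<longlonglongrightarrow> l" "!!n. n >= 1 ==> l <= b n / real n" using subadditive_limit[OF sub b0] by blast
 have ab: "\<bar>a n - b n\<bar> <= ln 2" for n
 proof -
  have "a n <= b n" unfolding a_def b_def
   by (rule integral_le[OF int[OF clo] int[OF clh]]) (rule ln_mono[OF bnd(1) o0])
  moreover have "b n <= integral {0..1} (%x. ln 2 + ln (?o n x))" unfolding b_def
  proof (rule integral_le[OF int[OF clh]])
   show "(%x. ln 2 + ln (?o n x)) integrable_on {0..1}" by (intro int continuous_intros clo)
   fix x :: real
   have "ln (hs (?T n x)) <= ln (2 * ?o n x)" using bnd(2)[of n x] hs1[of n x] o0[of n x] by (subst ln_le_cancel_iff) auto
   also have "... = ln 2 + ln (?o n x)" using o0[of n x] by (intro ln_mult_pos) auto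
   finally show "ln (hs (?T n x)) <= ln 2 + ln (?o n x)" .
  qed
  moreover have "integral {0..1} (%x. ln 2 + ln (?o n x)) = ln 2 + a n"
   unfolding a_def by (subst integral_add) (use int[OF clo] in auto)
  ultimately show ?thesis by simp
 qed
 have "(%n. 1 / real n * a n - b n / real n) \<longlonglongrightarrow> 0"
 proof (rule Lim_null_comparison)
  show "(%n. ln 2 / real n) \<longlonglongrightarrow> 0" by real_asymp
  show "\<forall>\<^sub>F n in sequentially. norm (1 / real n * a n - b n / real n) <= ln 2 / real n"
  proof (rule always_eventually, rule allI)
   fix n
   have "1 / real n * a n - b n / real n = (a n - b n) / real n" by (simp add: diff_divide_distrib)
   then show "norm (1 / real n * a n - b n / real n) <= ln 2 / real n" using ab[of n] by (simp add: divide_right_mono)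
  qed
 qed
 from tendsto_add[OF this l(1)] have "(%n. 1 / real n * a n) \<longlonglongrightarrow> l" by simp
 then have "lyapunov V \<omega> E = l" unfolding lyapunov_def a_def by (rule limI)
 then have \<gamma>l: "\<gamma> <= l" using L by simp
 show ?thesis
 proof (intro allI impI, rule ccontr)
  fix n :: nat assume n: "1 <= n" and "~ (\<exists>x. ln (hs (?T n x)) >= \<gamma> * real n)"
  then have less: "ln (hs (?T n x)) < \<gamma> * real n" for x by (auto simp: not_le)
  obtain z where z: "z \<in> {0..1}" "!!x. x \<in> {0..1} ==> ln (hs (?T n x)) <= ln (hs (?T n z))"
   using continuous_attains_sup[of "{0..1::real}" "%x. ln (hs (?T n x))"] continuous_on_subset[OF clh] by auto
  have "b n <= integral {0..1} (%x::real. ln (hs (?T n z)))" unfolding b_def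
   by (rule integral_le[OF int[OF clh]]) (use z in auto)
  also have "... = ln (hs (?T n z))" by simp
  also have "... < \<gamma> * real n" by (rule less)
  also have "... <= l * real n" using \<gamma>l by (intro mult_right_mono) auto
  also have "... <= b n" using l(2)[OF n] n by (simp add: pos_le_divide_eq)
  finally show False by simp
 qed
qed

section \<open>Choice of the parameters\<close>

definition gap_property :: "(real => real) => int set => real => real => real => real => bool" where
 "gap_property V \<Omega> \<omega> lo hi \<delta> \<longleftrightarrow> (ALL x E \<psi> \<sigma>. fsupp \<Omega> \<psi> --> nsq \<psi> > 0 --> nsq (ham \<Omega> (pot V \<omega> x) E \<psi>) <= \<sigma>^2 * nsq \<psi> -->
   0 < \<sigma> --> \<sigma> <= \<delta> / 16 --> lo - \<delta> / 2 <= E --> E <= hi + \<delta> / 2 --> lo - 2 * \<sigma> <= E & E <= hi + 2 * \<sigma>)"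

lemma gap_property_reflect:
 assumes g: "gap_property V \<Omega> \<omega> lo hi \<delta>" and sym: "uminus ` \<Omega> = \<Omega>"
 shows "gap_property V \<Omega> (- \<omega>) lo hi \<delta>"
 unfolding gap_property_def
proof (intro allI impI)
 fix x E \<psi> \<sigma>
 assume \<psi>: "fsupp \<Omega> \<psi>" "nsq \<psi> > 0" "nsq (ham \<Omega> (pot V (- \<omega>) x) E \<psi>) <= \<sigma>^2 * nsq \<psi>" and r: "0 < \<sigma>" "\<sigma> <= \<delta> / 16" "lo - \<delta> / 2 <= E" "E <= hi + \<delta> / 2"
 have fin: "finite {n. \<psi> n ~= 0}" using \<psi>(1) by (simp add: fsupp_def)
 have f: "fsupp \<Omega> (%n. \<psi> (- n))"
 proof (rule fsuppI[of "uminus ` {n. \<psi> n ~= 0}"])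
  fix n assume n: "n \<notin> uminus ` {n. \<psi> n ~= 0}"
  show "\<psi> (- n) = 0"
  proof (rule ccontr)
   assume "\<psi> (- n) ~= 0"
   then have "- (- n) \<in> uminus ` {n. \<psi> n ~= 0}" by (intro imageI) simp
   then show False using n by simp
  qed
 next
  fix n assume "n \<notin> \<Omega>"
  then have "- n \<notin> \<Omega>" using sym by (metis image_eqI minus_minus)
  then show "\<psi> (- n) = 0" using \<psi>(1) by (simp add: fsupp_def)
 qed (use fin in simp)
 have "ham \<Omega> (pot V \<omega> x) E (%n. \<psi> (- n)) = (%n. ham \<Omega> (pot V (- \<omega>) x) E \<psi> (- n))"
  using ham_reflect[of \<Omega> V "- \<omega>" x E \<psi>] unfolding sym by (intro ext) simp
 then have "nsq (ham \<Omega> (pot V \<omega> x) E (%n. \<psi> (- n))) <= \<sigma>^2 * nsq (%n. \<psi> (- n))"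
  using \<psi>(3) by (simp only: nsq_reflect[OF fsupp_ham[OF \<psi>(1)]] nsq_reflect[OF \<psi>(1)])
 moreover have "nsq (%n. \<psi> (- n)) > 0" using \<psi>(2) nsq_reflect[OF \<psi>(1)] by simp
 ultimately show "lo - 2 * \<sigma> <= E & E <= hi + 2 * \<sigma>" using g f r unfolding gap_property_def by blast
qed

text \<open>With \<open>x = N\<close>, scales are powers of \<open>ln x\<close>, the number \<open>R\<close> of
iterated windows is about \<open>x powr 0.995\<close>: enough for decay below \<open>\<delta> = exp (- (x powr
0.99))\<close>, and still with total length less than \<open>x / 8\<close>.\<close>

lemma parameter_asymptotics:
 fixes cA c1 c2 c3 c4 c Cb b0 J :: real
 assumes "cA > 0" "c1 > 0" "c2 > 0" "c3 > 0" "c4 > 0" "c > 0" "Cb > 0" "J > 0"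
 shows "\<forall>\<^sub>F x::real in at_top.
  exp (- (ln x ^ 20)) + exp (- (x powr (99 / 100))) <= exp (- (cA * ln x ^ 18)) &
  1 / x ^ 3 <= 1 / (2 * (c3 * ln x ^ 36)) &
  3 * (1 / x ^ 6) * ((9 * x + 1) * (c2 * ln x ^ 35)) <= 1 / x ^ 3 / 2 &
  2 ^ 12 * x^2 * (1 / 32) powr (x powr (199 / 200)) <= exp (- (x powr (99 / 100))) &
  (x powr (199 / 200) + (J + 6)) * (c1 * ln x ^ 18) + c4 * ln x ^ 108 * ((2 * (x powr (199 / 200) + (J + 4)) + 1) * (c2 * ln x ^ 35) + 1) <= x / 8 - 1 &
  2 * (1 / x ^ 6 + 1 / x ^ 3) <= c / x ^ 2 & b0 <= Cb * ln x & 1 <= ln x & x >= 3"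
proof (intro eventually_conj)
 show "\<forall>\<^sub>F x::real in at_top. exp (- (ln x ^ 20)) + exp (- (x powr (99 / 100))) <= exp (- (cA * ln x ^ 18))" using assms by real_asymp
 show "\<forall>\<^sub>F x::real in at_top. 1 / x ^ 3 <= 1 / (2 * (c3 * ln x ^ 36))" using assms by real_asymp
 show "\<forall>\<^sub>F x::real in at_top. 3 * (1 / x ^ 6) * ((9 * x + 1) * (c2 * ln x ^ 35)) <= 1 / x ^ 3 / 2" using assms by real_asymp
 show "\<forall>\<^sub>F x::real in at_top. 2 ^ 12 * x^2 * (1 / 32) powr (x powr (199 / 200)) <= exp (- (x powr (99 / 100)))" by real_asymp
 show "\<forall>\<^sub>F x::real in at_top. (x powr (199 / 200) + (J + 6)) * (c1 * ln x ^ 18) + c4 * ln x ^ 108 * ((2 * (x powr (199 / 200) + (J + 4)) + 1) * (c2 * ln x ^ 35) + 1) <= x / 8 - 1"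
  using assms by real_asymp
 show "\<forall>\<^sub>F x::real in at_top. 2 * (1 / x ^ 6 + 1 / x ^ 3) <= c / x ^ 2" using assms by real_asymp
 show "\<forall>\<^sub>F x::real in at_top. b0 <= Cb * ln x" using assms by real_asymp
 show "\<forall>\<^sub>F x::real in at_top. 1 <= ln x" by real_asymp
 show "\<forall>\<^sub>F x::real in at_top. x >= 3" by real_asymp
qed

abbreviation "island_at V \<omega> E0 \<Omega> lo hi LV N \<equiv> \<exists>C \<theta> K \<tau> \<eta> ys m nf J \<Theta> w h Mb P W R.
  island V \<omega> E0 w C \<theta> K \<tau> \<eta> ys m nf J \<Theta> \<Omega> lo hi (exp (- (real N powr (99 / 100)))) LV h Mb P W R (int (N div 8))"

text \<open>The choices are \<open>b\<close> about \<open>(6 / \<kappa>) * ln N\<close>, so that \<open>\<tau> \<le> N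
powr -6\<close>, and \<open>h = N powr -3\<close>, \<open>R = J + 2 + \<lceil>N powr 0.995\<rceil>\<close>, \<open>Q =
N div 8\<close>. The exponent 20 exceeds the 18 in \<open>m = O((ln N) ^ 18)\<close>, so the island is narrower than
\<open>exp (- CW * m)\<close>.\<close>

theorem island_exists:
 fixes V :: "real => real"
 assumes V: "fourier_class \<rho> Bv (%x. of_real (V x))" and \<rho>: "\<rho> > 0" and c: "c > 0" and \<gamma>: "\<gamma> > 0" and B: "B >= 0"
  and Lip: "!!s t. \<bar>V s - V t\<bar> <= LV * \<bar>s - t\<bar>" "LV > 0" and per: "!!s. V (s + 1) = V s" and bd: "!!s. \<bar>V s\<bar> <= A"
 obtains N0 :: nat where "N0 >= 3" "!!\<omega> E0 N lo hi \<Omega>. dioph c \<omega> ==> \<bar>E0\<bar> <= B ==> expanding V \<omega> E0 \<gamma> ==>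
   N >= N0 ==> lo <= E0 ==> E0 <= hi ==> hi - lo <= exp (- (ln (real N) ^ 20)) ==>
   gap_property V \<Omega> \<omega> lo hi (exp (- (real N powr (99 / 100)))) ==>
   island_at V \<omega> E0 \<Omega> lo hi LV N"
proof -
 obtain C \<kappa> CW CE :: real and d b0 I J :: nat where k: "\<kappa> > 0" "CW > 0" "CE >= 1" "b0 >= 2"
  and sc: "!!\<omega> E0 b. dioph c \<omega> ==> \<bar>E0\<bar> <= B ==> b >= b0 ==> expanding V \<omega> E0 \<gamma> ==>
   good_scale_at V \<omega> E0 b C \<kappa> CW CE d I J"
  using scale_exists[OF V \<rho> c \<gamma> B] by metis
 define Cb where "Cb = 6 / \<kappa>"
 have Cb: "Cb > 0" "\<kappa> * Cb = 6" unfolding Cb_def using k by auto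
 define c1 where "c1 = 2 ^ I * (Cb + 1) ^ 18"
 define c2 where "c2 = real d * c1 * (Cb + 1) ^ 17 + 1"
 define c3 where "c3 = CE * c1^2"
 define c4 where "c4 = 64 * c3 ^ 3 / c + 2"
 have pos: "c1 > 0" "c2 > 0" "c3 > 0" "c4 > 0" "CW * c1 > 0"
  unfolding c1_def c2_def c3_def c4_def using Cb k c by (auto intro!: add_nonneg_pos mult_pos_pos)
 have J0: "real J + 1 > 0" by simp
 obtain X0 :: real where X0: "!!x. x >= X0 ==>
  exp (- (ln x ^ 20)) + exp (- (x powr (99 / 100))) <= exp (- ((CW * c1) * ln x ^ 18)) &
  1 / x ^ 3 <= 1 / (2 * (c3 * ln x ^ 36)) &
  3 * (1 / x ^ 6) * ((9 * x + 1) * (c2 * ln x ^ 35)) <= 1 / x ^ 3 / 2 &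
  2 ^ 12 * x^2 * (1 / 32) powr (x powr (199 / 200)) <= exp (- (x powr (99 / 100))) &
  (x powr (199 / 200) + ((real J + 1) + 6)) * (c1 * ln x ^ 18) + c4 * ln x ^ 108 * ((2 * (x powr (199 / 200) + ((real J + 1) + 4)) + 1) * (c2 * ln x ^ 35) + 1) <= x / 8 - 1 &
  2 * (1 / x ^ 6 + 1 / x ^ 3) <= c / x ^ 2 & real b0 <= Cb * ln x & 1 <= ln x & x >= 3"
  using parameter_asymptotics[OF pos(5,1,2,3,4) c Cb(1) J0, of "real b0"] unfolding eventually_at_top_linorder by blast
 define N0 where "N0 = nat \<lceil>max X0 3\<rceil>"
 show ?thesis
 proof (rule that)
  show "N0 >= 3" unfolding N0_def by linarith
  fix \<omega> E0 N lo hi and \<Omega> :: "int set"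
  assume dio: "dioph c \<omega>" and E0: "\<bar>E0\<bar> <= B" and gr: "expanding V \<omega> E0 \<gamma>"
   and N: "N >= N0" and lohi: "lo <= E0" "E0 <= hi" "hi - lo <= exp (- (ln (real N) ^ 20))"
   and gp: "gap_property V \<Omega> \<omega> lo hi (exp (- (real N powr (99 / 100))))"
  define X where "X = real N"
  define T where "T = ln X"
  have "X >= X0" unfolding X_def using N unfolding N0_def by linarith
  from X0[OF this] have a1: "exp (- (T ^ 20)) + exp (- (X powr (99 / 100))) <= exp (- ((CW * c1) * T ^ 18))"
   and a2: "1 / X ^ 3 <= 1 / (2 * (c3 * T ^ 36))" and a3: "3 * (1 / X ^ 6) * ((9 * X + 1) * (c2 * T ^ 35)) <= 1 / X ^ 3 / 2"
   and a4: "2 ^ 12 * X^2 * (1 / 32) powr (X powr (199 / 200)) <= exp (- (X powr (99 / 100)))"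
   and a5: "(X powr (199 / 200) + ((real J + 1) + 6)) * (c1 * T ^ 18) + c4 * T ^ 108 * ((2 * (X powr (199 / 200) + ((real J + 1) + 4)) + 1) * (c2 * T ^ 35) + 1) <= X / 8 - 1"
   and a6: "2 * (1 / X ^ 6 + 1 / X ^ 3) <= c / X ^ 2" and a7: "real b0 <= Cb * T" "1 <= T" "X >= 3"
   unfolding T_def by auto
  define b where "b = nat \<lceil>Cb * T\<rceil>"
  have CbT: "Cb * T >= 0" using Cb a7 by simp
  have b1: "real b >= Cb * T" unfolding b_def by linarith
  have b2: "real b <= (Cb + 1) * T"
  proof -
   have "real b <= Cb * T + 1" unfolding b_def using CbT by linarith
   then show ?thesis using a7 by (simp add: algebra_simps)
  qed
  have b0: "b >= b0" using b1 a7 by linarith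
  obtain m nf \<theta> K ys \<Theta> where s: "scale V \<omega> E0 (exp (- CW * real m)) C \<theta> K (exp (- \<kappa> * real b)) (1 / (CE * (real m)^2)) ys m nf J \<Theta>"
   and m: "m <= 2 ^ I * b ^ 18" and card: "card \<Theta> <= d * m * b ^ 17"
   using sc[OF dio E0 b0 gr] by blast
  interpret scale V \<omega> E0 "exp (- CW * real m)" C \<theta> K "exp (- \<kappa> * real b)" "1 / (CE * (real m)^2)" ys m nf J \<Theta> by (rule s)
  have mT: "real m <= c1 * T ^ 18"
  proof -
   have "real m <= 2 ^ I * real b ^ 18" using m by (metis (mono_tags) of_nat_le_iff of_nat_mult of_nat_numeral of_nat_power)
   also have "... <= 2 ^ I * ((Cb + 1) * T) ^ 18" using b2 by (intro mult_left_mono power_mono) auto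
   also have "... = c1 * T ^ 18" unfolding c1_def by (simp add: power_mult_distrib)
   finally show ?thesis .
  qed
  have cardT: "real (card \<Theta>) <= c2 * T ^ 35"
  proof -
   have "real (card \<Theta>) <= real d * real m * real b ^ 17" using card by (metis of_nat_le_iff of_nat_mult of_nat_power)
   also have "... <= real d * (c1 * T ^ 18) * ((Cb + 1) * T) ^ 17" using mT b2 pos a7 by (intro mult_mono mult_left_mono power_mono) auto
   also have "... = (real d * c1 * (Cb + 1) ^ 17) * (T ^ 18 * T ^ 17)" by (simp only: power_mult_distrib mult_ac)
   also have "T ^ 18 * T ^ 17 = T ^ 35" by (simp flip: power_add)
   also have "(real d * c1 * (Cb + 1) ^ 17) * T ^ 35 <= c2 * T ^ 35" unfolding c2_def using a7 by (intro mult_right_mono) auto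
   finally show ?thesis .
  qed
  define \<tau> where "\<tau> = exp (- \<kappa> * real b)"
  define \<eta> where "\<eta> = 1 / (CE * (real m)^2)"
  define w where "w = exp (- CW * real m)"
  define h where "h = 1 / X ^ 3"
  define \<delta> where "\<delta> = exp (- (X powr (99 / 100)))"
  define P where "P = nat \<lceil>8 / (c * (\<eta> / 2) ^ 3)\<rceil>"
  define R where "R = J + 2 + nat \<lceil>X powr (199 / 200)\<rceil>"
  define W where "W = (P + 1) * ((2 * R + 1) * card \<Theta> + 1)"
  have m1: "real m >= 1" using m2 by simp
  have X1: "X > 0" using a7 by simp
  have \<tau>X: "\<tau> <= 1 / X ^ 6"
  proof -
   have "\<kappa> * (Cb * T) <= \<kappa> * real b" using k b1 by (intro mult_left_mono) auto
   moreover have "\<kappa> * (Cb * T) = 6 * T" using Cb(2) by (simp add: mult.assoc[symmetric])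
   ultimately have "\<tau> <= exp (- (6 * T))" unfolding \<tau>_def by simp
   also have "exp (6 * T) = X ^ 6" unfolding T_def using X1 exp_of_nat_mult[of 6 "ln X"] by simp
   then have "exp (- (6 * T)) = 1 / X ^ 6" by (simp add: exp_minus field_simps)
   finally show ?thesis .
  qed
  have mm: "CE * (real m)^2 >= 1"
  proof -
   have "1 * 1 <= CE * (real m)^2" using k m1 by (intro mult_mono) (auto simp: one_le_power)
   then show ?thesis by simp
  qed
  have \<eta>1: "0 < \<eta>" "\<eta> <= 1" unfolding \<eta>_def using mm by auto
  have inv\<eta>: "CE * (real m)^2 <= c3 * T ^ 36"
  proof -
   have "CE * (real m)^2 <= CE * (c1 * T ^ 18)^2" using mT k by (intro mult_left_mono power_mono) auto
   also have "... = c3 * T ^ 36" unfolding c3_def by (simp add: power_mult_distrib flip: power_mult)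
   finally show ?thesis .
  qed
  have h1: "0 < h" "h <= \<eta> / 2"
  proof -
   show "0 < h" unfolding h_def using X1 by simp
   have "1 / (2 * (c3 * T ^ 36)) <= 1 / (2 * (CE * (real m)^2))" using inv\<eta> mm by (intro frac_le) (simp, simp, linarith, linarith)
   then show "h <= \<eta> / 2" using a2 unfolding h_def \<eta>_def by simp
  qed
  have P1: "real P + 1 <= c4 * T ^ 108"
  proof -
   have "8 / (c * (\<eta> / 2) ^ 3) = 64 * (CE * (real m)^2) ^ 3 / c" unfolding \<eta>_def using c mm by (simp add: field_simps)
   also have "... <= 64 * (c3 * T ^ 36) ^ 3 / c" using inv\<eta> mm c by (intro divide_right_mono mult_left_mono power_mono) auto
   also have "... = 64 * c3 ^ 3 / c * T ^ 108" by (simp add: power_mult_distrib flip: power_mult)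
   finally have 1: "8 / (c * (\<eta> / 2) ^ 3) <= 64 * c3 ^ 3 / c * T ^ 108" .
   have "8 / (c * (\<eta> / 2) ^ 3) >= 0" using c \<eta>1 by simp
   then have "real P + 1 <= 8 / (c * (\<eta> / 2) ^ 3) + 2" unfolding P_def by linarith
   also have "... <= 64 * c3 ^ 3 / c * T ^ 108 + 2 * T ^ 108" using 1 one_le_power[OF a7(2), of 108] by linarith
   also have "... = c4 * T ^ 108" unfolding c4_def by (simp add: distrib_right)
   finally show ?thesis .
  qed
  have Y0: "X powr (199 / 200) >= 0" by simp
  have R1: "real R <= X powr (199 / 200) + (real J + 1 + 2)" unfolding R_def using Y0 by linarith
  have R2: "real (R - J) >= X powr (199 / 200)" unfolding R_def by linarith
  have W1: "real W <= c4 * T ^ 108 * ((2 * (X powr (199 / 200) + ((real J + 1) + 4)) + 1) * (c2 * T ^ 35) + 1)"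
  proof -
   have "real W = (real P + 1) * ((2 * real R + 1) * real (card \<Theta>) + 1)" unfolding W_def by (simp add: algebra_simps)
   also have "... <= c4 * T ^ 108 * ((2 * (X powr (199 / 200) + ((real J + 1) + 4)) + 1) * (c2 * T ^ 35) + 1)"
    using P1 R1 cardT Y0 a7 pos by (intro mult_mono add_mono order_refl) (auto intro!: mult_nonneg_nonneg add_nonneg_nonneg)
   finally show ?thesis .
  qed
  have RmW: "real (R + 2) * real m + real W <= X / 8 - 1"
  proof -
   have "real (R + 2) * real m <= (X powr (199 / 200) + ((real J + 1) + 6)) * (c1 * T ^ 18)"
    using R1 mT Y0 by (intro mult_mono) auto
   then show ?thesis using W1 a5 by linarith
  qed
  have Qr: "real_of_int (int (N div 8)) >= X / 8 - 1" "real_of_int (int (N div 8)) <= X"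
  proof -
   have "N = 8 * (N div 8) + N mod 8" "N mod 8 < 8" by simp_all
   then have "real N <= 8 * real (N div 8) + 8" by linarith
   then show "real_of_int (int (N div 8)) >= X / 8 - 1" unfolding X_def by simp
   show "real_of_int (int (N div 8)) <= X" unfolding X_def by simp
  qed
  have WX: "real W <= X"
  proof -
   have "0 <= real (R + 2) * real m" by simp
   then show ?thesis using RmW X1 by linarith
  qed
  have w1: "w <= 1" unfolding w_def using k by simp
  have "island_axioms V \<omega> E0 w \<tau> \<eta> m J \<Theta> \<Omega> lo hi \<delta> LV h (A + B + 1) P W R (int (N div 8))"
  proof
   show "\<tau> > 0" "0 < h" "h <= \<eta> / 2" "LV > 0" using h1 Lip by (auto simp: \<tau>_def)
   show "h <= 1 / 2" using h1 \<eta>1 by linarith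
   show "\<bar>V s - V t\<bar> <= LV * \<bar>s - t\<bar>" for s t by (rule Lip)
   show "V (s + 1) = V s" for s by (rule per)
   show "\<bar>V s - E\<bar> <= A + B + 1" if "\<bar>E - E0\<bar> <= w" for s E using bd[of s] E0 w1 that by linarith
   show "\<delta> > 0" by (simp add: \<delta>_def)
   show "(P + 1) * ((2 * R + 1) * card \<Theta> + 1) <= W" by (simp add: W_def)
   show "J + 2 <= R" by (simp add: R_def)
   show "lo - 2 * \<sigma> <= E & E <= hi + 2 * \<sigma>"
    if "fsupp \<Omega> \<psi>" "nsq \<psi> > 0" "nsq (ham \<Omega> (pot V \<omega> x) E \<psi>) <= \<sigma>^2 * nsq \<psi>" "0 < \<sigma>" "\<sigma> <= \<delta> / 16" "lo - \<delta> / 2 <= E" "E <= hi + \<delta> / 2" for x E \<psi> \<sigma>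
    using gp that unfolding gap_property_def \<delta>_def X_def by blast
   show "\<bar>E - E0\<bar> <= w" if "lo - \<delta> / 2 <= E" "E <= hi + \<delta> / 2" for E
   proof -
    have "\<bar>E - E0\<bar> <= exp (- (T ^ 20)) + exp (- (X powr (99 / 100)))"
     using that lohi unfolding \<delta>_def T_def X_def by (smt (verit) exp_gt_zero field_sum_of_halves)
    also have "... <= exp (- ((CW * c1) * T ^ 18))" by (rule a1)
    also have "... <= w" unfolding w_def using mult_left_mono[OF mT, of CW] k by simp
    finally show ?thesis .
   qed
   show "\<exists>q::nat. q <= P & dist_int (real q * \<omega> - y) <= \<eta> / 2" for y
   proof -
    have "0 < \<eta> / 2" "\<eta> / 2 <= 1" using \<eta>1 by auto
    from orbit_dense[OF dio c this] obtain q :: nat where q: "real q <= 8 / (c * (\<eta> / 2) ^ 3)" "dist_int (real q * \<omega> - y) <= \<eta> / 2" by blast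
    have "q <= P" using q(1) unfolding P_def by linarith
    then show ?thesis using q(2) by blast
   qed
   show "dist_int (of_int k * \<omega>) >= 2 * (\<tau> + h)" if k: "k ~= 0" "\<bar>k\<bar> <= int W" for k
   proof -
    define n where "n = nat \<bar>k\<bar>"
    have n: "n >= 1" "n <= W" unfolding n_def using k by linarith+
    have "dist_int (of_int k * \<omega>) = dist_int (real n * \<omega>)"
    proof (cases "k >= 0")
     case True
     then show ?thesis unfolding n_def by simp
    next
     case False
     then have "of_int k * \<omega> = - (real n * \<omega>)" unfolding n_def by simp
     then show ?thesis using dist_int_minus by simp
    qed
    also have "... >= c / (real n)^2" using dio n unfolding dioph_def by blast
    finally have 1: "dist_int (of_int k * \<omega>) >= c / (real n)^2" .
    have "real n <= X" using n WX by linarith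
    then have "c / X^2 <= c / (real n)^2" using c n by (intro divide_left_mono power_mono mult_pos_pos) auto
    moreover have "2 * (\<tau> + h) <= 2 * (1 / X ^ 6 + 1 / X ^ 3)" unfolding h_def using \<tau>X by simp
    ultimately show ?thesis using 1 a6 by (meson order_trans)
   qed
   show "int (R + 2) * int m + int W <= int (N div 8)"
   proof -
    have "real_of_int (int (R + 2) * int m + int W) <= real_of_int (int (N div 8))" using RmW Qr(1) by simp
    then show ?thesis by (simp only: of_int_le_iff)
   qed
   show "3 * \<tau> * ((9 * real_of_int (int (N div 8)) + 1) * real (card \<Theta>)) <= h / 2"
   proof -
    have "3 * \<tau> * ((9 * real_of_int (int (N div 8)) + 1) * real (card \<Theta>)) <= 3 * (1 / X ^ 6) * ((9 * X + 1) * (c2 * T ^ 35))"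
     using \<tau>X Qr(2) cardT X1 by (intro mult_mono add_mono) (auto simp: \<tau>_def)
    then show ?thesis using a3 unfolding h_def by linarith
   qed
   show "2 ^ 12 * (real_of_int (int (N div 8)))^2 * (1 / 32) ^ (R - J) <= \<delta>"
   proof -
    have "(1 / 32 :: real) ^ (R - J) = (1 / 32) powr real (R - J)" by (simp add: powr_realpow)
    also have "... <= (1 / 32) powr (X powr (199 / 200))" using R2 by (intro powr_mono') auto
    finally have "2 ^ 12 * (real_of_int (int (N div 8)))^2 * (1 / 32) ^ (R - J) <= 2 ^ 12 * X^2 * (1 / 32) powr (X powr (199 / 200))"
     using Qr(2) by (intro mult_mono power_mono) auto
    then show ?thesis using a4 unfolding \<delta>_def by linarith
   qed
  qed
  then have "island V \<omega> E0 w C \<theta> K \<tau> \<eta> ys m nf J \<Theta> \<Omega> lo hi \<delta> LV h (A + B + 1) P W R (int (N div 8))"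
   unfolding island_def using s unfolding w_def \<tau>_def \<eta>_def by blast
  then show "island_at V \<omega> E0 \<Omega> lo hi LV N"
   unfolding \<delta>_def X_def by blast
 qed
qed

section \<open>Separation of gaps\<close>

text \<open>A right end is treated as a left end for \<open>- \<omega>\<close>, with a scale of its own; only the
energies and \<open>Q\<close> are common to both.\<close>

theorem no_spectrum_in_small_island:
 fixes V :: "real => real"
 assumes V: "fourier_class \<rho> Bv (%x. of_real (V x))" and \<rho>: "\<rho> > 0" and c: "c > 0" and \<gamma>: "\<gamma> > 0" and B: "B >= 0"
  and Lip: "!!s t. \<bar>V s - V t\<bar> <= LV * \<bar>s - t\<bar>" "LV > 0" and per: "!!s. V (s + 1) = V s" and bd: "!!s. \<bar>V s\<bar> <= A"
 obtains N0 :: nat where "N0 >= 3" "!!\<omega> E0 N lo hi \<Omega> y. dioph c \<omega> ==> \<bar>E0\<bar> <= B ==> expanding V \<omega> E0 \<gamma> ==>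
   N >= N0 ==> lo <= E0 ==> E0 <= hi ==> hi - lo <= exp (- (ln (real N) ^ 20)) ==>
   gap_property V \<Omega> \<omega> lo hi (exp (- (real N powr (99 / 100)))) ==> \<Omega> = UNIV | (\<exists>N'\<ge>N. \<Omega> = {- int N'..int N'}) ==>
   approx_eig \<Omega> (pot V \<omega> y) E0 ==> False"
proof -
 obtain N0 :: nat where N0: "N0 >= 3"
  and isle: "!!\<omega> E0 N lo hi \<Omega>. dioph c \<omega> ==> \<bar>E0\<bar> <= B ==> expanding V \<omega> E0 \<gamma> ==>
   N >= N0 ==> lo <= E0 ==> E0 <= hi ==> hi - lo <= exp (- (ln (real N) ^ 20)) ==>
   gap_property V \<Omega> \<omega> lo hi (exp (- (real N powr (99 / 100)))) ==>
   island_at V \<omega> E0 \<Omega> lo hi LV N"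
  by (rule island_exists[OF V \<rho> c \<gamma> B Lip per bd]) blast
 show ?thesis
 proof (rule that[OF N0])
  fix \<omega> E0 N lo hi y and \<Omega> :: "int set"
  assume dio: "dioph c \<omega>" and E0: "\<bar>E0\<bar> <= B" and gr: "expanding V \<omega> E0 \<gamma>"
   and N: "N >= N0" and lohi: "lo <= E0" "E0 <= hi" "hi - lo <= exp (- (ln (real N) ^ 20))"
   and gp: "gap_property V \<Omega> \<omega> lo hi (exp (- (real N powr (99 / 100))))"
   and \<Omega>: "\<Omega> = UNIV | (\<exists>N'\<ge>N. \<Omega> = {- int N'..int N'})" and ap: "approx_eig \<Omega> (pot V \<omega> y) E0"
  let ?\<delta> = "exp (- (real N powr (99 / 100)))" and ?Q = "int (N div 8)"
  have Q8: "8 * ?Q <= int N" by linarith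
  obtain C \<theta> K \<tau> \<eta> ys m nf J \<Theta> w h Mb P W R where
   "island V \<omega> E0 w C \<theta> K \<tau> \<eta> ys m nf J \<Theta> \<Omega> lo hi ?\<delta> LV h Mb P W R ?Q"
   using isle[OF dio E0 gr N lohi gp] by blast
  then interpret island V \<omega> E0 w C \<theta> K \<tau> \<eta> ys m nf J \<Theta> \<Omega> lo hi ?\<delta> LV h Mb P W R ?Q .
  have "isl 0 E0" unfolding isl_def using lohi by simp
  moreover have "\<Omega> = UNIV | (\<exists>A B. \<Omega> = {A..B} & 8 * ?Q <= B - A)" using \<Omega> Q8 by fastforce
  ultimately obtain a b where ab: "\<Omega> = {a..b}" "8 * ?Q <= b - a"
   "edge_state V \<omega> lo hi ?\<delta> ?Q a y | edge_state V (- \<omega>) lo hi ?\<delta> ?Q (- b) y"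
   using state_at_an_end[OF ap] by blast
  have "{a..b} ~= UNIV" by (metis finite_atLeastAtMost_int infinite_UNIV_int)
  then obtain N' where N': "N' >= N" "\<Omega> = {- int N'..int N'}" using \<Omega> ab by blast
  from ab(3) show False
  proof
   assume "edge_state V \<omega> lo hi ?\<delta> ?Q a y"
   then show False by (rule no_left_edge_state) (use ab in auto)
  next
   assume st: "edge_state V (- \<omega>) lo hi ?\<delta> ?Q (- b) y"
   have "{a..b} = {- int N'..int N'}" using ab(1) N'(2) by simp
   then have b: "b = int N'" "a = - int N'" by (auto simp: Icc_eq_Icc)
   have sym: "uminus ` \<Omega> = \<Omega>" unfolding N'(2) by simp
   obtain C \<theta> K \<tau> \<eta> ys m nf J \<Theta> w h Mb P W R where
    i: "island V (- \<omega>) E0 w C \<theta> K \<tau> \<eta> ys m nf J \<Theta> \<Omega> lo hi ?\<delta> LV h Mb P W R ?Q"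
    using isle[OF dioph_minus[OF dio] E0 growth_reverse[OF gr] N lohi gap_property_reflect[OF gp sym]] by blast
   show False by (rule island.no_left_edge_state[OF i st]) (use ab b in auto)
  qed
 qed
qed

lemma gap_point:
 assumes "gap_length G > \<delta>" "\<delta> >= 0"
 shows "!!u. \<exists>g\<in>G. g \<notin> {u..u + \<delta>}"
proof (rule ccontr)
 fix u assume "~ (\<exists>g\<in>G. g \<notin> {u..u + \<delta>})"
 then have sub: "G \<subseteq> {u..u + \<delta>}" by auto
 have "measure lborel G <= \<delta>"
 proof (cases "G \<in> sets lborel")
  case True
  have "measure lborel G <= measure lborel {u..u + \<delta>}"
   by (rule measure_mono_fmeasurable[OF sub True]) (simp add: fmeasurable_def emeasure_lborel_Icc_eq)
  then show ?thesis using assms(2) by simp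
 next
  case False
  then show ?thesis using assms(2) by (simp add: measure_notin_sets)
 qed
 then show False using assms(1) unfolding gap_length_def by simp
qed

text \<open>Distinct components of the complement are separated by a point \<open>E0\<close> of \<open>S\<close>. The
island is bounded by the two facing ends of the gaps, and the gaps themselves are the collars.\<close>

lemma island_between_gaps:
 assumes G: "G1 \<in> gaps S E' E''" "G2 \<in> gaps S E' E''" "G1 ~= G2" and len: "gap_length G1 > \<delta>" "gap_length G2 > \<delta>" and \<delta>: "\<delta> > 0"
  and dist: "setdist G1 G2 <= d"
 obtains E0 lo hi where "E0 \<in> S" "E0 \<in> {E'<..<E''}" "lo <= E0" "E0 <= hi" "hi - lo <= d"
  "!!E. E \<in> S ==> lo - \<delta> <= E ==> E <= hi + \<delta> ==> lo <= E & E <= hi"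
proof -
 note result = that
 have ordered: thesis
  if G: "G1 \<in> gaps S E' E''" "G2 \<in> gaps S E' E''" "G1 ~= G2" and len: "gap_length G1 > \<delta>" "gap_length G2 > \<delta>"
   and dist: "setdist G1 G2 <= d" and g: "g1 \<in> G1" "g2 \<in> G2" "g1 < g2" for G1 G2 g1 g2
 proof -
  let ?U = "{E'<..<E''} - S"
  have sub: "G1 \<subseteq> ?U" "G2 \<subseteq> ?U" and con: "connected G1" "connected G2"
   using G unfolding gaps_def by (auto dest: in_components_subset in_components_connected)
  have ivl: "x \<in> G" if "G \<in> {G1, G2}" "u \<in> G" "v \<in> G" "u <= x" "x <= v" for G u v x
   using con that by (auto simp: connected_iff_interval)
  have disj: "G1 \<inter> G2 = {}" using G unfolding gaps_def by (meson components_nonoverlap)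
  have "~ {g1..g2} \<subseteq> ?U"
  proof
   assume s: "{g1..g2} \<subseteq> ?U"
   have "{g1..g2} \<subseteq> G1" by (rule components_maximal[OF _ _ s]) (use G g in \<open>auto simp: gaps_def\<close>)
   moreover have "g2 \<in> {g1..g2}" using g by simp
   ultimately show False using disj g by blast
  qed
  then obtain E0 where E0: "E0 \<in> {g1..g2}" "E0 \<notin> ?U" by blast
  have "g1 \<in> {E'<..<E''}" "g2 \<in> {E'<..<E''}" using g sub by auto
  then have E0': "E0 \<in> {E'<..<E''}" "E0 \<in> S" using E0 by auto
  have E0G: "E0 \<notin> G1" "E0 \<notin> G2" using E0(2) sub by auto
  have up: "x <= E0" if "x \<in> G1" for x
  proof (rule ccontr)
   assume *: "~ x <= E0"
   have "E0 \<in> G1" by (rule ivl[of G1 g1 x]) (use that g E0 * in auto)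
   then show False using E0G by simp
  qed
  have dn: "E0 <= x" if "x \<in> G2" for x
  proof (rule ccontr)
   assume *: "~ E0 <= x"
   have "E0 \<in> G2" by (rule ivl[of G2 x g2]) (use that g E0 * in auto)
   then show False using E0G by simp
  qed
  define lo where "lo = Sup G1"
  define hi where "hi = Inf G2"
  have bA: "bdd_above G1" using up by (meson bdd_aboveI)
  have bB: "bdd_below G2" using dn by (meson bdd_belowI)
  have ne: "G1 ~= {}" "G2 ~= {}" using g by auto
  have lo: "lo <= E0" "!!x. x \<in> G1 ==> x <= lo" unfolding lo_def using up bA ne by (auto intro: cSup_least cSup_upper)
  have hi: "E0 <= hi" "!!x. x \<in> G2 ==> hi <= x" unfolding hi_def using dn bB ne by (auto intro: cInf_greatest cInf_lower)
  have "hi - lo <= setdist G1 G2"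
  proof (rule le_setdistI)
   fix x y assume "x \<in> G1" "y \<in> G2"
   then show "hi - lo <= dist x y" using lo(2) hi(2) by (fastforce simp: dist_real_def)
  qed (use ne in auto)
  then have hl: "hi - lo <= d" using dist by linarith
  obtain a1 where a1: "a1 \<in> G1" "a1 \<notin> {lo - \<delta>..lo - \<delta> + \<delta>}" using gap_point[OF len(1)] \<delta> by fastforce
  then have a1': "a1 < lo - \<delta>" using lo(2)[of a1] by auto
  obtain a2 where a2: "a2 \<in> G2" "a2 \<notin> {hi..hi + \<delta>}" using gap_point[OF len(2)] \<delta> by fastforce
  then have a2': "a2 > hi + \<delta>" using hi(2)[of a2] by auto
  show thesis
  proof (rule result[OF E0'(2,1) lo(1) hi(1) hl])
   fix E assume E: "E \<in> S" "lo - \<delta> <= E" "E <= hi + \<delta>"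
   have "lo <= E"
   proof (rule ccontr)
    assume "~ lo <= E"
    then obtain z where z: "z \<in> G1" "E < z" unfolding lo_def using less_cSup_iff[OF ne(1) bA, of E] by (auto simp: not_le)
    have "E \<in> G1" by (rule ivl[of G1 a1 z]) (use z a1 a1' E in auto)
    then show False using sub E by auto
   qed
   moreover have "E <= hi"
   proof (rule ccontr)
    assume "~ E <= hi"
    then obtain z where z: "z \<in> G2" "z < E" unfolding hi_def using cInf_less_iff[OF ne(2) bB, of E] by (auto simp: not_le)
    have "E \<in> G2" by (rule ivl[of G2 z a2]) (use z a2 a2' E in auto)
    then show False using sub E by auto
   qed
   ultimately show "lo <= E & E <= hi" ..
  qed
 qed
 have "G1 ~= {}" "G2 ~= {}" "G1 \<inter> G2 = {}" using G unfolding gaps_def by (auto dest: in_components_nonempty components_nonoverlap)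
 then obtain g1 g2 where g: "g1 \<in> G1" "g2 \<in> G2" "g1 ~= g2" by blast
 show thesis
 proof (cases "g1 < g2")
  case True
  then show thesis using ordered[OF G len dist g(1,2)] by simp
 next
  case False
  then show thesis using ordered[OF G(2,1) G(3)[symmetric] len(2,1) _ g(2,1)] dist g(3) by (simp add: setdist_sym)
 qed
qed

lemma analytic_consequences:
 assumes an: "real_analytic V" and per: "!!x. V (x + 1) = V x"
 obtains \<rho> Bv LV A where "\<rho> > 0" "fourier_class \<rho> Bv (%x. of_real (V x))" "LV > 0" "!!s t. \<bar>V s - V t\<bar> <= LV * \<bar>s - t\<bar>"
  "A >= 0" "!!s. \<bar>V s\<bar> <= A" "continuous_on UNIV V"
proof -
 obtain A R where A: "A >= 0" "R > 0" "!!m y. ((deriv ^^ m) V has_real_derivative (deriv ^^ Suc m) V y) (at y)"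
  "!!m y. \<bar>(deriv ^^ m) V y\<bar> <= A * fact m * R ^ m" "!!m y. (deriv ^^ m) V (y + 1) = (deriv ^^ m) V y"
  using real_analytic_derivative_bounds[where V=V, OF an per] by metis
 have d: "(V has_real_derivative deriv V y) (at y)" for y using A(3)[of 0 y] by simp
 have db: "\<bar>deriv V y\<bar> <= A * R + 1" for y using A(4)[of 1 y] by simp
 have Lip: "\<bar>V s - V t\<bar> <= (A * R + 1) * \<bar>s - t\<bar>" for s t
  using field_differentiable_bound[of UNIV V "deriv V" "A * R + 1" s t] d db by (auto simp: has_field_derivative_at_within)
 have LV: "A * R + 1 > 0" using A by (simp add: add_nonneg_pos)
 have bd: "\<bar>V s\<bar> <= A" for s using A(4)[of 0 s] by simp
 have cont: "continuous_on UNIV V" using d by (meson DERIV_isCont continuous_at_imp_continuous_on)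
 show ?thesis
 proof (rule real_analytic_fourier_series[where V=V, OF an per])
  fix \<rho> v
  assume \<rho>: "\<rho> > 0" and v: "!!x. ((%k::int. v k * e1 (of_int k * x)) has_sum of_real (V x)) UNIV"
   "(%k::int. cmod (v k) * wt \<rho> k) summable_on UNIV"
  have "fourier_class \<rho> (\<Sum>\<^sub>\<infinity>k::int. cmod (v k) * wt \<rho> k) (%x. of_real (V x))"
   unfolding fourier_class_def using v(1) has_sum_infsum[OF v(2)] by blast
  then show ?thesis by (rule that[OF \<rho> _ LV Lip A(1) bd cont])
 qed
qed

text \<open>The choices \<open>\<epsilon> = 1 / 100\<close> and \<open>C0 = 20\<close> serve all potentials and
frequencies. The two spectra differ only in the index set \<open>\<Omega>\<close>, the whole line or an interval, and
in how approximate eigenfunctions yield spectrum nearby.\<close>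

theorem theorem1:
  "\<exists>\<epsilon>::real. 0 < \<epsilon> \<and> \<epsilon> \<le> 1 / 100 \<and>
    (\<forall>(V :: real \<Rightarrow> real) (c :: real) (a :: real) (\<gamma> :: real).
      real_analytic V \<and> (\<forall>x. V (x + 1) = V x) \<and> c > 0 \<and> a > 0 \<and> \<gamma> > 0 \<longrightarrow>
      (\<exists>(N0 :: nat) (C0 :: real). \<forall>(\<omega> :: real) (E' :: real) (E'' :: real).
        \<omega> \<in> diophantine c a \<and> (\<forall>E\<in>{E'<..<E''}. lyapunov V \<omega> E \<ge> \<gamma>) \<longrightarrow>
        (\<forall>N\<ge>N0.
          (\<forall>x. \<forall>G1\<in>gaps (full_spectrum V x \<omega>) E' E''. \<forall>G2\<in>gaps (full_spectrum V x \<omega>) E' E''.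
            G1 \<noteq> G2 \<and>
            gap_length G1 > exp (- (real N powr (1 - \<epsilon>))) \<and>
            gap_length G2 > exp (- (real N powr (1 - \<epsilon>))) \<longrightarrow>
            setdist G1 G2 > exp (- (ln (real N) powr C0))) \<and>
          (\<forall>N'\<ge>N. \<forall>G1\<in>gaps (finite_spectrum V N' \<omega>) E' E''. \<forall>G2\<in>gaps (finite_spectrum V N' \<omega>) E' E''.
            G1 \<noteq> G2 \<and>
            gap_length G1 > exp (- (real N powr (1 - \<epsilon>))) \<and>
            gap_length G2 > exp (- (real N powr (1 - \<epsilon>))) \<longrightarrow>
            setdist G1 G2 > exp (- (ln (real N) powr C0))))))"
proof (rule exI[of _ "1 / 100"], intro conjI allI impI)
 fix V :: "real => real" and c a \<gamma> :: real
 assume as: "real_analytic V & (\<forall>x. V (x + 1) = V x) & c > 0 & a > 0 & \<gamma> > 0"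
 then have per: "!!x. V (x + 1) = V x" and pos: "c > 0" "a > 0" "\<gamma> > 0" by auto
 obtain \<rho> Bv LV A where V: "\<rho> > 0" "fourier_class \<rho> Bv (%x. of_real (V x))" "LV > 0" "!!s t. \<bar>V s - V t\<bar> <= LV * \<bar>s - t\<bar>"
  "A >= 0" "!!s. \<bar>V s\<bar> <= A" "continuous_on UNIV V"
  using analytic_consequences[where V=V, OF _ per] as by blast
 obtain c' where c': "c' > 0" "!!\<omega>. \<omega> \<in> diophantine c a ==> dioph c' \<omega>" using diophantine_imp_dioph[OF pos(1,2)] by blast
 have B0: "3 * A + 4 >= 0" using V(5) by simp
 obtain N0 :: nat where N0: "N0 >= 3"
  and core: "!!\<omega> E0 N lo hi \<Omega> y. dioph c' \<omega> ==> \<bar>E0\<bar> <= 3 * A + 4 ==> expanding V \<omega> E0 \<gamma> ==>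
   N >= N0 ==> lo <= E0 ==> E0 <= hi ==> hi - lo <= exp (- (ln (real N) ^ 20)) ==>
   gap_property V \<Omega> \<omega> lo hi (exp (- (real N powr (99 / 100)))) ==> \<Omega> = UNIV | (\<exists>N'\<ge>N. \<Omega> = {- int N'..int N'}) ==>
   approx_eig \<Omega> (pot V \<omega> y) E0 ==> False"
  by (rule no_spectrum_in_small_island[OF V(2,1) c'(1) pos(3) B0 V(4,3) per V(6)]) blast
 have main: "setdist G1 G2 > exp (- (ln (real N) powr 20))"
  if dio: "dioph c' \<omega>" and L: "\<forall>E\<in>{E'<..<E''}. lyapunov V \<omega> E >= \<gamma>" and N: "N >= N0"
   and \<Omega>: "\<Omega> = UNIV | (\<exists>N'\<ge>N. \<Omega> = {- int N'..int N'})"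
   and near: "!!x E \<psi> \<sigma>. fsupp \<Omega> \<psi> ==> nsq \<psi> > 0 ==> nsq (ham \<Omega> (pot V \<omega> x) E \<psi>) <= \<sigma>^2 * nsq \<psi> ==> \<sigma> > 0 ==> \<exists>E1\<in>S. \<bar>E1 - E\<bar> <= 2 * \<sigma>"
   and eig: "!!E. E \<in> S ==> \<exists>x. approx_eig \<Omega> (pot V \<omega> x) E"
   and G: "G1 \<in> gaps S E' E''" "G2 \<in> gaps S E' E''" "G1 ~= G2"
   and len: "gap_length G1 > exp (- (real N powr (1 - 1 / 100)))" "gap_length G2 > exp (- (real N powr (1 - 1 / 100)))"
  for \<omega> E' E'' N \<Omega> S G1 G2
 proof (rule ccontr)
  assume "~ ?thesis"
  then have d: "setdist G1 G2 <= exp (- (ln (real N) powr 20))" by simp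
  have "ln (real N) > 0" using N N0 by simp
  then have p20: "ln (real N) powr 20 = ln (real N) ^ 20" using powr_realpow[of "ln (real N)" 20] by simp
  define \<delta> where "\<delta> = exp (- (real N powr (99 / 100)))"
  have \<delta>: "\<delta> > 0" unfolding \<delta>_def by simp
  have len': "gap_length G1 > \<delta>" "gap_length G2 > \<delta>" using len unfolding \<delta>_def by simp_all
  obtain E0 lo hi where E0: "E0 \<in> S" "E0 \<in> {E'<..<E''}" "lo <= E0" "E0 <= hi" "hi - lo <= exp (- (ln (real N) powr 20))"
   "!!E. E \<in> S ==> lo - \<delta> <= E ==> E <= hi + \<delta> ==> lo <= E & E <= hi"
   using island_between_gaps[OF G len' \<delta> d] by blast
  obtain y where y: "approx_eig \<Omega> (pot V \<omega> y) E0" using eig[OF E0(1)] by blast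
  have EB: "\<bar>E0\<bar> <= 3 * A + 4" by (rule approx_eig_energy_bound[where V=V, OF V(6) y])
  have gr: "expanding V \<omega> E0 \<gamma>"
   by (rule lyapunov_imp_growth[where V=V, OF V(7) per]) (use L E0(2) in blast)
  have gp: "gap_property V \<Omega> \<omega> lo hi \<delta>" unfolding gap_property_def
  proof (intro allI impI)
   fix x E \<psi> \<sigma>
   assume \<psi>: "fsupp \<Omega> \<psi>" "nsq \<psi> > 0" "nsq (ham \<Omega> (pot V \<omega> x) E \<psi>) <= \<sigma>^2 * nsq \<psi>" and r: "0 < \<sigma>" "\<sigma> <= \<delta> / 16" "lo - \<delta> / 2 <= E" "E <= hi + \<delta> / 2"
   obtain E1 where E1: "E1 \<in> S" "\<bar>E1 - E\<bar> <= 2 * \<sigma>" using near[OF \<psi> r(1)] by blast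
   have "lo - \<delta> <= E1" "E1 <= hi + \<delta>" using E1(2) r \<delta> by linarith+
   from E0(6)[OF E1(1) this] show "lo - 2 * \<sigma> <= E & E <= hi + 2 * \<sigma>" using E1(2) by linarith
  qed
  show False
   by (rule core[OF dio EB gr N E0(3,4) E0(5)[unfolded p20] gp[unfolded \<delta>_def] \<Omega> y])
 qed
 show "\<exists>(N0 :: nat) (C0 :: real). \<forall>(\<omega> :: real) (E' :: real) (E'' :: real).
    \<omega> \<in> diophantine c a & (\<forall>E\<in>{E'<..<E''}. lyapunov V \<omega> E >= \<gamma>) -->
    (\<forall>N\<ge>N0.
     (\<forall>x. \<forall>G1\<in>gaps (full_spectrum V x \<omega>) E' E''. \<forall>G2\<in>gaps (full_spectrum V x \<omega>) E' E''.
      G1 ~= G2 &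
      gap_length G1 > exp (- (real N powr (1 - 1 / 100))) &
      gap_length G2 > exp (- (real N powr (1 - 1 / 100))) -->
      setdist G1 G2 > exp (- (ln (real N) powr C0))) &
     (\<forall>N'\<ge>N. \<forall>G1\<in>gaps (finite_spectrum V N' \<omega>) E' E''. \<forall>G2\<in>gaps (finite_spectrum V N' \<omega>) E' E''.
      G1 ~= G2 &
      gap_length G1 > exp (- (real N powr (1 - 1 / 100))) &
      gap_length G2 > exp (- (real N powr (1 - 1 / 100))) -->
      setdist G1 G2 > exp (- (ln (real N) powr C0))))"
 proof (intro exI[of _ N0] exI[of _ 20] allI impI conjI ballI)
  fix \<omega> E' E'' :: real and N :: nat and x :: real and G1 G2
  assume h: "\<omega> \<in> diophantine c a & (\<forall>E\<in>{E'<..<E''}. lyapunov V \<omega> E >= \<gamma>)" and N: "N0 <= N"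
   and G: "G1 \<in> gaps (full_spectrum V x \<omega>) E' E''" "G2 \<in> gaps (full_spectrum V x \<omega>) E' E''"
   and l: "G1 ~= G2 & gap_length G1 > exp (- (real N powr (1 - 1 / 100))) & gap_length G2 > exp (- (real N powr (1 - 1 / 100)))"
  have dio: "dioph c' \<omega>" using c'(2) h by blast
  show "setdist G1 G2 > exp (- (ln (real N) powr 20))"
  proof (rule main[where \<Omega>=UNIV, OF dio _ N _ _ _ G])
   fix y E \<psi> \<sigma> assume "fsupp UNIV \<psi>" "nsq \<psi> > 0" "nsq (ham UNIV (pot V \<omega> y) E \<psi>) <= \<sigma>^2 * nsq \<psi>" "\<sigma> > 0"
   then show "\<exists>E1\<in>full_spectrum V x \<omega>. \<bar>E1 - E\<bar> <= 2 * \<sigma>"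
    by (rule near_full_spectrum[where V=V and ?x0.0=x, OF V(6) per V(4,3) dio c'(1)]) blast
  next
   fix E assume "E \<in> full_spectrum V x \<omega>"
   then have "of_real E \<in> spec (ell2 UNIV) (dirichlet UNIV (schroedinger V x \<omega>))" unfolding full_spectrum_def dirichlet_UNIV by simp
   then show "\<exists>y. approx_eig UNIV (pot V \<omega> y) E" using spec_imp_approx_eig[where V=V, OF V(6)] by blast
  qed (use h l in auto)
 next
  fix \<omega> E' E'' :: real and N N' :: nat and G1 G2
  assume h: "\<omega> \<in> diophantine c a & (\<forall>E\<in>{E'<..<E''}. lyapunov V \<omega> E >= \<gamma>)" and N: "N0 <= N" and N': "N <= N'"
   and G: "G1 \<in> gaps (finite_spectrum V N' \<omega>) E' E''" "G2 \<in> gaps (finite_spectrum V N' \<omega>) E' E''"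
   and l: "G1 ~= G2 & gap_length G1 > exp (- (real N powr (1 - 1 / 100))) & gap_length G2 > exp (- (real N powr (1 - 1 / 100)))"
  have dio: "dioph c' \<omega>" using c'(2) h by blast
  show "setdist G1 G2 > exp (- (ln (real N) powr 20))"
  proof (rule main[where \<Omega>="{- int N'..int N'}", OF dio _ N _ _ _ G])
   fix y E \<psi> \<sigma> assume \<psi>: "fsupp {- int N'..int N'} \<psi>" "nsq \<psi> > 0" "nsq (ham {- int N'..int N'} (pot V \<omega> y) E \<psi>) <= \<sigma>^2 * nsq \<psi>" "\<sigma> > 0"
   obtain E1 where "E1 \<in> finite_spectrum V N' \<omega>" "\<bar>E1 - E\<bar> <= \<sigma>"
    using near_finite_spectrum[where V=V, OF V(6) \<psi>(1-3) less_imp_le[OF \<psi>(4)]] by blast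
   then show "\<exists>E1\<in>finite_spectrum V N' \<omega>. \<bar>E1 - E\<bar> <= 2 * \<sigma>" using \<psi>(4) by (intro bexI[of _ E1]) auto
  next
   fix E assume "E \<in> finite_spectrum V N' \<omega>"
   then show "\<exists>y. approx_eig {- int N'..int N'} (pot V \<omega> y) E"
    unfolding finite_spectrum_def using spec_imp_approx_eig[where V=V, OF V(6)] by blast
  qed (use h l N' in auto)
 qed
qed simp_all

end
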